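(* Let $p,q>1$ and suppose that $$(u_0,u_1)\in(H^1\cap L^1)\times(L^2\cap L^1\cap L^q),\qquad (v_0,v_1)\in H^1\times(L^2\cap L^1),$$ and that $\operatorname{supp}(u_0,u_1,v_0,v_1)\subset[-R,R]$ for some $R>0$. Let $T_\varepsilon\in(0,\infty]$ be the lifespan of the unique maximal mild energy solution of the one-dimensional Nakao problem with initial data $\varepsilon(u_0,u_1)$, $\varepsilon(v_0,v_1)$. Then there exist constants $\varepsilon_0>0$ and $c>0$, independent of $\varepsilon$ (they may depend on $p,q$ and the fixed profiles $u_0,u_1,v_0,v_1$), such that for every $\varepsilon\in(0,\varepsilon_0]$: $$T_\varepsilon\geqslant c\,\varepsilon^{-\frac{pq-1}{q+2}}\quad\text{if }(p,q)\in\Omega_{\mathrm{Nakao},1},$$ $$T_\varepsilon\geqslant c\,\varepsilon^{-\frac{2q(pq-1)}{pq(3-q)+3q+1}}\quad\text{if }(p,q)\in(1,\infty)^2\setminus\Omega_{\mathrm{Nakao},1}.$$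
   Context: All function spaces are over $\mathbb{R}$. For $p,q>1$ and $\varepsilon>0$, the one-dimensional Nakao problem is the Cauchy problem $$u_{tt}-u_{xx}+u_t=|v|^p,\qquad v_{tt}-v_{xx}=|u|^q\qquad (x\in\mathbb{R},\ t>0),$$ $$(u,u_t)(0,x)=\varepsilon(u_0,u_1)(x),\qquad (v,v_t)(0,x)=\varepsilon(v_0,v_1)(x).$$ For data $(u_0,u_1),(v_0,v_1)\in H^1\times L^2$ it has, for every $\varepsilon>0$, a unique maximal mild energy solution $(u,v)$ on $[0,T_\varepsilon)$ with $u,v\in\mathcal{C}([0,T_\varepsilon),H^1)\cap\mathcal{C}^1([0,T_\varepsilon),L^2)$ (mild means satisfying the Duhamel integral formulas for the damped wave and wave equations); $T_\varepsilon\in(0,\infty]$ is called the lifespan, and if $T_\varepsilon<\infty$ then $\limsup_{t\to T_\varepsilon^-}\big(\|(u,u_t)(t,\cdot)\|_{H^1\times L^2}+\|(v,v_t)(t,\cdot)\|_{H^1\times L^2}\big)=+\infty$. $\operatorname{supp}(f_1,\dots,f_k):=\bigcup_{j}\operatorname{supp}f_j$. The region is $$\Omega_{\mathrm{Nakao},1}:=\Big\{(p,q)\in(1,\infty)^2:\ q\geqslant3,\ \text{ or }\ \Big(1<q<3\ \text{ and }\ p\leqslant\frac{2q^2+q-1}{q(3-q)}\Big)\Big\}.$$ *)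

theory Defs
  imports "HOL-Analysis.Analysis"
begin

text \<open>
  Elements of function spaces on the real line are represented by functions
  \<^typ>\<open>real \<Rightarrow> real\<close>; all notions below are invariant under modification on Lebesgue null sets.
\<close>

definition Lp_space :: "real \<Rightarrow> (real \<Rightarrow> real) set" where
  "Lp_space r = {f \<in> borel_measurable lebesgue. integrable lebesgue (\<lambda>x. \<bar>f x\<bar> powr r)}"

definition Lp_norm :: "real \<Rightarrow> (real \<Rightarrow> real) \<Rightarrow> real" where
  "Lp_norm r f = (LINT x|lebesgue. \<bar>f x\<bar> powr r) powr (1 / r)"

definition test_function :: "(real \<Rightarrow> real) \<Rightarrow> bool" where
  "test_function \<phi> \<longleftrightarrow>
     (\<forall>n x. (deriv ^^ n) \<phi> differentiable (at x)) \<and> (\<exists>r. \<forall>x. r < \<bar>x\<bar> \<longrightarrow> \<phi> x = 0)"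

definition has_weak_deriv :: "(real \<Rightarrow> real) \<Rightarrow> (real \<Rightarrow> real) \<Rightarrow> bool" where
  "has_weak_deriv f g \<longleftrightarrow>
     (\<forall>\<phi>. test_function \<phi> \<longrightarrow>
        (LINT x|lebesgue. f x * deriv \<phi> x) = - (LINT x|lebesgue. g x * \<phi> x))"

definition H1_space :: "(real \<Rightarrow> real) set" where
  "H1_space = {f \<in> Lp_space 2. \<exists>g \<in> Lp_space 2. has_weak_deriv f g}"

definition weak_deriv :: "(real \<Rightarrow> real) \<Rightarrow> real \<Rightarrow> real" where
  "weak_deriv f = (SOME g. g \<in> Lp_space 2 \<and> has_weak_deriv f g)"

definition H1_norm :: "(real \<Rightarrow> real) \<Rightarrow> real" where
  "H1_norm f = sqrt ((Lp_norm 2 f)\<^sup>2 + (Lp_norm 2 (weak_deriv f))\<^sup>2)"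

text \<open>Support in the sense of almost-everywhere classes (equivalently, of distributions).\<close>

definition ess_support :: "(real \<Rightarrow> real) \<Rightarrow> real set" where
  "ess_support f = {x. \<forall>e>0. \<not> (AE y in lebesgue. y \<in> ball x e \<longrightarrow> f y = 0)}"

definition time_interval :: "ereal \<Rightarrow> real set" where
  "time_interval T = {t. 0 \<le> t \<and> ereal t < T}"

text \<open>Curves \<open>u\<close> with values in a space \<open>X\<close> normed by \<open>N\<close>; \<open>u t x\<close> is the value at time \<open>t\<close>.\<close>

definition continuous_curve ::
  "(real \<Rightarrow> real) set \<Rightarrow> ((real \<Rightarrow> real) \<Rightarrow> real) \<Rightarrow> ereal \<Rightarrow> (real \<Rightarrow> real \<Rightarrow> real) \<Rightarrow> bool" where
  "continuous_curve X N T u \<longleftrightarrow>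
     (\<forall>t \<in> time_interval T. u t \<in> X \<and>
        ((\<lambda>s. N (\<lambda>x. u s x - u t x)) \<longlongrightarrow> 0) (at t within time_interval T))"

definition C1_curve ::
  "(real \<Rightarrow> real) set \<Rightarrow> ((real \<Rightarrow> real) \<Rightarrow> real) \<Rightarrow> ereal \<Rightarrow> (real \<Rightarrow> real \<Rightarrow> real) \<Rightarrow> bool" where
  "C1_curve X N T u \<longleftrightarrow>
     (\<forall>t \<in> time_interval T. u t \<in> X) \<and>
     (\<exists>ut. continuous_curve X N T ut \<and>
        (\<forall>t \<in> time_interval T.
           ((\<lambda>s. N (\<lambda>x. (u s x - u t x) / (s - t) - ut t x)) \<longlongrightarrow> 0)
             (at t within time_interval T)))"

definition energy_curve :: "ereal \<Rightarrow> (real \<Rightarrow> real \<Rightarrow> real) \<Rightarrow> bool" where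
  "energy_curve T u \<longleftrightarrow>
     continuous_curve H1_space H1_norm T u \<and> C1_curve (Lp_space 2) (Lp_norm 2) T u"

text \<open>d'Alembert's formula: the solution of \<open>w_tt - w_xx = 0\<close> with data \<open>(f, g)\<close>.\<close>

definition wave_prop :: "real \<Rightarrow> (real \<Rightarrow> real) \<Rightarrow> (real \<Rightarrow> real) \<Rightarrow> real \<Rightarrow> real" where
  "wave_prop t f g x =
     (f (x + t) + f (x - t)) / 2 + (LINT y:{x - t..x + t}|lebesgue. g y) / 2"

text \<open>Modified Bessel function of the first kind of integer order.\<close>

definition bessel_I :: "nat \<Rightarrow> real \<Rightarrow> real" where
  "bessel_I n z = (\<Sum>k. (z / 2) ^ (2 * k + n) / (fact k * fact (k + n)))"

text \<open>
  The solution of \<open>w_tt - w_xx + w_t = 0\<close> with data \<open>(f, g)\<close>: the substitution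
  \<open>w = exp (- t / 2) z\<close> leads to \<open>z_tt - z_xx = z / 4\<close> with data \<open>(f, g + f / 2)\<close>, whose
  fundamental solution is \<open>I\<^sub>0 (sqrt (t\<^sup>2 - x\<^sup>2) / 2) / 2\<close> on \<open>\<bar>x\<bar> < t\<close>. The \<open>I\<^sub>1\<close> term is the
  part of the time derivative of the \<open>I\<^sub>0\<close> integral that falls on the kernel. Its value at the
  end points of the interval (division by zero) is irrelevant.
\<close>

definition damped_wave_prop :: "real \<Rightarrow> (real \<Rightarrow> real) \<Rightarrow> (real \<Rightarrow> real) \<Rightarrow> real \<Rightarrow> real" where
  "damped_wave_prop t f g x =
     exp (- t / 2) *
       ((f (x + t) + f (x - t)) / 2
        + t / 4 * (LINT y:{x - t..x + t}|lebesgue.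
            bessel_I 1 (sqrt (t\<^sup>2 - (x - y)\<^sup>2) / 2) / sqrt (t\<^sup>2 - (x - y)\<^sup>2) * f y)
        + 1 / 2 * (LINT y:{x - t..x + t}|lebesgue.
            bessel_I 0 (sqrt (t\<^sup>2 - (x - y)\<^sup>2) / 2) * (g y + f y / 2)))"

definition mild_energy_solution ::
  "real \<Rightarrow> real \<Rightarrow> (real \<Rightarrow> real) \<Rightarrow> (real \<Rightarrow> real) \<Rightarrow> (real \<Rightarrow> real) \<Rightarrow> (real \<Rightarrow> real)
   \<Rightarrow> ereal \<Rightarrow> (real \<Rightarrow> real \<Rightarrow> real) \<Rightarrow> (real \<Rightarrow> real \<Rightarrow> real) \<Rightarrow> bool" where
  "mild_energy_solution p q f0 f1 g0 g1 T u v \<longleftrightarrow>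
     energy_curve T u \<and> energy_curve T v \<and>
     (\<forall>t \<in> time_interval T.
        (AE x in lebesgue. u t x = damped_wave_prop t f0 f1 x
           + (LINT s:{0..t}|lebesgue. damped_wave_prop (t - s) (\<lambda>_. 0) (\<lambda>y. \<bar>v s y\<bar> powr p) x)) \<and>
        (AE x in lebesgue. v t x = wave_prop t g0 g1 x
           + (LINT s:{0..t}|lebesgue. wave_prop (t - s) (\<lambda>_. 0) (\<lambda>y. \<bar>u s y\<bar> powr q) x)))"

text \<open>
  Solutions with the same data coincide on their common interval of existence, so the maximal
  solution lives on \<open>[0, T)\<close> with \<open>T\<close> the supremum of all existence times.
\<close>

definition lifespan ::
  "real \<Rightarrow> real \<Rightarrow> (real \<Rightarrow> real) \<Rightarrow> (real \<Rightarrow> real) \<Rightarrow> (real \<Rightarrow> real) \<Rightarrow> (real \<Rightarrow> real) \<Rightarrow> ereal" where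
  "lifespan p q f0 f1 g0 g1 =
     Sup {T. 0 < T \<and> (\<exists>u v. mild_energy_solution p q f0 f1 g0 g1 T u v)}"

definition Omega_Nakao1 :: "(real \<times> real) set" where
  "Omega_Nakao1 =
     {(p, q). 1 < p \<and> 1 < q \<and>
        (3 \<le> q \<or> (1 < q \<and> q < 3 \<and> p \<le> (2 * q\<^sup>2 + q - 1) / (q * (3 - q))))}"

end

theory Submission
  imports Defs "HOL-Computational_Algebra.Polynomial"
begin

text \<open>
  A lower bound for the lifespan follows as soon as a solution is constructed on \<open>[0, T)\<close> with
  \<open>T = c \<epsilon>^(- \<kappa>)\<close>. It is a fixed point in the single unknown \<open>v\<close>: given \<open>v\<close>, let \<open>u\<close> solve the linear
  damped equation with source \<open>|v|^p\<close>, and let \<open>\<Psi> v\<close> solve the linear wave equation with source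
  \<open>|u|^q\<close>. Since the equations propagate with speed one, everything lives in the cone
  \<open>|x| \<le> R + t\<close>, and the only bound to be propagated is \<open>|v| \<le> V\<close>.

  Three estimates carry the argument. The linear damped solution is bounded in \<open>L\<^sup>1\<close> and is
  \<open>O((1 + t)^(- 1 / 2))\<close> in the supremum norm (\<open>ulin_estimates\<close>), so the integral of its \<open>q\<close>-th power
  is \<open>O((1 + t)^(- (q - 1) / 2))\<close> (\<open>ulin_Lq\<close>); the Duhamel term of the damped equation is at most
  \<open>2 T V^p\<close>, because the damped kernel has bounded mass (\<open>Nd_bound\<close>); and a wave Duhamel term is at
  most half the space-time integral of its source (\<open>Nw_bound_L1\<close>). With the volume \<open>O(T\<^sup>2)\<close> of the
  cone, \<open>|\<Psi> v|\<close> is bounded by a constant times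
  \<open>\<epsilon> + \<epsilon>^q \<integral> (1 + s)^(- (q - 1) / 2) ds + T^(q + 2) V^(p q)\<close> (\<open>\<Psi>_apriori\<close>).

  The time integral grows at most like \<open>T^\<eta>\<close>, with \<open>\<eta> = (3 - q) / 2\<close> if \<open>q < 3\<close> and with an arbitrarily
  small \<open>\<eta> > 0\<close> otherwise. Take \<open>V\<close> of size \<open>\<epsilon>^\<mu>\<close>. The first two terms are then absorbed if
  \<open>\<mu> \<le> 1\<close> and \<open>\<mu> \<le> q - \<kappa> \<eta>\<close>, the last one if \<open>\<kappa> (q + 2) \<le> \<mu> (p q - 1)\<close>. In the first region
  \<open>\<mu> = 1\<close> is possible and the last condition gives \<open>\<kappa> = (p q - 1) / (q + 2)\<close>. In the second region
  the middle term dominates: \<open>\<mu> = q - \<kappa> (3 - q) / 2 < 1\<close>, and equality in the last condition is a linear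
  equation for \<open>\<kappa>\<close> whose solution is the second exponent.

  No smallness is needed for contraction: on the bounded functions \<open>\<Psi>\<close> is Lipschitz, and a weight
  \<open>exp (l t)\<close> with \<open>l\<close> large makes it a contraction (\<open>\<Psi>_contraction\<close>).

  The rest of the work is regularity: the fixed point has to be a curve of finite energy in the
  sense of weak derivatives and Lebesgue classes. Solutions are handled as triples \<open>(w, w_x, w_t)\<close> of
  Borel functions (\<open>energy_triple\<close>), where \<open>w\<close> is a primitive of \<open>w_x\<close> and \<open>w_t\<close> an \<open>L\<^sup>2\<close> limit of
  difference quotients. Data in \<open>H\<^sup>1\<close> with compact support are primitives of compactly supported
  square integrable functions of integral \<open>0\<close> (\<open>H1_compact_representative\<close>). The damped kernel is
  split into its constant boundary value on the cone, which is d'Alembert's kernel, and a Lipschitz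
  remainder (\<open>hk\<close>).
\<close>

section \<open>Translations in \<open>L\<^sup>2\<close> and curves of finite energy\<close>

lemma integral_shift:
  fixes f :: "real \<Rightarrow> real"
  shows "(LINT x|lborel. f (x + s)) = (LINT x|lborel. f x)"
  using lborel_integral_real_affine[of 1 f s] by (simp add: add.commute)

lemma integrable_shift:
  fixes f :: "real \<Rightarrow> real"
  shows "integrable lborel (\<lambda>x. f (x + s)) \<longleftrightarrow> integrable lborel f"
  using lborel_integrable_real_affine_iff[of 1 f s] by (simp add: add.commute)

text \<open>
  Continuity of translations is the source of all continuity in time: a travelling wave moves its
  profile by translation.
\<close>

definition L1_shift_cont :: "(real \<Rightarrow> real) \<Rightarrow> bool" where
  "L1_shift_cont h \<longleftrightarrow> (\<forall>e>0. \<exists>d>0. \<forall>s. \<bar>s\<bar> < d \<longrightarrow> (LINT x|lborel. \<bar>h (x + s) - h x\<bar>) < e)"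

lemma L1_shift_cont_approx:
  assumes h: "integrable lborel h"
    and appr: "\<And>e. e > 0 \<Longrightarrow> \<exists>k. integrable lborel k \<and> L1_shift_cont k \<and> (LINT x|lborel. \<bar>h x - k x\<bar>) < e"
  shows "L1_shift_cont h"
  unfolding L1_shift_cont_def
proof (intro allI impI)
  fix e :: real assume "e > 0"
  then obtain k where k: "integrable lborel k" "L1_shift_cont k" "(LINT x|lborel. \<bar>h x - k x\<bar>) < e / 3"
    using appr[of "e / 3"] by auto
  obtain d where d: "d > 0" "\<And>s. \<bar>s\<bar> < d \<Longrightarrow> (LINT x|lborel. \<bar>k (x + s) - k x\<bar>) < e / 3"
    using k(2) \<open>e > 0\<close> unfolding L1_shift_cont_def by (meson divide_pos_pos zero_less_numeral)
  show "\<exists>d>0. \<forall>s. \<bar>s\<bar> < d \<longrightarrow> (LINT x|lborel. \<bar>h (x + s) - h x\<bar>) < e"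
  proof (intro exI[of _ d] conjI allI impI)
    fix s :: real assume s: "\<bar>s\<bar> < d"
    have i1: "integrable lborel (\<lambda>x. \<bar>h x - k x\<bar>)" using h k by auto
    then have i2: "integrable lborel (\<lambda>x. \<bar>h (x + s) - k (x + s)\<bar>)"
      using integrable_shift[of "\<lambda>x. \<bar>h x - k x\<bar>" s] by simp
    have hs: "integrable lborel (\<lambda>x. h (x + s))" "integrable lborel (\<lambda>x. k (x + s))"
      using h k by (simp_all add: integrable_shift)
    have "(LINT x|lborel. \<bar>h (x + s) - h x\<bar>)
        \<le> (LINT x|lborel. \<bar>h (x + s) - k (x + s)\<bar> + \<bar>k (x + s) - k x\<bar> + \<bar>h x - k x\<bar>)"
      using h k hs by (intro integral_mono) auto
    also have "\<dots> = (LINT x|lborel. \<bar>h (x + s) - k (x + s)\<bar>) + (LINT x|lborel. \<bar>k (x + s) - k x\<bar>)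
        + (LINT x|lborel. \<bar>h x - k x\<bar>)"
      using h k hs by (subst Bochner_Integration.integral_add, auto)+
    also have "(LINT x|lborel. \<bar>h (x + s) - k (x + s)\<bar>) = (LINT x|lborel. \<bar>h x - k x\<bar>)"
      using integral_shift[of "\<lambda>x. \<bar>h x - k x\<bar>" s] by simp
    finally show "(LINT x|lborel. \<bar>h (x + s) - h x\<bar>) < e" using k(3) d(2)[OF s] by linarith
  qed (use d in auto)
qed

text \<open>
  The translates of an open set converge to it pointwise from inside, and since translation preserves
  the measure, the part that leaves \<open>U\<close> and the part that enters have equal size. So dominated
  convergence for the first part is enough.
\<close>

lemma L1_shift_cont_open:
  assumes U: "open U" "emeasure lborel U < \<infinity>"
  shows "L1_shift_cont (indicator U)"
proof -
  have [measurable]: "U \<in> sets borel" using U by auto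
  have iU: "integrable lborel (indicator U :: real \<Rightarrow> real)"
    using U by (auto intro!: integrable_real_indicator)
  have iUs: "integrable lborel (\<lambda>x. indicator U (x + s) :: real)" for s
    using iU by (simp add: integrable_shift)
  have iP: "integrable lborel (\<lambda>x. indicator U x * (1 - indicator U (x + s)) :: real)" for s
    by (rule Bochner_Integration.integrable_bound[OF iU]) (use U in \<open>auto simp: indicator_def\<close>)
  have eq: "(LINT x|lborel. \<bar>indicator U (x + s) - indicator U x\<bar>) =
      2 * (LINT x|lborel. indicator U x * (1 - indicator U (x + s)) :: real)" for s
  proof -
    have "(LINT x|lborel. \<bar>indicator U (x + s) - indicator U x :: real\<bar>) =
       (LINT x|lborel. (indicator U (x + s) - indicator U x) + 2 * (indicator U x * (1 - indicator U (x + s))))"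
      by (rule Bochner_Integration.integral_cong) (auto simp: indicator_def)
    also have "\<dots> = ((LINT x|lborel. indicator U (x + s)) - (LINT x|lborel. indicator U x))
        + 2 * (LINT x|lborel. indicator U x * (1 - indicator U (x + s)) :: real)"
      using iU iUs iP by (subst Bochner_Integration.integral_add) auto
    finally show ?thesis using integral_shift[of "indicator U" s] by simp
  qed
  have lim: "((\<lambda>s. LINT x|lborel. indicator U x * (1 - indicator U (x + s)) :: real) \<longlongrightarrow> 0) (at 0)"
    unfolding tendsto_at_iff_sequentially
  proof (intro allI impI)
    fix X :: "nat \<Rightarrow> real" assume X: "\<forall>i. X i \<in> UNIV - {0}" "X \<longlonglongrightarrow> 0"
    have "(\<lambda>i. LINT x|lborel. indicator U x * (1 - indicator U (x + X i)) :: real) \<longlonglongrightarrow> (LINT x::real|lborel. (0::real))"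
    proof (rule integral_dominated_convergence[OF _ _ iU])
      show "AE x in lborel. (\<lambda>i. indicator U x * (1 - indicator U (x + X i)) :: real) \<longlonglongrightarrow> 0"
      proof (rule AE_I2)
        fix x
        show "(\<lambda>i. indicator U x * (1 - indicator U (x + X i)) :: real) \<longlonglongrightarrow> 0"
        proof (cases "x \<in> U")
          case True
          have "(\<lambda>i. x + X i) \<longlonglongrightarrow> x + 0" using X by (intro tendsto_intros) auto
          then have "eventually (\<lambda>i. x + X i \<in> U) sequentially"
            using U True by (auto intro: topological_tendstoD)
          then show ?thesis by (intro tendsto_eventually, elim eventually_mono) (use True in auto)
        qed auto
      qed
    qed (use U in \<open>auto simp: indicator_def\<close>)
    then show "((\<lambda>s. LINT x|lborel. indicator U x * (1 - indicator U (x + s)) :: real) \<circ> X) \<longlonglongrightarrow> 0"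
      by (simp add: o_def)
  qed
  show ?thesis
    unfolding L1_shift_cont_def eq
  proof (intro allI impI)
    fix e :: real assume "e > 0"
    then have "e / 2 > 0" by simp
    from LIM_D[OF lim this] obtain d where d: "d > 0"
      "\<And>s. s \<noteq> 0 \<Longrightarrow> \<bar>s\<bar> < d \<Longrightarrow> \<bar>LINT x|lborel. indicator U x * (1 - indicator U (x + s)) :: real\<bar> < e / 2"
      by auto
    have z: "(LINT x|lborel. indicator U x * (1 - indicator U (x + 0)) :: real) = 0"
      by (auto intro!: integral_eq_zero_AE simp: indicator_def)
    show "\<exists>d>0. \<forall>s. \<bar>s\<bar> < d \<longrightarrow> 2 * (LINT x|lborel. indicator U x * (1 - indicator U (x + s)) :: real) < e"
    proof (intro exI[of _ d] conjI allI impI)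
      fix s :: real assume "\<bar>s\<bar> < d"
      then show "2 * (LINT x|lborel. indicator U x * (1 - indicator U (x + s)) :: real) < e"
        using d(2)[of s] z \<open>e > 0\<close> by (cases "s = 0") auto
    qed (use d in auto)
  qed
qed

lemma L1_shift_cont_scale: "L1_shift_cont h \<Longrightarrow> L1_shift_cont (\<lambda>x. h x * c)"
proof (cases "c = 0")
  case False
  assume h: "L1_shift_cont h"
  have eq: "(LINT x|lborel. \<bar>h (x + s) * c - h x * c\<bar>) = (LINT x|lborel. \<bar>h (x + s) - h x\<bar>) * \<bar>c\<bar>" for s
    by (subst integral_mult_left_zero[symmetric]) (simp add: abs_mult[symmetric] left_diff_distrib)
  show ?thesis
    unfolding L1_shift_cont_def eq
  proof (intro allI impI)
    fix e :: real assume "e > 0"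
    then obtain d where "d > 0" "\<And>s. \<bar>s\<bar> < d \<Longrightarrow> (LINT x|lborel. \<bar>h (x + s) - h x\<bar>) < e / \<bar>c\<bar>"
      using h False unfolding L1_shift_cont_def by (meson divide_pos_pos zero_less_abs_iff)
    then show "\<exists>d>0. \<forall>s. \<bar>s\<bar> < d \<longrightarrow> (LINT x|lborel. \<bar>h (x + s) - h x\<bar>) * \<bar>c\<bar> < e"
      using False by (intro exI[of _ d]) (auto simp: pos_less_divide_eq)
  qed
qed (auto simp: L1_shift_cont_def intro: exI[of _ 1])

text \<open>
  Indicators are approximated from outside by open sets, and integrable functions by simple ones.
\<close>

lemma L1_shift_cont:
  fixes h :: "real \<Rightarrow> real"
  assumes "integrable lborel h"
  shows "L1_shift_cont h"
  using assms
proof (induction rule: integrable_induct)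
  case (base A c)
  have "L1_shift_cont (indicator A)"
  proof (rule L1_shift_cont_approx)
    show iA: "integrable lborel (indicator A :: real \<Rightarrow> real)"
      using base by (auto intro!: integrable_real_indicator)
    fix e :: real assume e: "e > 0"
    obtain U where U: "open U" "A \<subseteq> U" "U - A \<in> lmeasurable" "emeasure lebesgue (U - A) < ennreal e"
      using sets_lebesgue_outer_open[of A e] e base by auto
    have [measurable]: "U \<in> sets borel" "A \<in> sets borel" using U base by auto
    have em: "emeasure lborel (U - A) < ennreal e" using U(4) by simp
    have "U = A \<union> (U - A)" using U by auto
    then have "emeasure lborel U \<le> emeasure lborel A + emeasure lborel (U - A)"
      by (metis emeasure_subadditive \<open>A \<in> sets borel\<close> \<open>U \<in> sets borel\<close> sets.Diff sets_lborel)
    also have "\<dots> < \<infinity>" using base(2) em by (simp add: ennreal_add_eq_top less_top order.strict_implies_not_eq less_trans)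
    finally have fU: "emeasure lborel U < \<infinity>" .
    show "\<exists>k. integrable lborel k \<and> L1_shift_cont k \<and> (LINT x|lborel. \<bar>indicator A x - k x\<bar>) < e"
    proof (intro exI[of _ "indicator U"] conjI)
      show "integrable lborel (indicator U :: real \<Rightarrow> real)"
        using fU by (auto intro!: integrable_real_indicator)
      have "(LINT x|lborel. \<bar>indicator A x - indicator U x :: real\<bar>) = (LINT x|lborel. indicator (U - A) x)"
        using U(2) by (intro Bochner_Integration.integral_cong) (auto simp: indicator_def)
      also have "\<dots> = measure lborel (U - A)" by simp
      also have "\<dots> < e" using em e by (metis emeasure_eq_ennreal_measure ennreal_less_iff less_top measure_nonneg top.not_eq_extremum ennreal_less_top order.strict_trans)
      finally show "(LINT x|lborel. \<bar>indicator A x - indicator U x :: real\<bar>) < e" .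
    qed (use L1_shift_cont_open U fU in auto)
  qed
  then show ?case using L1_shift_cont_scale[of "indicator A" c] by simp
next
  case (add f g)
  show ?case
    unfolding L1_shift_cont_def
  proof (intro allI impI)
    fix e :: real assume "e > 0"
    then have e2: "e / 2 > 0" by simp
    obtain d1 where d1: "d1 > 0" "\<And>s. \<bar>s\<bar> < d1 \<Longrightarrow> (LINT x|lborel. \<bar>f (x + s) - f x\<bar>) < e / 2"
      using add e2 unfolding L1_shift_cont_def by blast
    obtain d2 where d2: "d2 > 0" "\<And>s. \<bar>s\<bar> < d2 \<Longrightarrow> (LINT x|lborel. \<bar>g (x + s) - g x\<bar>) < e / 2"
      using add e2 unfolding L1_shift_cont_def by blast
    show "\<exists>d>0. \<forall>s. \<bar>s\<bar> < d \<longrightarrow> (LINT x|lborel. \<bar>f (x + s) + g (x + s) - (f x + g x)\<bar>) < e"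
    proof (intro exI[of _ "min d1 d2"] conjI allI impI)
      fix s assume s: "\<bar>s\<bar> < min d1 d2"
      have i: "integrable lborel (\<lambda>x. f (x + s))" "integrable lborel (\<lambda>x. g (x + s))"
        using add by (simp_all add: integrable_shift)
      have "(LINT x|lborel. \<bar>f (x + s) + g (x + s) - (f x + g x)\<bar>)
         \<le> (LINT x|lborel. \<bar>f (x + s) - f x\<bar> + \<bar>g (x + s) - g x\<bar>)"
        using i add by (intro integral_mono) auto
      also have "\<dots> = (LINT x|lborel. \<bar>f (x + s) - f x\<bar>) + (LINT x|lborel. \<bar>g (x + s) - g x\<bar>)"
        using i add by (intro Bochner_Integration.integral_add) auto
      finally show "(LINT x|lborel. \<bar>f (x + s) + g (x + s) - (f x + g x)\<bar>) < e"
        using d1(2)[of s] d2(2)[of s] s by simp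
    qed (use d1 d2 in auto)
  qed
next
  case (lim f s)
  show ?case
  proof (rule L1_shift_cont_approx)
    fix e :: real assume e: "e > 0"
    have "(\<lambda>i. LINT x|lborel. \<bar>f x - s i x\<bar>) \<longlonglongrightarrow> (LINT x::real|lborel. (0::real))"
    proof (rule integral_dominated_convergence[where w = "\<lambda>x. 3 * \<bar>f x\<bar>"])
      show "AE x in lborel. (\<lambda>i. \<bar>f x - s i x\<bar>) \<longlonglongrightarrow> 0"
      proof (rule AE_I2)
        fix x :: real
        have "(\<lambda>i. s i x) \<longlonglongrightarrow> f x" using lim by auto
        then have "(\<lambda>i. \<bar>f x - s i x\<bar>) \<longlonglongrightarrow> \<bar>f x - f x\<bar>" by (intro tendsto_intros)
        then show "(\<lambda>i. \<bar>f x - s i x\<bar>) \<longlonglongrightarrow> 0" by simp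
      qed
      show "AE x in lborel. norm \<bar>f x - s i x\<bar> \<le> 3 * \<bar>f x\<bar>" for i
      proof (rule AE_I2)
        fix x :: real
        have "\<bar>s i x\<bar> \<le> 2 * \<bar>f x\<bar>" using lim by (auto simp: real_norm_def)
        then show "norm \<bar>f x - s i x\<bar> \<le> 3 * \<bar>f x\<bar>" by simp
      qed
    qed (use lim in auto)
    then have "eventually (\<lambda>i. (LINT x|lborel. \<bar>f x - s i x\<bar>) < e) sequentially"
      using e by (intro order_tendstoD(2)[where y=0]) auto
    then obtain i where "(LINT x|lborel. \<bar>f x - s i x\<bar>) < e"
      using eventually_happens'[OF sequentially_bot] by blast
    then show "\<exists>k. integrable lborel k \<and> L1_shift_cont k \<and> (LINT x|lborel. \<bar>f x - k x\<bar>) < e"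
      using lim by blast
  qed (use lim in auto)
qed

lemma dominated_convergence_at:
  fixes f :: "'m \<Rightarrow> real" and z0 :: "'z::first_countable_topology"
  assumes f: "f \<in> borel_measurable M" and w: "integrable M w"
    and meas: "eventually (\<lambda>z. s z \<in> borel_measurable M) (at z0 within S)"
    and bound: "eventually (\<lambda>z. AE x in M. \<bar>s z x\<bar> \<le> w x) (at z0 within S)"
    and lim: "AE x in M. ((\<lambda>z. s z x) \<longlongrightarrow> f x) (at z0 within S)"
  shows "((\<lambda>z. integral\<^sup>L M (s z)) \<longlongrightarrow> integral\<^sup>L M f) (at z0 within S)"
  unfolding tendsto_at_iff_sequentially
proof (intro allI impI)
  fix X :: "nat \<Rightarrow> 'z" assume X: "\<forall>i. X i \<in> S - {z0}" "X \<longlonglongrightarrow> z0"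
  then have F: "filterlim X (at z0 within S) sequentially"
    by (auto simp: filterlim_at intro!: always_eventually)
  have "eventually (\<lambda>i. s (X i) \<in> borel_measurable M \<and> (AE x in M. \<bar>s (X i) x\<bar> \<le> w x)) sequentially"
    using eventually_conj[OF meas bound] F unfolding filterlim_iff by blast
  then obtain N where N: "\<And>i. i \<ge> N \<Longrightarrow> s (X i) \<in> borel_measurable M"
    "\<And>i. i \<ge> N \<Longrightarrow> AE x in M. \<bar>s (X i) x\<bar> \<le> w x"
    unfolding eventually_sequentially by blast
  have "(\<lambda>i. integral\<^sup>L M (s (X (i + N)))) \<longlonglongrightarrow> integral\<^sup>L M f"
  proof (rule integral_dominated_convergence[OF f _ w])
    show "AE x in M. (\<lambda>i. s (X (i + N)) x) \<longlonglongrightarrow> f x"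
      using lim
    proof eventually_elim
      case (elim x)
      from filterlim_compose[OF this F] show ?case by (rule LIMSEQ_ignore_initial_segment)
    qed
  qed (use N in auto)
  then show "((\<lambda>z. integral\<^sup>L M (s z)) \<circ> X) \<longlonglongrightarrow> integral\<^sup>L M f"
    by (simp add: o_def LIMSEQ_offset)
qed

lemma integrable_indicator_Icc: "integrable lborel (indicator {a..b} :: real \<Rightarrow> real)"
  by (rule integrable_real_indicator) (auto simp: emeasure_lborel_Icc_eq)

text \<open>
  Square integrable Borel functions, not classes: with pointwise values, sums, translates and
  primitives are literal, and null sets only enter where the classes of the data are represented.
\<close>

definition sqint :: "(real \<Rightarrow> real) \<Rightarrow> bool" where
  "sqint f \<longleftrightarrow> f \<in> borel_measurable borel \<and> integrable lborel (\<lambda>x. (f x)\<^sup>2)"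

lemma sqintD: "sqint f \<Longrightarrow> f \<in> borel_measurable borel" "sqint f \<Longrightarrow> integrable lborel (\<lambda>x. (f x)\<^sup>2)"
  by (auto simp: sqint_def)

lemma sq_add_le: "((x::real) + y)\<^sup>2 \<le> 2 * x\<^sup>2 + 2 * y\<^sup>2"
  using sum_squares_bound[of x y] by (simp add: power2_sum)

lemma sqint_add: "sqint f \<Longrightarrow> sqint g \<Longrightarrow> sqint (\<lambda>x. f x + g x)"
proof -
  assume f: "sqint f" and g: "sqint g"
  note [measurable] = sqintD(1)[OF f] sqintD(1)[OF g]
  have "integrable lborel (\<lambda>x. (f x + g x)\<^sup>2)"
  proof (rule Bochner_Integration.integrable_bound)
    show "integrable lborel (\<lambda>x. 2 * (f x)\<^sup>2 + 2 * (g x)\<^sup>2)"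
      using sqintD(2)[OF f] sqintD(2)[OF g] by simp
  qed (simp_all add: sq_add_le)
  then show ?thesis unfolding sqint_def by simp
qed

lemma sqint_cmult: "sqint f \<Longrightarrow> sqint (\<lambda>x. c * f x)"
  unfolding sqint_def power_mult_distrib
  by (intro conjI borel_measurable_times borel_measurable_const integrable_mult_right) simp_all

lemma sqint_diff: "sqint f \<Longrightarrow> sqint g \<Longrightarrow> sqint (\<lambda>x. f x - g x)"
  using sqint_add[of f "\<lambda>x. (- 1) * g x"] sqint_cmult[of g "-1"] by simp

lemma sqint_shift: "sqint f \<Longrightarrow> sqint (\<lambda>x. f (x + c))"
  using integrable_shift[of "\<lambda>x. (f x)\<^sup>2" c] measurable_compose[of "\<lambda>x. x + c" lborel borel f borel]
  unfolding sqint_def by simp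

lemma sqint_bounded:
  assumes [measurable]: "f \<in> borel_measurable borel" and "\<And>x. \<bar>f x\<bar> \<le> B" "\<And>x. \<bar>x\<bar> > M \<Longrightarrow> f x = 0"
  shows "sqint f"
  unfolding sqint_def
proof
  show "integrable lborel (\<lambda>x. (f x)\<^sup>2)"
  proof (rule Bochner_Integration.integrable_bound)
    show "integrable lborel (\<lambda>x. B\<^sup>2 * indicator {-M..M} x :: real)"
      using integrable_indicator_Icc by simp
    show "AE x in lborel. norm ((f x)\<^sup>2) \<le> norm (B\<^sup>2 * indicator {- M..M} x)"
    proof (rule AE_I2)
      fix x :: real
      have "(f x)\<^sup>2 \<le> B\<^sup>2" using power_mono[OF assms(2)[of x], of 2] by simp
      then show "norm ((f x)\<^sup>2) \<le> norm (B\<^sup>2 * indicator {- M..M} x)"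
        using assms(3)[of x] by (cases "\<bar>x\<bar> > M") (auto simp: indicator_def)
    qed
  qed simp
qed (use assms in auto)

lemma sqint_integrable:
  assumes "sqint f" and "\<And>x. \<bar>x\<bar> > M \<Longrightarrow> f x = 0"
  shows "integrable lborel f"
proof (rule Bochner_Integration.integrable_bound)
  show "integrable lborel (\<lambda>x. (f x)\<^sup>2 + indicator {-M..M} x :: real)"
    using sqintD(2)[OF assms(1)] integrable_indicator_Icc by simp
  show "AE x in lborel. norm (f x) \<le> norm ((f x)\<^sup>2 + indicator {- M..M} x)"
  proof (rule AE_I2)
    fix x :: real
    have "\<bar>f x\<bar> \<le> (f x)\<^sup>2 + 1" using sum_squares_bound[of "\<bar>f x\<bar>" 1] zero_le_power2[of "f x"]
      unfolding power2_abs power_one by linarith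
    then show "norm (f x) \<le> norm ((f x)\<^sup>2 + indicator {- M..M} x)"
      using assms(2)[of x] by (cases "\<bar>x\<bar> > M") (auto simp: indicator_def)
  qed
qed (use sqintD(1)[OF assms(1)] in simp)

text \<open>
  Convergence to \<open>0\<close> in \<open>L\<^sup>2\<close>. It is only required that the functions are square integrable eventually,
  because a difference quotient has no meaning at the point itself.
\<close>

definition L2_null :: "'i filter \<Rightarrow> ('i \<Rightarrow> real \<Rightarrow> real) \<Rightarrow> bool" where
  "L2_null F f \<longleftrightarrow> eventually (\<lambda>s. sqint (f s)) F \<and> ((\<lambda>s. LINT x|lborel. (f s x)\<^sup>2) \<longlongrightarrow> 0) F"

lemma L2_null_add:
  assumes "L2_null F f" "L2_null F g"
  shows "L2_null F (\<lambda>s x. f s x + g s x)"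
  unfolding L2_null_def
proof
  have ev: "eventually (\<lambda>s. sqint (f s) \<and> sqint (g s)) F"
    using assms unfolding L2_null_def by (auto intro: eventually_conj)
  then show "eventually (\<lambda>s. sqint (\<lambda>x. f s x + g s x)) F"
    by eventually_elim (auto intro: sqint_add)
  have "((\<lambda>s. 2 * (LINT x|lborel. (f s x)\<^sup>2) + 2 * (LINT x|lborel. (g s x)\<^sup>2)) \<longlongrightarrow> 2 * 0 + 2 * 0) F"
    using assms unfolding L2_null_def by (intro tendsto_intros) auto
  then have lim: "((\<lambda>s. 2 * (LINT x|lborel. (f s x)\<^sup>2) + 2 * (LINT x|lborel. (g s x)\<^sup>2)) \<longlongrightarrow> 0) F" by simp
  show "((\<lambda>s. LINT x|lborel. (f s x + g s x)\<^sup>2) \<longlongrightarrow> 0) F"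
  proof (rule tendsto_sandwich[OF _ _ tendsto_const lim])
    show "eventually (\<lambda>s. (LINT x|lborel. (f s x + g s x)\<^sup>2)
       \<le> 2 * (LINT x|lborel. (f s x)\<^sup>2) + 2 * (LINT x|lborel. (g s x)\<^sup>2)) F"
      using ev
    proof eventually_elim
      case (elim s)
      then have i: "integrable lborel (\<lambda>x. (f s x)\<^sup>2)" "integrable lborel (\<lambda>x. (g s x)\<^sup>2)"
        "integrable lborel (\<lambda>x. (f s x + g s x)\<^sup>2)"
        using sqintD(2) sqint_add by blast+
      have "(LINT x|lborel. (f s x + g s x)\<^sup>2) \<le> (LINT x|lborel. 2 * (f s x)\<^sup>2 + 2 * (g s x)\<^sup>2)"
        using i by (intro integral_mono) (auto simp: sq_add_le)
      then show ?case using i by simp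
    qed
  qed simp
qed

lemma L2_null_scale:
  assumes "L2_null F f" "(c \<longlongrightarrow> c0) F"
  shows "L2_null F (\<lambda>s x. c s * f s x)"
  unfolding L2_null_def
proof
  show "eventually (\<lambda>s. sqint (\<lambda>x. c s * f s x)) F"
    using assms(1) unfolding L2_null_def by (auto elim: eventually_mono intro: sqint_cmult)
  have "((\<lambda>s. (c s)\<^sup>2 * (LINT x|lborel. (f s x)\<^sup>2)) \<longlongrightarrow> c0\<^sup>2 * 0) F"
    using assms unfolding L2_null_def by (intro tendsto_intros) auto
  then show "((\<lambda>s. LINT x|lborel. (c s * f s x)\<^sup>2) \<longlongrightarrow> 0) F"
    by (simp add: power_mult_distrib)
qed

lemma L2_null_coeff:
  assumes "sqint f" "(c \<longlongrightarrow> 0) F"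
  shows "L2_null F (\<lambda>s x. c s * f x)"
  unfolding L2_null_def
proof
  show "eventually (\<lambda>s. sqint (\<lambda>x. c s * f x)) F"
    by (intro always_eventually allI sqint_cmult assms)
  have "((\<lambda>s. (c s)\<^sup>2 * (LINT x|lborel. (f x)\<^sup>2)) \<longlongrightarrow> 0\<^sup>2 * (LINT x|lborel. (f x)\<^sup>2)) F"
    using assms by (intro tendsto_intros) auto
  then show "((\<lambda>s. LINT x|lborel. (c s * f x)\<^sup>2) \<longlongrightarrow> 0) F"
    by (simp add: power_mult_distrib)
qed

lemma L2_null_shift:
  assumes "L2_null F f"
  shows "L2_null F (\<lambda>s x. f s (x + c))"
proof -
  have "(LINT x|lborel. (f s (x + c))\<^sup>2) = (LINT x|lborel. (f s x)\<^sup>2)" for s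
    by (rule integral_shift)
  moreover have "eventually (\<lambda>s. sqint (\<lambda>x. f s (x + c))) F"
    using assms[unfolded L2_null_def, THEN conjunct1] by eventually_elim (rule sqint_shift)
  ultimately show ?thesis using assms unfolding L2_null_def by simp
qed

lemma L2_null_compose:
  assumes "L2_null G f" "filterlim k G F"
  shows "L2_null F (\<lambda>s. f (k s))"
  unfolding L2_null_def
proof
  show "((\<lambda>s. LINT x|lborel. (f (k s) x)\<^sup>2) \<longlongrightarrow> 0) F"
    using filterlim_compose[of "\<lambda>s. LINT x|lborel. (f s x)\<^sup>2" "nhds 0" G k F] assms
    unfolding L2_null_def by simp
  show "eventually (\<lambda>s. sqint (f (k s))) F"
    using assms(1)[unfolded L2_null_def, THEN conjunct1] assms(2)[unfolded filterlim_iff] by blast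
qed

lemma L2_null_cong:
  assumes "L2_null F f" "eventually (\<lambda>s. \<forall>x. f s x = g s x) F"
  shows "L2_null F g"
proof -
  have ev: "eventually (\<lambda>s. f s = g s) F" using assms(2) by eventually_elim auto
  have "((\<lambda>s. LINT x|lborel. (f s x)\<^sup>2) \<longlongrightarrow> 0) F \<longleftrightarrow> ((\<lambda>s. LINT x|lborel. (g s x)\<^sup>2) \<longlongrightarrow> 0) F"
    using ev by (intro tendsto_cong) (auto elim: eventually_mono)
  moreover have "eventually (\<lambda>s. sqint (g s)) F"
    using ev assms(1)[unfolded L2_null_def, THEN conjunct1] by eventually_elim simp
  ultimately show ?thesis using assms(1) unfolding L2_null_def by simp
qed

lemma L2_nullI:
  assumes "\<And>s. sqint (f s)"
    and "\<And>e. e > 0 \<Longrightarrow> \<exists>d>0. \<forall>s. s \<noteq> 0 \<longrightarrow> \<bar>s\<bar> < d \<longrightarrow> (LINT x|lborel. (f s x)\<^sup>2) \<le> e"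
  shows "L2_null (at (0::real)) f"
  unfolding L2_null_def
proof
  show "((\<lambda>s. LINT x|lborel. (f s x)\<^sup>2) \<longlongrightarrow> 0) (at 0)"
  proof (rule LIM_I)
    fix e :: real assume "e > 0"
    then obtain d where d: "d > 0" "\<And>s. s \<noteq> 0 \<Longrightarrow> \<bar>s\<bar> < d \<Longrightarrow> (LINT x|lborel. (f s x)\<^sup>2) \<le> e / 2"
      using assms(2)[of "e / 2"] by auto
    show "\<exists>d>0. \<forall>s. s \<noteq> 0 \<and> norm (s - 0) < d \<longrightarrow> norm ((LINT x|lborel. (f s x)\<^sup>2) - 0) < e"
    proof (intro exI[of _ d] conjI allI impI, rule d)
      fix s :: real assume "s \<noteq> 0 \<and> norm (s - 0) < d"
      then have "(LINT x|lborel. (f s x)\<^sup>2) \<le> e / 2" using d(2)[of s] by simp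
      moreover have "(LINT x|lborel. (f s x)\<^sup>2) \<ge> 0" by simp
      ultimately show "norm ((LINT x|lborel. (f s x)\<^sup>2) - 0) < e"
        using \<open>e > 0\<close> by (simp only: real_norm_def diff_zero abs_of_nonneg)
    qed
  qed
qed (use assms in auto)

text \<open>
  For the truncation of \<open>h\<close> at height \<open>N\<close>, the squared \<open>L\<^sup>2\<close> norm of an increment is at most \<open>2 N\<close> times
  its \<open>L\<^sup>1\<close> norm, which reduces the claim to continuity of translations in \<open>L\<^sup>1\<close>.
\<close>

lemma L2_shift_cont:
  assumes h: "sqint h" "integrable lborel h" and e: "e > 0"
  shows "\<exists>d>0. \<forall>s. \<bar>s\<bar> < d \<longrightarrow> (LINT x|lborel. (h (x + s) - h x)\<^sup>2) \<le> e"
proof -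
  note [measurable] = sqintD(1)[OF h(1)]
  define k where "k N x = max (- real N) (min (real N) (h x))" for N x
  have [measurable]: "k N \<in> borel_measurable borel" for N unfolding k_def by measurable
  have hk: "\<bar>h x - k N x\<bar> \<le> \<bar>h x\<bar>" for N x unfolding k_def by auto
  have hk2: "(h x - k N x)\<^sup>2 \<le> (h x)\<^sup>2" for N x using hk[of x N] abs_le_square_iff by blast
  have sq: "sqint (\<lambda>x. h x - k N x)" for N
    unfolding sqint_def
    by (auto intro!: Bochner_Integration.integrable_bound[OF sqintD(2)[OF h(1)]] hk2)
  have "(\<lambda>N. LINT x|lborel. (h x - k N x)\<^sup>2) \<longlonglongrightarrow> (LINT x::real|lborel. (0::real))"
  proof (rule integral_dominated_convergence[OF _ _ sqintD(2)[OF h(1)]])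
    show "AE x in lborel. (\<lambda>N. (h x - k N x)\<^sup>2) \<longlonglongrightarrow> 0"
    proof (rule AE_I2)
      fix x :: real
      obtain N0 where "\<bar>h x\<bar> \<le> real N0" using real_arch_simple by blast
      then have "eventually (\<lambda>N. (h x - k N x)\<^sup>2 = 0) sequentially"
        unfolding eventually_sequentially k_def by (intro exI[of _ N0]) auto
      then show "(\<lambda>N. (h x - k N x)\<^sup>2) \<longlonglongrightarrow> 0" by (rule tendsto_eventually)
    qed
  qed (use hk2 in auto)
  then have "eventually (\<lambda>N. (LINT x|lborel. (h x - k N x)\<^sup>2) < e / 16) sequentially"
    using e by (intro order_tendstoD(2)[where y=0]) auto
  then obtain N where N: "(LINT x|lborel. (h x - k N x)\<^sup>2) < e / 16"
    using eventually_happens'[OF sequentially_bot] by blast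
  have pe: "e / (8 * (real N + 1)) > 0" using e by simp
  obtain d where d: "d > 0" "\<And>s. \<bar>s\<bar> < d \<Longrightarrow> (LINT x|lborel. \<bar>h (x + s) - h x\<bar>) < e / (8 * (real N + 1))"
    using L1_shift_cont[OF h(2)] pe unfolding L1_shift_cont_def by blast
  show ?thesis
  proof (intro exI[of _ d] conjI allI impI)
    fix s assume s: "\<bar>s\<bar> < d"
    have ptw: "(h (x + s) - h x)\<^sup>2 \<le> 4 * (h (x + s) - k N (x + s))\<^sup>2 + 4 * (h x - k N x)\<^sup>2
        + 4 * real N * \<bar>h (x + s) - h x\<bar>" for x
    proof -
      have kk: "\<bar>k N (x + s) - k N x\<bar> \<le> \<bar>h (x + s) - h x\<bar>" "\<bar>k N (x + s) - k N x\<bar> \<le> 2 * real N"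
        unfolding k_def by auto
      have "(k N (x + s) - k N x)\<^sup>2 \<le> 2 * real N * \<bar>h (x + s) - h x\<bar>"
        using mult_mono[OF kk(2,1)] by (simp add: power2_eq_square abs_mult[symmetric])
      moreover have "(h (x + s) - h x)\<^sup>2 \<le> 2 * (k N (x + s) - k N x)\<^sup>2
          + 2 * ((h (x + s) - k N (x + s)) + (- (h x - k N x)))\<^sup>2"
        using sq_add_le[of "k N (x + s) - k N x" "(h (x + s) - k N (x + s)) + (- (h x - k N x))"] by simp
      moreover have "((h (x + s) - k N (x + s)) + (- (h x - k N x)))\<^sup>2
          \<le> 2 * (h (x + s) - k N (x + s))\<^sup>2 + 2 * (h x - k N x)\<^sup>2"
        using sq_add_le[of "h (x + s) - k N (x + s)" "- (h x - k N x)"] by (simp only: power2_minus)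
      ultimately show ?thesis by linarith
    qed
    have i1: "integrable lborel (\<lambda>x. (h x - k N x)\<^sup>2)" using sqintD(2)[OF sq] .
    then have i2: "integrable lborel (\<lambda>x. (h (x + s) - k N (x + s))\<^sup>2)"
      using integrable_shift[of "\<lambda>x. (h x - k N x)\<^sup>2" s] by simp
    have i3: "integrable lborel (\<lambda>x. \<bar>h (x + s) - h x\<bar>)"
      using h(2) integrable_shift[of h s] by auto
    have i0: "integrable lborel (\<lambda>x. (h (x + s) - h x)\<^sup>2)"
      by (rule sqintD(2)[OF sqint_diff[OF sqint_shift[OF h(1)] h(1)]])
    have "(LINT x|lborel. (h (x + s) - h x)\<^sup>2) \<le> (LINT x|lborel. 4 * (h (x + s) - k N (x + s))\<^sup>2
        + 4 * (h x - k N x)\<^sup>2 + 4 * real N * \<bar>h (x + s) - h x\<bar>)"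
      using i0 i1 i2 i3 ptw by (intro integral_mono) auto
    also have "\<dots> = 4 * (LINT x|lborel. (h (x + s) - k N (x + s))\<^sup>2) + 4 * (LINT x|lborel. (h x - k N x)\<^sup>2)
        + 4 * real N * (LINT x|lborel. \<bar>h (x + s) - h x\<bar>)"
      using i1 i2 i3 by simp
    also have "(LINT x|lborel. (h (x + s) - k N (x + s))\<^sup>2) = (LINT x|lborel. (h x - k N x)\<^sup>2)"
      using integral_shift[of "\<lambda>x. (h x - k N x)\<^sup>2" s] by simp
    also have "4 * real N * (LINT x|lborel. \<bar>h (x + s) - h x\<bar>) \<le> 4 * real N * (e / (8 * (real N + 1)))"
      using d(2)[OF s] by (intro mult_left_mono) auto
    also have "\<dots> \<le> e / 2 * (real N / (real N + 1))" by (simp add: field_simps)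
    also have "\<dots> \<le> e / 2 * 1" using e by (intro mult_left_mono) auto
    finally have "(LINT x|lborel. (h (x + s) - h x)\<^sup>2)
        \<le> 4 * (LINT x|lborel. (h x - k N x)\<^sup>2) + 4 * (LINT x|lborel. (h x - k N x)\<^sup>2) + e / 2 * 1"
      by simp
    then show "(LINT x|lborel. (h (x + s) - h x)\<^sup>2) \<le> e" using N e by linarith
  qed (use d in auto)
qed

lemma nn_integral_le_imp_integral_le:
  fixes f :: "'a \<Rightarrow> real"
  assumes [measurable]: "f \<in> borel_measurable M" and "\<And>x. f x \<ge> 0" "0 \<le> e"
    and le: "(\<integral>\<^sup>+x. ennreal (f x) \<partial>M) \<le> ennreal e"
  shows "integrable M f \<and> (LINT x|M. f x) \<le> e"
proof
  show i: "integrable M f"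
    using le assms by (intro integrableI_nonneg) (auto intro: le_less_trans)
  have "(\<integral>\<^sup>+x. ennreal (f x) \<partial>M) = ennreal (LINT x|M. f x)"
    by (rule nn_integral_eq_integral[OF i]) (use assms in auto)
  then show "(LINT x|M. f x) \<le> e" using le assms(3) by simp
qed

definition prim :: "(real \<Rightarrow> real) \<Rightarrow> real \<Rightarrow> real" where
  "prim h x = (LINT y|lborel. indicator {..x} y * h y)"

lemma integrable_ind:
  fixes h :: "'a \<Rightarrow> real"
  assumes "integrable M h" "A \<in> sets M"
  shows "integrable M (\<lambda>y. indicator A y * h y)"
  using integrable_mult_indicator[OF assms(2,1)] by simp

lemma prim_diff:
  assumes "integrable lborel h" "x \<le> y"
  shows "prim h y - prim h x = (LINT z|lborel. indicator {x<..y} z * h z)"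
proof -
  have "prim h y - prim h x = (LINT z|lborel. indicator {..y} z * h z - indicator {..x} z * h z)"
    unfolding prim_def by (rule Bochner_Integration.integral_diff[symmetric]; rule integrable_ind[OF assms(1)]) auto
  also have "\<dots> = (LINT z|lborel. indicator {x<..y} z * h z)"
    using assms(2) by (intro Bochner_Integration.integral_cong) (auto simp: indicator_def)
  finally show ?thesis .
qed

lemma prim_bound:
  assumes h: "integrable lborel h"
  shows "\<bar>prim h x\<bar> \<le> (LINT y|lborel. \<bar>h y\<bar>)"
proof -
  have i: "integrable lborel (\<lambda>y. indicator {..x} y * h y)" by (rule integrable_ind[OF h]) simp
  have "\<bar>prim h x\<bar> \<le> (LINT y|lborel. \<bar>indicator {..x} y * h y\<bar>)"
    unfolding prim_def by (rule integral_abs_bound)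
  also have "\<dots> \<le> (LINT y|lborel. \<bar>h y\<bar>)"
    using h integrable_abs[OF i] by (intro integral_mono) (auto simp: abs_mult indicator_def)
  finally show ?thesis .
qed

lemma prim_eq_0:
  assumes "\<And>y. y < - R \<Longrightarrow> h y = 0" "x < - R"
  shows "prim h x = 0"
  unfolding prim_def using assms by (intro integral_eq_zero_AE AE_I2) (auto simp: indicator_def)

lemma prim_eq_total:
  assumes "\<And>y. y > R \<Longrightarrow> h y = 0" "x \<ge> R"
  shows "prim h x = (LINT y|lborel. h y)"
  unfolding prim_def using assms by (intro Bochner_Integration.integral_cong) (auto simp: indicator_def not_le)

lemma prim_continuous:
  assumes h: "integrable lborel h"
  shows "continuous_on UNIV (prim h)"
proof -
  note [measurable] = borel_measurable_integrable[OF h]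
  have "(prim h \<longlongrightarrow> prim h x) (at x)" for x
    unfolding prim_def
  proof (rule dominated_convergence_at[where w = "\<lambda>y. \<bar>h y\<bar>"])
    show "AE y in lborel. ((\<lambda>z. indicator {..z} y * h y) \<longlongrightarrow> indicator {..x} y * h y) (at x)"
      using AE_lborel_singleton[of x]
    proof eventually_elim
      case (elim y)
      have "eventually (\<lambda>z. (indicator {..z} y :: real) = indicator {..x} y) (at x)"
      proof (cases "y < x")
        case True
        have "eventually (\<lambda>z. z > y) (at x)" using True by (intro order_tendstoD(1)[OF tendsto_ident_at])
        then show ?thesis by eventually_elim (use True in \<open>auto simp: indicator_def\<close>)
      next
        case False
        then have "x < y" using elim by simp
        then have "eventually (\<lambda>z. z < y) (at x)" by (intro order_tendstoD(2)[OF tendsto_ident_at])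
        then show ?thesis by eventually_elim (use \<open>x < y\<close> in \<open>auto simp: indicator_def\<close>)
      qed
      then have "eventually (\<lambda>z. indicator {..z} y * h y = indicator {..x} y * h y) (at x)"
        by eventually_elim simp
      then show ?case by (rule tendsto_eventually)
    qed
  qed (use h in \<open>auto simp: indicator_def\<close>)
  then show ?thesis by (simp add: continuous_on_def)
qed

lemma prim_add: "integrable lborel h \<Longrightarrow> integrable lborel k \<Longrightarrow> prim (\<lambda>x. h x + k x) x = prim h x + prim k x"
  unfolding prim_def by (simp add: distrib_left integrable_ind)

lemma prim_cmult: "prim (\<lambda>x. c * h x) x = c * prim h x"
proof -
  have "(\<lambda>y. indicator {..x} y * (c * h y)) = (\<lambda>y. c * (indicator {..x} y * h y))" by auto
  then show ?thesis unfolding prim_def by simp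
qed

lemma prim_shift: "prim (\<lambda>y. h (y + c)) x = prim h (x + c)"
  unfolding prim_def
  using integral_shift[of "\<lambda>y. indicator {..x + c} y * h y" c] by (simp add: indicator_def)

text \<open>
  The difference quotient of a primitive minus \<open>h\<close> is the mean over \<open>r\<close> between \<open>0\<close> and \<open>d\<close> of
  \<open>h (x + r) - h x\<close>. Its square is at most the mean of the squares, so that after integration in \<open>x\<close>
  continuity of translations in \<open>L\<^sup>2\<close> applies.
\<close>

lemma L2_null_prim_quotient:
  assumes h: "sqint h" "integrable lborel h"
  shows "L2_null (at 0) (\<lambda>d x. (prim h (x + d) - prim h x) / d - h x)"
    and "d \<noteq> 0 \<Longrightarrow> sqint (\<lambda>x. (prim h (x + d) - prim h x) / d - h x)"
proof -
  note [measurable] = sqintD(1)[OF h(1)] borel_measurable_continuous_onI[OF prim_continuous[OF h(2)]]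
  define I where "I d = (if d > 0 then {0<..d} else {d<..0::real})" for d
  have [measurable]: "I d \<in> sets borel" for d unfolding I_def by auto
  have mI: "emeasure lborel (I d) = ennreal \<bar>d\<bar>" for d
    unfolding I_def by auto
  have iI: "integrable lborel (indicator (I d) :: real \<Rightarrow> real)" for d
    by (rule integrable_real_indicator) (auto simp: mI)
  have intI: "measure lborel (I d) = \<bar>d\<bar>" for d
    by (simp add: measure_def mI)
  have hs: "integrable lborel (\<lambda>r. h (x + r))" "integrable lborel (\<lambda>r. (h (x + r))\<^sup>2)" for x
    using h(2) sqintD(2)[OF h(1)] integrable_shift[of h x] integrable_shift[of "\<lambda>x. (h x)\<^sup>2" x]
    by (simp_all add: add.commute)
  have inc: "prim h (x + d) - prim h x = sgn d * (LINT r|lborel. indicator (I d) r * h (x + r))" if "d \<noteq> 0" for x d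
  proof (cases "d > 0")
    case True
    have "prim h (x + d) - prim h x = (LINT z|lborel. indicator {x<..x + d} z * h z)"
      using True by (intro prim_diff h) auto
    also have "\<dots> = (LINT r|lborel. indicator {x<..x + d} (r + x) * h (r + x))"
      by (rule integral_shift[symmetric])
    finally show ?thesis using True by (simp add: I_def indicator_def add.commute)
  next
    case False
    have "prim h x - prim h (x + d) = (LINT z|lborel. indicator {x + d<..x} z * h z)"
      using False by (intro prim_diff h) auto
    also have "\<dots> = (LINT r|lborel. indicator {x + d<..x} (r + x) * h (r + x))"
      by (rule integral_shift[symmetric])
    finally show ?thesis using False that by (simp add: I_def indicator_def add.commute)
  qed
  have quot: "(prim h (x + d) - prim h x) / d - h x = (LINT r|lborel. indicator (I d) r * (h (x + r) - h x)) / \<bar>d\<bar>"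
    if "d \<noteq> 0" for x d
  proof -
    have "(LINT r|lborel. indicator (I d) r * (h (x + r) - h x))
        = (LINT r|lborel. indicator (I d) r * h (x + r) - h x * indicator (I d) r)"
      by (simp add: algebra_simps)
    also have "\<dots> = (LINT r|lborel. indicator (I d) r * h (x + r)) - h x * \<bar>d\<bar>"
      using integrable_ind[OF hs(1)[of x], of "I d"] iI[of d] by (simp add: intI)
    finally have K: "(LINT r|lborel. indicator (I d) r * (h (x + r) - h x)) / \<bar>d\<bar>
        = (LINT r|lborel. indicator (I d) r * h (x + r)) / \<bar>d\<bar> - h x"
      using that by (simp add: diff_divide_distrib)
    have "sgn d / d = 1 / \<bar>d\<bar>" using that by (simp add: sgn_if)
    then have "(prim h (x + d) - prim h x) / d = (LINT r|lborel. indicator (I d) r * h (x + r)) / \<bar>d\<bar>"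
      unfolding inc[OF that] by (metis mult.commute mult_1 times_divide_eq_left)
    then show ?thesis unfolding K by simp
  qed
  have key: "integrable lborel (\<lambda>x. ((prim h (x + d) - prim h x) / d - h x)\<^sup>2) \<and>
      (LINT x|lborel. ((prim h (x + d) - prim h x) / d - h x)\<^sup>2) \<le> e"
    if d: "d \<noteq> 0" and e: "e \<ge> 0" "\<And>r. \<bar>r\<bar> \<le> \<bar>d\<bar> \<Longrightarrow> (LINT x|lborel. (h (x + r) - h x)\<^sup>2) \<le> e" for d e
  proof (rule nn_integral_le_imp_integral_le)
    have J: "((prim h (x + d) - prim h x) / d - h x)\<^sup>2
        \<le> (LINT r|lborel. indicator (I d) r * (h (x + r) - h x)\<^sup>2) / \<bar>d\<bar>" for x
    proof -
      define k where "k r = h (x + r) - h x" for r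
      define m where "m = (LINT r|lborel. indicator (I d) r * k r) / \<bar>d\<bar>"
      have ik: "integrable lborel (\<lambda>r. indicator (I d) r * k r)"
      proof -
        have "integrable lborel (\<lambda>r. indicator (I d) r * h (x + r) - h x * indicator (I d) r)"
          using integrable_ind[OF hs(1)[of x], of "I d"] iI[of d] by simp
        then show ?thesis by (simp add: k_def algebra_simps)
      qed
      have ik2: "integrable lborel (\<lambda>r. indicator (I d) r * (k r)\<^sup>2)"
      proof -
        have "integrable lborel (\<lambda>r. indicator (I d) r * (h (x + r))\<^sup>2 - (2 * h x) * (indicator (I d) r * h (x + r))
           + (h x)\<^sup>2 * indicator (I d) r)"
          using integrable_ind[OF hs(1)[of x], of "I d"] integrable_ind[OF hs(2)[of x], of "I d"] iI[of d] by simp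
        then show ?thesis by (simp add: k_def algebra_simps power2_diff)
      qed
      have "0 \<le> (LINT r|lborel. indicator (I d) r * (k r - m)\<^sup>2)" by (intro integral_nonneg_AE) auto
      also have "\<dots> = (LINT r|lborel. indicator (I d) r * (k r)\<^sup>2 - (2 * m) * (indicator (I d) r * k r)
           + m\<^sup>2 * indicator (I d) r)"
        by (simp add: algebra_simps power2_diff)
      also have "\<dots> = (LINT r|lborel. indicator (I d) r * (k r)\<^sup>2) - 2 * m * (LINT r|lborel. indicator (I d) r * k r)
           + m\<^sup>2 * \<bar>d\<bar>"
        using ik ik2 iI[of d] by (simp add: intI)
      also have "(LINT r|lborel. indicator (I d) r * k r) = m * \<bar>d\<bar>" using d by (simp add: m_def)
      finally have "m\<^sup>2 * \<bar>d\<bar> \<le> (LINT r|lborel. indicator (I d) r * (k r)\<^sup>2)"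
        by (simp add: power2_eq_square)
      then show ?thesis using d unfolding quot[OF d] m_def[symmetric] k_def[symmetric]
        by (simp add: pos_le_divide_eq)
    qed
    have sm: "ennreal ((LINT r|lborel. indicator (I d) r * (h (x + r) - h x)\<^sup>2) / \<bar>d\<bar>)
      = (\<integral>\<^sup>+r. ennreal (indicator (I d) r * (h (x + r) - h x)\<^sup>2 / \<bar>d\<bar>) \<partial>lborel)" for x
    proof -
      have "integrable lborel (\<lambda>r. indicator (I d) r * (h (x + r))\<^sup>2 - (2 * h x) * (indicator (I d) r * h (x + r))
           + (h x)\<^sup>2 * indicator (I d) r)"
        using integrable_ind[OF hs(1)[of x], of "I d"] integrable_ind[OF hs(2)[of x], of "I d"] iI[of d] by simp
      then have "integrable lborel (\<lambda>r. indicator (I d) r * (h (x + r) - h x)\<^sup>2)"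
        by (simp add: algebra_simps power2_diff)
      then have i: "integrable lborel (\<lambda>r. indicator (I d) r * (h (x + r) - h x)\<^sup>2 / \<bar>d\<bar>)" by simp
      show ?thesis by (subst nn_integral_eq_integral[OF i]) auto
    qed
    have "(\<integral>\<^sup>+x. ennreal (((prim h (x + d) - prim h x) / d - h x)\<^sup>2) \<partial>lborel)
        \<le> (\<integral>\<^sup>+x. (\<integral>\<^sup>+r. ennreal (indicator (I d) r * (h (x + r) - h x)\<^sup>2 / \<bar>d\<bar>) \<partial>lborel) \<partial>lborel)"
      using J by (intro nn_integral_mono) (simp add: sm[symmetric] ennreal_leI)
    also have "\<dots> = (\<integral>\<^sup>+r. (\<integral>\<^sup>+x. ennreal (indicator (I d) r * (h (x + r) - h x)\<^sup>2 / \<bar>d\<bar>) \<partial>lborel) \<partial>lborel)"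
      by (rule lborel_pair.Fubini') measurable
    also have "\<dots> \<le> (\<integral>\<^sup>+r. ennreal (e / \<bar>d\<bar>) * indicator (I d) r \<partial>lborel)"
    proof (rule nn_integral_mono)
      fix r :: real
      show "(\<integral>\<^sup>+x. ennreal (indicator (I d) r * (h (x + r) - h x)\<^sup>2 / \<bar>d\<bar>) \<partial>lborel) \<le> ennreal (e / \<bar>d\<bar>) * indicator (I d) r"
      proof (cases "r \<in> I d")
        case True
        then have r: "\<bar>r\<bar> \<le> \<bar>d\<bar>" by (auto simp: I_def split: if_splits)
        have i: "integrable lborel (\<lambda>x. (h (x + r) - h x)\<^sup>2 / \<bar>d\<bar>)"
          using sqintD(2)[OF sqint_diff[OF sqint_shift[OF h(1)] h(1)]] by simp
        have "(\<integral>\<^sup>+x. ennreal ((h (x + r) - h x)\<^sup>2 / \<bar>d\<bar>) \<partial>lborel) = ennreal (LINT x|lborel. (h (x + r) - h x)\<^sup>2 / \<bar>d\<bar>)"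
          by (rule nn_integral_eq_integral[OF i]) auto
        also have "\<dots> \<le> ennreal (e / \<bar>d\<bar>)" using e(2)[OF r] by (intro ennreal_leI) (simp add: divide_right_mono)
        finally show ?thesis using True by simp
      qed auto
    qed
    also have "\<dots> = ennreal (e / \<bar>d\<bar>) * ennreal \<bar>d\<bar>" by (subst nn_integral_cmult_indicator) (auto simp: mI)
    also have "\<dots> = ennreal e" using d e by (simp add: ennreal_mult[symmetric])
    finally show "(\<integral>\<^sup>+x. ennreal (((prim h (x + d) - prim h x) / d - h x)\<^sup>2) \<partial>lborel) \<le> ennreal e" .
  qed (use e in auto)
  show sq: "sqint (\<lambda>x. (prim h (x + d) - prim h x) / d - h x)" if "d \<noteq> 0" for d
  proof -
    have "(LINT x|lborel. (h (x + r) - h x)\<^sup>2) \<le> 4 * (LINT x|lborel. (h x)\<^sup>2)" for r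
    proof -
      have i: "integrable lborel (\<lambda>x. (h (x + r))\<^sup>2)" "integrable lborel (\<lambda>x. (h x)\<^sup>2)"
        "integrable lborel (\<lambda>x. (h (x + r) - h x)\<^sup>2)"
        using sqintD(2)[OF h(1)] sqintD(2)[OF sqint_shift[OF h(1)]] sqintD(2)[OF sqint_diff[OF sqint_shift[OF h(1)] h(1)]]
        by auto
      have "(h (x + r) - h x)\<^sup>2 \<le> 2 * (h (x + r))\<^sup>2 + 2 * (h x)\<^sup>2" for x
        using sq_add_le[of "h (x + r)" "- h x"] by simp
      then have "(LINT x|lborel. (h (x + r) - h x)\<^sup>2) \<le> (LINT x|lborel. 2 * (h (x + r))\<^sup>2 + 2 * (h x)\<^sup>2)"
        using i by (intro integral_mono) auto
      also have "\<dots> = 2 * (LINT x|lborel. (h (x + r))\<^sup>2) + 2 * (LINT x|lborel. (h x)\<^sup>2)" using i by simp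
      also have "(LINT x|lborel. (h (x + r))\<^sup>2) = (LINT x|lborel. (h x)\<^sup>2)" by (rule integral_shift)
      finally show ?thesis by simp
    qed
    from key[OF that _ this] show ?thesis unfolding sqint_def by auto
  qed
  show "L2_null (at 0) (\<lambda>d x. (prim h (x + d) - prim h x) / d - h x)"
    unfolding L2_null_def
  proof
    show "eventually (\<lambda>d. sqint (\<lambda>x. (prim h (x + d) - prim h x) / d - h x)) (at 0)"
      unfolding eventually_at by (intro exI[of _ 1]) (auto intro: sq)
    show "((\<lambda>d. LINT x|lborel. ((prim h (x + d) - prim h x) / d - h x)\<^sup>2) \<longlongrightarrow> 0) (at 0)"
    proof (rule LIM_I)
      fix e :: real assume "e > 0"
      then obtain d0 where d0: "d0 > 0" "\<And>s. \<bar>s\<bar> < d0 \<Longrightarrow> (LINT x|lborel. (h (x + s) - h x)\<^sup>2) \<le> e / 2"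
        using L2_shift_cont[OF h, of "e / 2"] by auto
      show "\<exists>s>0. \<forall>d. d \<noteq> 0 \<and> norm (d - 0) < s \<longrightarrow>
         norm ((LINT x|lborel. ((prim h (x + d) - prim h x) / d - h x)\<^sup>2) - 0) < e"
      proof (intro exI[of _ d0] conjI allI impI, rule d0)
        fix d :: real assume d: "d \<noteq> 0 \<and> norm (d - 0) < d0"
        then have "(LINT x|lborel. ((prim h (x + d) - prim h x) / d - h x)\<^sup>2) \<le> e / 2"
          using key[of d "e / 2"] d0(2) \<open>e > 0\<close> by auto
        moreover have "(LINT x|lborel. ((prim h (x + d) - prim h x) / d - h x)\<^sup>2) \<ge> 0" by simp
        ultimately show "norm ((LINT x|lborel. ((prim h (x + d) - prim h x) / d - h x)\<^sup>2) - 0) < e"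
          using \<open>e > 0\<close> by (simp only: real_norm_def diff_zero abs_of_nonneg)
      qed
    qed
  qed
qed

lemma prim_const_imp_AE_0:
  assumes h: "sqint h" "integrable lborel h" and c: "\<And>x. prim h x = c"
  shows "AE x in lborel. h x = 0"
proof -
  have "((\<lambda>d::real. LINT x|lborel. (h x)\<^sup>2) \<longlongrightarrow> 0) (at 0)"
    using L2_null_prim_quotient(1)[OF h] unfolding L2_null_def by (simp add: c)
  then have "(LINT x|lborel. (h x)\<^sup>2) = 0"
    using tendsto_unique[OF _ tendsto_const] by (metis at_neq_bot)
  then have "AE x in lborel. (h x)\<^sup>2 = 0"
    using integral_nonneg_eq_0_iff_AE[OF sqintD(2)[OF h(1)]] by simp
  then show ?thesis by simp
qed

definition L2_cts :: "real set \<Rightarrow> (real \<Rightarrow> real \<Rightarrow> real) \<Rightarrow> bool" where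
  "L2_cts I w \<longleftrightarrow> (\<forall>t\<in>I. sqint (w t) \<and> L2_null (at t within I) (\<lambda>s x. w s x - w t x))"

text \<open>
  A curve \<open>w\<close> in \<open>H\<^sup>1\<close> with space derivative \<open>a\<close> and time derivative \<open>b\<close>. The space derivative is encoded by
  \<open>w t = prim (a t)\<close>, the time derivative as an \<open>L\<^sup>2\<close> limit of difference quotients; carrying both along
  makes sums and products with functions of time elementary.
\<close>

definition energy_triple ::
  "real set \<Rightarrow> (real \<Rightarrow> real \<Rightarrow> real) \<Rightarrow> (real \<Rightarrow> real \<Rightarrow> real) \<Rightarrow> (real \<Rightarrow> real \<Rightarrow> real) \<Rightarrow> bool" where
  "energy_triple I w a b \<longleftrightarrow> L2_cts I w \<and> L2_cts I a \<and> L2_cts I b \<and>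
     (\<forall>t\<in>I. integrable lborel (a t) \<and> (\<forall>x. w t x = prim (a t) x) \<and>
        L2_null (at t within I) (\<lambda>s x. (w s x - w t x) / (s - t) - b t x))"

lemma eventually_at_neq: "eventually (\<lambda>s. s \<noteq> t) (at t within I)"
  unfolding eventually_at_filter by simp

lemma quotient_cancel: "r \<noteq> 0 \<Longrightarrow> r * (a / r - b) + r * b = (a::real)"
  by (simp add: right_diff_distrib)

lemma quotient_combine: "(a / (1 * r) - h) + (-1) * (b / ((-1) * r) - k) = (a + b) / r - (h - (k::real))"
  by (simp add: add_divide_distrib)

lemma energy_tripleI:
  assumes a: "L2_cts I a" and b: "L2_cts I b"
    and w: "\<And>t. t \<in> I \<Longrightarrow> sqint (w t)" "\<And>t. t \<in> I \<Longrightarrow> integrable lborel (a t)"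
      "\<And>t x. t \<in> I \<Longrightarrow> w t x = prim (a t) x"
    and q: "\<And>t. t \<in> I \<Longrightarrow> L2_null (at t within I) (\<lambda>s x. (w s x - w t x) / (s - t) - b t x)"
  shows "energy_triple I w a b"
  unfolding energy_triple_def
proof (intro conjI ballI a b w q allI)
  have lim: "((\<lambda>s. s - t) \<longlongrightarrow> 0) (at t within I)" for t :: real
    using tendsto_diff[OF tendsto_ident_at tendsto_const, of t t I] by simp
  show "L2_cts I w"
    unfolding L2_cts_def
  proof (intro ballI conjI w)
    fix t assume t: "t \<in> I"
    have bt: "sqint (b t)" using b t unfolding L2_cts_def by blast
    have "L2_null (at t within I) (\<lambda>s x. (s - t) * ((w s x - w t x) / (s - t) - b t x) + (s - t) * b t x)"
      by (rule L2_null_add[OF L2_null_scale[OF q[OF t] lim] L2_null_coeff[OF bt lim]])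
    then show "L2_null (at t within I) (\<lambda>s x. w s x - w t x)"
    proof (rule L2_null_cong)
      show "eventually (\<lambda>s. \<forall>x. (s - t) * ((w s x - w t x) / (s - t) - b t x) + (s - t) * b t x = w s x - w t x) (at t within I)"
        using eventually_at_neq by eventually_elim (simp add: quotient_cancel)
    qed
  qed
qed

lemma L2_cts_add:
  assumes "L2_cts I w" "L2_cts I w'"
  shows "L2_cts I (\<lambda>t x. w t x + w' t x)"
  unfolding L2_cts_def
proof (intro ballI conjI)
  fix t assume t: "t \<in> I"
  then show "sqint (\<lambda>x. w t x + w' t x)" using assms unfolding L2_cts_def by (auto intro: sqint_add)
  have "L2_null (at t within I) (\<lambda>s x. (w s x - w t x) + (w' s x - w' t x))"
    using assms t unfolding L2_cts_def by (intro L2_null_add) auto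
  then show "L2_null (at t within I) (\<lambda>s x. w s x + w' s x - (w t x + w' t x))"
    by (rule L2_null_cong) simp
qed

lemma L2_cts_mult:
  assumes w: "L2_cts I w" and c: "continuous_on I c"
  shows "L2_cts I (\<lambda>t x. c t * w t x)"
  unfolding L2_cts_def
proof (intro ballI conjI)
  fix t assume t: "t \<in> I"
  then have wt: "sqint (w t)" "L2_null (at t within I) (\<lambda>s x. w s x - w t x)"
    using w unfolding L2_cts_def by auto
  show "sqint (\<lambda>x. c t * w t x)" by (rule sqint_cmult[OF wt(1)])
  have ct: "(c \<longlongrightarrow> c t) (at t within I)" using c t by (simp add: continuous_on_def)
  then have "((\<lambda>s. c s - c t) \<longlongrightarrow> 0) (at t within I)" by (simp add: LIM_zero)
  then have "L2_null (at t within I) (\<lambda>s x. c s * (w s x - w t x) + (c s - c t) * w t x)"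
    by (intro L2_null_add L2_null_scale[OF wt(2) ct] L2_null_coeff[OF wt(1)])
  then show "L2_null (at t within I) (\<lambda>s x. c s * w s x - c t * w t x)"
    by (rule L2_null_cong) (simp add: algebra_simps)
qed

lemma energy_tripleD:
  assumes "energy_triple I w a b"
  shows "L2_cts I w" "L2_cts I a" "L2_cts I b"
    "\<And>t. t \<in> I \<Longrightarrow> sqint (w t)" "\<And>t. t \<in> I \<Longrightarrow> integrable lborel (a t)"
    "\<And>t x. t \<in> I \<Longrightarrow> w t x = prim (a t) x"
    "\<And>t. t \<in> I \<Longrightarrow> L2_null (at t within I) (\<lambda>s x. (w s x - w t x) / (s - t) - b t x)"
  using assms unfolding energy_triple_def L2_cts_def by blast+

lemma energy_triple_add:
  assumes 1: "energy_triple I w a b" and 2: "energy_triple I w' a' b'"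
  shows "energy_triple I (\<lambda>t x. w t x + w' t x) (\<lambda>t x. a t x + a' t x) (\<lambda>t x. b t x + b' t x)"
proof (rule energy_tripleI)
  note d1 = energy_tripleD[OF 1] and d2 = energy_tripleD[OF 2]
  show "L2_cts I (\<lambda>t x. a t x + a' t x)" "L2_cts I (\<lambda>t x. b t x + b' t x)"
    using d1 d2 by (auto intro: L2_cts_add)
  fix t assume t: "t \<in> I"
  show "sqint (\<lambda>x. w t x + w' t x)" by (rule sqint_add[OF d1(4)[OF t] d2(4)[OF t]])
  show "integrable lborel (\<lambda>x. a t x + a' t x)" using d1(5) d2(5) t by auto
  show "w t x + w' t x = prim (\<lambda>x. a t x + a' t x) x" for x
    using d1(5,6) d2(5,6) t by (simp add: prim_add)
  have "L2_null (at t within I) (\<lambda>s x. ((w s x - w t x) / (s - t) - b t x) + ((w' s x - w' t x) / (s - t) - b' t x))"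
    by (rule L2_null_add[OF d1(7)[OF t] d2(7)[OF t]])
  then show "L2_null (at t within I) (\<lambda>s x. (w s x + w' s x - (w t x + w' t x)) / (s - t) - (b t x + b' t x))"
  proof (rule L2_null_cong)
    show "eventually (\<lambda>s. \<forall>x. ((w s x - w t x) / (s - t) - b t x) + ((w' s x - w' t x) / (s - t) - b' t x)
       = (w s x + w' s x - (w t x + w' t x)) / (s - t) - (b t x + b' t x)) (at t within I)"
      by (simp add: divide_inverse algebra_simps)
  qed
qed

lemma energy_triple_mult:
  assumes 1: "energy_triple I w a b"
    and c: "\<And>t. t \<in> I \<Longrightarrow> (c has_real_derivative c' t) (at t within I)" and c': "continuous_on I c'"
  shows "energy_triple I (\<lambda>t x. c t * w t x) (\<lambda>t x. c t * a t x) (\<lambda>t x. c t * b t x + c' t * w t x)"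
proof (rule energy_tripleI)
  note d1 = energy_tripleD[OF 1]
  have cc: "continuous_on I c" by (rule DERIV_continuous_on[OF c])
  show "L2_cts I (\<lambda>t x. c t * a t x)" "L2_cts I (\<lambda>t x. c t * b t x + c' t * w t x)"
    using d1 cc c' by (auto intro!: L2_cts_add L2_cts_mult)
  fix t assume t: "t \<in> I"
  show "sqint (\<lambda>x. c t * w t x)" by (rule sqint_cmult[OF d1(4)[OF t]])
  show "integrable lborel (\<lambda>x. c t * a t x)" using d1(5) t by auto
  show "c t * w t x = prim (\<lambda>x. c t * a t x) x" for x
    using d1(6) t by (simp add: prim_cmult)
  have bt: "sqint (b t)" "sqint (w t)" using d1(3) d1(4)[OF t] t unfolding L2_cts_def by auto
  have ct: "(c \<longlongrightarrow> c t) (at t within I)" using cc t by (simp add: continuous_on_def)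
  then have ct0: "((\<lambda>s. c s - c t) \<longlongrightarrow> 0) (at t within I)" by (simp add: LIM_zero)
  have cq: "((\<lambda>s. (c s - c t) / (s - t) - c' t) \<longlongrightarrow> 0) (at t within I)"
    using c[OF t] unfolding has_field_derivative_iff by (simp add: LIM_zero)
  have "L2_null (at t within I) (\<lambda>s x. c s * ((w s x - w t x) / (s - t) - b t x)
      + ((c s - c t) * b t x + ((c s - c t) / (s - t) - c' t) * w t x))"
    by (intro L2_null_add L2_null_scale[OF d1(7)[OF t] ct] L2_null_coeff[OF bt(1) ct0] L2_null_coeff[OF bt(2) cq])
  then show "L2_null (at t within I) (\<lambda>s x. (c s * w s x - c t * w t x) / (s - t) - (c t * b t x + c' t * w t x))"
  proof (rule L2_null_cong)
    show "eventually (\<lambda>s. \<forall>x. c s * ((w s x - w t x) / (s - t) - b t x)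
      + ((c s - c t) * b t x + ((c s - c t) / (s - t) - c' t) * w t x)
       = (c s * w s x - c t * w t x) / (s - t) - (c t * b t x + c' t * w t x)) (at t within I)"
      by (simp add: divide_inverse algebra_simps)
  qed
qed

lemma L2_cts_shift:
  assumes h: "sqint h" "integrable lborel h" and c: "\<bar>c\<bar> = 1"
  shows "L2_cts I (\<lambda>t x. h (x + c * t))"
  unfolding L2_cts_def
proof (intro ballI conjI)
  fix t assume "t \<in> I"
  show "sqint (\<lambda>x. h (x + c * t))" by (rule sqint_shift[OF h(1)])
  have 0: "L2_null (at 0) (\<lambda>s x. h (x + s) - h x)"
    by (rule L2_nullI[OF sqint_diff[OF sqint_shift[OF h(1)] h(1)]]) (use L2_shift_cont[OF h] in meson)
  have "((\<lambda>s. c * (s - t)) \<longlongrightarrow> c * (t - t)) (at t within I)" by (intro tendsto_intros)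
  then have "filterlim (\<lambda>s. c * (s - t)) (at 0) (at t within I)"
    unfolding filterlim_at using eventually_at_neq[of t I] c
    by (auto elim!: eventually_mono)
  from L2_null_shift[OF L2_null_compose[OF 0 this], of "c * t"]
  show "L2_null (at t within I) (\<lambda>s x. h (x + c * s) - h (x + c * t))"
    by (simp add: algebra_simps)
qed

text \<open>
  The two travelling parts need not be in \<open>L\<^sup>2\<close> separately, since a primitive may tend to a nonzero
  constant at \<open>+\<infinity>\<close>; only the total integral of the two profiles has to vanish. This is what allows
  velocities of nonzero mean in d'Alembert's formula.
\<close>

lemma travelling_wave_triple:
  assumes h: "sqint h1" "sqint h2"
    and supp: "\<And>x. \<bar>x\<bar> > R \<Longrightarrow> h1 x = 0" "\<And>x. \<bar>x\<bar> > R \<Longrightarrow> h2 x = 0"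
    and tot: "(LINT x|lborel. h1 x) + (LINT x|lborel. h2 x) = 0"
  shows "energy_triple I (\<lambda>t x. prim h1 (x + t) + prim h2 (x - t))
     (\<lambda>t x. h1 (x + t) + h2 (x - t)) (\<lambda>t x. h1 (x + t) - h2 (x - t))"
proof -
  have i: "integrable lborel h1" "integrable lborel h2"
    using sqint_integrable[OF h(1) supp(1)] sqint_integrable[OF h(2) supp(2)] by auto
  have c1: "L2_cts I (\<lambda>t x. h1 (x + t))" and c2: "L2_cts I (\<lambda>t x. h2 (x - t))"
    using L2_cts_shift[OF h(1) i(1), of 1 I] L2_cts_shift[OF h(2) i(2), of "-1" I] by simp_all
  note [measurable] = borel_measurable_continuous_onI[OF prim_continuous[OF i(1)]]
    borel_measurable_continuous_onI[OF prim_continuous[OF i(2)]]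
  show ?thesis
  proof (rule energy_tripleI)
    show "L2_cts I (\<lambda>t x. h1 (x + t) + h2 (x - t))" by (rule L2_cts_add[OF c1 c2])
    show "L2_cts I (\<lambda>t x. h1 (x + t) - h2 (x - t))"
      using L2_cts_add[OF c1 L2_cts_mult[OF c2, of "\<lambda>_. -1"]] by simp
    fix t :: real
    assume "t \<in> I"
    show "sqint (\<lambda>x. prim h1 (x + t) + prim h2 (x - t))"
    proof (rule sqint_bounded)
      show "\<bar>prim h1 (x + t) + prim h2 (x - t)\<bar> \<le> (LINT y|lborel. \<bar>h1 y\<bar>) + (LINT y|lborel. \<bar>h2 y\<bar>)" for x
        using prim_bound[OF i(1), of "x + t"] prim_bound[OF i(2), of "x - t"] by linarith
      show "prim h1 (x + t) + prim h2 (x - t) = 0" if "\<bar>x\<bar> > \<bar>R\<bar> + \<bar>t\<bar>" for x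
      proof (cases "x > 0")
        case True
        then have "prim h1 (x + t) = (LINT y|lborel. h1 y)" "prim h2 (x - t) = (LINT y|lborel. h2 y)"
          using that by (auto intro!: prim_eq_total[of R] supp)
        then show ?thesis using tot by simp
      next
        case False
        then have "prim h1 (x + t) = 0" "prim h2 (x - t) = 0"
          using that by (auto intro!: prim_eq_0[of R] supp)
        then show ?thesis by simp
      qed
    qed measurable
    have ish: "integrable lborel (\<lambda>x. h1 (x + t))" "integrable lborel (\<lambda>x. h2 (x + - t))"
      using i by (auto simp only: integrable_shift)
    then show "integrable lborel (\<lambda>x. h1 (x + t) + h2 (x - t))" by simp
    show "prim h1 (x + t) + prim h2 (x - t) = prim (\<lambda>x. h1 (x + t) + h2 (x - t)) x" for x
      using prim_add[OF ish, of x] prim_shift[of h1 t x] prim_shift[of h2 "-t" x] by simp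
    have lim: "filterlim (\<lambda>s. c * (s - t)) (at 0) (at t within I)" if "\<bar>c\<bar> = 1" for c :: real
    proof -
      have "((\<lambda>s. c * (s - t)) \<longlongrightarrow> c * (t - t)) (at t within I)" by (intro tendsto_intros)
      then show ?thesis
        unfolding filterlim_at using eventually_at_neq[of t I] that
        by (auto elim!: eventually_mono)
    qed
    have "L2_null (at t within I) (\<lambda>s x. (prim h1 (x + t + 1 * (s - t)) - prim h1 (x + t)) / (1 * (s - t)) - h1 (x + t))"
      by (rule L2_null_shift[OF L2_null_compose[OF L2_null_prim_quotient(1)[OF h(1) i(1)] lim[of 1]]]) simp
    moreover have "L2_null (at t within I)
      (\<lambda>s x. (prim h2 (x + (- t) + (- 1) * (s - t)) - prim h2 (x + (- t))) / ((- 1) * (s - t)) - h2 (x + (- t)))"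
      by (rule L2_null_shift[OF L2_null_compose[OF L2_null_prim_quotient(1)[OF h(2) i(2)] lim[of "-1"]]]) simp
    ultimately have "L2_null (at t within I) (\<lambda>s x.
       ((prim h1 (x + t + 1 * (s - t)) - prim h1 (x + t)) / (1 * (s - t)) - h1 (x + t))
       + (-1) * ((prim h2 (x + (- t) + (- 1) * (s - t)) - prim h2 (x + (- t))) / ((- 1) * (s - t)) - h2 (x + (- t))))"
      by (intro L2_null_add L2_null_scale[OF _ tendsto_const])
    then show "L2_null (at t within I) (\<lambda>s x. (prim h1 (x + s) + prim h2 (x - s) - (prim h1 (x + t) + prim h2 (x - t))) / (s - t)
       - (h1 (x + t) - h2 (x - t)))"
    proof (rule L2_null_cong)
      show "eventually (\<lambda>s. \<forall>x. ((prim h1 (x + t + 1 * (s - t)) - prim h1 (x + t)) / (1 * (s - t)) - h1 (x + t))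
       + (-1) * ((prim h2 (x + (- t) + (- 1) * (s - t)) - prim h2 (x + (- t))) / ((- 1) * (s - t)) - h2 (x + (- t)))
       = (prim h1 (x + s) + prim h2 (x - s) - (prim h1 (x + t) + prim h2 (x - t))) / (s - t)
       - (h1 (x + t) - h2 (x - t))) (at t within I)"
        using eventually_at_neq
      proof eventually_elim
        case (elim s)
        have e: "x + t + 1 * (s - t) = x + s" "x + (- t) + (- 1) * (s - t) = x - s" for x by auto
        show ?case unfolding e quotient_combine by (simp add: algebra_simps)
      qed
    qed
  qed
qed

lemma L2_null_dominated:
  fixes f :: "real \<Rightarrow> real \<Rightarrow> real"
  assumes meas: "eventually (\<lambda>s. f s \<in> borel_measurable borel) (at t within I)"
    and bd: "eventually (\<lambda>s. \<forall>x. \<bar>f s x\<bar> \<le> B * indicator {-M..M} x) (at t within I)"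
    and lim: "\<And>x. ((\<lambda>s. f s x) \<longlongrightarrow> 0) (at t within I)"
  shows "L2_null (at t within I) f"
  unfolding L2_null_def
proof
  have b2: "eventually (\<lambda>s. \<forall>x. \<bar>(f s x)\<^sup>2\<bar> \<le> B\<^sup>2 * indicator {-M..M} x) (at t within I)"
    using bd
  proof eventually_elim
    case (elim s)
    show ?case
    proof
      fix x
      have "\<bar>f s x\<bar>\<^sup>2 \<le> (B * indicator {-M..M} x)\<^sup>2" using elim[rule_format, of x] by (intro power_mono) auto
      then show "\<bar>(f s x)\<^sup>2\<bar> \<le> B\<^sup>2 * indicator {-M..M} x" by (auto simp: indicator_def)
    qed
  qed
  have iB: "integrable lborel (\<lambda>x. B\<^sup>2 * indicator {-M..M} x)" using integrable_indicator_Icc by simp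
  show "eventually (\<lambda>s. sqint (f s)) (at t within I)"
    using meas b2
  proof eventually_elim
    case (elim s)
    then show ?case unfolding sqint_def
      by (intro conjI Bochner_Integration.integrable_bound[OF iB]) (auto intro!: AE_I2 order_trans[OF _ abs_ge_self])
  qed
  have "((\<lambda>s. LINT x|lborel. (f s x)\<^sup>2) \<longlongrightarrow> (LINT x::real|lborel. (0::real))) (at t within I)"
  proof (rule dominated_convergence_at[OF _ iB])
    show "eventually (\<lambda>s. (\<lambda>x. (f s x)\<^sup>2) \<in> borel_measurable lborel) (at t within I)"
      using meas by eventually_elim simp
    show "eventually (\<lambda>s. AE x in lborel. \<bar>(f s x)\<^sup>2\<bar> \<le> B\<^sup>2 * indicator {-M..M} x) (at t within I)"
      using b2 by eventually_elim simp
    show "AE x in lborel. ((\<lambda>s. (f s x)\<^sup>2) \<longlongrightarrow> 0) (at t within I)"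
      using tendsto_power[OF lim, of _ 2] by (intro AE_I2) simp
  qed simp
  then show "((\<lambda>s. LINT x|lborel. (f s x)\<^sup>2) \<longlongrightarrow> 0) (at t within I)" by simp
qed

text \<open>
  With compact supports, continuity of a function of two variables gives domination near every time,
  so that pointwise continuity and differentiability imply those in \<open>L\<^sup>2\<close>.
\<close>

lemma compact_support_bound:
  fixes f :: "real \<Rightarrow> real \<Rightarrow> real"
  assumes f: "continuous_on ({0..<T} \<times> UNIV) (\<lambda>(t, x). f t x)"
    and supp: "\<And>t x. t \<in> {0..<T} \<Longrightarrow> \<bar>x\<bar> > M \<Longrightarrow> f t x = 0" and T': "T' < T"
  obtains B where "B \<ge> 0" "\<And>t x. t \<in> {0..T'} \<Longrightarrow> \<bar>f t x\<bar> \<le> B * indicator {-M..M} x"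
proof -
  have "compact ((\<lambda>(t, x). f t x) ` ({0..T'} \<times> {-M..M}))"
    by (intro compact_continuous_image continuous_on_subset[OF f] compact_Times compact_Icc) (use T' in auto)
  then obtain B where B: "\<And>y. y \<in> (\<lambda>(t, x). f t x) ` ({0..T'} \<times> {-M..M}) \<Longrightarrow> \<bar>y\<bar> \<le> B"
    using compact_imp_bounded[THEN iffD1[OF bounded_iff]] by (metis real_norm_def)
  show ?thesis
  proof (rule that[of "max B 0"])
    fix t x assume t: "t \<in> {0..T'}"
    show "\<bar>f t x\<bar> \<le> max B 0 * indicator {-M..M} x"
    proof (cases "x \<in> {-M..M}")
      case True
      then have "\<bar>f t x\<bar> \<le> B" using t by (intro B) (auto intro!: image_eqI[of _ _ "(t, x)"])
      then show ?thesis using True by simp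
    next
      case False
      then have "f t x = 0" using t T' by (intro supp) auto
      then show ?thesis by simp
    qed
  qed simp
qed

lemma continuous_slice:
  assumes "continuous_on (A \<times> UNIV) (\<lambda>(t, x). f t x)" "t \<in> A"
  shows "continuous_on UNIV (f t)"
proof -
  have "continuous_on UNIV (\<lambda>x. (t, x))" by (intro continuous_intros)
  from continuous_on_compose2[OF assms(1) this] show ?thesis using assms(2) by auto
qed

lemma continuous_slice':
  assumes "continuous_on (A \<times> UNIV) (\<lambda>(t, x). f t x)"
  shows "continuous_on A (\<lambda>t. f t x)"
proof -
  have "continuous_on A (\<lambda>t. (t, x))" by (intro continuous_intros)
  from continuous_on_compose2[OF assms this] show ?thesis by auto
qed

lemma eventually_le_within: "t < T' \<Longrightarrow> eventually (\<lambda>s. s \<in> {0..T'}) (at t within {0..<T})" for t T' T :: real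
proof -
  assume "t < T'"
  then have "eventually (\<lambda>s. s < T') (at t within {0..<T})" by (intro order_tendstoD(2)[OF tendsto_ident_at])
  moreover have "eventually (\<lambda>s. s \<in> {0..<T}) (at t within {0..<T})" by (simp add: eventually_at_filter)
  ultimately show ?thesis by eventually_elim auto
qed

lemma L2_cts_classical:
  fixes f :: "real \<Rightarrow> real \<Rightarrow> real"
  assumes f: "continuous_on ({0..<T} \<times> UNIV) (\<lambda>(t, x). f t x)"
    and supp: "\<And>t x. t \<in> {0..<T} \<Longrightarrow> \<bar>x\<bar> > M \<Longrightarrow> f t x = 0"
  shows "L2_cts {0..<T} f"
  unfolding L2_cts_def
proof (intro ballI conjI)
  fix t assume t: "t \<in> {0..<T}"
  define T' where "T' = (t + T) / 2"
  have T': "t < T'" "T' < T" using t by (auto simp: T'_def)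
  obtain B where B: "B \<ge> 0" "\<And>t x. t \<in> {0..T'} \<Longrightarrow> \<bar>f t x\<bar> \<le> B * indicator {-M..M} x"
    using compact_support_bound[OF f supp T'(2)] by blast
  have m: "f s \<in> borel_measurable borel" if "s \<in> {0..<T}" for s
    by (rule borel_measurable_continuous_onI[OF continuous_slice[OF f that]])
  show "sqint (f t)"
  proof (rule sqint_bounded[OF m[OF t], of B M])
    show "\<bar>f t x\<bar> \<le> B" for x using B(2)[of t x] B(1) t T' by (cases "x \<in> {-M..M}") auto
  qed (use supp t in auto)
  show "L2_null (at t within {0..<T}) (\<lambda>s x. f s x - f t x)"
  proof (rule L2_null_dominated)
    show "eventually (\<lambda>s. (\<lambda>x. f s x - f t x) \<in> borel_measurable borel) (at t within {0..<T})"
      unfolding eventually_at_filter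
      by (intro always_eventually allI impI borel_measurable_diff m t)
    show "eventually (\<lambda>s. \<forall>x. \<bar>f s x - f t x\<bar> \<le> (2 * B) * indicator {-M..M} x) (at t within {0..<T})"
      using eventually_le_within[OF T'(1), of T]
    proof eventually_elim
      case (elim s)
      show ?case
      proof
        fix x
        have "\<bar>f s x\<bar> \<le> B * indicator {-M..M} x" "\<bar>f t x\<bar> \<le> B * indicator {-M..M} x"
          using elim t T' by (auto intro!: B)
        then show "\<bar>f s x - f t x\<bar> \<le> (2 * B) * indicator {-M..M} x" by linarith
      qed
    qed
    show "((\<lambda>s. f s x - f t x) \<longlongrightarrow> 0) (at t within {0..<T})" for x
      using continuous_slice'[OF f, of x] t by (simp add: continuous_on_def LIM_zero)
  qed
qed

lemma classical_triple:
  assumes cont: "continuous_on ({0..<T} \<times> UNIV) (\<lambda>(t, x). a t x)" "continuous_on ({0..<T} \<times> UNIV) (\<lambda>(t, x). b t x)"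
    and dx: "\<And>t x. t \<in> {0..<T} \<Longrightarrow> ((\<lambda>x. w t x) has_real_derivative a t x) (at x)"
    and dt: "\<And>t x. t \<in> {0..<T} \<Longrightarrow> ((\<lambda>t. w t x) has_real_derivative b t x) (at t within {0..<T})"
    and supp: "\<And>t x. t \<in> {0..<T} \<Longrightarrow> \<bar>x\<bar> > M \<Longrightarrow> w t x = 0"
      "\<And>t x. t \<in> {0..<T} \<Longrightarrow> \<bar>x\<bar> > M \<Longrightarrow> a t x = 0" "\<And>t x. t \<in> {0..<T} \<Longrightarrow> \<bar>x\<bar> > M \<Longrightarrow> b t x = 0"
  shows "energy_triple {0..<T} w a b"
proof (rule energy_tripleI)
  show "L2_cts {0..<T} a" "L2_cts {0..<T} b"
    by (rule L2_cts_classical[OF cont(1) supp(2)] L2_cts_classical[OF cont(2) supp(3)]; assumption)+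
  have wc: "continuous_on UNIV (w t)" if "t \<in> {0..<T}" for t
    using DERIV_continuous_on[of UNIV "w t" "a t"] dx[OF that] by auto
  have m: "w t \<in> borel_measurable borel" if "t \<in> {0..<T}" for t
    by (rule borel_measurable_continuous_onI[OF wc[OF that]])
  fix t assume t: "t \<in> {0..<T}"
  have wp: "w t x = prim (a t) x" for x
  proof -
    define N where "N = max (\<bar>M\<bar> + 1) \<bar>x\<bar>"
    have N: "- N \<le> x" "- N < - M" "- N < M" by (auto simp: N_def)
    have ac: "continuous_on UNIV (a t)" by (rule continuous_slice[OF cont(1) t])
    have hb: "has_bochner_integral lborel (\<lambda>y. a t y * indicator {-N..x} y) (w t x - w t (- N))"
    proof (rule has_bochner_integral_FTC_Icc_real[OF N(1)])
      show "DERIV (w t) y :> a t y" if "- N \<le> y" "y \<le> x" for y using dx[OF t] by simp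
      show "isCont (a t) y" if "- N \<le> y" "y \<le> x" for y using ac by (simp add: continuous_on_eq_continuous_at)
    qed
    have "w t (- N) = 0" using N by (intro supp(1)[OF t]) auto
    then have "w t x = (LINT y|lborel. a t y * indicator {-N..x} y)"
      using has_bochner_integral_integral_eq[OF hb] by simp
    also have "\<dots> = prim (a t) x"
      unfolding prim_def
    proof (rule Bochner_Integration.integral_cong)
      fix y
      show "a t y * indicator {- N..x} y = indicator {..x} y * a t y"
      proof (cases "y < - N")
        case True
        then have "a t y = 0" using N by (intro supp(2)[OF t]) auto
        then show ?thesis by simp
      qed (auto simp: indicator_def)
    qed simp
    finally show ?thesis .
  qed
  then show "w t x = prim (a t) x" for x .
  have sa: "sqint (a t)" using L2_cts_classical[OF cont(1) supp(2)] t unfolding L2_cts_def by blast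
  show ia: "integrable lborel (a t)" by (rule sqint_integrable[OF sa supp(2)[OF t]])
  show "sqint (w t)"
  proof (rule sqint_bounded[OF m[OF t], of _ M])
    show "\<bar>w t x\<bar> \<le> (LINT y|lborel. \<bar>a t y\<bar>)" for x unfolding wp by (rule prim_bound[OF ia])
  qed (use supp t in auto)
  define T' where "T' = (t + T) / 2"
  have T': "t < T'" "T' < T" using t by (auto simp: T'_def)
  obtain B where B: "B \<ge> 0" "\<And>t x. t \<in> {0..T'} \<Longrightarrow> \<bar>b t x\<bar> \<le> B * indicator {-M..M} x"
    using compact_support_bound[OF cont(2) supp(3) T'(2)] by blast
  show "L2_null (at t within {0..<T}) (\<lambda>s x. (w s x - w t x) / (s - t) - b t x)"
  proof (rule L2_null_dominated)
    have "b t \<in> borel_measurable borel" by (rule borel_measurable_continuous_onI[OF continuous_slice[OF cont(2) t]])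
    then show "eventually (\<lambda>s. (\<lambda>x. (w s x - w t x) / (s - t) - b t x) \<in> borel_measurable borel) (at t within {0..<T})"
      unfolding eventually_at_filter
      by (intro always_eventually allI impI borel_measurable_diff borel_measurable_divide m t) auto
    show "eventually (\<lambda>s. \<forall>x. \<bar>(w s x - w t x) / (s - t) - b t x\<bar> \<le> (2 * B) * indicator {-M..M} x) (at t within {0..<T})"
      using eventually_le_within[OF T'(1), of T] eventually_at_neq
    proof eventually_elim
      case (elim s)
      show ?case
      proof
        fix x
        have bt: "\<bar>b t x\<bar> \<le> B * indicator {-M..M} x" using t T' by (intro B) auto
        have "norm (w s x - w t x) \<le> (B * indicator {-M..M} x) * norm (s - t)"
        proof (rule field_differentiable_bound[where S = "{0..T'}"])
          show "((\<lambda>t. w t x) has_field_derivative b r x) (at r within {0..T'})" if "r \<in> {0..T'}" for r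
            using dt[of r x] that T' by (auto intro: DERIV_subset)
          show "norm (b r x) \<le> B * indicator {-M..M} x" if "r \<in> {0..T'}" for r using B(2)[OF that] by simp
        qed (use elim t T' in auto)
        then have "\<bar>(w s x - w t x) / (s - t)\<bar> \<le> B * indicator {-M..M} x"
          using elim(2) by (simp add: abs_divide pos_divide_le_eq)
        then show "\<bar>(w s x - w t x) / (s - t) - b t x\<bar> \<le> (2 * B) * indicator {-M..M} x" using bt by linarith
      qed
    qed
    show "((\<lambda>s. (w s x - w t x) / (s - t) - b t x) \<longlongrightarrow> 0) (at t within {0..<T})" for x
      using dt[OF t, of x] unfolding has_field_derivative_iff by (simp add: LIM_zero)
  qed
qed

section \<open>Weak derivatives\<close>

lemma test_function_family:
  assumes diff: "\<And>f x. f \<in> S \<Longrightarrow> f differentiable (at x)" and clo: "\<And>f. f \<in> S \<Longrightarrow> deriv f \<in> S"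
    and f: "f \<in> S" and supp: "\<And>x. \<bar>x\<bar> > r \<Longrightarrow> f x = 0"
  shows "test_function f"
proof -
  have "(deriv ^^ n) f \<in> S" for n by (induction n) (auto intro: f clo)
  then show ?thesis unfolding test_function_def using diff supp by blast
qed

lemma test_functionD:
  assumes "test_function \<phi>"
  shows "\<And>x. (\<phi> has_real_derivative deriv \<phi> x) (at x)" "continuous_on UNIV (deriv \<phi>)" "continuous_on UNIV \<phi>"
    "\<exists>r. \<forall>x. \<bar>x\<bar> > r \<longrightarrow> \<phi> x = 0 \<and> deriv \<phi> x = 0"
proof -
  have d: "(deriv ^^ n) \<phi> differentiable (at x)" for n x using assms unfolding test_function_def by blast
  show D: "(\<phi> has_real_derivative deriv \<phi> x) (at x)" for x
    using d[of 0 x] by (simp add: DERIV_deriv_iff_real_differentiable)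
  show "continuous_on UNIV (deriv \<phi>)"
    using d[of 1] by (auto simp: continuous_on_eq_continuous_at differentiable_imp_continuous_within)
  show "continuous_on UNIV \<phi>"
    using D by (auto simp: continuous_on_eq_continuous_at intro: DERIV_isCont)
  obtain r where r: "\<And>x. \<bar>x\<bar> > r \<Longrightarrow> \<phi> x = 0" using assms unfolding test_function_def by blast
  show "\<exists>r. \<forall>x. \<bar>x\<bar> > r \<longrightarrow> \<phi> x = 0 \<and> deriv \<phi> x = 0"
  proof (intro exI[of _ r] allI impI conjI r)
    fix x assume x: "\<bar>x\<bar> > r"
    have "eventually (\<lambda>y. \<bar>y\<bar> > r) (nhds x)"
      using x eventually_nhds_in_open[of "{y. r < \<bar>y\<bar>}" x]
      by (simp add: open_Collect_less continuous_on_rabs)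
    then have "eventually (\<lambda>y. \<phi> y = 0) (nhds x)" by eventually_elim (rule r)
    then have "deriv \<phi> x = deriv (\<lambda>_. 0) x" by (rule deriv_cong_ev) simp
    then show "deriv \<phi> x = 0" by simp
  qed
qed

lemma integrable_cont_support:
  fixes k :: "real \<Rightarrow> real"
  assumes k: "continuous_on UNIV k" and supp: "\<And>x. \<bar>x\<bar> > r \<Longrightarrow> k x = 0"
  shows "\<exists>B. \<forall>x. \<bar>k x\<bar> \<le> B" "sqint k" "integrable lborel k"
proof -
  have "compact (k ` {-r..r})" by (intro compact_continuous_image continuous_on_subset[OF k]) auto
  then obtain B where B: "\<And>x. x \<in> {-r..r} \<Longrightarrow> \<bar>k x\<bar> \<le> B"
    using compact_imp_bounded[THEN iffD1[OF bounded_iff]] by (metis real_norm_def imageI)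
  have b: "\<bar>k x\<bar> \<le> max B 0" for x
    using B[of x] supp[of x] by (cases "\<bar>x\<bar> > r") (auto simp: abs_le_iff not_less intro: max.coboundedI1)
  then show "\<exists>B. \<forall>x. \<bar>k x\<bar> \<le> B" by blast
  show s: "sqint k" by (rule sqint_bounded[OF borel_measurable_continuous_onI[OF k] b supp])
  show "integrable lborel k" by (rule sqint_integrable[OF s supp])
qed

lemma integrable_mult_bounded:
  fixes f g :: "'a \<Rightarrow> real"
  assumes "integrable M f" "g \<in> borel_measurable M" "\<And>x. \<bar>g x\<bar> \<le> B"
  shows "integrable M (\<lambda>x. f x * g x)"
proof (rule Bochner_Integration.integrable_bound)
  show "integrable M (\<lambda>x. B * f x)" using assms by simp
  have "\<bar>f x * g x\<bar> \<le> \<bar>B * f x\<bar>" for x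
    using mult_right_mono[OF assms(3)[of x], of "\<bar>f x\<bar>"] order_trans[OF abs_ge_zero assms(3)[of x]]
    by (simp add: abs_mult mult.commute)
  then show "AE x in M. norm (f x * g x) \<le> norm (B * f x)" by simp
qed (use assms in auto)

text \<open>
  The primitive need not decay at \<open>+\<infinity>\<close> and \<open>h\<close> need not be continuous, so this is Fubini on the half
  plane \<open>y \<le> x\<close>: the inner integral of \<open>deriv \<phi>\<close> over \<open>{y..}\<close> is \<open>- \<phi> y\<close>.
\<close>

lemma prim_by_parts:
  assumes h: "integrable lborel h" and \<phi>: "test_function \<phi>"
  shows "(LINT x|lborel. prim h x * deriv \<phi> x) = - (LINT x|lborel. h x * \<phi> x)"
proof -
  note D = test_functionD[OF \<phi>]
  obtain r where r: "\<And>x. \<bar>x\<bar> > r \<Longrightarrow> \<phi> x = 0" "\<And>x. \<bar>x\<bar> > r \<Longrightarrow> deriv \<phi> x = 0" using D(4) by blast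
  have d\<phi>: "integrable lborel (deriv \<phi>)" by (rule integrable_cont_support(3)[OF D(2) r(2)])
  note [measurable] = borel_measurable_integrable[OF h] borel_measurable_continuous_onI[OF D(2)]
  have int: "integrable (lborel \<Otimes>\<^sub>M lborel) (\<lambda>(x, y). indicator {..x} y * h y * deriv \<phi> x)"
  proof (rule lborel_pair.Fubini_integrable)
    have [measurable]: "h \<in> borel_measurable borel" using borel_measurable_integrable[OF h] by simp
    have "(\<lambda>(x, y). indicator {..x} y * h y * deriv \<phi> x) = (\<lambda>(x, y). if y \<le> x then h y * deriv \<phi> x else 0)"
      by (auto simp: indicator_def)
    then show "(\<lambda>(x, y). indicator {..x} y * h y * deriv \<phi> x) \<in> borel_measurable (lborel \<Otimes>\<^sub>M lborel)"
      by simp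
    have i: "integrable lborel (\<lambda>y. indicator {..x} y * h y)" for x by (rule integrable_ind[OF h]) simp
    show "AE x in lborel. integrable lborel (\<lambda>y. case (x, y) of (x, y) \<Rightarrow> indicator {..x} y * h y * deriv \<phi> x)"
      using i by (intro AE_I2) simp
    have eq: "(LINT y|lborel. norm (case (x, y) of (x, y) \<Rightarrow> indicator {..x} y * h y * deriv \<phi> x))
       = deriv \<phi> x * (sgn (deriv \<phi> x) * prim (\<lambda>y. \<bar>h y\<bar>) x)" for x
    proof -
      have "(LINT y|lborel. norm (case (x, y) of (x, y) \<Rightarrow> indicator {..x} y * h y * deriv \<phi> x))
        = (LINT y|lborel. \<bar>deriv \<phi> x\<bar> * (indicator {..x} y * \<bar>h y\<bar>))"
        by (intro Bochner_Integration.integral_cong) (auto simp: abs_mult indicator_def)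
      also have "\<dots> = \<bar>deriv \<phi> x\<bar> * prim (\<lambda>y. \<bar>h y\<bar>) x" unfolding prim_def by simp
      finally show ?thesis by (simp add: abs_sgn[of "deriv \<phi> x"] mult.assoc)
    qed
    have ia: "integrable lborel (\<lambda>y. \<bar>h y\<bar>)" using h by simp
    show "integrable lborel (\<lambda>x. LINT y|lborel. norm (case (x, y) of (x, y) \<Rightarrow> indicator {..x} y * h y * deriv \<phi> x))"
      unfolding eq
    proof (rule integrable_mult_bounded[OF d\<phi>])
      have [measurable]: "prim (\<lambda>y. \<bar>h y\<bar>) \<in> borel_measurable borel"
        by (rule borel_measurable_continuous_onI[OF prim_continuous[OF ia]])
      show "(\<lambda>x. sgn (deriv \<phi> x) * prim (\<lambda>y. \<bar>h y\<bar>) x) \<in> borel_measurable lborel"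
        unfolding sgn_if by measurable
      show "\<bar>sgn (deriv \<phi> x) * prim (\<lambda>y. \<bar>h y\<bar>) x\<bar> \<le> (LINT y|lborel. \<bar>\<bar>h y\<bar>\<bar>)" for x
        using prim_bound[OF ia, of x] by (auto simp: sgn_if abs_mult)
    qed
  qed
  have "(LINT x|lborel. prim h x * deriv \<phi> x) = (LINT x|lborel. (LINT y|lborel. indicator {..x} y * h y * deriv \<phi> x))"
    unfolding prim_def by simp
  also have "\<dots> = (LINT y|lborel. (LINT x|lborel. indicator {..x} y * h y * deriv \<phi> x))"
    by (rule lborel_pair.Fubini_integral[symmetric]) (rule int)
  also have "\<dots> = (LINT y|lborel. h y * (- \<phi> y))"
  proof (rule Bochner_Integration.integral_cong)
    fix y :: real
    define N where "N = max y (\<bar>r\<bar> + 1)"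
    have hb: "has_bochner_integral lborel (\<lambda>x. deriv \<phi> x * indicator {y..N} x) (\<phi> N - \<phi> y)"
    proof (rule has_bochner_integral_FTC_Icc_real)
      show "isCont (deriv \<phi>) x" for x using D(2) by (simp add: continuous_on_eq_continuous_at)
    qed (use D(1) in \<open>auto simp: N_def\<close>)
    have "(LINT x|lborel. indicator {..x} y * h y * deriv \<phi> x) = (LINT x|lborel. h y * (deriv \<phi> x * indicator {y..N} x))"
    proof (rule Bochner_Integration.integral_cong)
      fix x
      show "indicator {..x} y * h y * deriv \<phi> x = h y * (deriv \<phi> x * indicator {y..N} x)"
        using r(2)[of x] by (cases "x > N") (auto simp: indicator_def N_def)
    qed simp
    also have "\<dots> = h y * (\<phi> N - \<phi> y)" using has_bochner_integral_integral_eq[OF hb] by simp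
    also have "\<phi> N = 0" using r(1)[of N] by (auto simp: N_def)
    finally show "(LINT x|lborel. indicator {..x} y * h y * deriv \<phi> x) = h y * (- \<phi> y)" by simp
  qed simp
  finally show ?thesis by simp
qed

subsection \<open>Bump functions\<close>

text \<open>
  The family is closed under differentiation: each derivative changes the polynomial and raises the
  power of the denominator by two. Hence smoothness of all members reduces to one differentiation.
  The parameter \<open>\<alpha>\<close> is there to be sent to \<open>0\<close>, where the bumps tend to the indicator of the interval.
\<close>

definition bump :: "real \<Rightarrow> real \<Rightarrow> real \<Rightarrow> real poly \<Rightarrow> nat \<Rightarrow> real \<Rightarrow> real" where
  "bump \<alpha> a b P m x = (if a < x \<and> x < b
     then poly P x / ((x - a) * (b - x)) ^ m * exp (- \<alpha> / ((x - a) * (b - x))) else 0)"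

lemma exp_minus_inverse_le:
  fixes \<alpha> w :: real
  assumes "\<alpha> > 0" "w > 0"
  shows "exp (- \<alpha> / w) \<le> fact n / \<alpha> ^ n * w ^ n"
proof -
  have "(\<alpha> / w) ^ n / fact n \<le> exp (\<alpha> / w)"
  proof -
    have "(\<alpha> / w) ^ n / fact n = (\<Sum>k\<in>{n}. (\<alpha> / w) ^ k / fact k)" by simp
    also have "\<dots> \<le> (\<Sum>k. (\<alpha> / w) ^ k / fact k)"
      by (intro sum_le_suminf) (use summable_exp[of "\<alpha> / w"] assms in \<open>auto simp: field_simps\<close>)
    also have "\<dots> = exp (\<alpha> / w)" by (simp add: exp_def divide_inverse mult.commute)
    finally show ?thesis .
  qed
  then have "inverse (exp (\<alpha> / w)) \<le> inverse ((\<alpha> / w) ^ n / fact n)"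
    by (rule le_imp_inverse_le) (use assms in simp)
  moreover have "exp (- \<alpha> / w) = inverse (exp (\<alpha> / w))" by (simp add: exp_minus)
  moreover have "inverse ((\<alpha> / w) ^ n / fact n) = fact n / \<alpha> ^ n * w ^ n"
    using assms by (simp add: power_divide field_simps)
  ultimately show ?thesis by simp
qed

text \<open>
  The exponential beats every power of the distance to the end points; the quadratic bound is what is
  needed for the derivative to exist and vanish there.
\<close>

lemma bump_bound:
  assumes ab: "a < b" and \<alpha>: "\<alpha> > 0"
  shows "\<exists>C. \<forall>x. \<bar>bump \<alpha> a b P m x\<bar> \<le> C * (x - a)\<^sup>2 \<and> \<bar>bump \<alpha> a b P m x\<bar> \<le> C * (x - b)\<^sup>2"
proof -
  have "compact (poly P ` {a..b})" by (intro compact_continuous_image continuous_intros) auto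
  then obtain K where K: "\<And>x. x \<in> {a..b} \<Longrightarrow> \<bar>poly P x\<bar> \<le> K"
    using compact_imp_bounded[THEN iffD1[OF bounded_iff]] by (metis real_norm_def imageI)
  have K0: "K \<ge> 0" using K[of a] ab by (auto intro: order_trans[OF abs_ge_zero])
  define C0 where "C0 = K * (fact (m + 2) / \<alpha> ^ (m + 2))"
  have C0: "C0 \<ge> 0" using K0 \<alpha> by (simp add: C0_def)
  have 1: "\<bar>bump \<alpha> a b P m x\<bar> \<le> C0 * ((x - a) * (b - x))\<^sup>2" for x
  proof (cases "a < x \<and> x < b")
    case True
    define w where "w = (x - a) * (b - x)"
    have w: "w > 0" using True by (simp add: w_def)
    have "\<bar>bump \<alpha> a b P m x\<bar> = \<bar>poly P x\<bar> * (exp (- \<alpha> / w) / w ^ m)"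
      using True w unfolding bump_def w_def[symmetric] by (simp add: abs_mult)
    also have "\<dots> \<le> K * (fact (m + 2) / \<alpha> ^ (m + 2) * w ^ (m + 2) / w ^ m)"
      using K[of x] True w exp_minus_inverse_le[OF \<alpha> w, of "m + 2"] K0
      by (intro mult_mono divide_right_mono) auto
    also have "\<dots> = C0 * w\<^sup>2" using w by (simp add: C0_def power_add power2_eq_square)
    finally show ?thesis by (simp add: w_def)
  next
    case False
    then show ?thesis using C0 by (auto simp: bump_def)
  qed
  have 2: "\<bar>bump \<alpha> a b P m x\<bar> \<le> (C0 * (b - a)\<^sup>2) * (x - a)\<^sup>2 \<and> \<bar>bump \<alpha> a b P m x\<bar> \<le> (C0 * (b - a)\<^sup>2) * (x - b)\<^sup>2" for x
  proof (cases "a < x \<and> x < b")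
    case True
    then have le: "(b - x)\<^sup>2 \<le> (b - a)\<^sup>2" "(x - a)\<^sup>2 \<le> (b - a)\<^sup>2" by (auto intro!: power_mono)
    have "C0 * ((x - a) * (b - x))\<^sup>2 \<le> (C0 * (b - a)\<^sup>2) * (x - a)\<^sup>2"
      using mult_left_mono[OF le(1), of "C0 * (x - a)\<^sup>2"] C0 by (simp add: power_mult_distrib mult_ac)
    moreover have "C0 * ((x - a) * (b - x))\<^sup>2 \<le> (C0 * (b - a)\<^sup>2) * (x - b)\<^sup>2"
      using mult_left_mono[OF le(2), of "C0 * (x - b)\<^sup>2"] C0 by (simp add: power_mult_distrib power2_commute[of x b] mult_ac)
    ultimately show ?thesis using 1[of x] by linarith
  next
    case False
    then show ?thesis using C0 by (auto simp: bump_def)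
  qed
  then show ?thesis by blast
qed

lemma quadratic_zero_deriv:
  fixes f :: "real \<Rightarrow> real"
  assumes "\<And>y. \<bar>f y\<bar> \<le> C * (y - x)\<^sup>2"
  shows "(f has_real_derivative 0) (at x)"
proof -
  have f0: "f x = 0" using assms[of x] by simp
  have "((\<lambda>y. (f y - f x) / (y - x)) \<longlongrightarrow> 0) (at x)"
  proof (rule Lim_null_comparison)
    show "eventually (\<lambda>y. norm ((f y - f x) / (y - x)) \<le> C * \<bar>y - x\<bar>) (at x)"
      using eventually_at_neq
    proof eventually_elim
      case (elim y)
      then have "\<bar>f y\<bar> \<le> (C * \<bar>y - x\<bar>) * \<bar>y - x\<bar>"
        using assms[of y] by (simp add: power2_eq_square[of "y - x"] mult.assoc abs_mult[symmetric])
      then show ?case using elim f0 by (simp add: abs_divide pos_divide_le_eq)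
    qed
    have "((\<lambda>y. C * \<bar>y - x\<bar>) \<longlongrightarrow> C * \<bar>x - x\<bar>) (at x)" by (intro tendsto_intros)
    then show "((\<lambda>y. C * \<bar>y - x\<bar>) \<longlongrightarrow> 0) (at x)" by simp
  qed
  then show ?thesis by (simp add: has_field_derivative_iff)
qed

lemma bump_derivative_algebra:
  fixes w :: real
  assumes w: "w > 0"
  shows "(p' * w ^ m - p * (c * w' * w ^ m / w)) / (w ^ m * w ^ m) * E + E * (\<alpha> * w' / (w * w)) * (p / w ^ m)
    = (p' * w\<^sup>2 - c * (p * w' * w) + \<alpha> * (p * w')) / w ^ (m + 2) * E"
proof -
  define z where "z = w ^ m"
  have z: "z > 0" using w by (simp add: z_def)
  have "(p' * z - p * (c * w' * z / w)) / (z * z) * E + E * (\<alpha> * w' / (w * w)) * (p / z)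
    = (p' * w\<^sup>2 - c * (p * w' * w) + \<alpha> * (p * w')) / (z * w\<^sup>2) * E"
    using w z by (simp add: field_simps power2_eq_square)
  then show ?thesis by (simp only: z_def power_add)
qed

lemma bump_has_derivative:
  assumes ab: "a < b" and \<alpha>: "\<alpha> > 0"
  shows "\<exists>Q. \<forall>x. (bump \<alpha> a b P m has_real_derivative bump \<alpha> a b Q (m + 2) x) (at x)"
proof -
  define W where "W = [: - (a * b), a + b, - 1 :]"
  define W' where "W' = [: a + b, - 2 :]"
  define Q where "Q = pderiv P * W ^ 2 - smult (real m) (P * W' * W) + smult \<alpha> (P * W')"
  have W: "poly W x = (x - a) * (b - x)" "poly W' x = a + b - 2 * x" for x
    by (auto simp: W_def W'_def algebra_simps)
  show ?thesis
  proof (intro exI[of _ Q] allI)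
    fix x
    consider "a < x \<and> x < b" | "x < a" | "b < x" | "x = a" | "x = b" by linarith
    then show "(bump \<alpha> a b P m has_real_derivative bump \<alpha> a b Q (m + 2) x) (at x)"
    proof cases
      case 1
      define w where "w = (x - a) * (b - x)"
      have w: "w > 0" using 1 by (simp add: w_def)
      define w' where "w' = a + b - 2 * x"
      have dw: "((\<lambda>y. (y - a) * (b - y)) has_real_derivative w') (at x)"
        unfolding w'_def by (auto intro!: derivative_eq_intros)
      have d1: "((\<lambda>y. poly P y / ((y - a) * (b - y)) ^ m) has_real_derivative
          (poly (pderiv P) x * w ^ m - poly P x * (real m * (w' * w ^ (m - Suc 0)))) / (w ^ m * w ^ m)) (at x)"
        using DERIV_divide[OF poly_DERIV[of P x] DERIV_power[OF dw, of m]] 1 by (auto simp: w_def)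
      have d2: "((\<lambda>y. exp (- \<alpha> / ((y - a) * (b - y)))) has_real_derivative
          exp (- \<alpha> / w) * (\<alpha> * w' / (w * w))) (at x)"
        using DERIV_fun_exp[OF DERIV_divide[OF DERIV_const[of "- \<alpha>"] dw]] 1 by (auto simp: w_def)
      have "((\<lambda>y. poly P y / ((y - a) * (b - y)) ^ m * exp (- \<alpha> / ((y - a) * (b - y)))) has_real_derivative
         bump \<alpha> a b Q (m + 2) x) (at x)"
      proof (rule DERIV_cong[OF DERIV_mult[OF d1 d2]])
        have m1: "real m * (w' * w ^ (m - Suc 0)) = real m * w' * w ^ m / w" using w by (cases m) auto
        have "bump \<alpha> a b Q (m + 2) x = (poly (pderiv P) x * w\<^sup>2 - real m * (poly P x * w' * w) + \<alpha> * (poly P x * w')) / w ^ (m + 2) * exp (- \<alpha> / w)"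
          using 1 unfolding bump_def Q_def by (simp add: W w_def w'_def)
        then show "(poly (pderiv P) x * w ^ m - poly P x * (real m * (w' * w ^ (m - Suc 0)))) / (w ^ m * w ^ m)
            * exp (- \<alpha> / ((x - a) * (b - x))) + exp (- \<alpha> / w) * (\<alpha> * w' / (w * w)) * (poly P x / ((x - a) * (b - x)) ^ m)
            = bump \<alpha> a b Q (m + 2) x"
          unfolding m1 w_def[symmetric] bump_derivative_algebra[OF w] by simp
      qed
      then show ?thesis
      proof (rule has_field_derivative_transform_within_open[of _ _ _ "{a<..<b}"])
        show "poly P y / ((y - a) * (b - y)) ^ m * exp (- \<alpha> / ((y - a) * (b - y))) = bump \<alpha> a b P m y"
          if "y \<in> {a<..<b}" for y using that by (simp add: bump_def)
      qed (use 1 in auto)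
    next
      case 2
      have "((\<lambda>_. 0) has_real_derivative 0) (at x)" by simp
      then have "(bump \<alpha> a b P m has_real_derivative 0) (at x)"
        by (rule has_field_derivative_transform_within_open[of _ _ _ "{..<a}"]) (use 2 in \<open>auto simp: bump_def\<close>)
      then show ?thesis using 2 by (simp add: bump_def)
    next
      case 3
      have "((\<lambda>_. 0) has_real_derivative 0) (at x)" by simp
      then have "(bump \<alpha> a b P m has_real_derivative 0) (at x)"
        by (rule has_field_derivative_transform_within_open[of _ _ _ "{b<..}"]) (use 3 in \<open>auto simp: bump_def\<close>)
      then show ?thesis using 3 by (simp add: bump_def)
    next
      case 4
      then have "(bump \<alpha> a b P m has_real_derivative 0) (at x)"
        using bump_bound[OF ab \<alpha>, of P m] quadratic_zero_deriv by blast
      then show ?thesis using 4 by (simp add: bump_def)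
    next
      case 5
      then have "(bump \<alpha> a b P m has_real_derivative 0) (at x)"
        using bump_bound[OF ab \<alpha>, of P m] quadratic_zero_deriv by blast
      then show ?thesis using 5 by (simp add: bump_def)
    qed
  qed
qed

abbreviation bump1 :: "real \<Rightarrow> real \<Rightarrow> real \<Rightarrow> real \<Rightarrow> real" where
  "bump1 \<alpha> a b \<equiv> bump \<alpha> a b 1 0"

lemma bump1_range: "\<alpha> > 0 \<Longrightarrow> \<bar>bump1 \<alpha> a b x\<bar> \<le> 1"
proof -
  assume "\<alpha> > 0"
  then have "- \<alpha> / ((x - a) * (b - x)) \<le> 0" if "a < x" "x < b"
    using that by (intro divide_nonpos_pos) auto
  then show ?thesis unfolding bump_def by simp
qed

lemma bump_support: "\<bar>x\<bar> > max \<bar>a\<bar> \<bar>b\<bar> \<Longrightarrow> bump \<alpha> a b P m x = 0"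
  by (auto simp: bump_def)

lemma bump_continuous: "a < b \<Longrightarrow> \<alpha> > 0 \<Longrightarrow> continuous_on UNIV (bump \<alpha> a b P m)"
  using bump_has_derivative[of a b \<alpha> P m] DERIV_isCont[of "bump \<alpha> a b P m"]
  by (auto intro!: continuous_at_imp_continuous_on)

lemma bump_deriv:
  assumes "a < b" "\<alpha> > 0"
  obtains Q where "deriv (bump \<alpha> a b P m) = bump \<alpha> a b Q (m + 2)"
    "\<And>x. bump \<alpha> a b P m differentiable (at x)"
    "\<And>x. (bump \<alpha> a b P m has_real_derivative bump \<alpha> a b Q (m + 2) x) (at x)"
proof -
  obtain Q where Q: "\<And>x. (bump \<alpha> a b P m has_real_derivative bump \<alpha> a b Q (m + 2) x) (at x)"
    using bump_has_derivative[OF assms] by blast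
  show ?thesis
  proof (rule that[of Q])
    show "deriv (bump \<alpha> a b P m) = bump \<alpha> a b Q (m + 2)"
      by (rule ext) (rule DERIV_imp_deriv[OF Q])
    show "bump \<alpha> a b P m differentiable (at x)" for x
      using Q[of x] unfolding real_differentiable_def by blast
  qed (rule Q)
qed

lemma bump_test_function:
  assumes "a < b" "\<alpha> > 0"
  shows "test_function (bump \<alpha> a b P m)"
proof (rule test_function_family[where S = "{bump \<alpha> a b P m |P m. True}" and r = "max \<bar>a\<bar> \<bar>b\<bar>"])
  fix f x assume "f \<in> {bump \<alpha> a b P m |P m. True}"
  then obtain P m where f: "f = bump \<alpha> a b P m" by auto
  show "f differentiable (at x)" unfolding f by (rule bump_deriv[OF assms, of P m])
next
  fix f assume "f \<in> {bump \<alpha> a b P m |P m. True}"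
  then obtain P m where f: "f = bump \<alpha> a b P m" by auto
  obtain Q where "deriv (bump \<alpha> a b P m) = bump \<alpha> a b Q (m + 2)" by (rule bump_deriv[OF assms])
  then show "deriv f \<in> {bump \<alpha> a b P m |P m. True}" unfolding f by auto
next
  show "bump \<alpha> a b P m \<in> {bump \<alpha> a b P m |P m. True}" by blast
qed (rule bump_support)

lemma DERIV_diff_shift:
  fixes f :: "real \<Rightarrow> real"
  assumes "\<And>x. (f has_real_derivative f' x) (at x)"
  shows "((\<lambda>x. f x - f (x - c)) has_real_derivative (f' x - f' (x - c))) (at x)"
  using DERIV_diff[OF assms[of x] DERIV_shift[of f "f' (x - c)" x "- c", THEN iffD1]] assms[of "x - c"] by simp

lemma prim_has_derivative:
  assumes h: "continuous_on UNIV h" and supp: "\<And>x. \<bar>x\<bar> > R \<Longrightarrow> h x = 0"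
  shows "(prim h has_real_derivative h x) (at x)"
proof -
  have i: "integrable lborel h" by (rule integrable_cont_support(3)[OF h supp])
  define l where "l = min (- \<bar>R\<bar>) x - 1"
  have eq: "prim h y = integral {l..y} h" if "y > l" for y
  proof -
    have "prim h y = (LINT z|lborel. indicator {l..y} z *\<^sub>R h z)"
      unfolding prim_def
    proof (intro Bochner_Integration.integral_cong)
      fix z
      show "indicator {..y} z * h z = indicator {l..y} z *\<^sub>R h z"
        using supp[of z] by (cases "z < l") (auto simp: indicator_def l_def)
    qed simp
    also have "\<dots> = integral {l..y} h"
      using set_borel_integral_eq_integral(2)[of "{l..y}" h] integrable_mult_indicator[OF _ i, of "{l..y}"]
      by (simp add: set_integrable_def set_lebesgue_integral_def)
    finally show ?thesis .
  qed
  have "((\<lambda>y. integral {l..y} h) has_real_derivative h x) (at x within {l..x + 1})"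
    by (rule integral_has_real_derivative) (auto intro: continuous_on_subset[OF h] simp: l_def)
  then have "((\<lambda>y. integral {l..y} h) has_real_derivative h x) (at x)"
    by (subst (asm) at_within_interior[of x "{l..x + 1}"]) (auto simp: l_def interior_atLeastAtMost_real)
  then show ?thesis
    by (rule has_field_derivative_transform_within_open[of _ _ _ "{l<..}"]) (auto simp: eq l_def)
qed

text \<open>
  A bump is not the derivative of a test function, because its integral is positive; but the difference
  of two translates has integral \<open>0\<close>, hence a primitive of compact support.
\<close>

lemma bump_difference_antiderivative:
  assumes ab: "a < b" and \<alpha>: "\<alpha> > 0"
  shows "\<exists>\<phi>. test_function \<phi> \<and> deriv \<phi> = (\<lambda>x. bump1 \<alpha> a b x - bump1 \<alpha> a b (x - c))"
proof -
  let ?\<psi> = "bump1 \<alpha> a b"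
  define \<phi> where "\<phi> x = prim ?\<psi> x - prim ?\<psi> (x - c)" for x
  have i: "integrable lborel ?\<psi>"
    by (rule integrable_cont_support(3)[OF bump_continuous[OF ab \<alpha>] bump_support])
  have dp: "(prim ?\<psi> has_real_derivative ?\<psi> x) (at x)" for x
    by (rule prim_has_derivative[OF bump_continuous[OF ab \<alpha>] bump_support])
  have d\<phi>: "(\<phi> has_real_derivative (?\<psi> x - ?\<psi> (x - c))) (at x)" for x
    unfolding \<phi>_def[abs_def] by (rule DERIV_diff_shift[OF dp])
  let ?S = "insert \<phi> {\<lambda>x. bump \<alpha> a b P m x - bump \<alpha> a b P m (x - c) |P m. True}"
  have derivs: "\<exists>Q n. deriv (\<lambda>x. bump \<alpha> a b P m x - bump \<alpha> a b P m (x - c)) = (\<lambda>x. bump \<alpha> a b Q n x - bump \<alpha> a b Q n (x - c))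
     \<and> (\<forall>x. (\<lambda>x. bump \<alpha> a b P m x - bump \<alpha> a b P m (x - c)) differentiable (at x))" for P m
  proof -
    obtain Q where Q: "\<And>x. (bump \<alpha> a b P m has_real_derivative bump \<alpha> a b Q (m + 2) x) (at x)"
      using bump_has_derivative[OF ab \<alpha>] by blast
    have "((\<lambda>x. bump \<alpha> a b P m x - bump \<alpha> a b P m (x - c)) has_real_derivative
       (bump \<alpha> a b Q (m + 2) x - bump \<alpha> a b Q (m + 2) (x - c))) (at x)" for x
      by (rule DERIV_diff_shift[OF Q])
    then show ?thesis by (intro exI[of _ Q] exI[of _ "m + 2"]) (auto intro: DERIV_imp_deriv simp: real_differentiable_def)
  qed
  have "test_function \<phi>"
  proof (rule test_function_family[where S = ?S])
    show "f differentiable (at x)" if "f \<in> ?S" for f x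
    proof -
      consider "f = \<phi>" | P m where "f = (\<lambda>x. bump \<alpha> a b P m x - bump \<alpha> a b P m (x - c))"
        using \<open>f \<in> ?S\<close> by blast
      then show ?thesis
      proof cases
        case 1
        then show ?thesis using d\<phi>[of x] unfolding real_differentiable_def by blast
      next
        case 2
        then show ?thesis using derivs[of P m] by blast
      qed
    qed
    show "deriv f \<in> ?S" if "f \<in> ?S" for f
    proof -
      have e: "deriv \<phi> = (\<lambda>x. ?\<psi> x - ?\<psi> (x - c))" using d\<phi> by (auto intro: DERIV_imp_deriv)
      consider "f = \<phi>" | P m where "f = (\<lambda>x. bump \<alpha> a b P m x - bump \<alpha> a b P m (x - c))"
        using \<open>f \<in> ?S\<close> by blast
      then show ?thesis
      proof cases
        case 1
        show ?thesis unfolding 1 e by blast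
      next
        case 2
        then show ?thesis using derivs[of P m] by blast
      qed
    qed
    fix x :: real assume x: "\<bar>x\<bar> > max \<bar>a\<bar> \<bar>b\<bar> + \<bar>c\<bar>"
    have p0: "prim ?\<psi> y = 0" if "y < - max \<bar>a\<bar> \<bar>b\<bar>" for y
      using that by (intro prim_eq_0[of "max \<bar>a\<bar> \<bar>b\<bar>"] bump_support) auto
    have p1: "prim ?\<psi> y = (LINT x|lborel. ?\<psi> x)" if "y \<ge> max \<bar>a\<bar> \<bar>b\<bar>" for y
      using that by (intro prim_eq_total[of "max \<bar>a\<bar> \<bar>b\<bar>"] bump_support) auto
    show "\<phi> x = 0"
    proof (cases "x > 0")
      case True
      then have "x \<ge> max \<bar>a\<bar> \<bar>b\<bar>" "x - c \<ge> max \<bar>a\<bar> \<bar>b\<bar>"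
        using x abs_ge_self[of c] abs_ge_zero[of c] by linarith+
      then show ?thesis using p1[of x] p1[of "x - c"] by (simp only: \<phi>_def)
    next
      case False
      then have "x < - max \<bar>a\<bar> \<bar>b\<bar>" "x - c < - max \<bar>a\<bar> \<bar>b\<bar>"
        using x abs_ge_minus_self[of c] abs_ge_zero[of c] by linarith+
      then show ?thesis using p0[of x] p0[of "x - c"] by (simp only: \<phi>_def)
    qed
  qed auto
  moreover have "deriv \<phi> = (\<lambda>x. ?\<psi> x - ?\<psi> (x - c))" using d\<phi> by (auto intro: DERIV_imp_deriv)
  ultimately show ?thesis by blast
qed

text \<open>
  Letting \<open>\<alpha>\<close> tend to \<open>0\<close> turns the hypothesis into vanishing integrals over all subintervals, so the
  primitive of \<open>h\<close> on \<open>{c..d}\<close> is constant.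
\<close>

lemma bumps_detect_zero:
  assumes h: "h \<in> borel_measurable borel" "sqint (\<lambda>x. indicator {c..d} x * h x)"
    and orth: "\<And>a b \<alpha>. c \<le> a \<Longrightarrow> a < b \<Longrightarrow> b \<le> d \<Longrightarrow> \<alpha> > 0 \<Longrightarrow> (LINT x|lborel. h x * bump1 \<alpha> a b x) = 0"
  shows "AE x in lborel. x \<in> {c..d} \<longrightarrow> h x = 0"
proof -
  note [measurable] = h(1)
  define H where "H x = indicator {c..d} x * h x" for x
  have H: "sqint H" using h(2) by (simp add: H_def[abs_def])
  have iH: "integrable lborel H"
    by (rule sqint_integrable[OF H, of "max \<bar>c\<bar> \<bar>d\<bar>"]) (auto simp: H_def indicator_def)
  note [measurable] = sqintD(1)[OF H]
  have z: "(LINT x|lborel. indicator {a<..<b} x * H x) = 0" if ab: "c \<le> a" "a < b" "b \<le> d" for a b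
  proof -
    have "(\<lambda>n. LINT x|lborel. H x * bump1 (1 / real (Suc n)) a b x) \<longlonglongrightarrow> (LINT x|lborel. indicator {a<..<b} x * H x)"
    proof (rule integral_dominated_convergence)
      show "integrable lborel (\<lambda>x. \<bar>H x\<bar>)" using iH by simp
      show "(\<lambda>x. H x * bump1 (1 / real (Suc n)) a b x) \<in> borel_measurable lborel" for n
        using borel_measurable_continuous_onI[OF bump_continuous[OF ab(2), of "1 / real (Suc n)"]] by simp
      show "AE x in lborel. norm (H x * bump1 (1 / real (Suc n)) a b x) \<le> \<bar>H x\<bar>" for n
      proof (rule AE_I2)
        fix x
        have "\<bar>bump1 (1 / real (Suc n)) a b x\<bar> \<le> 1" by (rule bump1_range) simp
        then show "norm (H x * bump1 (1 / real (Suc n)) a b x) \<le> \<bar>H x\<bar>"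
          using mult_left_mono[of "\<bar>bump1 (1 / real (Suc n)) a b x\<bar>" 1 "\<bar>H x\<bar>"] by (simp add: abs_mult)
      qed
      show "AE x in lborel. (\<lambda>n. H x * bump1 (1 / real (Suc n)) a b x) \<longlonglongrightarrow> indicator {a<..<b} x * H x"
      proof (rule AE_I2)
        fix x
        show "(\<lambda>n. H x * bump1 (1 / real (Suc n)) a b x) \<longlonglongrightarrow> indicator {a<..<b} x * H x"
        proof (cases "a < x \<and> x < b")
          case True
          have "(\<lambda>n. H x * exp (- (1 / real (Suc n)) / ((x - a) * (b - x)))) \<longlonglongrightarrow> H x * exp (- 0 / ((x - a) * (b - x)))"
            using LIMSEQ_inverse_real_of_nat True by (intro tendsto_intros) (auto simp: inverse_eq_divide)
          then show ?thesis using True by (simp add: bump_def)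
        next
          case False
          then show ?thesis by (auto simp: bump_def indicator_def)
        qed
      qed
    qed measurable
    moreover have "(LINT x|lborel. H x * bump1 (1 / real (Suc n)) a b x) = 0" for n
    proof -
      have "(LINT x|lborel. H x * bump1 (1 / real (Suc n)) a b x) = (LINT x|lborel. h x * bump1 (1 / real (Suc n)) a b x)"
        using ab by (intro Bochner_Integration.integral_cong) (auto simp: H_def indicator_def bump_def)
      then show ?thesis using orth[OF ab, of "1 / real (Suc n)"] by simp
    qed
    ultimately show ?thesis using LIMSEQ_unique[OF _ tendsto_const[of 0]] by simp
  qed
  have "prim H x = 0" for x
  proof (cases "c < x \<and> c < d")
    case True
    have "prim H x = (LINT y|lborel. indicator {c<..<min x d} y * H y)"
      unfolding prim_def
    proof (rule integral_cong_AE)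
      show "AE y in lborel. indicator {..x} y * H y = indicator {c<..<min x d} y * H y"
        using AE_lborel_singleton[of x] AE_lborel_singleton[of c] AE_lborel_singleton[of d]
        by eventually_elim (auto simp: H_def indicator_def)
    qed measurable
    also have "\<dots> = 0" using True by (intro z) auto
    finally show ?thesis .
  next
    case False
    have "prim H x = (LINT y::real|lborel. (0::real))"
      unfolding prim_def
    proof (rule integral_cong_AE)
      show "AE y in lborel. indicator {..x} y * H y = 0"
        using AE_lborel_singleton[of c] by eventually_elim (use False in \<open>auto simp: H_def indicator_def\<close>)
    qed measurable
    then show ?thesis by simp
  qed
  then have "AE x in lborel. H x = 0" by (rule prim_const_imp_AE_0[OF H iH])
  then show ?thesis by eventually_elim (auto simp: H_def)
qed

lemma lebesgue_representative:
  fixes f :: "real \<Rightarrow> real"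
  assumes "f \<in> borel_measurable lebesgue"
  obtains f' where "f' \<in> borel_measurable borel" "AE x in lborel. f x = f' x"
  using completion_ex_borel_measurable_real[OF assms] by auto

lemma AE_lebesgue_iff: "(AE x in lebesgue. P x) \<longleftrightarrow> (AE x in lborel. P x)"
  by (simp add: AE_completion_iff)

lemma integral_lebesgue_representative:
  fixes f f' :: "real \<Rightarrow> real"
  assumes "f \<in> borel_measurable lebesgue" "f' \<in> borel_measurable borel" "AE x in lborel. f x = f' x"
  shows "integrable lebesgue f \<longleftrightarrow> integrable lborel f'" "(LINT x|lebesgue. f x) = (LINT x|lborel. f' x)"
proof -
  have m: "f' \<in> borel_measurable lebesgue" using assms(2) by (simp add: measurable_completion)
  have ae: "AE x in lebesgue. f x = f' x" using assms(3) by (simp add: AE_lebesgue_iff)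
  show "integrable lebesgue f \<longleftrightarrow> integrable lborel f'"
    using integrable_cong_AE[OF assms(1) m ae] integrable_completion[of f' lborel] assms(2) by simp
  show "(LINT x|lebesgue. f x) = (LINT x|lborel. f' x)"
    using integral_cong_AE[OF assms(1) m ae] integral_completion[of f' lborel] assms(2) by simp
qed

lemma Lp_space_2_iff: "f \<in> Lp_space 2 \<longleftrightarrow> f \<in> borel_measurable lebesgue \<and> integrable lebesgue (\<lambda>x. (f x)\<^sup>2)"
proof -
  have "\<bar>y\<bar> powr 2 = y\<^sup>2" for y :: real
    by (cases "y = 0") (auto simp: powr_numeral)
  then show ?thesis unfolding Lp_space_def by simp
qed

lemma Lp_norm_2: "Lp_norm 2 f = sqrt (LINT x|lebesgue. (f x)\<^sup>2)"
proof -
  have e: "\<bar>y\<bar> powr 2 = y\<^sup>2" for y :: real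
    by (cases "y = 0") (auto simp: powr_numeral)
  have "(LINT x|lebesgue. (f x)\<^sup>2) \<ge> 0" by simp
  then show ?thesis unfolding Lp_norm_def e by (simp add: powr_half_sqrt)
qed

lemma Lp_space_2_representative:
  assumes "f \<in> Lp_space 2"
  obtains f' where "sqint f'" "AE x in lborel. f x = f' x"
proof -
  have f: "f \<in> borel_measurable lebesgue" "integrable lebesgue (\<lambda>x. (f x)\<^sup>2)"
    using assms by (auto simp: Lp_space_2_iff)
  obtain f' where f': "f' \<in> borel_measurable borel" "AE x in lborel. f x = f' x"
    by (rule lebesgue_representative[OF f(1)])
  have "AE x in lborel. (f x)\<^sup>2 = (f' x)\<^sup>2" using f'(2) by eventually_elim simp
  then have "integrable lborel (\<lambda>x. (f' x)\<^sup>2)"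
    using integral_lebesgue_representative(1)[of "\<lambda>x. (f x)\<^sup>2" "\<lambda>x. (f' x)\<^sup>2"] f f'(1) by simp
  then show ?thesis using that f' unfolding sqint_def by blast
qed

lemma sqint_Lp_space: "sqint f \<Longrightarrow> f \<in> Lp_space 2"
  unfolding Lp_space_2_iff sqint_def
  by (auto simp: measurable_completion integrable_completion)

lemma sqint_Lp_norm: "sqint f \<Longrightarrow> Lp_norm 2 f = sqrt (LINT x|lborel. (f x)\<^sup>2)"
  unfolding Lp_norm_2 sqint_def by (subst integral_completion) auto

lemma lebesgue_test_integral:
  fixes f f' k :: "real \<Rightarrow> real"
  assumes f: "f \<in> borel_measurable lebesgue" and f': "f' \<in> borel_measurable borel" "AE x in lborel. f x = f' x"
    and k: "continuous_on UNIV k"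
  shows "(LINT x|lebesgue. f x * k x) = (LINT x|lborel. f' x * k x)"
proof (rule integral_lebesgue_representative(2))
  note [measurable] = borel_measurable_continuous_onI[OF k]
  have "k \<in> borel_measurable lebesgue" by (simp add: measurable_completion)
  then show "(\<lambda>x. f x * k x) \<in> borel_measurable lebesgue" using f by simp
  show "(\<lambda>x. f' x * k x) \<in> borel_measurable borel" using f' by simp
  show "AE x in lborel. f x * k x = f' x * k x" using f'(2) by eventually_elim simp
qed

lemma has_weak_deriv_representative:
  fixes f f' g g' :: "real \<Rightarrow> real"
  assumes "f \<in> borel_measurable lebesgue" "f' \<in> borel_measurable borel" "AE x in lborel. f x = f' x"
    and "g \<in> borel_measurable lebesgue" "g' \<in> borel_measurable borel" "AE x in lborel. g x = g' x"
  shows "has_weak_deriv f g \<longleftrightarrow>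
    (\<forall>\<phi>. test_function \<phi> \<longrightarrow> (LINT x|lborel. f' x * deriv \<phi> x) = - (LINT x|lborel. g' x * \<phi> x))"
  unfolding has_weak_deriv_def
  using lebesgue_test_integral[OF assms(1-3) test_functionD(2)] lebesgue_test_integral[OF assms(4-6) test_functionD(3)]
  by auto

lemma prim_has_weak_deriv:
  assumes h: "integrable lborel h"
  shows "has_weak_deriv (prim h) h"
proof -
  have m: "h \<in> borel_measurable borel" "prim h \<in> borel_measurable borel"
    using borel_measurable_integrable[OF h] borel_measurable_continuous_onI[OF prim_continuous[OF h]] by auto
  then have "h \<in> borel_measurable lebesgue" "prim h \<in> borel_measurable lebesgue"
    by (auto simp: measurable_completion)
  then show ?thesis
    using has_weak_deriv_representative[of "prim h" "prim h" h h] m prim_by_parts[OF h] by auto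
qed

lemma AE_on_all_intervals:
  assumes "\<And>n::nat. AE x in lborel. x \<in> {- real n..real n} \<longrightarrow> P (x::real)"
  shows "AE x in lborel. P x"
proof -
  have "AE x in lborel. \<forall>n::nat. x \<in> {- real n..real n} \<longrightarrow> P x"
    unfolding AE_all_countable using assms by blast
  then show ?thesis
  proof eventually_elim
    case (elim x)
    obtain n :: nat where "\<bar>x\<bar> \<le> real n" using real_arch_simple by blast
    then show ?case using elim by (auto simp: abs_le_iff)
  qed
qed

lemma weak_deriv_unique:
  assumes 1: "f \<in> borel_measurable lebesgue" and g: "g \<in> Lp_space 2" "has_weak_deriv f g"
    and h: "sqint h" "has_weak_deriv f h"
  shows "AE x in lborel. g x = h x"
proof -
  obtain g' where g': "sqint g'" "AE x in lborel. g x = g' x" by (rule Lp_space_2_representative[OF g(1)])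
  obtain f' where f': "f' \<in> borel_measurable borel" "AE x in lborel. f x = f' x"
    by (rule lebesgue_representative[OF 1])
  have gm: "g \<in> borel_measurable lebesgue" using g(1) by (simp add: Lp_space_2_iff)
  have hm: "h \<in> borel_measurable lebesgue" using sqintD(1)[OF h(1)] by (simp add: measurable_completion)
  note [measurable] = sqintD(1)[OF g'(1)] sqintD(1)[OF h(1)]
  have sq: "sqint (\<lambda>x. g' x - h x)" by (rule sqint_diff[OF g'(1) h(1)])
  have "AE x in lborel. x \<in> {- real n..real n} \<longrightarrow> g' x - h x = 0" for n :: nat
  proof (rule bumps_detect_zero)
    show "sqint (\<lambda>x. indicator {- real n..real n} x * (g' x - h x))"
      unfolding sqint_def
      by (intro conjI Bochner_Integration.integrable_bound[OF sqintD(2)[OF sq]]) (auto simp: indicator_def)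
    fix a b \<alpha> :: real assume ab: "a < b" "\<alpha> > 0"
    let ?\<psi> = "bump1 \<alpha> a b"
    have t: "test_function ?\<psi>" by (rule bump_test_function[OF ab])
    have int: "integrable lborel (\<lambda>x. k x * ?\<psi> x)" if k: "sqint k" for k
    proof -
      note [measurable] = sqintD(1)[OF k] borel_measurable_continuous_onI[OF bump_continuous[OF ab]]
      have "sqint ?\<psi>" by (rule integrable_cont_support(2)[OF bump_continuous[OF ab] bump_support])
      then have "integrable lborel (\<lambda>x. (k x)\<^sup>2 + (?\<psi> x)\<^sup>2)"
        using sqintD(2)[OF k] sqintD(2) by (intro Bochner_Integration.integrable_add)
      then show ?thesis
      proof (rule Bochner_Integration.integrable_bound)
        have "\<bar>k x * ?\<psi> x\<bar> \<le> \<bar>(k x)\<^sup>2 + (?\<psi> x)\<^sup>2\<bar>" for x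
        proof -
          have "0 \<le> \<bar>k x\<bar> * \<bar>?\<psi> x\<bar>" by simp
          moreover have "2 * (\<bar>k x\<bar> * \<bar>?\<psi> x\<bar>) \<le> (k x)\<^sup>2 + (?\<psi> x)\<^sup>2"
            using sum_squares_bound[of "\<bar>k x\<bar>" "\<bar>?\<psi> x\<bar>"] by (simp add: mult.assoc)
          ultimately show ?thesis by (simp only: abs_mult)
        qed
        then show "AE x in lborel. norm (k x * ?\<psi> x) \<le> norm ((k x)\<^sup>2 + (?\<psi> x)\<^sup>2)" by simp
      qed measurable
    qed
    have "(LINT x|lborel. g' x * ?\<psi> x) = (LINT x|lborel. h x * ?\<psi> x)"
      using has_weak_deriv_representative[OF 1 f' gm sqintD(1)[OF g'(1)] g'(2)] g(2)
        has_weak_deriv_representative[OF 1 f' hm sqintD(1)[OF h(1)]] h(2) t by simp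
    then show "(LINT x|lborel. (g' x - h x) * ?\<psi> x) = 0"
      using int[OF g'(1)] int[OF h(1)] by (simp add: left_diff_distrib)
  qed measurable
  then have "AE x in lborel. g' x - h x = 0" by (rule AE_on_all_intervals)
  with g'(2) show ?thesis by eventually_elim simp
qed

lemma ess_support_AE:
  assumes "ess_support f \<subseteq> {- R..R}"
  shows "AE x in lborel. \<bar>x\<bar> > R \<longrightarrow> f x = 0"
proof -
  define Z where "Z = {z :: rat \<times> rat. AE y in lebesgue. y \<in> ball (of_rat (fst z)) (of_rat (snd z)) \<longrightarrow> f y = 0}"
  have "AE y in lborel. \<forall>z\<in>Z. y \<in> ball (of_rat (fst z)) (of_rat (snd z)) \<longrightarrow> f y = 0"
  proof (rule AE_ball_countable')
    show "countable Z" by (rule countable_subset[of _ UNIV]) auto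
    show "AE y in lborel. y \<in> ball (of_rat (fst z)) (of_rat (snd z)) \<longrightarrow> f y = 0" if "z \<in> Z" for z
      using that unfolding Z_def by (auto simp: AE_lebesgue_iff)
  qed
  then show ?thesis
  proof eventually_elim
    case (elim x)
    show ?case
    proof
      assume "\<bar>x\<bar> > R"
      then have "x \<notin> {- R..R}" by auto
      then have "x \<notin> ess_support f" using assms by blast
      then obtain e where e: "e > 0" "AE y in lebesgue. y \<in> ball x e \<longrightarrow> f y = 0"
        unfolding ess_support_def by auto
      obtain r where r: "e / 4 < of_rat r" "of_rat r < e / 2" using of_rat_dense[of "e / 4" "e / 2"] e by auto
      obtain q where q: "x - e / 4 < of_rat q" "of_rat q < x + e / 4"
        using of_rat_dense[of "x - e / 4" "x + e / 4"] e by auto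
      have xq: "\<bar>x - of_rat q\<bar> < of_rat r" using q r by linarith
      have sub: "ball (of_rat q) (of_rat r) \<subseteq> ball x e"
      proof
        fix y :: real assume "y \<in> ball (of_rat q) (of_rat r)"
        then have "\<bar>of_rat q - y\<bar> < of_rat r" by (simp add: dist_real_def)
        then show "y \<in> ball x e" using xq r by (simp add: dist_real_def)
      qed
      have "AE y in lebesgue. y \<in> ball (of_rat q) (of_rat r) \<longrightarrow> f y = 0"
        using e(2) by eventually_elim (use sub in blast)
      then have "(q, r) \<in> Z" unfolding Z_def by simp
      moreover have "x \<in> ball (of_rat q) (of_rat r)" using xq by (simp add: dist_real_def abs_minus_commute)
      ultimately show "f x = 0" using elim by fastforce
    qed
  qed
qed

lemma compact_L2_representative:
  assumes "f \<in> Lp_space 2" "ess_support f \<subseteq> {- R..R}"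
  obtains f' where "sqint f'" "\<And>x. \<bar>x\<bar> > R \<Longrightarrow> f' x = 0" "AE x in lborel. f x = f' x"
proof -
  obtain g where g: "sqint g" "AE x in lborel. f x = g x" by (rule Lp_space_2_representative[OF assms(1)])
  note [measurable] = sqintD(1)[OF g(1)]
  show ?thesis
  proof (rule that[of "\<lambda>x. indicator {-R..R} x * g x"])
    show "sqint (\<lambda>x. indicator {-R..R} x * g x)"
      unfolding sqint_def
      by (intro conjI Bochner_Integration.integrable_bound[OF sqintD(2)[OF g(1)]]) (auto simp: indicator_def)
    show "indicator {-R..R} x * g x = 0" if "\<bar>x\<bar> > R" for x using that by (auto simp: indicator_def)
    show "AE x in lborel. f x = indicator {-R..R} x * g x"
      using g(2) ess_support_AE[OF assms(2)] by eventually_elim (auto simp: indicator_def abs_le_iff)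
  qed
qed

text \<open>
  Let \<open>U\<close> represent \<open>f\<close> and \<open>h\<close> its weak derivative. Outside \<open>{-R..R}\<close> the derivative of \<open>U = 0\<close> vanishes.
  Both \<open>U\<close> and \<open>prim h\<close> have weak derivative \<open>h\<close>; tested against the primitive of a bump minus a translate of
  it that lies beyond \<open>R\<close>, where \<open>U = 0\<close> and \<open>prim h\<close> equals its limit \<open>k\<close>, this shows that
  \<open>U - prim h + k\<close> is orthogonal to all bumps, hence \<open>0\<close>. To the left of \<open>-R\<close> this reads \<open>k = 0\<close>.
\<close>

lemma H1_compact_representative:
  assumes f: "f \<in> H1_space" "ess_support f \<subseteq> {- R..R}" and R: "R > 0"
  obtains h where "sqint h" "\<And>x. \<bar>x\<bar> > R \<Longrightarrow> h x = 0" "(LINT x|lborel. h x) = 0" "AE x in lborel. f x = prim h x"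
proof -
  obtain g where g: "f \<in> Lp_space 2" "g \<in> Lp_space 2" "has_weak_deriv f g" using f(1) unfolding H1_space_def by auto
  obtain U where U: "sqint U" "\<And>x. \<bar>x\<bar> > R \<Longrightarrow> U x = 0" "AE x in lborel. f x = U x"
    by (rule compact_L2_representative[OF g(1) f(2)]) blast
  obtain G where G: "sqint G" "AE x in lborel. g x = G x" by (rule Lp_space_2_representative[OF g(2)])
  note [measurable] = sqintD(1)[OF U(1)] sqintD(1)[OF G(1)]
  have wd: "(LINT x|lborel. U x * deriv \<phi> x) = - (LINT x|lborel. G x * \<phi> x)" if "test_function \<phi>" for \<phi>
    using has_weak_deriv_representative[of f U g G] g U G that by (auto simp: Lp_space_2_iff)
  have G0: "AE x in lborel. x \<in> {c..d} \<longrightarrow> G x = 0" if cd: "c \<ge> R \<or> d \<le> - R" for c d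
  proof (rule bumps_detect_zero)
    show "sqint (\<lambda>x. indicator {c..d} x * G x)"
      unfolding sqint_def
      by (intro conjI Bochner_Integration.integrable_bound[OF sqintD(2)[OF G(1)]]) (auto simp: indicator_def)
    fix a b \<alpha> :: real assume ab: "c \<le> a" "a < b" "b \<le> d" "\<alpha> > 0"
    obtain Q where Q: "deriv (bump1 \<alpha> a b) = bump \<alpha> a b Q (0 + 2)" by (rule bump_deriv[OF ab(2,4)])
    have "U x * deriv (bump1 \<alpha> a b) x = 0" for x
      unfolding Q using U(2)[of x] ab cd by (auto simp: bump_def abs_less_iff)
    then have "(LINT x|lborel. U x * deriv (bump1 \<alpha> a b) x) = 0" by (simp only:) simp
    then show "(LINT x|lborel. G x * bump1 \<alpha> a b x) = 0"
      using wd[OF bump_test_function[OF ab(2,4), of 1 0]] by (simp only:)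
  qed measurable
  have Goff: "AE x in lborel. \<bar>x\<bar> > R \<longrightarrow> G x = 0"
  proof (rule AE_on_all_intervals)
    fix n :: nat
    show "AE x in lborel. x \<in> {- real n..real n} \<longrightarrow> \<bar>x\<bar> > R \<longrightarrow> G x = 0"
      using G0[of R "real n"] G0[of "- real n" "- R"] by (auto elim!: eventually_elim2)
  qed
  define h where "h x = indicator {-R..R} x * G x" for x
  have hG: "AE x in lborel. G x = h x" using Goff by eventually_elim (auto simp: h_def indicator_def abs_le_iff)
  have h: "sqint h"
    unfolding sqint_def h_def[abs_def]
    by (intro conjI Bochner_Integration.integrable_bound[OF sqintD(2)[OF G(1)]]) (auto simp: indicator_def)
  have h0: "h x = 0" if "\<bar>x\<bar> > R" for x using that by (auto simp: h_def indicator_def)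
  have ih: "integrable lborel h" by (rule sqint_integrable[OF h h0])
  note [measurable] = sqintD(1)[OF h] borel_measurable_continuous_onI[OF prim_continuous[OF ih]]
  define k where "k = (LINT x|lborel. h x)"
  have iU: "integrable lborel U" by (rule sqint_integrable[OF U(1,2)])
  obtain B where B: "\<And>x. \<bar>prim h x\<bar> \<le> B" using prim_bound[OF ih] by blast
  have orth: "(LINT x|lborel. U x * deriv \<phi> x) = (LINT x|lborel. prim h x * deriv \<phi> x)" if \<phi>: "test_function \<phi>" for \<phi>
  proof -
    note [measurable] = borel_measurable_continuous_onI[OF test_functionD(3)[OF \<phi>]]
    have "(LINT x|lborel. G x * \<phi> x) = (LINT x|lborel. h x * \<phi> x)"
      by (rule integral_cong_AE) (use hG in auto)
    then show ?thesis using wd[OF \<phi>] prim_by_parts[OF ih \<phi>] by simp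
  qed
  have key: "(LINT x|lborel. (U x - prim h x + k) * bump1 \<alpha> a b x) = 0" if ab: "a < b" "\<alpha> > 0" for a b \<alpha> :: real
  proof -
    \<comment> \<open>the translate by \<open>c\<close> is supported to the right of \<open>R\<close>\<close>
    define c where "c = R + \<bar>a\<bar> + \<bar>b\<bar> + 1"
    let ?\<psi> = "bump1 \<alpha> a b"
    obtain \<phi> where \<phi>: "test_function \<phi>" "deriv \<phi> = (\<lambda>x. ?\<psi> x - ?\<psi> (x - c))"
      using bump_difference_antiderivative[OF ab, of c] by blast
    note [measurable] = borel_measurable_continuous_onI[OF bump_continuous[OF ab]]
    have i\<psi>: "integrable lborel ?\<psi>" by (rule integrable_cont_support(3)[OF bump_continuous[OF ab] bump_support])
    have i\<psi>c: "integrable lborel (\<lambda>x. ?\<psi> (x - c))" using integrable_shift[of ?\<psi> "- c"] i\<psi> by simp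
    have b1: "\<bar>?\<psi> x\<bar> \<le> 1" for x by (rule bump1_range[OF ab(2)])
    have iU\<psi>: "integrable lborel (\<lambda>x. U x * ?\<psi> x)" by (rule integrable_mult_bounded[OF iU _ b1]) measurable
    have iF\<psi>: "integrable lborel (\<lambda>x. prim h x * ?\<psi> x)"
      using integrable_mult_bounded[OF i\<psi> _ B] by (simp add: mult.commute)
    have far: "U x * ?\<psi> (x - c) = 0" "prim h x * ?\<psi> (x - c) = k * ?\<psi> (x - c)" for x
    proof -
      show "U x * ?\<psi> (x - c) = 0"
        using U(2)[of x] by (auto simp: bump_def c_def)
      have "prim h x = k" if "a < x - c"
        unfolding k_def using that R by (intro prim_eq_total[of R] h0) (auto simp: c_def)
      then show "prim h x * ?\<psi> (x - c) = k * ?\<psi> (x - c)" by (auto simp: bump_def)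
    qed
    have "(LINT x|lborel. U x * deriv \<phi> x) = (LINT x|lborel. U x * ?\<psi> x)"
      unfolding \<phi>(2) by (simp add: right_diff_distrib far)
    moreover have "(LINT x|lborel. prim h x * deriv \<phi> x) = (LINT x|lborel. prim h x * ?\<psi> x) - k * (LINT x|lborel. ?\<psi> x)"
    proof -
      have "(LINT x|lborel. prim h x * deriv \<phi> x) = (LINT x|lborel. prim h x * ?\<psi> x - k * ?\<psi> (x - c))"
        unfolding \<phi>(2) by (simp add: right_diff_distrib far)
      also have "\<dots> = (LINT x|lborel. prim h x * ?\<psi> x) - k * (LINT x|lborel. ?\<psi> (x - c))"
        using iF\<psi> i\<psi>c by simp
      also have "(LINT x|lborel. ?\<psi> (x - c)) = (LINT x|lborel. ?\<psi> x)" using integral_shift[of ?\<psi> "- c"] by simp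
      finally show ?thesis .
    qed
    ultimately have "(LINT x|lborel. U x * ?\<psi> x) = (LINT x|lborel. prim h x * ?\<psi> x) - k * (LINT x|lborel. ?\<psi> x)"
      using orth[OF \<phi>(1)] by simp
    moreover have "(LINT x|lborel. (U x - prim h x + k) * ?\<psi> x) = (LINT x|lborel. U x * ?\<psi> x - prim h x * ?\<psi> x + k * ?\<psi> x)"
      by (simp add: algebra_simps)
    moreover have "\<dots> = (LINT x|lborel. U x * ?\<psi> x) - (LINT x|lborel. prim h x * ?\<psi> x) + k * (LINT x|lborel. ?\<psi> x)"
      using iU\<psi> iF\<psi> i\<psi> by simp
    ultimately show ?thesis by simp
  qed
  have ae: "AE x in lborel. U x - prim h x + k = 0"
  proof (rule AE_on_all_intervals, rule bumps_detect_zero)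
    fix n :: nat
    have s1: "sqint (\<lambda>x. indicator {- real n..real n} x * U x)"
      unfolding sqint_def
      by (intro conjI Bochner_Integration.integrable_bound[OF sqintD(2)[OF U(1)]]) (auto simp: indicator_def)
    have s2: "sqint (\<lambda>x. indicator {- real n..real n} x * (k - prim h x))"
    proof (rule sqint_bounded)
      show "\<bar>indicator {- real n..real n} x * (k - prim h x)\<bar> \<le> \<bar>k\<bar> + B" for x
        using B[of x] by (auto simp: indicator_def)
      show "indicator {- real n..real n} x * (k - prim h x) = 0" if "\<bar>x\<bar> > real n" for x
        using that by (auto simp: indicator_def)
    qed measurable
    show "sqint (\<lambda>x. indicator {- real n..real n} x * (U x - prim h x + k))"
      using sqint_add[OF s1 s2] by (simp add: algebra_simps)
  qed (use key in auto)
  have k0: "k = 0"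
  proof (rule ccontr)
    assume "k \<noteq> 0"
    have "AE x in lborel. x \<notin> {- R - 2<..<- R - 1}"
      using ae
    proof eventually_elim
      case (elim x)
      show ?case
      proof
        assume x: "x \<in> {- R - 2<..<- R - 1}"
        then have "U x = 0" "prim h x = 0" by (auto intro!: U(2) prim_eq_0[of R] h0)
        then show False using elim \<open>k \<noteq> 0\<close> by simp
      qed
    qed
    then have "{- R - 2<..<- R - 1} \<in> null_sets lborel"
      by (subst AE_iff_null_sets) auto
    then show False by (simp add: null_sets_def)
  qed
  show ?thesis
  proof (rule that[OF h h0])
    show "(LINT x|lborel. h x) = 0" using k0 by (simp add: k_def)
    show "AE x in lborel. f x = prim h x" using U(3) ae by eventually_elim (simp add: k0)
  qed
qed

subsection \<open>Energy curves\<close>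

text \<open>
  The chosen weak derivative is determined up to null sets: two candidates differ by a function that is
  orthogonal to all bumps.
\<close>

lemma H1_norm_prim:
  assumes h: "sqint h" "integrable lborel h" and f: "sqint f" "\<And>x. f x = prim h x"
  shows "f \<in> H1_space" "H1_norm f = sqrt ((LINT x|lborel. (f x)\<^sup>2) + (LINT x|lborel. (h x)\<^sup>2))"
proof -
  have ff: "f = prim h" using f(2) by auto
  have w: "has_weak_deriv f h" unfolding ff by (rule prim_has_weak_deriv[OF h(2)])
  show "f \<in> H1_space" unfolding H1_space_def using sqint_Lp_space[OF f(1)] sqint_Lp_space[OF h(1)] w by blast
  define g where "g = weak_deriv f"
  have "g \<in> Lp_space 2 \<and> has_weak_deriv f g"
    unfolding g_def weak_deriv_def by (rule someI[of _ h]) (use sqint_Lp_space[OF h(1)] w in auto)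
  then have g: "g \<in> Lp_space 2" "has_weak_deriv f g" by auto
  have fm: "f \<in> borel_measurable lebesgue" using sqintD(1)[OF f(1)] by (simp add: measurable_completion)
  have "AE x in lborel. g x = h x" by (rule weak_deriv_unique[OF fm g h(1) w])
  then have "AE x in lborel. (g x)\<^sup>2 = (h x)\<^sup>2" by eventually_elim simp
  then have "(LINT x|lebesgue. (g x)\<^sup>2) = (LINT x|lborel. (h x)\<^sup>2)"
    using g(1) sqintD(1)[OF h(1)] by (intro integral_lebesgue_representative) (auto simp: Lp_space_2_iff)
  then have n: "Lp_norm 2 g = sqrt (LINT x|lborel. (h x)\<^sup>2)" by (simp add: Lp_norm_2)
  show "H1_norm f = sqrt ((LINT x|lborel. (f x)\<^sup>2) + (LINT x|lborel. (h x)\<^sup>2))"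
    unfolding H1_norm_def g_def[symmetric] n sqint_Lp_norm[OF f(1)] by simp
qed

lemma L2_null_Lp_norm:
  assumes "L2_null F f"
  shows "((\<lambda>s. Lp_norm 2 (f s)) \<longlongrightarrow> 0) F"
proof -
  have "((\<lambda>s. sqrt (LINT x|lborel. (f s x)\<^sup>2)) \<longlongrightarrow> sqrt 0) F"
    using assms unfolding L2_null_def by (intro tendsto_real_sqrt) auto
  moreover have "eventually (\<lambda>s. sqrt (LINT x|lborel. (f s x)\<^sup>2) = Lp_norm 2 (f s)) F"
    using assms[unfolded L2_null_def, THEN conjunct1] by eventually_elim (simp add: sqint_Lp_norm)
  ultimately show ?thesis unfolding real_sqrt_zero by (rule Lim_transform_eventually)
qed

lemma energy_triple_imp_energy_curve:
  assumes tr: "energy_triple {0..<T} w a b"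
  shows "energy_curve (ereal T) w"
proof -
  have I: "time_interval (ereal T) = {0..<T}" by (auto simp: time_interval_def)
  note d = energy_tripleD[OF tr]
  have sa: "sqint (a t)" "sqint (b t)" if "t \<in> {0..<T}" for t using d(2,3) that unfolding L2_cts_def by auto
  have H1: "((\<lambda>s. H1_norm (\<lambda>x. w s x - w t x)) \<longlongrightarrow> 0) (at t within {0..<T})" if t: "t \<in> {0..<T}" for t
  proof -
    have "((\<lambda>s. sqrt ((LINT x|lborel. (w s x - w t x)\<^sup>2) + (LINT x|lborel. (a s x - a t x)\<^sup>2))) \<longlongrightarrow> sqrt (0 + 0))
       (at t within {0..<T})"
      using d(1,2) t unfolding L2_cts_def L2_null_def by (intro tendsto_real_sqrt tendsto_add) auto
    moreover have "eventually (\<lambda>s. sqrt ((LINT x|lborel. (w s x - w t x)\<^sup>2) + (LINT x|lborel. (a s x - a t x)\<^sup>2))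
       = H1_norm (\<lambda>x. w s x - w t x)) (at t within {0..<T})"
      unfolding eventually_at_filter
    proof (intro always_eventually allI impI)
      fix s assume s: "s \<in> {0..<T}"
      have "w s x - w t x = prim (\<lambda>x. a s x - a t x) x" for x
        using prim_add[of "a s" "\<lambda>x. (- 1) * a t x" x] d(5,6) s t by (simp add: prim_cmult[of "-1", simplified])
      then show "sqrt ((LINT x|lborel. (w s x - w t x)\<^sup>2) + (LINT x|lborel. (a s x - a t x)\<^sup>2))
       = H1_norm (\<lambda>x. w s x - w t x)"
        using s t d(4,5) sa by (intro H1_norm_prim(2)[symmetric] sqint_diff Bochner_Integration.integrable_diff) auto
    qed
    ultimately show ?thesis unfolding add_0 real_sqrt_zero by (rule Lim_transform_eventually)
  qed
  have "continuous_curve H1_space H1_norm (ereal T) w"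
    unfolding continuous_curve_def I
  proof (intro ballI conjI H1)
    fix t assume "t \<in> {0..<T}"
    then show "w t \<in> H1_space" using d sa by (intro H1_norm_prim(1)[of "a t"]) auto
  qed
  moreover have "C1_curve (Lp_space 2) (Lp_norm 2) (ereal T) w"
    unfolding C1_curve_def I
  proof (intro conjI ballI exI[of _ b])
    show "w t \<in> Lp_space 2" if "t \<in> {0..<T}" for t using d(4)[OF that] by (rule sqint_Lp_space)
    show "continuous_curve (Lp_space 2) (Lp_norm 2) (ereal T) b"
      unfolding continuous_curve_def I
      using d(3) sqint_Lp_space L2_null_Lp_norm unfolding L2_cts_def by blast
    show "((\<lambda>s. Lp_norm 2 (\<lambda>x. (w s x - w t x) / (s - t) - b t x)) \<longlongrightarrow> 0) (at t within {0..<T})" if "t \<in> {0..<T}" for t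
      by (rule L2_null_Lp_norm[OF d(7)[OF that]])
  qed
  ultimately show ?thesis unfolding energy_curve_def by simp
qed

section \<open>The Bessel kernels\<close>

text \<open>
  The entire function with \<open>I\<^sub>n(z) = (z / 2)^n bE n (z\<^sup>2 / 4)\<close>. In terms of the squared argument the square
  roots disappear, the kernels become smooth up to the boundary of the cone, and differentiation is a
  shift of the index.
\<close>

definition bE :: "nat \<Rightarrow> real \<Rightarrow> real" where
  "bE n s = (\<Sum>k. s ^ k / (fact k * fact (k + n)))"

lemma bE_summable: "summable (\<lambda>k. (s::real) ^ k / (fact k * fact (k + n)))"
proof (rule summable_comparison_test)
  show "summable (\<lambda>k. inverse (fact k) * \<bar>s\<bar> ^ k)" by (rule summable_exp)
  have "norm (s ^ k / (fact k * fact (k + n))) \<le> inverse (fact k) * \<bar>s\<bar> ^ k" for k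
  proof -
    have "(fact k * 1 :: real) \<le> fact k * fact (k + n)" by (intro mult_left_mono) (auto simp: fact_ge_1)
    then have "\<bar>s\<bar> ^ k / (fact k * fact (k + n)) \<le> \<bar>s\<bar> ^ k / fact k"
      by (intro divide_left_mono) auto
    then show ?thesis by (simp add: power_abs abs_mult divide_inverse mult.commute)
  qed
  then show "\<exists>N. \<forall>k\<ge>N. norm (s ^ k / (fact k * fact (k + n))) \<le> inverse (fact k) * \<bar>s\<bar> ^ k" by blast
qed

lemma bE_deriv: "(bE n has_real_derivative bE (Suc n) s) (at s)"
proof -
  let ?c = "\<lambda>k. 1 / (fact k * fact (k + n)) :: real"
  have "((\<lambda>x. \<Sum>k. ?c k * x ^ k) has_real_derivative (\<Sum>k. diffs ?c k * s ^ k)) (at s)"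
    by (rule termdiffs_strong_converges_everywhere) (use bE_summable in simp)
  moreover have "diffs ?c k * s ^ k = s ^ k / (fact k * fact (k + Suc n))" for k
    by (simp add: diffs_def)
  ultimately show ?thesis by (simp add: bE_def[abs_def])
qed

lemma bE_continuous: "continuous_on UNIV (bE n)"
  using bE_deriv by (auto intro!: continuous_at_imp_continuous_on DERIV_isCont)

lemma bE_mono: "0 \<le> s \<Longrightarrow> s \<le> t \<Longrightarrow> bE n s \<le> bE n t"
  unfolding bE_def by (intro suminf_le bE_summable divide_right_mono power_mono) auto

lemma bE_nonneg: "0 \<le> s \<Longrightarrow> 0 \<le> bE n s"
  unfolding bE_def by (intro suminf_nonneg bE_summable) auto

lemma bE_0: "bE n 0 = 1 / fact n"
  unfolding bE_def by (subst suminf_finite[of "{0}"]) auto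

lemma bessel_I_0: "r \<ge> 0 \<Longrightarrow> bessel_I 0 (sqrt r / 2) = bE 0 (r / 16)"
  unfolding bessel_I_def bE_def by (simp add: power_mult power_divide)

lemma bessel_I_1:
  assumes "r > 0"
  shows "bessel_I 1 (sqrt r / 2) / sqrt r = bE 1 (r / 16) / 4"
proof -
  have "(sqrt r / 2 / 2) ^ (2 * k + 1) = (sqrt r / 4) * (r / 16) ^ k" for k
    using assms by (simp add: power_mult power_divide)
  then have "bessel_I 1 (sqrt r / 2) = (\<Sum>k. (sqrt r / 4) * ((r / 16) ^ k / (fact k * fact (k + 1))))"
    unfolding bessel_I_def by (simp only: times_divide_eq_right)
  also have "\<dots> = (sqrt r / 4) * bE 1 (r / 16)" unfolding bE_def by (rule suminf_mult[OF bE_summable])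
  finally show ?thesis using assms by simp
qed

text \<open>
  All bounds on \<open>bE\<close> compare its terms with terms of the exponential series, indexed by \<open>2 k\<close> or \<open>2 k + 1\<close>.
\<close>

lemma exp_subseries_le:
  fixes x :: real
  assumes x: "x \<ge> 0" and h: "inj h"
  shows "summable (\<lambda>k::nat. x ^ h k / fact (h k))" "(\<Sum>k. x ^ h k / fact (h k)) \<le> exp x"
proof -
  have s: "summable (\<lambda>j. x ^ j / fact j)" using summable_exp[of x] by (simp add: divide_inverse mult.commute)
  have e: "exp x = (\<Sum>j. x ^ j / fact j)" by (simp add: exp_def divide_inverse mult.commute)
  have b: "(\<Sum>k<n. x ^ h k / fact (h k)) \<le> exp x" for n
  proof -
    have "(\<Sum>k<n. x ^ h k / fact (h k)) = (\<Sum>j\<in>h ` {..<n}. x ^ j / fact j)"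
      by (subst sum.reindex) (use h in \<open>auto simp: inj_on_def\<close>)
    also have "\<dots> \<le> exp x" unfolding e by (intro sum_le_suminf s) (use x in auto)
    finally show ?thesis .
  qed
  show "summable (\<lambda>k. x ^ h k / fact (h k))" by (rule summableI_nonneg_bounded[OF _ b]) (use x in auto)
  then show "(\<Sum>k. x ^ h k / fact (h k)) \<le> exp x" by (rule suminf_le_const) (rule b)
qed

lemma fact_double_Suc: "fact (2 * Suc k) = (2 * real k + 1) * (2 * real k + 2) * fact (2 * k)"
  by (simp add: algebra_simps)

lemma central_binomial_le: "(fact (2 * k))\<^sup>2 * (2 * real k + 1) \<le> (4 ^ k * (fact k)\<^sup>2)\<^sup>2"
proof (induction k)
  case (Suc k)
  have "(fact (2 * Suc k))\<^sup>2 * (2 * real (Suc k) + 1)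
     = ((fact (2 * k))\<^sup>2 * (2 * real k + 1)) * ((2 * real k + 1) * (2 * real k + 2)\<^sup>2 * (2 * real k + 3))"
    unfolding fact_double_Suc by (simp add: power2_eq_square algebra_simps)
  also have "\<dots> \<le> (4 ^ k * (fact k)\<^sup>2)\<^sup>2 * (16 * (real k + 1) ^ 4)"
  proof (rule mult_mono[OF Suc])
    show "(2 * real k + 1) * (2 * real k + 2)\<^sup>2 * (2 * real k + 3) \<le> 16 * (real k + 1) ^ 4"
      by (simp add: power2_eq_square power4_eq_xxxx algebra_simps)
  qed auto
  also have "\<dots> = (4 ^ Suc k * (fact (Suc k))\<^sup>2)\<^sup>2"
    by (simp add: power_mult_distrib power2_eq_square power4_eq_xxxx algebra_simps)
  finally show ?case .
qed simp

lemma cross_le: "a > 0 \<Longrightarrow> b > 0 \<Longrightarrow> x * b \<le> y * a \<Longrightarrow> x / a \<le> y / (b::real)"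
  by (simp add: pos_divide_le_eq pos_le_divide_eq)

lemma bE_0_le_exp: "r \<ge> 0 \<Longrightarrow> bE 0 (r\<^sup>2) \<le> exp (2 * r)"
proof -
  assume r: "r \<ge> 0"
  have le: "(r\<^sup>2) ^ k / (fact k * fact (k + 0)) \<le> (2 * r) ^ (2 * k) / fact (2 * k)" for k
  proof -
    have "(fact (2 * k))\<^sup>2 * 1 \<le> (fact (2 * k))\<^sup>2 * (2 * real k + 1)" by (intro mult_left_mono) auto
    then have "((fact (2 * k))::real)\<^sup>2 \<le> (4 ^ k * (fact k)\<^sup>2)\<^sup>2" using central_binomial_le[of k] by linarith
    then have "(fact (2 * k) :: real) \<le> 4 ^ k * (fact k)\<^sup>2" by (rule power2_le_imp_le) simp
    then have "(r\<^sup>2) ^ k * fact (2 * k) \<le> (r\<^sup>2) ^ k * (4 ^ k * (fact k)\<^sup>2)" by (intro mult_left_mono) auto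
    also have "\<dots> = (2 * r) ^ (2 * k) * (fact k * fact (k + 0))"
      unfolding power_mult power_mult_distrib by (simp add: power2_eq_square)
    finally show ?thesis by (intro cross_le) simp_all
  qed
  have inj: "inj (\<lambda>k::nat. 2 * k)" by (auto simp: inj_on_def)
  have r2: "2 * r \<ge> 0" using r by simp
  have "bE 0 (r\<^sup>2) \<le> (\<Sum>k. (2 * r) ^ (2 * k) / fact (2 * k))"
    unfolding bE_def by (rule suminf_le[OF le bE_summable exp_subseries_le(1)[OF r2 inj]])
  also have "\<dots> \<le> exp (2 * r)" by (rule exp_subseries_le(2)[OF r2 inj])
  finally show ?thesis .
qed

text \<open>
  The factor \<open>1 / sqrt (2 k + 1)\<close> comes from the central binomial coefficient. By the inequality of means
  with weight \<open>l = sqrt (2 r)\<close> it is at most \<open>(l / (2 k + 1) + 1 / l) / 2\<close>, and the two summands produce the odd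
  and the even part of the series of \<open>exp (2 r)\<close>.
\<close>

lemma bE_0_decay:
  assumes r: "r > 0"
  shows "bE 0 (r\<^sup>2) \<le> exp (2 * r) / sqrt (2 * r)"
proof -
  define l where "l = sqrt (2 * r)"
  have l: "l > 0" "l\<^sup>2 = 2 * r" using r by (auto simp: l_def)
  have inj: "inj (\<lambda>k::nat. 2 * k)" "inj (\<lambda>k::nat. 2 * k + 1)" by (auto simp: inj_on_def)
  have r2: "2 * r \<ge> 0" using r by simp
  have le: "(r\<^sup>2) ^ k / (fact k * fact (k + 0))
      \<le> 1 / (2 * l) * ((2 * r) ^ (2 * k + 1) / fact (2 * k + 1)) + 1 / (2 * l) * ((2 * r) ^ (2 * k) / fact (2 * k))" for k
  proof -
    define m where "m = 2 * real k + 1"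
    have m: "m > 0" by (simp add: m_def)
    have am: "1 / sqrt m \<le> (l / m + 1 / l) / 2"
    proof -
      have "0 \<le> (l - sqrt m)\<^sup>2" by simp
      then have "2 * (l * sqrt m) \<le> l\<^sup>2 + m" using m by (simp add: power2_diff)
      then have "2 * (l * sqrt m) / (2 * (l * m)) \<le> (l\<^sup>2 + m) / (2 * (l * m))" using l m by (intro divide_right_mono) auto
      moreover have "2 * (l * sqrt m) / (2 * (l * m)) = 1 / sqrt m"
        using l m by (simp add: divide_simps)
      moreover have "(l\<^sup>2 + m) / (2 * (l * m)) = (l / m + 1 / l) / 2" using l m by (simp add: field_simps power2_eq_square)
      ultimately show ?thesis by simp
    qed
    have "(fact (2 * k) * sqrt m)\<^sup>2 \<le> (4 ^ k * (fact k)\<^sup>2)\<^sup>2"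
      using central_binomial_le[of k] m by (simp add: power_mult_distrib m_def)
    then have f: "fact (2 * k) * sqrt m \<le> 4 ^ k * (fact k)\<^sup>2" by (rule power2_le_imp_le) simp
    have "r ^ (2 * k) * (fact (2 * k) * sqrt m) \<le> r ^ (2 * k) * (4 ^ k * (fact k)\<^sup>2)"
      using f r by (intro mult_left_mono) auto
    also have "\<dots> = (2 * r) ^ (2 * k) * (fact k)\<^sup>2"
    proof -
      have "(2 * r) ^ (2 * k) = r ^ (2 * k) * 4 ^ k" by (simp add: power_mult power_mult_distrib)
      then show ?thesis by (simp only: mult.assoc)
    qed
    finally have "(r\<^sup>2) ^ k / (fact k)\<^sup>2 \<le> ((2 * r) ^ (2 * k) / fact (2 * k)) * (1 / sqrt m)"
      using m by (simp add: divide_simps power_mult[symmetric] mult_ac)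
    also have "\<dots> \<le> ((2 * r) ^ (2 * k) / fact (2 * k)) * ((l / m + 1 / l) / 2)"
      using am r by (intro mult_left_mono) auto
    also have "\<dots> = l / (2 * (2 * r)) * ((2 * r) ^ (2 * k + 1) / (m * fact (2 * k))) + 1 / (2 * l) * ((2 * r) ^ (2 * k) / fact (2 * k))"
      using r l m by (simp add: field_simps)
    also have "m * fact (2 * k) = fact (2 * k + 1)" by (simp add: m_def algebra_simps)
    also have "l / (2 * (2 * r)) = 1 / (2 * l)" using l r by (simp add: divide_simps power2_eq_square)
    finally show ?thesis by (simp add: power2_eq_square)
  qed
  have s: "summable (\<lambda>k. 1 / (2 * l) * ((2 * r) ^ (2 * k + 1) / fact (2 * k + 1)))"
    "summable (\<lambda>k. 1 / (2 * l) * ((2 * r) ^ (2 * k) / fact (2 * k)))"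
    by (intro summable_mult exp_subseries_le(1)[OF r2 inj(2)] exp_subseries_le(1)[OF r2 inj(1)])+
  have "bE 0 (r\<^sup>2) \<le> (\<Sum>k. 1 / (2 * l) * ((2 * r) ^ (2 * k + 1) / fact (2 * k + 1)) + 1 / (2 * l) * ((2 * r) ^ (2 * k) / fact (2 * k)))"
    unfolding bE_def by (rule suminf_le[OF le bE_summable summable_add[OF s]])
  also have "\<dots> = 1 / (2 * l) * (\<Sum>k. (2 * r) ^ (2 * k + 1) / fact (2 * k + 1)) + 1 / (2 * l) * (\<Sum>k. (2 * r) ^ (2 * k) / fact (2 * k))"
    unfolding suminf_add[OF s, symmetric]
    by (simp only: suminf_mult[OF exp_subseries_le(1)[OF r2 inj(2)]] suminf_mult[OF exp_subseries_le(1)[OF r2 inj(1)]])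
  also have "\<dots> \<le> 1 / (2 * l) * exp (2 * r) + 1 / (2 * l) * exp (2 * r)"
    using exp_subseries_le(2)[OF r2 inj(1)] exp_subseries_le(2)[OF r2 inj(2)] l
    by (intro add_mono mult_left_mono) auto
  also have "\<dots> = exp (2 * r) / l" using l by (simp add: field_simps)
  finally show ?thesis by (simp add: l_def)
qed

text \<open>
  The damped kernel decays like \<open>t^(- 1 / 2)\<close>, as the heat kernel does: the exponential growth of \<open>I\<^sub>0\<close> is exactly
  compensated by the damping.
\<close>

lemma damped_kernel_decay:
  assumes t: "t \<ge> 0"
  shows "exp (- t / 2) * bE 0 (t\<^sup>2 / 16) \<le> 2 / sqrt (1 + t)"
proof -
  have e: "bE 0 (t\<^sup>2 / 16) = bE 0 ((t / 4)\<^sup>2)" by (simp add: power_divide)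
  show ?thesis
  proof (cases "t \<le> 1")
    case True
    have "exp (- t / 2) * bE 0 (t\<^sup>2 / 16) \<le> exp (- t / 2) * exp (t / 2)"
      unfolding e using bE_0_le_exp[of "t / 4"] t by (intro mult_left_mono) auto
    also have "\<dots> = 1" by (simp add: exp_minus)
    also have "1 \<le> 2 / sqrt (1 + t)"
    proof -
      have "sqrt (1 + t) \<le> sqrt 4" using True by (intro real_sqrt_le_mono) auto
      then show ?thesis using t by (simp add: pos_le_divide_eq)
    qed
    finally show ?thesis .
  next
    case False
    have "exp (- t / 2) * bE 0 (t\<^sup>2 / 16) \<le> exp (- t / 2) * (exp (t / 2) / sqrt (t / 2))"
      unfolding e using bE_0_decay[of "t / 4"] False by (intro mult_left_mono) auto
    also have "\<dots> = 1 / sqrt (t / 2)" by (simp add: exp_minus)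
    also have "\<dots> \<le> 1 / sqrt ((1 + t) / 4)" using False by (intro divide_left_mono real_sqrt_le_mono) auto
    also have "\<dots> = 2 / sqrt (1 + t)" by (simp add: real_sqrt_divide)
    finally show ?thesis .
  qed
qed

lemma bE_1_le_bE_0:
  assumes t: "t \<ge> 0"
  shows "t / 16 * bE 1 (t\<^sup>2 / 16) \<le> bE 0 (t\<^sup>2 / 16)"
proof -
  define r where "r = t / 4"
  have r: "r \<ge> 0" "t = 4 * r" "t\<^sup>2 / 16 = r\<^sup>2" using t by (auto simp: r_def power_divide)
  let ?a = "\<lambda>k. (r\<^sup>2) ^ k / (fact k * fact (k + 0))"
  have le: "r / 4 * ((r\<^sup>2) ^ k / (fact k * fact (k + 1))) \<le> 1 / 8 * ?a k + 1 / 8 * ?a (k + 1)" for k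
  proof -
    define x y where "x = r ^ k / fact k" and "y = r ^ (k + 1) / fact (k + 1)"
    have "2 * (x * y) \<le> x\<^sup>2 + y\<^sup>2" using sum_squares_bound[of x y] by simp
    then have le: "x * y / 4 \<le> 1 / 8 * x\<^sup>2 + 1 / 8 * y\<^sup>2" by simp
    have "r * ((r\<^sup>2) ^ k / (fact k * fact (k + 1))) = x * y"
      unfolding x_def y_def by (simp add: power_mult[symmetric] mult_2 power_add)
    then have xy: "r / 4 * ((r\<^sup>2) ^ k / (fact k * fact (k + 1))) = x * y / 4" by (simp only: times_divide_eq_left)
    have a: "?a k = x\<^sup>2" "?a (k + 1) = y\<^sup>2"
      unfolding x_def y_def by (simp_all only: power_divide power_mult[symmetric] add_0_right power2_eq_square[of "fact _"] mult.commute[of 2])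
    show ?thesis unfolding xy a by (rule le)
  qed
  have s: "summable ?a" "summable (\<lambda>k. ?a (k + 1))"
    using bE_summable[of "r\<^sup>2" 0] summable_ignore_initial_segment[OF bE_summable[of "r\<^sup>2" 0], of 1] by auto
  have "(\<Sum>k. ?a (k + 1)) = bE 0 (r\<^sup>2) - 1"
    using suminf_split_initial_segment[OF s(1), of 1] by (simp add: bE_def)
  have "t / 16 * bE 1 (t\<^sup>2 / 16) = r / 4 * bE 1 (r\<^sup>2)" using r by simp
  also have "\<dots> = (\<Sum>k. r / 4 * ((r\<^sup>2) ^ k / (fact k * fact (k + 1))))"
    unfolding bE_def by (rule suminf_mult[symmetric, OF bE_summable])
  also have "\<dots> \<le> (\<Sum>k. 1 / 8 * ?a k + 1 / 8 * ?a (k + 1))"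
    by (rule suminf_le[OF le summable_mult[OF bE_summable] summable_add[OF summable_mult[OF s(1)] summable_mult[OF s(2)]]])
  also have "\<dots> = 1 / 8 * bE 0 (r\<^sup>2) + 1 / 8 * (\<Sum>k. ?a (k + 1))"
    unfolding suminf_add[OF summable_mult[OF s(1)] summable_mult[OF s(2)], symmetric]
      suminf_mult[OF s(1)] suminf_mult[OF s(2)] by (simp add: bE_def)
  also have "\<dots> = 1 / 8 * bE 0 (r\<^sup>2) + 1 / 8 * (bE 0 (r\<^sup>2) - 1)"
    using \<open>(\<Sum>k. ?a (k + 1)) = bE 0 (r\<^sup>2) - 1\<close> by simp
  also have "\<dots> \<le> bE 0 (r\<^sup>2)" using bE_nonneg[of "r\<^sup>2" 0] by (auto simp: field_simps)
  finally show ?thesis using r by simp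
qed

subsection \<open>Integrals of the kernels\<close>

lemma beta_integral:
  fixes \<tau> :: real
  assumes \<tau>: "\<tau> \<ge> 0"
  shows "(LINT z|lborel. indicator {-\<tau>..\<tau>} z * (\<tau>\<^sup>2 - z\<^sup>2) ^ k) = \<tau> ^ (2 * k + 1) * 2 ^ (2 * k + 1) * (fact k)\<^sup>2 / fact (2 * k + 1)"
proof (induction k)
  case 0
  show ?case using \<tau> by simp
next
  case (Suc k)
  let ?I = "\<lambda>k. (LINT z|lborel. indicator {-\<tau>..\<tau>} z * (\<tau>\<^sup>2 - z\<^sup>2) ^ k)"
  have int: "integrable lborel (\<lambda>z. indicator {-\<tau>..\<tau>} z * (\<tau>\<^sup>2 - z\<^sup>2) ^ k)" for k
  proof -
    have "set_integrable lborel {-\<tau>..\<tau>} (\<lambda>z. (\<tau>\<^sup>2 - z\<^sup>2) ^ k)"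
      by (intro borel_integrable_atLeastAtMost' continuous_intros)
    then show ?thesis by (simp add: set_integrable_def)
  qed
  have hb: "has_bochner_integral lborel (\<lambda>z. ((2 * real k + 3) * (\<tau>\<^sup>2 - z\<^sup>2) ^ Suc k - 2 * (real k + 1) * \<tau>\<^sup>2 * (\<tau>\<^sup>2 - z\<^sup>2) ^ k) * indicator {-\<tau>..\<tau>} z)
     (\<tau> * (\<tau>\<^sup>2 - \<tau>\<^sup>2) ^ Suc k - (- \<tau>) * (\<tau>\<^sup>2 - (- \<tau>)\<^sup>2) ^ Suc k)"
  proof (rule has_bochner_integral_FTC_Icc_real)
    fix z :: real
    show "((\<lambda>z. z * (\<tau>\<^sup>2 - z\<^sup>2) ^ Suc k) has_real_derivative
      ((2 * real k + 3) * (\<tau>\<^sup>2 - z\<^sup>2) ^ Suc k - 2 * (real k + 1) * \<tau>\<^sup>2 * (\<tau>\<^sup>2 - z\<^sup>2) ^ k)) (at z)"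
      by (rule derivative_eq_intros refl | simp)+ (simp add: algebra_simps power2_eq_square)
    show "isCont (\<lambda>z. (2 * real k + 3) * (\<tau>\<^sup>2 - z\<^sup>2) ^ Suc k - 2 * (real k + 1) * \<tau>\<^sup>2 * (\<tau>\<^sup>2 - z\<^sup>2) ^ k) z"
      by (intro continuous_intros)
  qed (use \<tau> in auto)
  have "0 = (LINT z|lborel. ((2 * real k + 3) * (\<tau>\<^sup>2 - z\<^sup>2) ^ Suc k - 2 * (real k + 1) * \<tau>\<^sup>2 * (\<tau>\<^sup>2 - z\<^sup>2) ^ k) * indicator {-\<tau>..\<tau>} z)"
    using has_bochner_integral_integral_eq[OF hb] by simp
  also have "\<dots> = (LINT z|lborel. (2 * real k + 3) * (indicator {-\<tau>..\<tau>} z * (\<tau>\<^sup>2 - z\<^sup>2) ^ Suc k)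
      - (2 * (real k + 1) * \<tau>\<^sup>2) * (indicator {-\<tau>..\<tau>} z * (\<tau>\<^sup>2 - z\<^sup>2) ^ k))"
    by (intro Bochner_Integration.integral_cong) (auto simp: algebra_simps)
  also have "\<dots> = (2 * real k + 3) * ?I (Suc k) - (2 * (real k + 1) * \<tau>\<^sup>2) * ?I k"
    using int[of k] int[of "Suc k"] by (subst Bochner_Integration.integral_diff) auto
  finally have "?I (Suc k) = (2 * (real k + 1) * \<tau>\<^sup>2) / (2 * real k + 3) * ?I k"
    by (simp add: field_simps)
  also have "\<dots> = \<tau> ^ (2 * Suc k + 1) * 2 ^ (2 * Suc k + 1) * (fact (Suc k))\<^sup>2 / fact (2 * Suc k + 1)"
  proof -
    define F :: real where "F = fact (2 * k + 1)"
    have F: "F > 0" by (simp add: F_def)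
    have "(fact (2 * Suc k + 1) :: real) = (2 * real k + 3) * (2 * (real k + 1)) * F"
      by (simp add: F_def algebra_simps)
    define f K M u w where "f = (fact k :: real)" and "K = real k + 1" and "M = 2 * real k + 3"
      and "u = \<tau> ^ (2 * k + 1)" and "w = (2::real) ^ (2 * k + 1)"
    have pos: "M > 0" "K > 0" by (simp_all add: M_def K_def)
    have e: "(fact (Suc k) :: real) = K * f" "\<tau> ^ (2 * Suc k + 1) = u * \<tau>\<^sup>2" "(2::real) ^ (2 * Suc k + 1) = w * 4"
      "(fact (2 * Suc k + 1) :: real) = M * (2 * K) * F"
      using \<open>(fact (2 * Suc k + 1) :: real) = (2 * real k + 3) * (2 * (real k + 1)) * F\<close>
      by (simp_all add: f_def K_def M_def u_def w_def power2_eq_square)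
    have "(2 * K * \<tau>\<^sup>2) / M * (u * w * f\<^sup>2 / F) = u * \<tau>\<^sup>2 * (w * 4) * (K * f)\<^sup>2 / (M * (2 * K) * F)"
      using F pos by (simp add: field_simps power2_eq_square)
    then show ?thesis
      unfolding Suc e by (simp only: F_def f_def K_def M_def u_def w_def)
  qed
  finally show ?case .
qed

text \<open>
  By the beta integral every term of the integrated series is a multiple of a term of \<open>exp (\<tau> / 2)\<close>, so the
  total mass of the kernel grows no faster than \<open>exp (\<tau> / 2)\<close> and is bounded after damping.
\<close>

lemma bE_mass:
  assumes \<tau>: "\<tau> \<ge> 0" and h: "inj h" and B: "B \<ge> 0"
    and le: "\<And>k. C * (\<tau> ^ (2 * k + 1) * 2 ^ (2 * k + 1) * (fact k)\<^sup>2 / fact (2 * k + 1) / (16 ^ k * (fact k * fact (k + n))))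
       \<le> B * ((\<tau> / 2) ^ h k / fact (h k))" and C: "C \<ge> 0"
  shows "C * (LINT z|lborel. indicator {-\<tau>..\<tau>} z * bE n ((\<tau>\<^sup>2 - z\<^sup>2) / 16)) \<le> B * exp (\<tau> / 2)"
proof -
  let ?f = "\<lambda>k z. C * (1 / (16 ^ k * (fact k * fact (k + n)))) * (indicator {-\<tau>..\<tau>} z * (\<tau>\<^sup>2 - z\<^sup>2) ^ k)"
  have t2: "\<tau> / 2 \<ge> 0" using \<tau> by simp
  have int: "integrable lborel (\<lambda>z. indicator {-\<tau>..\<tau>} z * (\<tau>\<^sup>2 - z\<^sup>2) ^ k)" for k
  proof -
    have "set_integrable lborel {-\<tau>..\<tau>} (\<lambda>z. (\<tau>\<^sup>2 - z\<^sup>2) ^ k)"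
      by (intro borel_integrable_atLeastAtMost' continuous_intros)
    then show ?thesis by (simp add: set_integrable_def)
  qed
  have i: "integrable lborel (?f k)" for k using int by simp
  have nn: "?f k z \<ge> 0" for k z
  proof (cases "z \<in> {-\<tau>..\<tau>}")
    case True
    then have "z\<^sup>2 \<le> \<tau>\<^sup>2" using \<tau> by (auto simp: abs_le_square_iff[symmetric] abs_le_iff)
    then show ?thesis using C by auto
  qed auto
  have If: "(LINT z|lborel. ?f k z) = C * (\<tau> ^ (2 * k + 1) * 2 ^ (2 * k + 1) * (fact k)\<^sup>2 / fact (2 * k + 1) / (16 ^ k * (fact k * fact (k + n))))" for k
    using beta_integral[OF \<tau>, of k] by simp
  have sm: "summable (\<lambda>k. LINT z|lborel. ?f k z)"
  proof (rule summable_comparison_test[OF _ summable_mult[OF exp_subseries_le(1)[OF t2 h], of B]])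
    have "norm (LINT z|lborel. ?f k z) \<le> B * ((\<tau> / 2) ^ h k / fact (h k))" for k
    proof -
      have "0 \<le> (LINT z|lborel. ?f k z)" using nn by (intro integral_nonneg_AE) auto
      then have "norm (LINT z|lborel. ?f k z) = (LINT z|lborel. ?f k z)" by (simp only: real_norm_def abs_of_nonneg)
      then show ?thesis using le[of k] by (simp only: If)
    qed
    then show "\<exists>N. \<forall>k\<ge>N. norm (LINT z|lborel. ?f k z) \<le> B * ((\<tau> / 2) ^ h k / fact (h k))" by blast
  qed
  have ser: "(\<lambda>k. ?f k z) sums (C * (indicator {-\<tau>..\<tau>} z * bE n ((\<tau>\<^sup>2 - z\<^sup>2) / 16)))" for z
  proof -
    have "(\<lambda>k. C * indicator {-\<tau>..\<tau>} z * (((\<tau>\<^sup>2 - z\<^sup>2) / 16) ^ k / (fact k * fact (k + n)))) sums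
       (C * indicator {-\<tau>..\<tau>} z * bE n ((\<tau>\<^sup>2 - z\<^sup>2) / 16))"
      unfolding bE_def by (rule sums_mult[OF summable_sums[OF bE_summable]])
    then show ?thesis by (simp add: power_divide mult_ac)
  qed
  have "C * (LINT z|lborel. indicator {-\<tau>..\<tau>} z * bE n ((\<tau>\<^sup>2 - z\<^sup>2) / 16))
     = (LINT z|lborel. C * (indicator {-\<tau>..\<tau>} z * bE n ((\<tau>\<^sup>2 - z\<^sup>2) / 16)))" by simp
  also have "\<dots> = (LINT z|lborel. (\<Sum>k. ?f k z))" using sums_unique[OF ser] by simp
  also have "\<dots> = (\<Sum>k. LINT z|lborel. ?f k z)"
  proof (rule integral_suminf[OF i])
    show "AE z in lborel. summable (\<lambda>k. norm (?f k z))"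
      using nn sums_summable[OF ser] by (intro AE_I2) (simp only: real_norm_def abs_of_nonneg)
    show "summable (\<lambda>k. LINT z|lborel. norm (?f k z))"
      using nn sm by (simp only: real_norm_def abs_of_nonneg)
  qed
  also have "\<dots> \<le> (\<Sum>k. B * ((\<tau> / 2) ^ h k / fact (h k)))"
    by (rule suminf_le[OF _ sm summable_mult[OF exp_subseries_le(1)[OF t2 h]]]) (use le If in simp)
  also have "\<dots> = B * (\<Sum>k. (\<tau> / 2) ^ h k / fact (h k))" by (rule suminf_mult[OF exp_subseries_le(1)[OF t2 h]])
  also have "\<dots> \<le> B * exp (\<tau> / 2)" using exp_subseries_le(2)[OF t2 h] B by (intro mult_left_mono)
  finally show ?thesis .
qed

lemma bE_0_mass:
  assumes \<tau>: "\<tau> \<ge> 0"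
  shows "(LINT z|lborel. indicator {-\<tau>..\<tau>} z * bE 0 ((\<tau>\<^sup>2 - z\<^sup>2) / 16)) \<le> 4 * exp (\<tau> / 2)"
proof -
  have "1 * (LINT z|lborel. indicator {-\<tau>..\<tau>} z * bE 0 ((\<tau>\<^sup>2 - z\<^sup>2) / 16)) \<le> 4 * exp (\<tau> / 2)"
  proof (rule bE_mass[OF \<tau>, of "\<lambda>k. 2 * k + 1"])
    fix k :: nat
    have p: "(16::real) ^ k = 4 ^ k * 4 ^ k" "(2::real) ^ (2 * k) = 4 ^ k"
      by (simp_all add: power_mult power_mult_distrib[symmetric])
    define F :: real where "F = fact (2 * k + 1)"
    have F: "F > 0" by (simp only: F_def fact_gt_zero)
    have "1 * (\<tau> ^ (2 * k + 1) * 2 ^ (2 * k + 1) * (fact k)\<^sup>2 / F / (16 ^ k * (fact k * fact (k + 0))))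
       = 4 * ((\<tau> / 2) ^ (2 * k + 1) / F)"
      using F p by (simp add: power_divide power2_eq_square field_simps)
    then show "1 * (\<tau> ^ (2 * k + 1) * 2 ^ (2 * k + 1) * (fact k)\<^sup>2 / fact (2 * k + 1) / (16 ^ k * (fact k * fact (k + 0))))
       \<le> 4 * ((\<tau> / 2) ^ (2 * k + 1) / fact (2 * k + 1))"
      by (simp only: F_def)
  qed (auto simp: inj_on_def)
  then show ?thesis by simp
qed

lemma bE_1_mass:
  assumes \<tau>: "\<tau> \<ge> 0"
  shows "\<tau> / 16 * (LINT z|lborel. indicator {-\<tau>..\<tau>} z * bE 1 ((\<tau>\<^sup>2 - z\<^sup>2) / 16)) \<le> 1 * exp (\<tau> / 2)"
proof (rule bE_mass[OF \<tau>, of "\<lambda>k. 2 * k + 2"])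
  fix k :: nat
  have p: "(16::real) ^ k = 4 ^ k * 4 ^ k" "(2::real) ^ (2 * k) = 4 ^ k"
    by (simp_all add: power_mult power_mult_distrib[symmetric])
  define F :: real where "F = fact (2 * k + 1)"
  have F: "F > 0" "fact (2 * k + 2) = 2 * (real k + 1) * F"
    by (simp only: F_def fact_gt_zero) (simp add: F_def algebra_simps)
  define f K q u where "f = (fact k :: real)" and "K = real k + 1" and "q = (4::real) ^ k" and "u = \<tau> ^ (2 * k)"
  have pos: "f > 0" "K > 0" "q > 0" by (simp_all add: f_def K_def q_def)
  have e: "(fact (k + 1) :: real) = K * f" "\<tau> ^ (2 * k + 1) = u * \<tau>" "(2::real) ^ (2 * k + 1) = q * 2" "(16::real) ^ k = q * q"
    "(\<tau> / 2) ^ (2 * k + 2) = u * \<tau>\<^sup>2 / (q * 4)" "fact (2 * k + 2) = 2 * K * F"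
    using p F(2) by (simp_all add: f_def K_def q_def u_def power_divide power_add power2_eq_square mult_ac)
  have "\<tau> / 16 * (u * \<tau> * (q * 2) * f\<^sup>2 / F / (q * q * (f * (K * f)))) = 1 * (u * \<tau>\<^sup>2 / (q * 4) / (2 * K * F))"
    using pos F(1) by (simp add: field_simps power2_eq_square)
  then have "\<tau> / 16 * (\<tau> ^ (2 * k + 1) * 2 ^ (2 * k + 1) * (fact k)\<^sup>2 / F / (16 ^ k * (fact k * fact (k + 1))))
       = 1 * ((\<tau> / 2) ^ (2 * k + 2) / fact (2 * k + 2))"
    unfolding e f_def[symmetric] .
  then show "\<tau> / 16 * (\<tau> ^ (2 * k + 1) * 2 ^ (2 * k + 1) * (fact k)\<^sup>2 / fact (2 * k + 1) / (16 ^ k * (fact k * fact (k + 1))))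
       \<le> 1 * ((\<tau> / 2) ^ (2 * k + 2) / fact (2 * k + 2))" by (simp only: F_def)
qed (use \<tau> in \<open>auto simp: inj_on_def\<close>)

section \<open>Regularity of integrals depending on parameters\<close>

lemma tendsto_isCont_pair:
  "isCont (\<lambda>(t, x). f t x) (t, x) \<Longrightarrow> ((\<lambda>z. f (fst z) (snd z)) \<longlongrightarrow> f t x) (at (t, x))"
  unfolding isCont_def by (simp add: case_prod_beta')

text \<open>
  Differentiation under the integral sign in \<open>L\<^sup>2\<close>. The integrand is only Lipschitz, with derivatives
  outside a null set that may depend on the point: for wave kernels this null set is the boundary of
  the light cone.
\<close>

lemma parametric_triple:
  fixes \<Phi> \<Phi>x \<Phi>t :: "'m \<Rightarrow> real \<Rightarrow> real \<Rightarrow> real"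
  assumes L: "integrable M L"
    and meas: "\<And>t x. (\<lambda>m. \<Phi> m t x) \<in> borel_measurable M" "\<And>t x. (\<lambda>m. \<Phi>x m t x) \<in> borel_measurable M"
      "\<And>t x. (\<lambda>m. \<Phi>t m t x) \<in> borel_measurable M"
    and bound: "\<And>m t x. \<bar>t\<bar> \<le> T \<Longrightarrow> \<bar>\<Phi> m t x\<bar> \<le> L m" "\<And>m t x. \<bar>t\<bar> \<le> T \<Longrightarrow> \<bar>\<Phi>x m t x\<bar> \<le> L m"
      "\<And>m t x. \<bar>t\<bar> \<le> T \<Longrightarrow> \<bar>\<Phi>t m t x\<bar> \<le> L m"
    and lip: "\<And>m t t' x. \<bar>t\<bar> \<le> T \<Longrightarrow> \<bar>t'\<bar> \<le> T \<Longrightarrow> \<bar>\<Phi> m t x - \<Phi> m t' x\<bar> \<le> L m * \<bar>t - t'\<bar>"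
      "\<And>m t x x'. \<bar>t\<bar> \<le> T \<Longrightarrow> \<bar>\<Phi> m t x - \<Phi> m t x'\<bar> \<le> L m * \<bar>x - x'\<bar>"
    and ae: "\<And>t x. \<bar>t\<bar> < T \<Longrightarrow> AE m in M. ((\<lambda>x. \<Phi> m t x) has_real_derivative \<Phi>x m t x) (at x) \<and>
        ((\<lambda>t. \<Phi> m t x) has_real_derivative \<Phi>t m t x) (at t) \<and>
        isCont (\<lambda>(t, x). \<Phi>x m t x) (t, x) \<and> isCont (\<lambda>(t, x). \<Phi>t m t x) (t, x)"
    and supp: "\<And>m t x. 0 \<le> t \<Longrightarrow> t < T \<Longrightarrow> \<bar>x\<bar> > K \<Longrightarrow> \<Phi> m t x = 0 \<and> \<Phi>x m t x = 0 \<and> \<Phi>t m t x = 0"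
  shows "energy_triple {0..<T} (\<lambda>t x. LINT m|M. \<Phi> m t x) (\<lambda>t x. LINT m|M. \<Phi>x m t x) (\<lambda>t x. LINT m|M. \<Phi>t m t x)
    \<and> continuous_on ({-T..T} \<times> UNIV) (\<lambda>(t, x). LINT m|M. \<Phi> m t x)"
proof
  have i\<Phi>: "integrable M (\<lambda>m. \<Phi> m t x)" if "\<bar>t\<bar> \<le> T" for t x
    by (rule Bochner_Integration.integrable_bound[OF L meas(1)]) (use bound(1)[OF that] in \<open>auto intro!: AE_I2 order_trans[OF _ abs_ge_self]\<close>)
  have diff: "(LINT m|M. \<Phi> m t x) - (LINT m|M. \<Phi> m t' x') = (LINT m|M. \<Phi> m t x - \<Phi> m t' x')" if "\<bar>t\<bar> \<le> T" "\<bar>t'\<bar> \<le> T" for t t' x x'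
    by (rule Bochner_Integration.integral_diff[symmetric, OF i\<Phi>[OF that(1)] i\<Phi>[OF that(2)]])
  show "continuous_on ({-T..T} \<times> UNIV) (\<lambda>(t, x). LINT m|M. \<Phi> m t x)"
    unfolding continuous_on_def
  proof
    fix z assume "z \<in> {-T..T} \<times> (UNIV :: real set)"
    then obtain t x where z: "z = (t, x)" "\<bar>t\<bar> \<le> T" by auto
    define C where "C = (LINT m|M. L m)"
    have le: "\<bar>(LINT m|M. \<Phi> m t' x') - (LINT m|M. \<Phi> m t x)\<bar> \<le> C * \<bar>t' - t\<bar> + C * \<bar>x' - x\<bar>" if "\<bar>t'\<bar> \<le> T" for t' x'
    proof -
      have "\<bar>(LINT m|M. \<Phi> m t' x') - (LINT m|M. \<Phi> m t x)\<bar> \<le> (LINT m|M. \<bar>\<Phi> m t' x' - \<Phi> m t x\<bar>)"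
        unfolding diff[OF that z(2)] by (rule integral_abs_bound)
      also have "\<dots> \<le> (LINT m|M. L m * \<bar>t' - t\<bar> + L m * \<bar>x' - x\<bar>)"
      proof (rule integral_mono)
        show "integrable M (\<lambda>m. \<bar>\<Phi> m t' x' - \<Phi> m t x\<bar>)" using i\<Phi>[OF that] i\<Phi>[OF z(2)] by auto
        show "integrable M (\<lambda>m. L m * \<bar>t' - t\<bar> + L m * \<bar>x' - x\<bar>)" using L by auto
        show "\<bar>\<Phi> m t' x' - \<Phi> m t x\<bar> \<le> L m * \<bar>t' - t\<bar> + L m * \<bar>x' - x\<bar>" for m
          using lip(1)[OF that z(2), of m x'] lip(2)[OF z(2), of m x' x] by linarith
      qed
      also have "\<dots> = C * \<bar>t' - t\<bar> + C * \<bar>x' - x\<bar>" using L by (simp add: C_def)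
      finally show ?thesis .
    qed
    have "((\<lambda>(t, x). LINT m|M. \<Phi> m t x) \<longlongrightarrow> (LINT m|M. \<Phi> m t x)) (at (t, x) within {-T..T} \<times> UNIV)"
    proof (rule LIM_zero_cancel, rule Lim_null_comparison)
      show "eventually (\<lambda>z'. norm ((case z' of (t, x) \<Rightarrow> LINT m|M. \<Phi> m t x) - (LINT m|M. \<Phi> m t x))
         \<le> C * \<bar>fst z' - t\<bar> + C * \<bar>snd z' - x\<bar>) (at (t, x) within {-T..T} \<times> UNIV)"
        unfolding eventually_at_filter by (rule always_eventually) (use le in auto)
      have "((\<lambda>z'. C * \<bar>fst z' - t\<bar> + C * \<bar>snd z' - x\<bar>) \<longlongrightarrow> C * \<bar>fst (t, x) - t\<bar> + C * \<bar>snd (t, x) - x\<bar>) (at (t, x) within {-T..T} \<times> UNIV)"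
        by (intro tendsto_intros)
      then show "((\<lambda>z'. C * \<bar>fst z' - t\<bar> + C * \<bar>snd z' - x\<bar>) \<longlongrightarrow> 0) (at (t, x) within {-T..T} \<times> UNIV)" by simp
    qed
    then show "((\<lambda>(t, x). LINT m|M. \<Phi> m t x) \<longlongrightarrow> (case z of (t, x) \<Rightarrow> LINT m|M. \<Phi> m t x)) (at z within {-T..T} \<times> UNIV)"
      by (simp add: z)
  qed
  have near: "eventually (\<lambda>z. \<bar>fst z\<bar> \<le> T) (at (t, x))" if "\<bar>t\<bar> < T" for t x :: real
  proof -
    have "((\<lambda>z. \<bar>fst z\<bar>) \<longlongrightarrow> \<bar>fst (t, x)\<bar>) (at (t, x))" by (intro tendsto_intros)
    then have "eventually (\<lambda>z. \<bar>fst z\<bar> < T) (at (t, x))"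
      by (rule order_tendstoD(2)) (use that in simp)
    then show ?thesis by eventually_elim simp
  qed
  have near1: "eventually (\<lambda>s. \<bar>s\<bar> \<le> T) (at t)" if "\<bar>t\<bar> < T" for t :: real
  proof -
    have "eventually (\<lambda>s. \<bar>s\<bar> < T) (at t)"
      by (rule order_tendstoD(2)[of _ "\<bar>t\<bar>"]) (use that in \<open>auto intro!: tendsto_intros\<close>)
    then show ?thesis by eventually_elim simp
  qed
  have cont: "continuous_on ({0..<T} \<times> UNIV) (\<lambda>(t, x). LINT m|M. f m t x)"
    if f: "\<And>t x. (\<lambda>m. f m t x) \<in> borel_measurable M" "\<And>m t x. \<bar>t\<bar> \<le> T \<Longrightarrow> \<bar>f m t x\<bar> \<le> L m"
      "\<And>t x. \<bar>t\<bar> < T \<Longrightarrow> AE m in M. isCont (\<lambda>(t, x). f m t x) (t, x)" for f :: "'m \<Rightarrow> real \<Rightarrow> real \<Rightarrow> real"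
    unfolding continuous_on_def
  proof
    fix z assume "z \<in> {0..<T} \<times> (UNIV :: real set)"
    then obtain t x where z: "z = (t, x)" "\<bar>t\<bar> < T" by auto
    have "((\<lambda>z. LINT m|M. f m (fst z) (snd z)) \<longlongrightarrow> (LINT m|M. f m t x)) (at (t, x))"
    proof (rule dominated_convergence_at[OF f(1) L])
      show "eventually (\<lambda>z. (\<lambda>m. f m (fst z) (snd z)) \<in> borel_measurable M) (at (t, x))"
        using f(1) by simp
      show "eventually (\<lambda>z. AE m in M. \<bar>f m (fst z) (snd z)\<bar> \<le> L m) (at (t, x))"
        using near[OF z(2)] by eventually_elim (use f(2) in auto)
      show "AE m in M. ((\<lambda>z. f m (fst z) (snd z)) \<longlongrightarrow> f m t x) (at (t, x))"
        using f(3)[OF z(2), of x] by eventually_elim (rule tendsto_isCont_pair)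
    qed
    then have "((\<lambda>(t, x). LINT m|M. f m t x) \<longlongrightarrow> (LINT m|M. f m t x)) (at (t, x))"
      by (simp add: case_prod_beta')
    then show "((\<lambda>(t, x). LINT m|M. f m t x) \<longlongrightarrow> (case z of (t, x) \<Rightarrow> LINT m|M. f m t x)) (at z within {0..<T} \<times> UNIV)"
      unfolding z(1) by (auto intro: tendsto_within_subset)
  qed
  show "energy_triple {0..<T} (\<lambda>t x. LINT m|M. \<Phi> m t x) (\<lambda>t x. LINT m|M. \<Phi>x m t x) (\<lambda>t x. LINT m|M. \<Phi>t m t x)"
  proof (rule classical_triple)
    show "continuous_on ({0..<T} \<times> UNIV) (\<lambda>(t, x). LINT m|M. \<Phi>x m t x)"
    proof (rule cont[OF meas(2) bound(2)])
      show "AE m in M. isCont (\<lambda>(t, x). \<Phi>x m t x) (t, x)" if "\<bar>t\<bar> < T" for t x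
        using ae[OF that, of x] by eventually_elim blast
    qed
    show "continuous_on ({0..<T} \<times> UNIV) (\<lambda>(t, x). LINT m|M. \<Phi>t m t x)"
    proof (rule cont[OF meas(3) bound(3)])
      show "AE m in M. isCont (\<lambda>(t, x). \<Phi>t m t x) (t, x)" if "\<bar>t\<bar> < T" for t x
        using ae[OF that, of x] by eventually_elim blast
    qed
    fix t x :: real assume "t \<in> {0..<T}"
    then have t: "\<bar>t\<bar> < T" "0 \<le> t" "t < T" and t': "\<bar>t\<bar> \<le> T" by auto
    show "((\<lambda>x. LINT m|M. \<Phi> m t x) has_real_derivative (LINT m|M. \<Phi>x m t x)) (at x)"
      unfolding has_field_derivative_iff
    proof -
      have "((\<lambda>y. LINT m|M. (\<Phi> m t y - \<Phi> m t x) / (y - x)) \<longlongrightarrow> (LINT m|M. \<Phi>x m t x)) (at x)"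
      proof (rule dominated_convergence_at[OF meas(2) L])
        show "eventually (\<lambda>y. (\<lambda>m. (\<Phi> m t y - \<Phi> m t x) / (y - x)) \<in> borel_measurable M) (at x)"
          using meas(1) by simp
        show "eventually (\<lambda>y. AE m in M. \<bar>(\<Phi> m t y - \<Phi> m t x) / (y - x)\<bar> \<le> L m) (at x)"
          using eventually_at_neq by eventually_elim (use lip(2)[OF t'] in \<open>simp add: abs_divide pos_divide_le_eq\<close>)
        show "AE m in M. ((\<lambda>y. (\<Phi> m t y - \<Phi> m t x) / (y - x)) \<longlongrightarrow> \<Phi>x m t x) (at x)"
          using ae[OF t(1), of x] by eventually_elim (simp add: has_field_derivative_iff)
      qed
      then show "((\<lambda>y. ((LINT m|M. \<Phi> m t y) - (LINT m|M. \<Phi> m t x)) / (y - x)) \<longlongrightarrow> (LINT m|M. \<Phi>x m t x)) (at x)"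
        unfolding diff[OF t' t'] by simp
    qed
    have "((\<lambda>t. LINT m|M. \<Phi> m t x) has_real_derivative (LINT m|M. \<Phi>t m t x)) (at t)"
      unfolding has_field_derivative_iff
    proof -
      have "((\<lambda>s. LINT m|M. (\<Phi> m s x - \<Phi> m t x) / (s - t)) \<longlongrightarrow> (LINT m|M. \<Phi>t m t x)) (at t)"
      proof (rule dominated_convergence_at[OF meas(3) L])
        show "eventually (\<lambda>s. (\<lambda>m. (\<Phi> m s x - \<Phi> m t x) / (s - t)) \<in> borel_measurable M) (at t)"
          using meas(1) by simp
        show "eventually (\<lambda>s. AE m in M. \<bar>(\<Phi> m s x - \<Phi> m t x) / (s - t)\<bar> \<le> L m) (at t)"
          using eventually_at_neq near1[OF t(1)]
          by eventually_elim (use lip(1)[OF _ t'] in \<open>simp add: abs_divide pos_divide_le_eq\<close>)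
        show "AE m in M. ((\<lambda>s. (\<Phi> m s x - \<Phi> m t x) / (s - t)) \<longlongrightarrow> \<Phi>t m t x) (at t)"
          using ae[OF t(1), of x] by eventually_elim (simp add: has_field_derivative_iff)
      qed
      moreover have "eventually (\<lambda>s. (LINT m|M. (\<Phi> m s x - \<Phi> m t x) / (s - t)) = ((LINT m|M. \<Phi> m s x) - (LINT m|M. \<Phi> m t x)) / (s - t)) (at t)"
        using near1[OF t(1)] by eventually_elim (simp add: diff[OF _ t'])
      ultimately show "((\<lambda>s. ((LINT m|M. \<Phi> m s x) - (LINT m|M. \<Phi> m t x)) / (s - t)) \<longlongrightarrow> (LINT m|M. \<Phi>t m t x)) (at t)"
        by (rule Lim_transform_eventually)
    qed
    then show "((\<lambda>t. LINT m|M. \<Phi> m t x) has_real_derivative (LINT m|M. \<Phi>t m t x)) (at t within {0..<T})"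
      by (rule has_field_derivative_at_within)
    assume x: "\<bar>x\<bar> > K"
    show "(LINT m|M. \<Phi> m t x) = 0" "(LINT m|M. \<Phi>x m t x) = 0" "(LINT m|M. \<Phi>t m t x) = 0"
      using supp[OF t(2,3) x] by simp_all
  qed
qed

subsection \<open>The continuous part of the kernels\<close>

text \<open>
  The argument \<open>\<tau>\<^sup>2 - z\<^sup>2\<close> of the kernels, cut off at the cone \<open>|z| \<le> \<tau>\<close>. The inner cutoff makes it vanish for
  negative times, so that Duhamel integrals can run over all of time.
\<close>

definition sg :: "real \<Rightarrow> real \<Rightarrow> real" where
  "sg \<tau> z = max 0 ((max 0 \<tau>)\<^sup>2 - z\<^sup>2)"

text \<open>
  The kernel minus its jump across the cone: Lipschitz everywhere and \<open>0\<close> outside the cone. The jump has the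
  constant height \<open>bE n 0\<close> and is treated as d'Alembert's kernel.
\<close>

definition hk :: "nat \<Rightarrow> real \<Rightarrow> real \<Rightarrow> real" where
  "hk n \<tau> z = bE n (sg \<tau> z / 16) - bE n 0"

definition hkz :: "nat \<Rightarrow> real \<Rightarrow> real \<Rightarrow> real" where
  "hkz n \<tau> z = (if \<bar>z\<bar> < \<tau> then bE (Suc n) ((\<tau>\<^sup>2 - z\<^sup>2) / 16) * (- z / 8) else 0)"

definition hkt :: "nat \<Rightarrow> real \<Rightarrow> real \<Rightarrow> real" where
  "hkt n \<tau> z = (if \<bar>z\<bar> < \<tau> then bE (Suc n) ((\<tau>\<^sup>2 - z\<^sup>2) / 16) * (\<tau> / 8) else 0)"

lemma sg_eq: "\<bar>z\<bar> \<le> \<tau> \<Longrightarrow> sg \<tau> z = \<tau>\<^sup>2 - z\<^sup>2"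
proof -
  assume z: "\<bar>z\<bar> \<le> \<tau>"
  have "z\<^sup>2 \<le> \<tau>\<^sup>2" using power_mono[OF z, of 2] by simp
  moreover have "max 0 \<tau> = \<tau>" using z by simp
  ultimately show ?thesis by (simp add: sg_def)
qed

lemma sg_eq_0: "\<tau> \<le> \<bar>z\<bar> \<Longrightarrow> sg \<tau> z = 0"
proof -
  assume "\<tau> \<le> \<bar>z\<bar>"
  then have "(max 0 \<tau>)\<^sup>2 \<le> \<bar>z\<bar>\<^sup>2" by (intro power_mono) auto
  then show ?thesis by (simp add: sg_def)
qed

lemma sg_range:
  assumes "\<tau> \<le> \<Theta>" "0 \<le> \<Theta>"
  shows "0 \<le> sg \<tau> z" "sg \<tau> z \<le> \<Theta>\<^sup>2"
proof -
  have "(max 0 \<tau>)\<^sup>2 \<le> \<Theta>\<^sup>2" using assms by (intro power_mono) auto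
  then show "0 \<le> sg \<tau> z" "sg \<tau> z \<le> \<Theta>\<^sup>2"
    unfolding sg_def using zero_le_power2[of z] zero_le_power2[of \<Theta>] by linarith+
qed

lemma square_diff_le:
  fixes a b \<Theta> :: real
  assumes "0 \<le> a" "a \<le> \<Theta>" "0 \<le> b" "b \<le> \<Theta>"
  shows "\<bar>a\<^sup>2 - b\<^sup>2\<bar> \<le> 2 * \<Theta> * \<bar>a - b\<bar>"
proof -
  have "\<bar>a\<^sup>2 - b\<^sup>2\<bar> = (a + b) * \<bar>a - b\<bar>"
    using assms by (simp add: power2_eq_square square_diff_square_factored abs_mult)
  also have "\<dots> \<le> 2 * \<Theta> * \<bar>a - b\<bar>" using assms by (intro mult_right_mono) auto
  finally show ?thesis .
qed

lemma sg_lipschitz: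
  assumes "\<tau> \<le> \<Theta>" "\<tau>' \<le> \<Theta>" "0 \<le> \<Theta>"
  shows "\<bar>sg \<tau> z - sg \<tau>' z\<bar> \<le> 2 * \<Theta> * \<bar>\<tau> - \<tau>'\<bar>" "\<bar>sg \<tau> z - sg \<tau> z'\<bar> \<le> 2 * \<Theta> * \<bar>z - z'\<bar>"
proof -
  have "\<bar>sg \<tau> z - sg \<tau>' z\<bar> \<le> \<bar>(max 0 \<tau>)\<^sup>2 - (max 0 \<tau>')\<^sup>2\<bar>" unfolding sg_def by linarith
  also have "\<dots> \<le> 2 * \<Theta> * \<bar>max 0 \<tau> - max 0 \<tau>'\<bar>" using assms by (intro square_diff_le) auto
  also have "\<dots> \<le> 2 * \<Theta> * \<bar>\<tau> - \<tau>'\<bar>" using assms by (intro mult_left_mono) auto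
  finally show "\<bar>sg \<tau> z - sg \<tau>' z\<bar> \<le> 2 * \<Theta> * \<bar>\<tau> - \<tau>'\<bar>" .
  define m where "m y = min \<bar>y\<bar> (max 0 \<tau>)" for y
  have sm: "sg \<tau> y = (max 0 \<tau>)\<^sup>2 - (m y)\<^sup>2" for y
  proof (cases "\<bar>y\<bar> \<le> max 0 \<tau>")
    case True
    then have "\<bar>y\<bar>\<^sup>2 \<le> (max 0 \<tau>)\<^sup>2" by (intro power_mono) auto
    then show ?thesis using True by (simp add: sg_def m_def)
  next
    case False
    then have "(max 0 \<tau>)\<^sup>2 \<le> \<bar>y\<bar>\<^sup>2" by (intro power_mono) auto
    then show ?thesis using False by (simp add: sg_def m_def)
  qed
  have "\<bar>sg \<tau> z - sg \<tau> z'\<bar> = \<bar>(m z)\<^sup>2 - (m z')\<^sup>2\<bar>" unfolding sm by linarith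
  also have "\<dots> \<le> 2 * \<Theta> * \<bar>m z - m z'\<bar>" using assms by (intro square_diff_le) (auto simp: m_def)
  also have "\<dots> \<le> 2 * \<Theta> * \<bar>z - z'\<bar>"
  proof (intro mult_left_mono)
    show "\<bar>m z - m z'\<bar> \<le> \<bar>z - z'\<bar>" unfolding m_def by linarith
  qed (use assms in auto)
  finally show "\<bar>sg \<tau> z - sg \<tau> z'\<bar> \<le> 2 * \<Theta> * \<bar>z - z'\<bar>" .
qed

lemma bE_lipschitz:
  assumes "0 \<le> s" "s \<le> S" "0 \<le> s'" "s' \<le> S"
  shows "\<bar>bE n s - bE n s'\<bar> \<le> bE (Suc n) S * \<bar>s - s'\<bar>"
proof -
  have "norm (bE n s - bE n s') \<le> bE (Suc n) S * norm (s - s')"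
  proof (rule field_differentiable_bound[where S = "{0..S}"])
    show "(bE n has_field_derivative bE (Suc n) r) (at r within {0..S})" for r
      by (rule has_field_derivative_at_within[OF bE_deriv])
    show "norm (bE (Suc n) r) \<le> bE (Suc n) S" if "r \<in> {0..S}" for r
      using that bE_mono[of r S "Suc n"] bE_nonneg[of r "Suc n"] by auto
  qed (use assms in auto)
  then show ?thesis by simp
qed

lemma half_le_aux: "0 \<le> \<Theta> * d \<Longrightarrow> x \<le> 2 * \<Theta> * d \<Longrightarrow> x / 16 \<le> \<Theta> * (d::real)"
  by simp

definition hkC :: "nat \<Rightarrow> real \<Rightarrow> real" where
  "hkC n \<Theta> = bE (Suc n) (\<Theta>\<^sup>2 / 16) * (\<Theta>\<^sup>2 + \<Theta>)"

lemma hkC_nonneg: "0 \<le> \<Theta> \<Longrightarrow> 0 \<le> hkC n \<Theta>"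
  unfolding hkC_def by (intro mult_nonneg_nonneg bE_nonneg) auto

lemma hk_bounds:
  assumes \<tau>: "\<tau> \<le> \<Theta>" "\<tau>' \<le> \<Theta>" "0 \<le> \<Theta>"
  shows "\<bar>hk n \<tau> z\<bar> \<le> hkC n \<Theta>" "\<bar>hkz n \<tau> z\<bar> \<le> hkC n \<Theta>" "\<bar>hkt n \<tau> z\<bar> \<le> hkC n \<Theta>"
    "\<bar>hk n \<tau> z - hk n \<tau>' z\<bar> \<le> hkC n \<Theta> * \<bar>\<tau> - \<tau>'\<bar>" "\<bar>hk n \<tau> z - hk n \<tau> z'\<bar> \<le> hkC n \<Theta> * \<bar>z - z'\<bar>"
proof -
  define b where "b = bE (Suc n) (\<Theta>\<^sup>2 / 16)"
  have b: "b \<ge> 0" unfolding b_def by (rule bE_nonneg) simp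
  have lip: "\<bar>bE n (s / 16) - bE n (s' / 16)\<bar> \<le> b * (\<bar>s - s'\<bar> / 16)"
    if "0 \<le> s" "s \<le> \<Theta>\<^sup>2" "0 \<le> s'" "s' \<le> \<Theta>\<^sup>2" for s s'
    using bE_lipschitz[of "s / 16" "\<Theta>\<^sup>2 / 16" "s' / 16" n] that
    unfolding b_def diff_divide_distrib[symmetric] by (simp add: abs_divide)
  have C: "b * \<Theta>\<^sup>2 \<le> hkC n \<Theta>" "b * \<Theta> \<le> hkC n \<Theta>"
    using b \<tau>(3) unfolding hkC_def b_def[symmetric] by (auto simp: distrib_left)
  note r = sg_range[OF \<tau>(1,3)] sg_range[OF \<tau>(2,3)]
  have "\<bar>hk n \<tau> z\<bar> \<le> b * (\<bar>sg \<tau> z - 0\<bar> / 16)"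
    unfolding hk_def using lip[of "sg \<tau> z" 0] r by simp
  also have "\<dots> \<le> b * \<Theta>\<^sup>2" using r(1,2)[of z] b by (intro mult_left_mono) auto
  finally show "\<bar>hk n \<tau> z\<bar> \<le> hkC n \<Theta>" using C by linarith
  have bb: "\<bar>bE (Suc n) ((\<tau>\<^sup>2 - z\<^sup>2) / 16)\<bar> \<le> b" if "\<bar>z\<bar> < \<tau>"
  proof -
    have "sg \<tau> z = \<tau>\<^sup>2 - z\<^sup>2" using that by (intro sg_eq) auto
    then have "0 \<le> (\<tau>\<^sup>2 - z\<^sup>2) / 16" "(\<tau>\<^sup>2 - z\<^sup>2) / 16 \<le> \<Theta>\<^sup>2 / 16" using r(1,2)[of z] by auto
    then show ?thesis unfolding b_def using bE_mono bE_nonneg[of "(\<tau>\<^sup>2 - z\<^sup>2) / 16" "Suc n"] by simp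
  qed
  show "\<bar>hkz n \<tau> z\<bar> \<le> hkC n \<Theta>"
  proof (cases "\<bar>z\<bar> < \<tau>")
    case True
    have "\<bar>hkz n \<tau> z\<bar> = \<bar>bE (Suc n) ((\<tau>\<^sup>2 - z\<^sup>2) / 16)\<bar> * (\<bar>z\<bar> / 8)" using True by (simp add: hkz_def abs_mult)
    also have "\<dots> \<le> b * \<Theta>" using True \<tau> bb[OF True] b by (intro mult_mono) auto
    finally show ?thesis using C by linarith
  next
    case False
    then show ?thesis using hkC_nonneg[OF \<tau>(3)] by (auto simp: hkz_def)
  qed
  show "\<bar>hkt n \<tau> z\<bar> \<le> hkC n \<Theta>"
  proof (cases "\<bar>z\<bar> < \<tau>")
    case True
    have "\<bar>hkt n \<tau> z\<bar> = \<bar>bE (Suc n) ((\<tau>\<^sup>2 - z\<^sup>2) / 16)\<bar> * (\<bar>\<tau>\<bar> / 8)" using True by (simp add: hkt_def abs_mult)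
    also have "\<dots> \<le> b * \<Theta>" using True \<tau> bb[OF True] b by (intro mult_mono) auto
    finally show ?thesis using C by linarith
  next
    case False
    then show ?thesis using hkC_nonneg[OF \<tau>(3)] by (auto simp: hkt_def)
  qed
  have "\<bar>hk n \<tau> z - hk n \<tau>' z\<bar> \<le> b * (\<bar>sg \<tau> z - sg \<tau>' z\<bar> / 16)"
    unfolding hk_def using lip[of "sg \<tau> z" "sg \<tau>' z"] r by simp
  also have "\<dots> \<le> b * (\<Theta> * \<bar>\<tau> - \<tau>'\<bar>)"
  proof (intro mult_left_mono b)
    have "0 \<le> \<Theta> * \<bar>\<tau> - \<tau>'\<bar>" using \<tau> by simp
    then show "\<bar>sg \<tau> z - sg \<tau>' z\<bar> / 16 \<le> \<Theta> * \<bar>\<tau> - \<tau>'\<bar>" using sg_lipschitz(1)[OF \<tau>, of z] by (rule half_le_aux)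
  qed
  also have "\<dots> \<le> hkC n \<Theta> * \<bar>\<tau> - \<tau>'\<bar>" using C mult_right_mono[OF C(2), of "\<bar>\<tau> - \<tau>'\<bar>"] by (simp add: mult.assoc)
  finally show "\<bar>hk n \<tau> z - hk n \<tau>' z\<bar> \<le> hkC n \<Theta> * \<bar>\<tau> - \<tau>'\<bar>" .
  have "\<bar>hk n \<tau> z - hk n \<tau> z'\<bar> \<le> b * (\<bar>sg \<tau> z - sg \<tau> z'\<bar> / 16)"
    unfolding hk_def using lip[of "sg \<tau> z" "sg \<tau> z'"] r by simp
  also have "\<dots> \<le> b * (\<Theta> * \<bar>z - z'\<bar>)"
  proof (intro mult_left_mono b)
    have "0 \<le> \<Theta> * \<bar>z - z'\<bar>" using \<tau> by simp
    then show "\<bar>sg \<tau> z - sg \<tau> z'\<bar> / 16 \<le> \<Theta> * \<bar>z - z'\<bar>" using sg_lipschitz(2)[OF \<tau>, of z z'] by (rule half_le_aux)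
  qed
  also have "\<dots> \<le> hkC n \<Theta> * \<bar>z - z'\<bar>" using C mult_right_mono[OF C(2), of "\<bar>z - z'\<bar>"] by (simp add: mult.assoc)
  finally show "\<bar>hk n \<tau> z - hk n \<tau> z'\<bar> \<le> hkC n \<Theta> * \<bar>z - z'\<bar>" .
qed

lemma hk_outside: "\<tau> \<le> \<bar>z\<bar> \<Longrightarrow> hk n \<tau> z = 0 \<and> hkz n \<tau> z = 0 \<and> hkt n \<tau> z = 0"
  by (simp add: hk_def sg_eq_0 hkz_def hkt_def)

lemma hk_derivs:
  assumes ne: "\<bar>z\<bar> \<noteq> \<tau>"
  shows "((\<lambda>z. hk n \<tau> z) has_real_derivative hkz n \<tau> z) (at z)"
    "((\<lambda>\<tau>. hk n \<tau> z) has_real_derivative hkt n \<tau> z) (at \<tau>)"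
    "isCont (\<lambda>(\<tau>, z). hkz n \<tau> z) (\<tau>, z)" "isCont (\<lambda>(\<tau>, z). hkt n \<tau> z) (\<tau>, z)"
proof -
  have "(\<bar>z\<bar> < \<tau>) \<or> (\<tau> < \<bar>z\<bar>)" using ne by linarith
  then show "((\<lambda>z. hk n \<tau> z) has_real_derivative hkz n \<tau> z) (at z)"
  proof
    assume z: "\<bar>z\<bar> < \<tau>"
    have "((\<lambda>y. bE n ((\<tau>\<^sup>2 - y\<^sup>2) / 16) - bE n 0) has_real_derivative hkz n \<tau> z) (at z)"
      unfolding hkz_def using z
      by (auto intro!: derivative_eq_intros DERIV_chain2[OF bE_deriv])
    then show ?thesis
      by (rule has_field_derivative_transform_within_open[of _ _ _ "{-\<tau><..<\<tau>}"]) (use z in \<open>auto simp: hk_def sg_eq\<close>)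
  next
    assume z: "\<tau> < \<bar>z\<bar>"
    have "((\<lambda>y. 0) has_real_derivative hkz n \<tau> z) (at z)" using z by (simp add: hkz_def)
    then show ?thesis
      by (rule has_field_derivative_transform_within_open[of _ _ _ "{y. \<tau> < \<bar>y\<bar>}"])
        (use z in \<open>auto simp: hk_def sg_eq_0 intro!: open_Collect_less continuous_intros\<close>)
  qed
  have "(\<bar>z\<bar> < \<tau>) \<or> (\<tau> < \<bar>z\<bar>)" using ne by linarith
  then show "((\<lambda>\<tau>. hk n \<tau> z) has_real_derivative hkt n \<tau> z) (at \<tau>)"
  proof
    assume z: "\<bar>z\<bar> < \<tau>"
    have "((\<lambda>t. bE n ((t\<^sup>2 - z\<^sup>2) / 16) - bE n 0) has_real_derivative hkt n \<tau> z) (at \<tau>)"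
      unfolding hkt_def using z
      by (auto intro!: derivative_eq_intros DERIV_chain2[OF bE_deriv])
    then show ?thesis
      by (rule has_field_derivative_transform_within_open[of _ _ _ "{\<bar>z\<bar><..}"]) (use z in \<open>auto simp: hk_def sg_eq\<close>)
  next
    assume z: "\<tau> < \<bar>z\<bar>"
    have "((\<lambda>y. 0) has_real_derivative hkt n \<tau> z) (at \<tau>)" using z by (simp add: hkt_def)
    then show ?thesis
      by (rule has_field_derivative_transform_within_open[of _ _ _ "{..<\<bar>z\<bar>}"]) (use z in \<open>auto simp: hk_def sg_eq_0\<close>)
  qed
  have o: "open {p :: real \<times> real. \<bar>snd p\<bar> < fst p}" "open {p :: real \<times> real. fst p < \<bar>snd p\<bar>}"
    by (auto intro!: open_Collect_less continuous_intros)
  have bc: "isCont (\<lambda>p :: real \<times> real. bE (Suc n) (((fst p)\<^sup>2 - (snd p)\<^sup>2) / 16)) (\<tau>, z)"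
    by (rule isCont_o2[where g = "bE (Suc n)"]) (auto intro!: continuous_intros DERIV_isCont[OF bE_deriv])
  have ev: "eventually (\<lambda>p. (case p of (\<tau>, z) \<Rightarrow> (if \<bar>z\<bar> < \<tau> then f \<tau> z else 0)) = (if \<bar>z\<bar> < \<tau> then f (fst p) (snd p) else (0::real))) (nhds (\<tau>, z))"
    for f :: "real \<Rightarrow> real \<Rightarrow> real"
  proof (cases "\<bar>z\<bar> < \<tau>")
    case True
    then have "eventually (\<lambda>p. p \<in> {p :: real \<times> real. \<bar>snd p\<bar> < fst p}) (nhds (\<tau>, z))"
      by (intro eventually_nhds_in_open o) simp
    then show ?thesis by eventually_elim (use True in auto)
  next
    case False
    then have "eventually (\<lambda>p. p \<in> {p :: real \<times> real. fst p < \<bar>snd p\<bar>}) (nhds (\<tau>, z))"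
      using ne by (intro eventually_nhds_in_open o) simp
    then show ?thesis by eventually_elim (use False in auto)
  qed
  show "isCont (\<lambda>(\<tau>, z). hkz n \<tau> z) (\<tau>, z)"
    unfolding hkz_def isCont_cong[OF ev]
    by (cases "\<bar>z\<bar> < \<tau>") (auto intro!: continuous_intros bc)
  show "isCont (\<lambda>(\<tau>, z). hkt n \<tau> z) (\<tau>, z)"
    unfolding hkt_def isCont_cong[OF ev]
    by (cases "\<bar>z\<bar> < \<tau>") (auto intro!: continuous_intros bc)
qed

lemma bE_measurable [measurable]: "bE n \<in> borel_measurable borel"
  by (rule borel_measurable_continuous_onI[OF bE_continuous])

lemma hk_measurable [measurable]:
  assumes [measurable]: "f \<in> borel_measurable M" "g \<in> borel_measurable M"
  shows "(\<lambda>m. hk n (f m) (g m)) \<in> borel_measurable M" "(\<lambda>m. hkz n (f m) (g m)) \<in> borel_measurable M"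
    "(\<lambda>m. hkt n (f m) (g m)) \<in> borel_measurable M"
proof -
  have b: "(\<lambda>m. bE k (h m)) \<in> borel_measurable M" if "h \<in> borel_measurable M" for k h
    using measurable_compose[OF that bE_measurable] .
  have [measurable]: "(\<lambda>m. bE k (((f m)\<^sup>2 - (g m)\<^sup>2) / 16)) \<in> borel_measurable M"
    "(\<lambda>m. bE k (max 0 ((max 0 (f m))\<^sup>2 - (g m)\<^sup>2) / 16)) \<in> borel_measurable M" for k
    by (rule b, simp)+
  show "(\<lambda>m. hk n (f m) (g m)) \<in> borel_measurable M" unfolding hk_def sg_def by simp
  show "(\<lambda>m. hkz n (f m) (g m)) \<in> borel_measurable M" unfolding hkz_def by simp
  show "(\<lambda>m. hkt n (f m) (g m)) \<in> borel_measurable M" unfolding hkt_def by simp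
qed

text \<open>
  The measure space is either the line, for initial data, or space-time, for sources; \<open>s\<close> and \<open>y\<close> give the time
  and the place from which a point of it emits.
\<close>

lemma kernel_convolution_triple:
  fixes s y H :: "'m \<Rightarrow> real"
  assumes [measurable]: "s \<in> borel_measurable M" "y \<in> borel_measurable M" and H: "integrable M H"
    and supp: "\<And>m. H m \<noteq> 0 \<Longrightarrow> 0 \<le> s m \<and> \<bar>y m\<bar> \<le> R + s m"
    and ae: "\<And>t x. AE m in M. \<bar>x - y m\<bar> \<noteq> t - s m" and T: "T \<ge> 0"
  shows "\<exists>a b. energy_triple {0..<T} (\<lambda>t x. LINT m|M. hk n (t - s m) (x - y m) * H m) a b"
    and "continuous_on ({-T..T} \<times> UNIV) (\<lambda>(t, x). LINT m|M. hk n (t - s m) (x - y m) * H m)"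
proof -
  note [measurable] = borel_measurable_integrable[OF H]
  define C where "C = hkC n T"
  have le: "\<bar>k * H m\<bar> \<le> C * \<bar>H m\<bar>" if "H m \<noteq> 0 \<Longrightarrow> \<bar>k\<bar> \<le> C" for k m
    using that mult_right_mono[of "\<bar>k\<bar>" C "\<bar>H m\<bar>"] by (cases "H m = 0") (auto simp: abs_mult)
  have dec: "t - s m \<le> T" if "\<bar>t\<bar> \<le> T" "H m \<noteq> 0" for t m using that supp[of m] by auto
  have conds: "integrable M (\<lambda>m. C * \<bar>H m\<bar>)" using H by auto
  have lip: "\<bar>k * H m - l * H m\<bar> \<le> C * \<bar>H m\<bar> * d" if "H m \<noteq> 0 \<Longrightarrow> \<bar>k - l\<bar> \<le> C * d" for k l m d
  proof (cases "H m = 0")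
    case False
    have "\<bar>k * H m - l * H m\<bar> = \<bar>k - l\<bar> * \<bar>H m\<bar>" by (simp add: left_diff_distrib[symmetric] abs_mult)
    also have "\<dots> \<le> C * d * \<bar>H m\<bar>" using that[OF False] by (intro mult_right_mono) auto
    finally show ?thesis by (simp add: mult_ac)
  qed auto
  have aes: "AE m in M. ((\<lambda>x. hk n (t - s m) (x - y m) * H m) has_real_derivative hkz n (t - s m) (x - y m) * H m) (at x) \<and>
        ((\<lambda>t. hk n (t - s m) (x - y m) * H m) has_real_derivative hkt n (t - s m) (x - y m) * H m) (at t) \<and>
        isCont (\<lambda>(t, x). hkz n (t - s m) (x - y m) * H m) (t, x) \<and> isCont (\<lambda>(t, x). hkt n (t - s m) (x - y m) * H m) (t, x)" for t x
    using ae[of x t]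
  proof eventually_elim
    case (elim m)
    note d = hk_derivs[OF elim, of n]
    have 1: "((\<lambda>x. hk n (t - s m) (x - y m)) has_real_derivative hkz n (t - s m) (x - y m)) (at x)"
      using d(1) DERIV_shift[of "hk n (t - s m)" _ x "- y m"] by simp
    have 2: "((\<lambda>t. hk n (t - s m) (x - y m)) has_real_derivative hkt n (t - s m) (x - y m)) (at t)"
      using d(2) DERIV_shift[of "\<lambda>\<tau>. hk n \<tau> (x - y m)" _ t "- s m"] by simp
    have sh: "isCont (\<lambda>p. (fst p - s m, snd p - y m)) (t, x)" by (intro continuous_intros)
    have c1: "isCont (\<lambda>(t, x). hkz n (t - s m) (x - y m)) (t, x)"
      using isCont_o2[OF sh, of "\<lambda>(\<tau>, z). hkz n \<tau> z"] d(3) by (simp add: case_prod_beta')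
    have c2: "isCont (\<lambda>(t, x). hkt n (t - s m) (x - y m)) (t, x)"
      using isCont_o2[OF sh, of "\<lambda>(\<tau>, z). hkt n \<tau> z"] d(4) by (simp add: case_prod_beta')
    show ?case
      using DERIV_cmult_right[OF 1, of "H m"] DERIV_cmult_right[OF 2, of "H m"]
        isCont_mult[OF c1 continuous_const[of _ "H m"]] isCont_mult[OF c2 continuous_const[of _ "H m"]]
      by (simp add: case_prod_beta')
  qed
  have off: "hk n (t - s m) (x - y m) * H m = 0 \<and> hkz n (t - s m) (x - y m) * H m = 0 \<and> hkt n (t - s m) (x - y m) * H m = 0"
    if "0 \<le> t" "t < T" "\<bar>x\<bar> > R + T" for t x m
  proof (cases "H m = 0")
    case False
    then have "t - s m \<le> \<bar>x - y m\<bar>" using that supp[OF False] by linarith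
    then show ?thesis using hk_outside by simp
  qed simp
  have "energy_triple {0..<T} (\<lambda>t x. LINT m|M. hk n (t - s m) (x - y m) * H m)
      (\<lambda>t x. LINT m|M. hkz n (t - s m) (x - y m) * H m) (\<lambda>t x. LINT m|M. hkt n (t - s m) (x - y m) * H m) \<and>
      continuous_on ({-T..T} \<times> UNIV) (\<lambda>(t, x). LINT m|M. hk n (t - s m) (x - y m) * H m)"
  proof (rule parametric_triple[OF conds])
    fix m t x assume t: "\<bar>t\<bar> \<le> T"
    show "\<bar>hk n (t - s m) (x - y m) * H m\<bar> \<le> C * \<bar>H m\<bar>" "\<bar>hkz n (t - s m) (x - y m) * H m\<bar> \<le> C * \<bar>H m\<bar>"
      "\<bar>hkt n (t - s m) (x - y m) * H m\<bar> \<le> C * \<bar>H m\<bar>"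
      unfolding C_def by (rule le[unfolded C_def], rule hk_bounds[OF dec[OF t] _ T, of m 0], assumption, rule T)+
  next
    fix m t t' x assume t: "\<bar>t\<bar> \<le> T" "\<bar>t'\<bar> \<le> T"
    show "\<bar>hk n (t - s m) (x - y m) * H m - hk n (t' - s m) (x - y m) * H m\<bar> \<le> C * \<bar>H m\<bar> * \<bar>t - t'\<bar>"
    proof (rule lip)
      assume "H m \<noteq> 0"
      then show "\<bar>hk n (t - s m) (x - y m) - hk n (t' - s m) (x - y m)\<bar> \<le> C * \<bar>t - t'\<bar>"
        using hk_bounds(4)[OF dec[OF t(1)] dec[OF t(2)] T, of m m n "x - y m"] by (simp add: C_def)
    qed
  next
    fix m t x x' assume t: "\<bar>t\<bar> \<le> T"
    show "\<bar>hk n (t - s m) (x - y m) * H m - hk n (t - s m) (x' - y m) * H m\<bar> \<le> C * \<bar>H m\<bar> * \<bar>x - x'\<bar>"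
    proof (rule lip)
      assume "H m \<noteq> 0"
      then show "\<bar>hk n (t - s m) (x - y m) - hk n (t - s m) (x' - y m)\<bar> \<le> C * \<bar>x - x'\<bar>"
        using hk_bounds(5)[OF dec[OF t] _ T, of m 0 n "x - y m" "x' - y m"] T by (simp add: C_def)
    qed
  next
    fix t x
    show "(\<lambda>m. hk n (t - s m) (x - y m) * H m) \<in> borel_measurable M"
      "(\<lambda>m. hkz n (t - s m) (x - y m) * H m) \<in> borel_measurable M"
      "(\<lambda>m. hkt n (t - s m) (x - y m) * H m) \<in> borel_measurable M"
      by (intro borel_measurable_times hk_measurable borel_measurable_diff borel_measurable_const; simp)+
  next
    fix t x
    show "AE m in M. ((\<lambda>x. hk n (t - s m) (x - y m) * H m) has_real_derivative hkz n (t - s m) (x - y m) * H m) (at x) \<and>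
        ((\<lambda>t. hk n (t - s m) (x - y m) * H m) has_real_derivative hkt n (t - s m) (x - y m) * H m) (at t) \<and>
        isCont (\<lambda>(t, x). hkz n (t - s m) (x - y m) * H m) (t, x) \<and> isCont (\<lambda>(t, x). hkt n (t - s m) (x - y m) * H m) (t, x)"
      by (rule aes)
  qed (rule off)
  then show "\<exists>a b. energy_triple {0..<T} (\<lambda>t x. LINT m|M. hk n (t - s m) (x - y m) * H m) a b"
    "continuous_on ({-T..T} \<times> UNIV) (\<lambda>(t, x). LINT m|M. hk n (t - s m) (x - y m) * H m)" by blast+
qed

section \<open>The propagators and Duhamel operators\<close>

text \<open>
  The Bessel parts of the damped propagator; the argument \<open>(\<tau>\<^sup>2 - (x - y)\<^sup>2) / 16\<close> is \<open>z\<^sup>2 / 4\<close> for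
  \<open>z = sqrt (\<tau>\<^sup>2 - (x - y)\<^sup>2) / 2\<close>.
\<close>

definition Ker :: "nat \<Rightarrow> real \<Rightarrow> real \<Rightarrow> (real \<Rightarrow> real) \<Rightarrow> real" where
  "Ker n \<tau> x H = (LINT y|lborel. indicator {x - \<tau>..x + \<tau>} y * bE n ((\<tau>\<^sup>2 - (x - y)\<^sup>2) / 16) * H y)"

lemma prim_diff_Icc:
  assumes h: "integrable lborel h" and "x \<le> y"
  shows "prim h y - prim h x = (LINT z|lborel. indicator {x..y} z * h z)"
proof -
  note [measurable] = borel_measurable_integrable[OF h]
  have "(LINT z|lborel. indicator {x<..y} z * h z) = (LINT z|lborel. indicator {x..y} z * h z)"
  proof (rule integral_cong_AE)
    show "AE z in lborel. indicator {x<..y} z * h z = indicator {x..y} z * h z"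
      using AE_lborel_singleton[of x] by eventually_elim (auto simp: indicator_def)
  qed measurable
  then show ?thesis using prim_diff[OF assms] by simp
qed

lemma Ker_eq:
  assumes \<tau>: "\<tau> \<ge> 0" and H: "integrable lborel H"
  shows "Ker n \<tau> x H = bE n 0 * (prim H (x + \<tau>) - prim H (x - \<tau>)) + (LINT y|lborel. hk n \<tau> (x - y) * H y)"
    and "integrable lborel (\<lambda>y. hk n \<tau> (x - y) * H y)"
proof -
  note [measurable] = borel_measurable_integrable[OF H]
  show ih: "integrable lborel (\<lambda>y. hk n \<tau> (x - y) * H y)"
    using integrable_mult_bounded[OF H _ hk_bounds(1)[of \<tau> \<tau> \<tau>]] \<tau> by (simp add: mult.commute)
  have "Ker n \<tau> x H = (LINT y|lborel. bE n 0 * (indicator {x - \<tau>..x + \<tau>} y * H y) + hk n \<tau> (x - y) * H y)"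
    unfolding Ker_def
  proof (rule Bochner_Integration.integral_cong)
    fix y
    show "indicator {x - \<tau>..x + \<tau>} y * bE n ((\<tau>\<^sup>2 - (x - y)\<^sup>2) / 16) * H y
       = bE n 0 * (indicator {x - \<tau>..x + \<tau>} y * H y) + hk n \<tau> (x - y) * H y"
    proof (cases "\<bar>x - y\<bar> \<le> \<tau>")
      case True
      then have "indicator {x - \<tau>..x + \<tau>} y = (1::real)" by (auto simp: indicator_def abs_le_iff)
      then show ?thesis by (simp add: hk_def sg_eq[OF True] algebra_simps)
    next
      case False
      then have "indicator {x - \<tau>..x + \<tau>} y = (0::real)" by (auto simp: indicator_def abs_le_iff)
      then show ?thesis using False hk_outside[of \<tau> "x - y" n] by simp
    qed
  qed simp
  also have "\<dots> = bE n 0 * (LINT y|lborel. indicator {x - \<tau>..x + \<tau>} y * H y) + (LINT y|lborel. hk n \<tau> (x - y) * H y)"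
    using ih integrable_ind[OF H, of "{x - \<tau>..x + \<tau>}"] by simp
  also have "(LINT y|lborel. indicator {x - \<tau>..x + \<tau>} y * H y) = prim H (x + \<tau>) - prim H (x - \<tau>)"
    using prim_diff_Icc[OF H, of "x - \<tau>" "x + \<tau>"] \<tau> by simp
  finally show "Ker n \<tau> x H = bE n 0 * (prim H (x + \<tau>) - prim H (x - \<tau>)) + (LINT y|lborel. hk n \<tau> (x - y) * H y)" .
qed

text \<open>
  The class of sources and solutions of the iteration. It is stable under \<open>|F|^p\<close>, under the Duhamel operators
  with a cutoff in time, and under uniform limits. Continuity is required in space only, because of that cutoff.
\<close>

definition cone_source :: "real \<Rightarrow> real \<Rightarrow> (real \<Rightarrow> real \<Rightarrow> real) \<Rightarrow> bool" where
  "cone_source R T F \<longleftrightarrow> (\<lambda>(s, y). F s y) \<in> borel_measurable borel \<and> (\<exists>B. \<forall>s y. \<bar>F s y\<bar> \<le> B) \<and>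
     (\<forall>s y. F s y \<noteq> 0 \<longrightarrow> 0 \<le> s \<and> s \<le> T \<and> \<bar>y\<bar> \<le> R + s) \<and> (\<forall>s. continuous_on UNIV (F s))"

lemma cone_sourceD:
  assumes "cone_source R T F"
  shows "(\<lambda>(s, y). F s y) \<in> borel_measurable borel"
    "(\<lambda>(s, y). F s y) \<in> borel_measurable (borel \<Otimes>\<^sub>M borel)"
    "\<And>s. F s \<in> borel_measurable borel" "\<And>s. continuous_on UNIV (F s)"
    "\<And>s y. F s y \<noteq> 0 \<Longrightarrow> 0 \<le> s \<and> s \<le> T \<and> \<bar>y\<bar> \<le> R + s"
    "\<And>s y. \<bar>y\<bar> > \<bar>R\<bar> + \<bar>T\<bar> \<Longrightarrow> F s y = 0"
    "\<And>s. integrable lborel (F s)"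
proof -
  show m: "(\<lambda>(s, y). F s y) \<in> borel_measurable borel" using assms unfolding cone_source_def by blast
  then show "(\<lambda>(s, y). F s y) \<in> borel_measurable (borel \<Otimes>\<^sub>M borel)" by (simp add: borel_prod)
  show c: "continuous_on UNIV (F s)" for s using assms unfolding cone_source_def by blast
  then show "F s \<in> borel_measurable borel" for s by (rule borel_measurable_continuous_onI)
  show s: "F s y \<noteq> 0 \<Longrightarrow> 0 \<le> s \<and> s \<le> T \<and> \<bar>y\<bar> \<le> R + s" for s y using assms unfolding cone_source_def by blast
  show z: "F s y = 0" if "\<bar>y\<bar> > \<bar>R\<bar> + \<bar>T\<bar>" for s y
  proof (rule ccontr)
    assume "F s y \<noteq> 0"
    then show False using s[of s y] that by linarith
  qed
  show "integrable lborel (F s)" for s by (rule integrable_cont_support(3)[OF c z])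
qed

lemma cone_source_integrable:
  assumes F: "cone_source R T F"
  shows "integrable (lborel \<Otimes>\<^sub>M lborel) (\<lambda>m. F (fst m) (snd m))"
proof -
  obtain B where B: "\<And>s y. \<bar>F s y\<bar> \<le> B" using F unfolding cone_source_def by blast
  note [measurable] = cone_sourceD(2)[OF F]
  have fin: "emeasure (lborel \<Otimes>\<^sub>M lborel) ({0..T} \<times> {-(\<bar>R\<bar> + \<bar>T\<bar>)..\<bar>R\<bar> + \<bar>T\<bar>}) < \<infinity>"
    by (subst lborel.emeasure_pair_measure_Times) (auto simp: emeasure_lborel_Icc_eq ennreal_mult_less_top)
  have iB: "integrable (lborel \<Otimes>\<^sub>M lborel) (\<lambda>m. B * indicator ({0..T} \<times> {-(\<bar>R\<bar> + \<bar>T\<bar>)..\<bar>R\<bar> + \<bar>T\<bar>}) m)"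
    using fin by (intro integrable_mult_right integrable_real_indicator) auto
  show ?thesis
  proof (rule Bochner_Integration.integrable_bound[OF iB])
    have "(\<lambda>m. F (fst m) (snd m)) = (\<lambda>(s, y). F s y)" by auto
    then show "(\<lambda>m. F (fst m) (snd m)) \<in> borel_measurable (lborel \<Otimes>\<^sub>M lborel)"
      using cone_sourceD(2)[OF F] by simp
    show "AE m in lborel \<Otimes>\<^sub>M lborel. norm (F (fst m) (snd m)) \<le> norm (B * indicator ({0..T} \<times> {-(\<bar>R\<bar> + \<bar>T\<bar>)..\<bar>R\<bar> + \<bar>T\<bar>}) m)"
    proof (rule AE_I2)
      fix m :: "real \<times> real"
      have B0: "0 \<le> B" using B[of 0 0] by (rule order_trans[OF abs_ge_zero])
      show "norm (F (fst m) (snd m)) \<le> norm (B * indicator ({0..T} \<times> {-(\<bar>R\<bar> + \<bar>T\<bar>)..\<bar>R\<bar> + \<bar>T\<bar>}) m)"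
      proof (cases "F (fst m) (snd m) = 0")
        case False
        from cone_sourceD(5)[OF F False] have "fst m \<in> {0..T}" "snd m \<in> {-(\<bar>R\<bar> + \<bar>T\<bar>)..\<bar>R\<bar> + \<bar>T\<bar>}"
          by (auto simp: abs_le_iff)
        then have "m \<in> {0..T} \<times> {-(\<bar>R\<bar> + \<bar>T\<bar>)..\<bar>R\<bar> + \<bar>T\<bar>}" by (cases m) auto
        then show ?thesis using B[of "fst m" "snd m"] B0 by simp
      qed simp
    qed
  qed
qed

text \<open>
  The Duhamel operators of the wave equation and of the damped wave equation.
\<close>

definition Nw :: "(real \<Rightarrow> real \<Rightarrow> real) \<Rightarrow> real \<Rightarrow> real \<Rightarrow> real" where
  "Nw F t x = (LINT s|lborel. indicator {0..t} s * ((prim (F s) (x + (t - s)) - prim (F s) (x - (t - s))) / 2))"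

definition Nd :: "(real \<Rightarrow> real \<Rightarrow> real) \<Rightarrow> real \<Rightarrow> real \<Rightarrow> real" where
  "Nd F t x = (LINT s|lborel. indicator {0..t} s * (exp (- (t - s) / 2) * (Ker 0 (t - s) x (F s) / 2)))"

lemma prim_param_measurable:
  assumes F: "cone_source R T F" and [measurable]: "k \<in> borel_measurable borel"
  shows "(\<lambda>s. prim (F s) (k s)) \<in> borel_measurable borel"
proof -
  note [measurable] = cone_sourceD(2)[OF F]
  have "(\<lambda>s. LINT y|lborel. (\<lambda>(s, y). (if y \<le> k s then F s y else 0)) (s, y)) \<in> borel_measurable borel"
    by (rule lborel.borel_measurable_lebesgue_integral) simp
  moreover have "(LINT y|lborel. (\<lambda>(s, y). (if y \<le> k s then F s y else 0)) (s, y)) = prim (F s) (k s)" for s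
    unfolding prim_def by (intro Bochner_Integration.integral_cong) (auto simp: indicator_def)
  ultimately show ?thesis by (simp only:)
qed

lemma prim_lipschitz:
  assumes h: "continuous_on UNIV h" "\<And>x. \<bar>x\<bar> > R \<Longrightarrow> h x = 0" and B: "\<And>x. \<bar>h x\<bar> \<le> B"
  shows "\<bar>prim h x - prim h y\<bar> \<le> B * \<bar>x - y\<bar>"
proof -
  have "norm (prim h x - prim h y) \<le> B * norm (x - y)"
  proof (rule field_differentiable_bound[where S = UNIV])
    show "(prim h has_field_derivative h r) (at r within UNIV)" for r
      using prim_has_derivative[OF h] by simp
    show "norm (h r) \<le> B" for r using B by simp
  qed auto
  then show ?thesis by simp
qed

lemma Nw_eq_max:
  assumes F: "cone_source R T F"
  shows "Nw F t x = (LINT s|lborel. (prim (F s) (x + max 0 (t - s)) - prim (F s) (x - max 0 (t - s))) / 2)"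
  unfolding Nw_def
proof (rule Bochner_Integration.integral_cong)
  fix s
  have "F s = (\<lambda>_. 0)" if "s < 0" using cone_sourceD(5)[OF F, of s] that by force
  then show "indicator {0..t} s * ((prim (F s) (x + (t - s)) - prim (F s) (x - (t - s))) / 2)
      = (prim (F s) (x + max 0 (t - s)) - prim (F s) (x - max 0 (t - s))) / 2"
    by (cases "s < 0"; cases "s \<le> t") (auto simp: indicator_def prim_def max_def)
qed simp

lemma half_difference_le:
  "\<bar>a - a'\<bar> \<le> c \<Longrightarrow> \<bar>b - b'\<bar> \<le> c \<Longrightarrow> \<bar>(a - b) / 2 - (a' - b') / 2\<bar> \<le> (c::real)"
  by (auto simp: abs_le_iff field_simps)

text \<open>
  Writing \<open>max 0 (t - s)\<close> for \<open>t - s\<close> removes the time dependent domain of integration; the integrand becomes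
  Lipschitz in \<open>t\<close>, with a kink at \<open>t = s\<close> only.
\<close>

lemma Nw_triple:
  assumes F: "cone_source R T0 F" and R: "R \<ge> 0" and T: "T \<ge> 0"
  shows "\<exists>a b. energy_triple {0..<T} (Nw F) a b" and "continuous_on ({-T..T} \<times> UNIV) (\<lambda>(t, x). Nw F t x)"
proof -
  obtain B where B: "\<And>s y. \<bar>F s y\<bar> \<le> B" using F unfolding cone_source_def by blast
  have B0: "0 \<le> B" using B[of 0 0] by (rule order_trans[OF abs_ge_zero])
  note D = cone_sourceD[OF F]
  have lipP: "\<bar>prim (F s) x - prim (F s) y\<bar> \<le> B * \<bar>x - y\<bar>" for s x y
    by (rule prim_lipschitz[OF D(4) D(6) B])
  define I where "I s = (indicator {0..T0} s :: real)" for s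
  have off: "F s = (\<lambda>_. 0)" if "I s = 0" for s
    using D(5)[of s] that by (force simp: I_def indicator_def)
  have prim0: "prim (\<lambda>_. 0) x = 0" for x by (simp add: prim_def)
  define L where "L s = (B * (T + 1) + B * (\<bar>T0\<bar> + 1)) * I s" for s
  have L: "integrable lborel L" unfolding L_def I_def using integrable_indicator_Icc by simp
  define \<Phi> where "\<Phi> s t x = (prim (F s) (x + max 0 (t - s)) - prim (F s) (x - max 0 (t - s))) / 2" for s t x
  define \<Phi>x where "\<Phi>x s t x = (F s (x + max 0 (t - s)) - F s (x - max 0 (t - s))) / 2" for s t x
  define \<Phi>t where "\<Phi>t s t x = (if s < t then (F s (x + (t - s)) + F s (x - (t - s))) / 2 else 0)" for s t x
  have NwE: "Nw F = (\<lambda>t x. LINT s|lborel. \<Phi> s t x)" unfolding \<Phi>_def by (intro ext Nw_eq_max[OF F])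
  have zero: "\<Phi> s t x = 0 \<and> \<Phi>x s t x = 0 \<and> \<Phi>t s t x = 0" if "I s = 0" for s t x
    unfolding \<Phi>_def \<Phi>x_def \<Phi>t_def off[OF that] by (simp add: prim0)
  have I1: "I s = 0 \<or> (I s = 1 \<and> 0 \<le> s \<and> s \<le> T0)" for s by (auto simp: I_def indicator_def)
  have b1: "\<bar>\<Phi> s t x - \<Phi> s t' x\<bar> \<le> B * \<bar>t - t'\<bar>" for s t t' x
  proof -
    have "\<bar>max 0 (t - s) - max 0 (t' - s)\<bar> \<le> \<bar>t - t'\<bar>" by linarith
    then have m: "B * \<bar>max 0 (t - s) - max 0 (t' - s)\<bar> \<le> B * \<bar>t - t'\<bar>" using B0 by (rule mult_left_mono)
    have "\<bar>prim (F s) (x + max 0 (t - s)) - prim (F s) (x + max 0 (t' - s))\<bar> \<le> B * \<bar>max 0 (t - s) - max 0 (t' - s)\<bar>"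
      using lipP[of s "x + max 0 (t - s)" "x + max 0 (t' - s)"] by simp
    moreover have "\<bar>prim (F s) (x - max 0 (t - s)) - prim (F s) (x - max 0 (t' - s))\<bar> \<le> B * \<bar>max 0 (t - s) - max 0 (t' - s)\<bar>"
      using lipP[of s "x - max 0 (t - s)" "x - max 0 (t' - s)"] by (simp add: abs_minus_commute)
    ultimately have "\<bar>\<Phi> s t x - \<Phi> s t' x\<bar> \<le> B * \<bar>max 0 (t - s) - max 0 (t' - s)\<bar>"
      unfolding \<Phi>_def by (rule half_difference_le)
    then show ?thesis using m by (rule order_trans)
  qed
  have b2: "\<bar>\<Phi> s t x - \<Phi> s t x'\<bar> \<le> B * \<bar>x - x'\<bar>" for s t x x'
  proof -
    have "\<bar>prim (F s) (x + max 0 (t - s)) - prim (F s) (x' + max 0 (t - s))\<bar> \<le> B * \<bar>x - x'\<bar>"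
      using lipP[of s "x + max 0 (t - s)" "x' + max 0 (t - s)"] by simp
    moreover have "\<bar>prim (F s) (x - max 0 (t - s)) - prim (F s) (x' - max 0 (t - s))\<bar> \<le> B * \<bar>x - x'\<bar>"
      using lipP[of s "x - max 0 (t - s)" "x' - max 0 (t - s)"] by simp
    ultimately show ?thesis unfolding \<Phi>_def by (rule half_difference_le)
  qed
  have b3: "\<bar>\<Phi> s t x\<bar> \<le> B * max 0 (t - s)" for s t x
    using lipP[of s "x + max 0 (t - s)" "x - max 0 (t - s)"] unfolding \<Phi>_def by (simp add: abs_divide)
  have triple: "energy_triple {0..<T} (\<lambda>t x. LINT s|lborel. \<Phi> s t x) (\<lambda>t x. LINT s|lborel. \<Phi>x s t x) (\<lambda>t x. LINT s|lborel. \<Phi>t s t x)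
     \<and> continuous_on ({-T..T} \<times> UNIV) (\<lambda>(t, x). LINT s|lborel. \<Phi> s t x)"
  proof (rule parametric_triple[OF L])
    fix t x :: real
    show "(\<lambda>s. \<Phi> s t x) \<in> borel_measurable lborel"
      unfolding \<Phi>_def using prim_param_measurable[OF F, of "\<lambda>s. x + max 0 (t - s)"] prim_param_measurable[OF F, of "\<lambda>s. x - max 0 (t - s)"]
      by simp
    have Fm: "(\<lambda>s. F s (k s)) \<in> borel_measurable borel" if [measurable]: "k \<in> borel_measurable borel" for k
      using measurable_compose[of "\<lambda>s. (s, k s)" borel "borel \<Otimes>\<^sub>M borel" "\<lambda>(s, y). F s y" borel] D(2) by simp
    show "(\<lambda>s. \<Phi>x s t x) \<in> borel_measurable lborel"
      unfolding \<Phi>x_def using Fm[of "\<lambda>s. x + max 0 (t - s)"] Fm[of "\<lambda>s. x - max 0 (t - s)"] by simp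
    have [measurable]: "(\<lambda>s. F s (x + (t - s))) \<in> borel_measurable borel" "(\<lambda>s. F s (x - (t - s))) \<in> borel_measurable borel"
      by (rule Fm, simp)+
    show "(\<lambda>s. \<Phi>t s t x) \<in> borel_measurable lborel" unfolding \<Phi>t_def by simp
  next
    fix s t x :: real assume t: "\<bar>t\<bar> \<le> T"
    have LB: "I s = 1 \<Longrightarrow> B * (T + 1) \<le> L s" "I s = 1 \<Longrightarrow> B \<le> L s"
      using B0 T mult_nonneg_nonneg[OF B0 T] mult_nonneg_nonneg[OF B0, of "\<bar>T0\<bar> + 1"] by (auto simp: L_def distrib_left)
    show "\<bar>\<Phi> s t x\<bar> \<le> L s"
    proof (cases "I s = 0")
      case True then show ?thesis using zero by (simp add: L_def)
    next
      case False
      then have i: "I s = 1" "0 \<le> s" using I1[of s] by auto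
      have "B * max 0 (t - s) \<le> B * (T + 1)" using t i B0 by (intro mult_left_mono) auto
      then show ?thesis using b3[of s t x] LB(1)[OF i(1)] by linarith
    qed
    have FB: "\<bar>F s y + F s z\<bar> / 2 \<le> B" "\<bar>F s y - F s z\<bar> / 2 \<le> B" for y z using B[of s y] B[of s z] by auto
    show "\<bar>\<Phi>x s t x\<bar> \<le> L s"
    proof (cases "I s = 0")
      case True then show ?thesis using zero by (simp add: L_def)
    next
      case False
      then have i: "I s = 1" using I1[of s] by auto
      show ?thesis unfolding \<Phi>x_def
        using order_trans[OF FB(2)[of "x + max 0 (t - s)" "x - max 0 (t - s)"] LB(2)[OF i]] by (simp add: abs_divide)
    qed
    show "\<bar>\<Phi>t s t x\<bar> \<le> L s"
    proof (cases "I s = 0")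
      case True then show ?thesis using zero by (simp add: L_def)
    next
      case False
      then have i: "I s = 1" using I1[of s] by auto
      have "\<bar>\<Phi>t s t x\<bar> \<le> B" unfolding \<Phi>t_def using FB(1) B0 by (simp add: abs_divide)
      then show ?thesis using LB(2)[OF i] by linarith
    qed
    fix x' :: real
    show "\<bar>\<Phi> s t x - \<Phi> s t x'\<bar> \<le> L s * \<bar>x - x'\<bar>"
    proof (cases "I s = 0")
      case True then show ?thesis using zero by (simp add: L_def)
    next
      case False
      then have i: "I s = 1" using I1[of s] by auto
      show ?thesis using b2[of s t x x'] mult_right_mono[OF LB(2)[OF i], of "\<bar>x - x'\<bar>"] by simp
    qed
    fix t' :: real
    show "\<bar>\<Phi> s t x - \<Phi> s t' x\<bar> \<le> L s * \<bar>t - t'\<bar>"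
    proof (cases "I s = 0")
      case True then show ?thesis using zero by (simp add: L_def)
    next
      case False
      then have i: "I s = 1" using I1[of s] by auto
      show ?thesis using b1[of s t x t'] mult_right_mono[OF LB(2)[OF i], of "\<bar>t - t'\<bar>"] by simp
    qed
  next
    fix t x :: real assume t: "\<bar>t\<bar> < T"
    show "AE s in lborel. ((\<lambda>x. \<Phi> s t x) has_real_derivative \<Phi>x s t x) (at x) \<and>
        ((\<lambda>t. \<Phi> s t x) has_real_derivative \<Phi>t s t x) (at t) \<and>
        isCont (\<lambda>(t, x). \<Phi>x s t x) (t, x) \<and> isCont (\<lambda>(t, x). \<Phi>t s t x) (t, x)"
      using AE_lborel_singleton[of t]
    proof eventually_elim
      case (elim s)
      have dP: "(prim (F s) has_real_derivative F s r) (at r)" for r by (rule prim_has_derivative[OF D(4) D(6)])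
      have cF: "isCont (F s) r" for r using D(4)[of s] by (simp add: continuous_on_eq_continuous_at)
      have 1: "((\<lambda>x. \<Phi> s t x) has_real_derivative \<Phi>x s t x) (at x)"
      proof -
        have sh: "((\<lambda>x. prim (F s) (x + c)) has_real_derivative F s (x + c)) (at x)" for c
          using dP[of "x + c"] DERIV_shift[of "prim (F s)" "F s (x + c)" x c] by simp
        show ?thesis
          using DERIV_cdivide[OF DERIV_diff[OF sh[of "max 0 (t - s)"] sh[of "- max 0 (t - s)"]], of 2]
          unfolding \<Phi>_def \<Phi>x_def by simp
      qed
      have 2: "((\<lambda>t. \<Phi> s t x) has_real_derivative \<Phi>t s t x) (at t)"
      proof (cases "s < t")
        case True
        have "((\<lambda>t. (prim (F s) (x + (t - s)) - prim (F s) (x - (t - s))) / 2) has_real_derivative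
            (F s (x + (t - s)) * 1 - F s (x - (t - s)) * (- 1)) / 2) (at t)"
          by (rule DERIV_cdivide[OF DERIV_diff[OF DERIV_chain2[OF dP] DERIV_chain2[OF dP]]]) (auto intro!: derivative_eq_intros)
        then have "((\<lambda>t. (prim (F s) (x + (t - s)) - prim (F s) (x - (t - s))) / 2) has_real_derivative \<Phi>t s t x) (at t)"
          using True by (simp add: \<Phi>t_def)
        then show ?thesis
          by (rule has_field_derivative_transform_within_open[of _ _ _ "{s<..}"]) (use True in \<open>auto simp: \<Phi>_def\<close>)
      next
        case False
        then have "t < s" using elim by simp
        have "((\<lambda>t. 0) has_real_derivative \<Phi>t s t x) (at t)" using \<open>t < s\<close> by (simp add: \<Phi>t_def)
        then show ?thesis
          by (rule has_field_derivative_transform_within_open[of _ _ _ "{..<s}"]) (use \<open>t < s\<close> in \<open>auto simp: \<Phi>_def\<close>)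
      qed
      have cc: "isCont (\<lambda>p. F s (k p)) (t, x)" if "isCont k (t, x)" for k :: "real \<times> real \<Rightarrow> real"
        by (rule isCont_o2[OF that cF])
      have k: "isCont (\<lambda>p. F s (snd p + max 0 (fst p - s))) (t, x)" "isCont (\<lambda>p. F s (snd p - max 0 (fst p - s))) (t, x)"
        "isCont (\<lambda>p. F s (snd p + (fst p - s))) (t, x)" "isCont (\<lambda>p. F s (snd p - (fst p - s))) (t, x)"
        by (rule cc, intro continuous_intros)+
      have 3: "isCont (\<lambda>(t, x). \<Phi>x s t x) (t, x)"
        unfolding \<Phi>x_def case_prod_beta' by (intro continuous_divide continuous_diff k continuous_const) simp
      have 4: "isCont (\<lambda>(t, x). \<Phi>t s t x) (t, x)"
      proof -
        have ev: "eventually (\<lambda>p. (case p of (t, x) \<Rightarrow> \<Phi>t s t x)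
            = (if s < t then (F s (snd p + (fst p - s)) + F s (snd p - (fst p - s))) / 2 else 0)) (nhds (t, x))"
        proof (cases "s < t")
          case True
          have "open {p :: real \<times> real. s < fst p}" by (intro open_Collect_less continuous_intros)
          then have "eventually (\<lambda>p. p \<in> {p :: real \<times> real. s < fst p}) (nhds (t, x))"
            using True by (intro eventually_nhds_in_open) auto
          then show ?thesis by eventually_elim (use True in \<open>auto simp: \<Phi>t_def\<close>)
        next
          case False
          have "open {p :: real \<times> real. fst p < s}" by (intro open_Collect_less continuous_intros)
          then have "eventually (\<lambda>p. p \<in> {p :: real \<times> real. fst p < s}) (nhds (t, x))"
            using False elim by (intro eventually_nhds_in_open) auto
          then show ?thesis by eventually_elim (use False in \<open>auto simp: \<Phi>t_def\<close>)
        qed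
        show ?thesis unfolding isCont_cong[OF ev]
          using continuous_divide[OF continuous_add[OF k(3,4)] continuous_const, of 2] by (cases "s < t") simp_all
      qed
      show ?case using 1 2 3 4 by blast
    qed
  next
    fix s t x :: real assume t: "0 \<le> t" "t < T" and x: "\<bar>x\<bar> > \<bar>R\<bar> + \<bar>T0\<bar> + T"
    show "\<Phi> s t x = 0 \<and> \<Phi>x s t x = 0 \<and> \<Phi>t s t x = 0"
    proof (cases "I s = 0")
      case False
      then have i: "0 \<le> s" "s \<le> T0" using I1[of s] by auto
      have out: "F s y = 0" if "\<bar>y\<bar> > \<bar>R\<bar> + \<bar>T0\<bar>" for y by (rule D(6)[OF that])
      define d where "d = max 0 (t - s)"
      have d: "0 \<le> d" "d \<le> T" using t i by (auto simp: d_def)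
      have e: "\<bar>x + d\<bar> > \<bar>R\<bar> + \<bar>T0\<bar>" "\<bar>x - d\<bar> > \<bar>R\<bar> + \<bar>T0\<bar>" using x d by linarith+
      have "prim (F s) (x + d) = prim (F s) (x - d)"
      proof (cases "x > 0")
        case True
        then show ?thesis using e d x prim_eq_total[of "\<bar>R\<bar> + \<bar>T0\<bar>" "F s" "x + d"] prim_eq_total[of "\<bar>R\<bar> + \<bar>T0\<bar>" "F s" "x - d"] out
          by (auto simp: abs_if split: if_splits)
      next
        case False
        have "prim (F s) (x + d) = 0" "prim (F s) (x - d) = 0"
          by (rule prim_eq_0[of "\<bar>R\<bar> + \<bar>T0\<bar>"]; use False x d out in auto)+
        then show ?thesis by simp
      qed
      moreover have "s < t \<Longrightarrow> d = t - s" by (simp add: d_def)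
      ultimately show ?thesis using out[OF e(1)] out[OF e(2)]
        unfolding \<Phi>_def \<Phi>x_def \<Phi>t_def d_def[symmetric] by auto
    qed (rule zero)
  qed
  then show "\<exists>a b. energy_triple {0..<T} (Nw F) a b" "continuous_on ({-T..T} \<times> UNIV) (\<lambda>(t, x). Nw F t x)"
    unfolding NwE by blast+
qed

lemma energy_triple_cong:
  assumes tr: "energy_triple I w a b" and eq: "\<And>t x. t \<in> I \<Longrightarrow> w t x = w' t x"
  shows "energy_triple I w' a b"
proof (rule energy_tripleI)
  note d = energy_tripleD[OF tr]
  have e: "w t = w' t" if "t \<in> I" for t using eq[OF that] by auto
  show "L2_cts I a" "L2_cts I b" by (fact d)+
  fix t assume t: "t \<in> I"
  show "sqint (w' t)" using d(4)[OF t] unfolding e[OF t] .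
  show "integrable lborel (a t)" by (rule d(5)[OF t])
  show "w' t x = prim (a t) x" for x using d(6)[OF t, of x] unfolding e[OF t] .
  show "L2_null (at t within I) (\<lambda>s x. (w' s x - w' t x) / (s - t) - b t x)"
  proof (rule L2_null_cong[OF d(7)[OF t]])
    show "eventually (\<lambda>s. \<forall>x. (w s x - w t x) / (s - t) - b t x = (w' s x - w' t x) / (s - t) - b t x) (at t within I)"
      unfolding eventually_at_filter
    proof (intro always_eventually allI impI)
      fix s x assume "s \<in> I"
      then show "(w s x - w t x) / (s - t) - b t x = (w' s x - w' t x) / (s - t) - b t x"
        by (simp only: e[OF \<open>s \<in> I\<close>] e[OF t])
    qed
  qed
qed

text \<open>
  For fixed \<open>s\<close> only two points \<open>y\<close> lie on the cone through \<open>(t, x)\<close>.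
\<close>

lemma AE_off_cone: "AE m in lborel \<Otimes>\<^sub>M lborel. \<bar>x - snd m\<bar> \<noteq> t - fst (m :: real \<times> real)"
proof (rule lborel_pair.AE_pair_measure)
  show "{m \<in> space (lborel \<Otimes>\<^sub>M lborel). \<bar>x - snd m\<bar> \<noteq> t - fst m} \<in> sets (lborel \<Otimes>\<^sub>M lborel)"
  proof -
    have "open {m :: real \<times> real. \<bar>x - snd m\<bar> \<noteq> t - fst m}"
      by (intro open_Collect_neq continuous_intros)
    then have "{m :: real \<times> real. \<bar>x - snd m\<bar> \<noteq> t - fst m} \<in> sets lborel" by simp
    then show ?thesis unfolding lborel_prod by simp
  qed
  show "AE s in lborel. AE y in lborel. \<bar>x - snd (s, y)\<bar> \<noteq> t - fst (s, y)"
  proof (rule AE_I2)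
    fix s :: real
    show "AE y in lborel. \<bar>x - snd (s, y)\<bar> \<noteq> t - fst (s, y)"
      using AE_lborel_singleton[of "x - (t - s)"] AE_lborel_singleton[of "x + (t - s)"]
      by eventually_elim auto
  qed
qed

text \<open>
  The substitution \<open>u = exp (- t / 2) z\<close> removes the damping; it multiplies the source by \<open>exp (s / 2)\<close>.
\<close>

definition expw :: "(real \<Rightarrow> real \<Rightarrow> real) \<Rightarrow> real \<Rightarrow> real \<Rightarrow> real" where
  "expw F s y = exp (s / 2) * F s y"

lemma cone_source_expw:
  assumes F: "cone_source R T F"
  shows "cone_source R T (expw F)"
  unfolding cone_source_def
proof (intro conjI allI impI)
  note D = cone_sourceD[OF F]
  have [measurable]: "(\<lambda>m. F (fst m) (snd m)) \<in> borel_measurable (borel \<Otimes>\<^sub>M borel)"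
    using D(2) by (simp add: case_prod_beta')
  show "(\<lambda>(s, y). expw F s y) \<in> borel_measurable borel"
    unfolding expw_def case_prod_beta' borel_prod[symmetric] by simp
  obtain B where B: "\<And>s y. \<bar>F s y\<bar> \<le> B" using F unfolding cone_source_def by blast
  have "\<bar>expw F s y\<bar> \<le> exp (T / 2) * B" for s y
  proof (cases "F s y = 0")
    case True
    have "0 \<le> B" using B[of 0 0] by (rule order_trans[OF abs_ge_zero])
    then show ?thesis using True by (simp add: expw_def)
  next
    case False
    then have "exp (s / 2) \<le> exp (T / 2)" using D(5) by auto
    then show ?thesis using B[of s y] unfolding expw_def abs_mult by (intro mult_mono) auto
  qed
  then show "\<exists>B. \<forall>s y. \<bar>expw F s y\<bar> \<le> B" by blast
  fix s y
  show "continuous_on UNIV (expw F s)" unfolding expw_def[abs_def] by (intro continuous_intros D(4))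
  assume "expw F s y \<noteq> 0"
  then have "F s y \<noteq> 0" by (auto simp: expw_def)
  then show "0 \<le> s" "s \<le> T" "\<bar>y\<bar> \<le> R + s" using D(5) by auto
qed

lemma Nw_integrable:
  assumes G: "cone_source R T G"
  shows "integrable lborel (\<lambda>s. indicator {0..t} s * ((prim (G s) (x + (t - s)) - prim (G s) (x - (t - s))) / 2))"
proof -
  note D = cone_sourceD[OF G]
  obtain B where B: "\<And>s y. \<bar>G s y\<bar> \<le> B" using G unfolding cone_source_def by blast
  have B0: "0 \<le> B" using B[of 0 0] by (rule order_trans[OF abs_ge_zero])
  define A where "A s = indicator {0..t} s * ((prim (G s) (x + (t - s)) - prim (G s) (x - (t - s))) / 2)" for s
  have [measurable]: "(\<lambda>s. prim (G s) (x + (t - s))) \<in> borel_measurable borel" "(\<lambda>s. prim (G s) (x - (t - s))) \<in> borel_measurable borel"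
    by (rule prim_param_measurable[OF G], simp)+
  have iA: "integrable lborel A"
  proof (rule Bochner_Integration.integrable_bound)
    show "integrable lborel (\<lambda>s. (B * \<bar>t\<bar>) * indicator {0..t} s)" using integrable_indicator_Icc by simp
    show "A \<in> borel_measurable lborel" unfolding A_def by simp
    show "AE s in lborel. norm (A s) \<le> norm ((B * \<bar>t\<bar>) * indicator {0..t} s)"
    proof (rule AE_I2)
      fix s
      have "\<bar>prim (G s) (x + (t - s)) - prim (G s) (x - (t - s))\<bar> \<le> B * (2 * \<bar>t\<bar>)" if "s \<in> {0..t}"
      proof -
        have "\<bar>prim (G s) (x + (t - s)) - prim (G s) (x - (t - s))\<bar> \<le> B * \<bar>(x + (t - s)) - (x - (t - s))\<bar>"
          by (rule prim_lipschitz[OF D(4) D(6) B])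
        also have "\<dots> \<le> B * (2 * \<bar>t\<bar>)" using that B0 by (intro mult_left_mono) auto
        finally show ?thesis .
      qed
      then show "norm (A s) \<le> norm ((B * \<bar>t\<bar>) * indicator {0..t} s)"
        using B0 by (cases "s \<in> {0..t}") (auto simp: A_def abs_divide abs_mult)
    qed
  qed
  then show ?thesis unfolding A_def .
qed

lemma Nd_eq:
  assumes F: "cone_source R T F"
  shows "Nd F t x = exp (- t / 2) * (Nw (expw F) t x
    + 1 / 2 * (LINT m|(lborel \<Otimes>\<^sub>M lborel). hk 0 (t - fst m) (x - snd m) * expw F (fst m) (snd m)))"
    and "integrable lborel (\<lambda>s. indicator {0..t} s * (exp (- (t - s) / 2) * (Ker 0 (t - s) x (F s) / 2)))"
proof -
  define G where "G = expw F"
  have G: "cone_source R T G" unfolding G_def by (rule cone_source_expw[OF F])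
  note D = cone_sourceD[OF G] and DF = cone_sourceD[OF F]
  define A where "A s = indicator {0..t} s * ((prim (G s) (x + (t - s)) - prim (G s) (x - (t - s))) / 2)" for s
  define K where "K s = (LINT y|lborel. hk 0 (t - s) (x - y) * G s y)" for s
  have iA: "integrable lborel A" unfolding A_def[abs_def] by (rule Nw_integrable[OF G])
  have iP: "integrable (lborel \<Otimes>\<^sub>M lborel) (\<lambda>m. hk 0 (t - fst m) (x - snd m) * G (fst m) (snd m))"
  proof (rule Bochner_Integration.integrable_bound[OF integrable_mult_right[OF cone_source_integrable[OF G], of "hkC 0 \<bar>t\<bar>"]])
    have [measurable]: "(\<lambda>m. G (fst m) (snd m)) \<in> borel_measurable (lborel \<Otimes>\<^sub>M lborel)"
      using cone_source_integrable[OF G] by (rule borel_measurable_integrable)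
    show "(\<lambda>m. hk 0 (t - fst m) (x - snd m) * G (fst m) (snd m)) \<in> borel_measurable (lborel \<Otimes>\<^sub>M lborel)"
      by (intro borel_measurable_times hk_measurable) simp_all
    show "AE m in lborel \<Otimes>\<^sub>M lborel. norm (hk 0 (t - fst m) (x - snd m) * G (fst m) (snd m)) \<le> norm (hkC 0 \<bar>t\<bar> * G (fst m) (snd m))"
    proof (rule AE_I2)
      fix m :: "real \<times> real"
      show "norm (hk 0 (t - fst m) (x - snd m) * G (fst m) (snd m)) \<le> norm (hkC 0 \<bar>t\<bar> * G (fst m) (snd m))"
      proof (cases "G (fst m) (snd m) = 0")
        case False
        then have "t - fst m \<le> \<bar>t\<bar>" using D(5) by fastforce
        then have "\<bar>hk 0 (t - fst m) (x - snd m)\<bar> \<le> hkC 0 \<bar>t\<bar>" by (intro hk_bounds(1)[of _ _ 0]) auto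
        then show ?thesis using hkC_nonneg[of "\<bar>t\<bar>" 0] by (auto simp: abs_mult intro!: mult_right_mono)
      qed simp
    qed
  qed
  have iK: "integrable lborel K" using lborel_pair.integrable_fst'[OF iP] by (simp add: K_def[abs_def])
  have intK: "(LINT s|lborel. K s) = (LINT m|(lborel \<Otimes>\<^sub>M lborel). hk 0 (t - fst m) (x - snd m) * G (fst m) (snd m))"
    using lborel_pair.integral_fst'[OF iP] by (simp add: K_def)
  have pt: "indicator {0..t} s * (exp (- (t - s) / 2) * (Ker 0 (t - s) x (F s) / 2)) = exp (- t / 2) * (A s + 1 / 2 * K s)" for s
  proof -
    have Gs: "G s = (\<lambda>y. exp (s / 2) * F s y)" unfolding G_def expw_def[abs_def] ..
    consider "s < 0" | "s > t" | "0 \<le> s \<and> s \<le> t" by linarith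
    then show ?thesis
    proof cases
      case 1
      then have "G s = (\<lambda>_. 0)" using D(5)[of s] by force
      then show ?thesis using 1 by (simp add: A_def K_def)
    next
      case 2
      then have "hk 0 (t - s) (x - y) = 0" for y using hk_outside[of "t - s" "x - y" 0] by simp
      then show ?thesis using 2 by (simp add: A_def K_def)
    next
      case 3
      then have \<tau>: "t - s \<ge> 0" by simp
      have "Ker 0 (t - s) x (F s) = (prim (F s) (x + (t - s)) - prim (F s) (x - (t - s))) + (LINT y|lborel. hk 0 (t - s) (x - y) * F s y)"
        unfolding Ker_eq(1)[OF \<tau> DF(7)] by (simp add: bE_0)
      moreover have "K s = exp (s / 2) * (LINT y|lborel. hk 0 (t - s) (x - y) * F s y)"
        unfolding K_def Gs by (simp add: mult.left_commute)
      moreover have "prim (G s) z = exp (s / 2) * prim (F s) z" for z unfolding Gs by (rule prim_cmult)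
      moreover have "exp (- (t - s) / 2) = exp (- t / 2) * exp (s / 2)" by (simp add: exp_add[symmetric] diff_divide_distrib)
      ultimately show ?thesis using 3 by (simp only: A_def) (simp add: field_simps)
    qed
  qed
  show "integrable lborel (\<lambda>s. indicator {0..t} s * (exp (- (t - s) / 2) * (Ker 0 (t - s) x (F s) / 2)))"
    unfolding pt using iA iK by simp
  have "Nd F t x = (LINT s|lborel. exp (- t / 2) * (A s + 1 / 2 * K s))" unfolding Nd_def pt ..
  also have "\<dots> = exp (- t / 2) * ((LINT s|lborel. A s) + 1 / 2 * (LINT s|lborel. K s))" using iA iK by simp
  also have "(LINT s|lborel. A s) = Nw G t x" unfolding A_def Nw_def ..
  finally show "Nd F t x = exp (- t / 2) * (Nw (expw F) t x
    + 1 / 2 * (LINT m|(lborel \<Otimes>\<^sub>M lborel). hk 0 (t - fst m) (x - snd m) * expw F (fst m) (snd m)))"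
    unfolding intK G_def .
qed

lemma exp_factor_deriv: "((\<lambda>t. exp (- t / 2)) has_real_derivative (- exp (- t / 2) / 2)) (at t within I)"
  by (auto intro!: derivative_eq_intros)

lemma Nd_triple:
  assumes F: "cone_source R T0 F" and R: "R \<ge> 0" and T: "T \<ge> 0"
  shows "\<exists>a b. energy_triple {0..<T} (Nd F) a b" and "continuous_on ({-T..T} \<times> UNIV) (\<lambda>(t, x). Nd F t x)"
proof -
  define G where "G = expw F"
  have G: "cone_source R T0 G" unfolding G_def by (rule cone_source_expw[OF F])
  let ?J = "\<lambda>t x. LINT m|(lborel \<Otimes>\<^sub>M lborel). hk 0 (t - fst m) (x - snd m) * G (fst m) (snd m)"
  have E: "Nd F = (\<lambda>t x. exp (- t / 2) * (Nw G t x + 1 / 2 * ?J t x))"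
    unfolding G_def by (intro ext Nd_eq(1)[OF F])
  have J: "\<exists>a b. energy_triple {0..<T} ?J a b" "continuous_on ({-T..T} \<times> UNIV) (\<lambda>(t, x). ?J t x)"
    by (rule kernel_convolution_triple[OF _ _ cone_source_integrable[OF G] _ AE_off_cone T, of R];
        use cone_sourceD(5)[OF G] in auto)+
  obtain a1 b1 where 1: "energy_triple {0..<T} (Nw G) a1 b1" using Nw_triple(1)[OF G R T] by blast
  obtain a2 b2 where 2: "energy_triple {0..<T} ?J a2 b2" using J(1) by blast
  have c: "((\<lambda>t. 1 / 2) has_real_derivative 0) (at t within I)" for t :: real and I by simp
  show "\<exists>a b. energy_triple {0..<T} (Nd F) a b"
    unfolding E
    using energy_triple_mult[OF energy_triple_add[OF 1 energy_triple_mult[OF 2 c]] exp_factor_deriv]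
    by (fastforce intro!: continuous_intros)
  have "continuous_on ({-T..T} \<times> UNIV) (\<lambda>z. Nw G (fst z) (snd z))" "continuous_on ({-T..T} \<times> UNIV) (\<lambda>z. ?J (fst z) (snd z))"
    using Nw_triple(2)[OF G R T] J(2) by (simp_all add: case_prod_beta')
  then show "continuous_on ({-T..T} \<times> UNIV) (\<lambda>(t, x). Nd F t x)"
    unfolding E case_prod_beta' by (intro continuous_intros) auto
qed

subsection \<open>The linear solutions\<close>

text \<open>
  d'Alembert's formula and its damped analogue, for Borel data.
\<close>

definition vlin :: "(real \<Rightarrow> real) \<Rightarrow> (real \<Rightarrow> real) \<Rightarrow> real \<Rightarrow> real \<Rightarrow> real" where
  "vlin f g t x = (f (x + t) + f (x - t)) / 2 + (prim g (x + t) - prim g (x - t)) / 2"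

definition ulin :: "(real \<Rightarrow> real) \<Rightarrow> (real \<Rightarrow> real) \<Rightarrow> real \<Rightarrow> real \<Rightarrow> real" where
  "ulin f g t x = exp (- t / 2) * ((f (x + t) + f (x - t)) / 2
     + t / 16 * Ker 1 t x f + 1 / 2 * Ker 0 t x (\<lambda>y. g y + f y / 2))"

text \<open>
  Good representatives of data in \<open>H\<^sup>1 \<times> L\<^sup>2\<close> with support in \<open>{-R..R}\<close>: the position is a primitive of a function of
  integral \<open>0\<close>, hence itself supported there.
\<close>

definition nice_data :: "real \<Rightarrow> (real \<Rightarrow> real) \<Rightarrow> (real \<Rightarrow> real) \<Rightarrow> bool" where
  "nice_data R f g \<longleftrightarrow> sqint g \<and> (\<forall>x. \<bar>x\<bar> > R \<longrightarrow> g x = 0) \<and>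
     (\<exists>h. sqint h \<and> (\<forall>x. \<bar>x\<bar> > R \<longrightarrow> h x = 0) \<and> (LINT x|lborel. h x) = 0 \<and> f = prim h)"

lemma nice_dataD:
  assumes "nice_data R f g"
  shows "sqint g" "\<And>x. \<bar>x\<bar> > R \<Longrightarrow> g x = 0" "integrable lborel g"
    "continuous_on UNIV f" "\<And>x. \<bar>x\<bar> > R \<Longrightarrow> f x = 0" "sqint f" "integrable lborel f" "\<exists>B. \<forall>x. \<bar>f x\<bar> \<le> B"
proof -
  show g: "sqint g" "\<And>x. \<bar>x\<bar> > R \<Longrightarrow> g x = 0" using assms unfolding nice_data_def by auto
  show "integrable lborel g" by (rule sqint_integrable[OF g])
  obtain h where h: "sqint h" "\<And>x. \<bar>x\<bar> > R \<Longrightarrow> h x = 0" "(LINT x|lborel. h x) = 0" "f = prim h"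
    using assms unfolding nice_data_def by blast
  have ih: "integrable lborel h" by (rule sqint_integrable[OF h(1,2)])
  show c: "continuous_on UNIV f" unfolding h(4) by (rule prim_continuous[OF ih])
  show z: "f x = 0" if "\<bar>x\<bar> > R" for x
  proof (cases "x > 0")
    case True
    then show ?thesis unfolding h(4) using prim_eq_total[of R h x] h(2,3) that by auto
  next
    case False
    then show ?thesis unfolding h(4) using prim_eq_0[of R h x] h(2) that by auto
  qed
  show "sqint f" "integrable lborel f" "\<exists>B. \<forall>x. \<bar>f x\<bar> \<le> B"
    using integrable_cont_support[OF c z] by blast+
qed

text \<open>
  The solution is a sum of two travelling waves with profiles \<open>(h + g) / 2\<close> and \<open>(h - g) / 2\<close>, of total integral \<open>0\<close>.
\<close>

lemma dalembert_triple:
  assumes h: "sqint h" "\<And>x. \<bar>x\<bar> > R \<Longrightarrow> h x = 0" "(LINT x|lborel. h x) = 0"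
    and g: "sqint g" "\<And>x. \<bar>x\<bar> > R \<Longrightarrow> g x = 0"
  shows "\<exists>a b. energy_triple I (vlin (prim h) g) a b"
proof -
  have i: "integrable lborel h" "integrable lborel g" using sqint_integrable h g by blast+
  define h1 where "h1 x = (1 / 2) * h x + (1 / 2) * g x" for x
  define h2 where "h2 x = (1 / 2) * h x + (- 1 / 2) * g x" for x
  have p: "prim h1 x = (1 / 2) * prim h x + (1 / 2) * prim g x" "prim h2 x = (1 / 2) * prim h x + (- 1 / 2) * prim g x" for x
  proof -
    have j: "integrable lborel (\<lambda>x. c * h x)" "integrable lborel (\<lambda>x. c * g x)" for c using i by simp_all
    show "prim h1 x = (1 / 2) * prim h x + (1 / 2) * prim g x"
      unfolding h1_def using prim_add[OF j] by (simp only: prim_cmult)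
    show "prim h2 x = (1 / 2) * prim h x + (- 1 / 2) * prim g x"
      unfolding h2_def using prim_add[OF j] by (simp only: prim_cmult)
  qed
  have "energy_triple I (\<lambda>t x. prim h1 (x + t) + prim h2 (x - t)) (\<lambda>t x. h1 (x + t) + h2 (x - t)) (\<lambda>t x. h1 (x + t) - h2 (x - t))"
  proof (rule travelling_wave_triple)
    show "sqint h1" "sqint h2" unfolding h1_def h2_def by (intro sqint_add sqint_cmult h g)+
    show "h1 x = 0" "h2 x = 0" if "\<bar>x\<bar> > R" for x using h(2)[OF that] g(2)[OF that] by (auto simp: h1_def h2_def)
    show "(LINT x|lborel. h1 x) + (LINT x|lborel. h2 x) = 0" unfolding h1_def h2_def using i h(3) by simp
  qed
  then have "energy_triple I (vlin (prim h) g) (\<lambda>t x. h1 (x + t) + h2 (x - t)) (\<lambda>t x. h1 (x + t) - h2 (x - t))"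
    by (rule energy_triple_cong) (simp add: p vlin_def add_divide_distrib diff_divide_distrib)
  then show ?thesis by blast
qed

lemma vlin_triple: "nice_data R f g \<Longrightarrow> \<exists>a b. energy_triple I (vlin f g) a b"
  unfolding nice_data_def using dalembert_triple by blast

lemma continuous_on_compose_UNIV:
  "continuous_on UNIV (f :: real \<Rightarrow> real) \<Longrightarrow> continuous_on A k \<Longrightarrow> continuous_on A (\<lambda>z. f (k z))"
  by (rule continuous_on_compose2[of UNIV f]) auto

lemma vlin_continuous:
  assumes "nice_data R f g"
  shows "continuous_on A (\<lambda>(t, x). vlin f g t x)"
  unfolding vlin_def case_prod_beta'
  by (intro continuous_intros continuous_on_compose_UNIV[OF nice_dataD(4)[OF assms]]
      continuous_on_compose_UNIV[OF prim_continuous[OF nice_dataD(3)[OF assms]]]) simp_all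

lemma ulin_triple:
  assumes nd: "nice_data R f g" and T: "T \<ge> 0"
  shows "\<exists>a b. energy_triple {0..<T} (ulin f g) a b" and "continuous_on ({0..T} \<times> UNIV) (\<lambda>(t, x). ulin f g t x)"
proof -
  note D = nice_dataD[OF nd]
  obtain h where h: "sqint h" "\<And>x. \<bar>x\<bar> > R \<Longrightarrow> h x = 0" "(LINT x|lborel. h x) = 0" "f = prim h"
    using nd unfolding nice_data_def by blast
  define k where "k y = g y + (1 / 2) * f y" for y
  have k: "sqint k" "\<And>x. \<bar>x\<bar> > R \<Longrightarrow> k x = 0"
    unfolding k_def[abs_def] by (intro sqint_add sqint_cmult D) (simp add: D(2,5))
  have ik: "integrable lborel k" by (rule sqint_integrable[OF k])
  have z: "sqint (\<lambda>_. 0)" "(LINT x::real|lborel. (0::real)) = 0" by (simp_all add: sqint_def)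
  let ?C = "\<lambda>n H t x. LINT y|lborel. hk n (t - 0) (x - y) * H y"
  have E: "ulin f g t x = exp (- t / 2) * (vlin (prim h) k t x + (t / 16 * (2 * vlin (prim (\<lambda>_. 0)) f t x + ?C 1 f t x) + 1 / 2 * ?C 0 k t x))"
    if "t \<ge> 0" for t x
  proof -
    have kk: "(\<lambda>y. g y + f y / 2) = k" by (simp add: k_def[abs_def])
    show ?thesis unfolding ulin_def kk Ker_eq(1)[OF that D(7)] Ker_eq(1)[OF that ik] vlin_def h(4)[symmetric]
      by (simp add: bE_0 prim_def[of "\<lambda>_. 0"] field_simps)
  qed
  have ae: "AE y in lborel. \<bar>x - y\<bar> \<noteq> t - 0" for t x :: real
    using AE_lborel_singleton[of "x - t"] AE_lborel_singleton[of "x + t"] by eventually_elim auto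
  have C: "\<exists>a b. energy_triple {0..<T} (?C n H) a b" "continuous_on ({-T..T} \<times> UNIV) (\<lambda>(t, x). ?C n H t x)"
    if H: "integrable lborel H" "\<And>x. \<bar>x\<bar> > R \<Longrightarrow> H x = 0" for n H
    by (rule kernel_convolution_triple[OF _ _ H(1) _ ae T, of R]; use H(2) in \<open>auto simp: not_less[symmetric]\<close>)+
  have X1: "\<exists>a b. energy_triple {0..<T} (vlin (prim h) k) a b" by (rule dalembert_triple[OF h(1-3) k])
  have X2: "\<exists>a b. energy_triple {0..<T} (vlin (prim (\<lambda>_. 0)) f) a b"
    by (rule dalembert_triple[OF z(1) _ z(2) D(6), where R = R]) (simp_all add: D(5))
  have X3: "\<exists>a b. energy_triple {0..<T} (?C 1 f) a b" by (rule C(1)[OF D(7,5)])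
  have X4: "\<exists>a b. energy_triple {0..<T} (?C 0 k) a b" by (rule C(1)[OF ik k(2)])
  have c: "((\<lambda>t. c) has_real_derivative 0) (at t within I)" for t c :: real and I by simp
  have c16: "((\<lambda>t. t / 16) has_real_derivative (1 / 16)) (at t within I)" for t :: real and I
    by (auto intro!: derivative_eq_intros)
  have ex: "\<exists>a b. energy_triple {0..<T} (\<lambda>t x. c t * w t x) a b"
    if "\<exists>a b. energy_triple {0..<T} w a b" "\<And>t I. (c has_real_derivative c' t) (at t within I)" "continuous_on {0..<T} c'" for c c' w
    using energy_triple_mult[OF _ that(2,3)] that(1) by blast
  have ad: "\<exists>a b. energy_triple {0..<T} (\<lambda>t x. w t x + w' t x) a b"
    if "\<exists>a b. energy_triple {0..<T} w a b" "\<exists>a b. energy_triple {0..<T} w' a b" for w w'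
    using energy_triple_add that by blast
  have "\<exists>a b. energy_triple {0..<T} (\<lambda>t x. exp (- t / 2) * (vlin (prim h) k t x + (t / 16 * (2 * vlin (prim (\<lambda>_. 0)) f t x + ?C 1 f t x) + 1 / 2 * ?C 0 k t x))) a b"
    by (rule ex[OF ad[OF X1 ad[OF ex[OF ad[OF ex[OF X2 c] X3] c16] ex[OF X4 c]]] exp_factor_deriv])
      (auto intro!: continuous_intros)
  then obtain a b where ab: "energy_triple {0..<T} (\<lambda>t x. exp (- t / 2) * (vlin (prim h) k t x + (t / 16 * (2 * vlin (prim (\<lambda>_. 0)) f t x + ?C 1 f t x) + 1 / 2 * ?C 0 k t x))) a b"
    by blast
  have "energy_triple {0..<T} (ulin f g) a b" by (rule energy_triple_cong[OF ab]) (simp add: E)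
  then show "\<exists>a b. energy_triple {0..<T} (ulin f g) a b" by blast
  have cc: "continuous_on ({0..T} \<times> UNIV) (\<lambda>z. ?C n H (fst z) (snd z))" if "integrable lborel H" "\<And>x. \<bar>x\<bar> > R \<Longrightarrow> H x = 0" for n H
  proof -
    have "{0..T} \<times> UNIV \<subseteq> {-T..T} \<times> (UNIV :: real set)" using T by auto
    from continuous_on_subset[OF C(2)[OF that, of n] this] show ?thesis by (simp add: case_prod_beta')
  qed
  have v1: "continuous_on ({0..T} \<times> UNIV) (\<lambda>z. vlin (prim h) k (fst z) (snd z))"
    unfolding vlin_def h(4)[symmetric]
    by (intro continuous_intros continuous_on_compose_UNIV[OF D(4)] continuous_on_compose_UNIV[OF prim_continuous[OF ik]]) simp_all
  have v2: "continuous_on ({0..T} \<times> UNIV) (\<lambda>z. vlin (prim (\<lambda>_. 0)) f (fst z) (snd z))"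
    unfolding vlin_def prim_def[of "\<lambda>_. 0"]
    by (intro continuous_intros continuous_on_compose_UNIV[OF prim_continuous[OF D(7)]]) simp_all
  have "continuous_on ({0..T} \<times> UNIV) (\<lambda>z. exp (- fst z / 2) * (vlin (prim h) k (fst z) (snd z)
     + (fst z / 16 * (2 * vlin (prim (\<lambda>_. 0)) f (fst z) (snd z) + ?C 1 f (fst z) (snd z)) + 1 / 2 * ?C 0 k (fst z) (snd z))))"
    by (intro continuous_intros v1 v2 cc[OF D(7,5)] cc[OF ik k(2)]) simp_all
  then show "continuous_on ({0..T} \<times> UNIV) (\<lambda>(t, x). ulin f g t x)"
    by (rule continuous_on_eq) (auto simp: E)
qed

section \<open>Size of the kernels and decay of the linear solutions\<close>

lemma abs_integral_le:
  fixes f g :: "'a \<Rightarrow> real"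
  assumes "integrable M g" "\<And>x. \<bar>f x\<bar> \<le> g x"
  shows "\<bar>LINT x|M. f x\<bar> \<le> (LINT x|M. g x)"
proof (cases "integrable M f")
  case True
  have "\<bar>LINT x|M. f x\<bar> \<le> (LINT x|M. \<bar>f x\<bar>)" by (rule integral_abs_bound)
  also have "\<dots> \<le> (LINT x|M. g x)" using True assms by (intro integral_mono) auto
  finally show ?thesis .
next
  case False
  have "0 \<le> g x" for x using assms(2)[of x] by (rule order_trans[OF abs_ge_zero])
  then have "0 \<le> (LINT x|M. g x)" by (intro integral_nonneg_AE) auto
  then show ?thesis using False by (simp add: not_integrable_integral_eq)
qed

definition mass :: "nat \<Rightarrow> real \<Rightarrow> real" where
  "mass n \<tau> = (LINT z|lborel. indicator {-\<tau>..\<tau>} z * bE n ((\<tau>\<^sup>2 - z\<^sup>2) / 16))"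

lemma kernel_integrable: "integrable lborel (\<lambda>z. indicator {-\<tau>..\<tau>} z * bE n ((\<tau>\<^sup>2 - z\<^sup>2) / 16))"
proof -
  have "set_integrable lborel {-\<tau>..\<tau>} (\<lambda>z. bE n ((\<tau>\<^sup>2 - z\<^sup>2) / 16))"
    by (intro borel_integrable_atLeastAtMost' continuous_on_compose_UNIV[OF bE_continuous] continuous_intros) simp
  then show ?thesis by (simp add: set_integrable_def)
qed

lemma kernel_nonneg_le:
  assumes "\<tau> \<ge> 0"
  shows "0 \<le> indicator {-\<tau>..\<tau>} z * bE n ((\<tau>\<^sup>2 - z\<^sup>2) / 16)"
    "indicator {-\<tau>..\<tau>} z * bE n ((\<tau>\<^sup>2 - z\<^sup>2) / 16) \<le> bE n (\<tau>\<^sup>2 / 16)"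
proof -
  have "0 \<le> bE n (\<tau>\<^sup>2 / 16)" by (rule bE_nonneg) simp
  moreover have "0 \<le> bE n ((\<tau>\<^sup>2 - z\<^sup>2) / 16) \<and> bE n ((\<tau>\<^sup>2 - z\<^sup>2) / 16) \<le> bE n (\<tau>\<^sup>2 / 16)" if "z \<in> {-\<tau>..\<tau>}"
  proof -
    have "z\<^sup>2 \<le> \<tau>\<^sup>2" using that assms power_mono[of "\<bar>z\<bar>" \<tau> 2] by (auto simp: abs_le_iff)
    then show ?thesis by (intro conjI bE_nonneg bE_mono) (auto simp: divide_right_mono)
  qed
  ultimately show "0 \<le> indicator {-\<tau>..\<tau>} z * bE n ((\<tau>\<^sup>2 - z\<^sup>2) / 16)"
    "indicator {-\<tau>..\<tau>} z * bE n ((\<tau>\<^sup>2 - z\<^sup>2) / 16) \<le> bE n (\<tau>\<^sup>2 / 16)"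
    by (cases "z \<in> {-\<tau>..\<tau>}"; simp)+
qed

lemma kernel_translate:
  "indicator {x - \<tau>..x + \<tau>} y * bE n ((\<tau>\<^sup>2 - (x - y)\<^sup>2) / 16)
     = indicator {-\<tau>..\<tau>} (y - x) * bE n ((\<tau>\<^sup>2 - (y - x)\<^sup>2) / 16)"
  "indicator {x - \<tau>..x + \<tau>} y * bE n ((\<tau>\<^sup>2 - (x - y)\<^sup>2) / 16)
     = indicator {-\<tau>..\<tau>} (x - y) * bE n ((\<tau>\<^sup>2 - (x - y)\<^sup>2) / 16)"
proof -
  have "indicator {x - \<tau>..x + \<tau>} y = (indicator {-\<tau>..\<tau>} (y - x) :: real)" by (auto simp: indicator_def)
  then show "indicator {x - \<tau>..x + \<tau>} y * bE n ((\<tau>\<^sup>2 - (x - y)\<^sup>2) / 16)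
     = indicator {-\<tau>..\<tau>} (y - x) * bE n ((\<tau>\<^sup>2 - (y - x)\<^sup>2) / 16)"
    by (simp only: power2_commute[of x y])
  have "indicator {x - \<tau>..x + \<tau>} y = (indicator {-\<tau>..\<tau>} (x - y) :: real)" by (auto simp: indicator_def)
  then show "indicator {x - \<tau>..x + \<tau>} y * bE n ((\<tau>\<^sup>2 - (x - y)\<^sup>2) / 16)
     = indicator {-\<tau>..\<tau>} (x - y) * bE n ((\<tau>\<^sup>2 - (x - y)\<^sup>2) / 16)"
    by (simp only:)
qed

lemma kernel_integral_y:
  "integrable lborel (\<lambda>y. indicator {x - \<tau>..x + \<tau>} y * bE n ((\<tau>\<^sup>2 - (x - y)\<^sup>2) / 16))"
  "(LINT y|lborel. indicator {x - \<tau>..x + \<tau>} y * bE n ((\<tau>\<^sup>2 - (x - y)\<^sup>2) / 16)) = mass n \<tau>"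
proof -
  define k where "k z = indicator {-\<tau>..\<tau>} z * bE n ((\<tau>\<^sup>2 - z\<^sup>2) / 16)" for z
  have "integrable lborel k" unfolding k_def[abs_def] by (rule kernel_integrable)
  then have "integrable lborel (\<lambda>y. k (y + - x))" unfolding integrable_shift .
  moreover have "(LINT y|lborel. k (y + - x)) = mass n \<tau>" 
    unfolding integral_shift unfolding mass_def k_def ..
  moreover have "indicator {x - \<tau>..x + \<tau>} y * bE n ((\<tau>\<^sup>2 - (x - y)\<^sup>2) / 16) = k (y + - x)" for y
    unfolding k_def kernel_translate(1) by (simp only: diff_conv_add_uminus)
  ultimately show "integrable lborel (\<lambda>y. indicator {x - \<tau>..x + \<tau>} y * bE n ((\<tau>\<^sup>2 - (x - y)\<^sup>2) / 16))"
    "(LINT y|lborel. indicator {x - \<tau>..x + \<tau>} y * bE n ((\<tau>\<^sup>2 - (x - y)\<^sup>2) / 16)) = mass n \<tau>"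
    by (simp_all only:)
qed

lemma Ker_sup_source:
  assumes \<tau>: "\<tau> \<ge> 0" and H: "\<And>y. \<bar>H y\<bar> \<le> \<psi>"
  shows "\<bar>Ker n \<tau> x H\<bar> \<le> mass n \<tau> * \<psi>"
proof -
  have "\<bar>Ker n \<tau> x H\<bar> \<le> (LINT y|lborel. indicator {x - \<tau>..x + \<tau>} y * bE n ((\<tau>\<^sup>2 - (x - y)\<^sup>2) / 16) * \<psi>)"
    unfolding Ker_def
  proof (rule abs_integral_le)
    show "integrable lborel (\<lambda>y. indicator {x - \<tau>..x + \<tau>} y * bE n ((\<tau>\<^sup>2 - (x - y)\<^sup>2) / 16) * \<psi>)"
      using kernel_integral_y(1) by simp
    show "\<bar>indicator {x - \<tau>..x + \<tau>} y * bE n ((\<tau>\<^sup>2 - (x - y)\<^sup>2) / 16) * H y\<bar>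
        \<le> indicator {x - \<tau>..x + \<tau>} y * bE n ((\<tau>\<^sup>2 - (x - y)\<^sup>2) / 16) * \<psi>" for y
      unfolding kernel_translate(2) abs_mult[of _ "H y"] abs_of_nonneg[OF kernel_nonneg_le(1)[OF \<tau>]]
      by (rule mult_left_mono[OF H kernel_nonneg_le(1)[OF \<tau>]])
  qed
  then show ?thesis using kernel_integral_y(2) by simp
qed

lemma Ker_L1_source:
  assumes \<tau>: "\<tau> \<ge> 0" and m: "integrable lborel m" "\<And>y. \<bar>H y\<bar> \<le> m y"
  shows "\<bar>Ker n \<tau> x H\<bar> \<le> bE n (\<tau>\<^sup>2 / 16) * (LINT y|lborel. m y)"
proof -
  have "\<bar>Ker n \<tau> x H\<bar> \<le> (LINT y|lborel. bE n (\<tau>\<^sup>2 / 16) * m y)"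
    unfolding Ker_def
  proof (rule abs_integral_le)
    show "\<bar>indicator {x - \<tau>..x + \<tau>} y * bE n ((\<tau>\<^sup>2 - (x - y)\<^sup>2) / 16) * H y\<bar> \<le> bE n (\<tau>\<^sup>2 / 16) * m y" for y
      unfolding kernel_translate(2) abs_mult[of _ "H y"] abs_of_nonneg[OF kernel_nonneg_le(1)[OF \<tau>]]
      by (rule mult_mono[OF kernel_nonneg_le(2)[OF \<tau>] m(2) bE_nonneg]) simp_all
  qed (use m in simp)
  then show ?thesis by simp
qed

lemma Ker_abs_le:
  assumes \<tau>: "\<tau> \<ge> 0" and m: "integrable lborel m" "\<And>y. \<bar>H y\<bar> \<le> m y"
  shows "\<bar>Ker n \<tau> x H\<bar> \<le> Ker n \<tau> x m" "integrable lborel (\<lambda>y. indicator {x - \<tau>..x + \<tau>} y * bE n ((\<tau>\<^sup>2 - (x - y)\<^sup>2) / 16) * m y)"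
proof -
  show i: "integrable lborel (\<lambda>y. indicator {x - \<tau>..x + \<tau>} y * bE n ((\<tau>\<^sup>2 - (x - y)\<^sup>2) / 16) * m y)"
  proof -
    have "\<bar>indicator {x - \<tau>..x + \<tau>} y * bE n ((\<tau>\<^sup>2 - (x - y)\<^sup>2) / 16)\<bar> \<le> bE n (\<tau>\<^sup>2 / 16)" for y
      unfolding kernel_translate(2) abs_of_nonneg[OF kernel_nonneg_le(1)[OF \<tau>]] by (rule kernel_nonneg_le(2)[OF \<tau>])
    from integrable_mult_bounded[OF m(1) _ this] show ?thesis
      using borel_measurable_integrable[OF kernel_integral_y(1)] by (simp add: mult.commute)
  qed
  show "\<bar>Ker n \<tau> x H\<bar> \<le> Ker n \<tau> x m"
    unfolding Ker_def
  proof (rule abs_integral_le[OF i])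
    show "\<bar>indicator {x - \<tau>..x + \<tau>} y * bE n ((\<tau>\<^sup>2 - (x - y)\<^sup>2) / 16) * H y\<bar>
        \<le> indicator {x - \<tau>..x + \<tau>} y * bE n ((\<tau>\<^sup>2 - (x - y)\<^sup>2) / 16) * m y" for y
      unfolding kernel_translate(2) abs_mult[of _ "H y"] abs_of_nonneg[OF kernel_nonneg_le(1)[OF \<tau>]]
      by (rule mult_left_mono[OF m(2) kernel_nonneg_le(1)[OF \<tau>]])
  qed
qed

lemma mass_nonneg: "\<tau> \<ge> 0 \<Longrightarrow> 0 \<le> mass n \<tau>"
  unfolding mass_def by (rule integral_nonneg_AE) (simp only: kernel_nonneg_le(1) AE_I2)

text \<open>
  Tonelli: convolution multiplies masses.
\<close>

lemma Ker_nn_integral: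
  assumes \<tau>: "\<tau> \<ge> 0" and m: "integrable lborel m" "\<And>y. 0 \<le> m y"
  shows "(\<integral>\<^sup>+x. ennreal (Ker n \<tau> x m) \<partial>lborel) = ennreal (mass n \<tau> * (LINT y|lborel. m y))"
proof -
  have mm: "\<bar>m y\<bar> \<le> m y" for y using m(2)[of y] by simp
  have [measurable]: "m \<in> borel_measurable borel" using borel_measurable_integrable[OF m(1)] by simp
  define k where "k z = indicator {-\<tau>..\<tau>} z * bE n ((\<tau>\<^sup>2 - z\<^sup>2) / 16)" for z
  have k0: "0 \<le> k z" for z unfolding k_def by (rule kernel_nonneg_le(1)[OF \<tau>])
  have ik: "integrable lborel k" unfolding k_def[abs_def] by (rule kernel_integrable)
  have [measurable]: "k \<in> borel_measurable borel" using borel_measurable_integrable[OF ik] by simp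
  have "ennreal (Ker n \<tau> x m) = (\<integral>\<^sup>+y. ennreal (k (x - y) * m y) \<partial>lborel)" for x
  proof -
    have "(\<integral>\<^sup>+y. ennreal (k (x - y) * m y) \<partial>lborel) = ennreal (LINT y|lborel. k (x - y) * m y)"
      using Ker_abs_le(2)[OF \<tau> m(1) mm, of x n] k0 m(2)
      unfolding kernel_translate(2) k_def[symmetric] by (intro nn_integral_eq_integral) auto
    then show ?thesis unfolding Ker_def kernel_translate(2) k_def[symmetric] by simp
  qed
  then have "(\<integral>\<^sup>+x. ennreal (Ker n \<tau> x m) \<partial>lborel) = (\<integral>\<^sup>+x. (\<integral>\<^sup>+y. ennreal (k (x - y) * m y) \<partial>lborel) \<partial>lborel)" by simp
  also have "\<dots> = (\<integral>\<^sup>+y. (\<integral>\<^sup>+x. ennreal (k (x - y) * m y) \<partial>lborel) \<partial>lborel)"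
    by (rule lborel_pair.Fubini'[symmetric]) measurable
  also have "\<dots> = (\<integral>\<^sup>+y. ennreal (mass n \<tau> * m y) \<partial>lborel)"
  proof (rule nn_integral_cong)
    fix y :: real
    have "integrable lborel (\<lambda>x. k (x - y) * m y)" using integrable_shift[of k "- y"] ik by simp
    then have "(\<integral>\<^sup>+x. ennreal (k (x - y) * m y) \<partial>lborel) = ennreal (LINT x|lborel. k (x - y) * m y)"
      using k0 m(2) by (intro nn_integral_eq_integral) auto
    also have "(LINT x|lborel. k (x - y) * m y) = mass n \<tau> * m y"
      using integral_shift[of k "- y"] by (simp add: mass_def k_def[abs_def])
    finally show "(\<integral>\<^sup>+x. ennreal (k (x - y) * m y) \<partial>lborel) = ennreal (mass n \<tau> * m y)" .
  qed
  also have "\<dots> = ennreal (LINT y|lborel. mass n \<tau> * m y)"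
    using m mass_nonneg[OF \<tau>, of n] by (intro nn_integral_eq_integral) auto
  finally show ?thesis by simp
qed

text \<open>
  The supremum of the source is multiplied by \<open>exp (- \<tau> / 2)\<close> times half the mass of the kernel, which is at most
  \<open>2\<close>. So, in contrast to the undamped equation, there is no loss of a factor \<open>t\<close>.
\<close>

lemma Nd_bound:
  assumes \<psi>: "integrable lborel (\<lambda>s. indicator {0..t} s * \<psi> s)"
    and F: "\<And>s y. 0 \<le> s \<Longrightarrow> s \<le> t \<Longrightarrow> \<bar>F s y\<bar> \<le> \<psi> s"
  shows "\<bar>Nd F t x\<bar> \<le> 2 * (LINT s|lborel. indicator {0..t} s * \<psi> s)"
proof -
  have "\<bar>Nd F t x\<bar> \<le> (LINT s|lborel. 2 * (indicator {0..t} s * \<psi> s))"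
    unfolding Nd_def
  proof (rule abs_integral_le)
    fix s
    show "\<bar>indicator {0..t} s * (exp (- (t - s) / 2) * (Ker 0 (t - s) x (F s) / 2))\<bar> \<le> 2 * (indicator {0..t} s * \<psi> s)"
    proof (cases "s \<in> {0..t}")
      case True
      then have \<tau>: "t - s \<ge> 0" by simp
      have \<psi>0: "0 \<le> \<psi> s" using F[of s 0] True by (auto intro: order_trans[OF abs_ge_zero])
      have "\<bar>Ker 0 (t - s) x (F s)\<bar> \<le> mass 0 (t - s) * \<psi> s" using F True by (intro Ker_sup_source \<tau>) auto
      also have "\<dots> \<le> (4 * exp ((t - s) / 2)) * \<psi> s"
        using bE_0_mass[OF \<tau>] \<psi>0 unfolding mass_def by (intro mult_right_mono)
      finally have "exp (- (t - s) / 2) * \<bar>Ker 0 (t - s) x (F s)\<bar> \<le> exp (- (t - s) / 2) * ((4 * exp ((t - s) / 2)) * \<psi> s)"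
        by (intro mult_left_mono) auto
      also have "\<dots> = 4 * \<psi> s"
      proof -
        have ee: "exp (- (t - s) / 2) * exp ((t - s) / 2) = 1"
          unfolding divide_minus_left by (simp only: mult.commute[of "exp (- ((t - s) / 2))"] exp_minus_inverse)
        have "exp (- (t - s) / 2) * ((4 * exp ((t - s) / 2)) * \<psi> s) = 4 * \<psi> s * (exp (- (t - s) / 2) * exp ((t - s) / 2))"
          by (simp only: mult_ac)
        then show ?thesis unfolding ee by simp
      qed
      finally show ?thesis using True by (simp add: abs_mult)
    qed simp
  qed (use \<psi> in simp)
  then show ?thesis by simp
qed

text \<open>
  The height of d'Alembert's kernel is \<open>1 / 2\<close>.
\<close>

lemma Nw_bound_L1:
  assumes F: "cone_source R T F" and \<phi>: "integrable lborel (\<lambda>s. indicator {0..t} s * \<phi> s)"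
    and b: "\<And>s. 0 \<le> s \<Longrightarrow> s \<le> t \<Longrightarrow> (LINT y|lborel. \<bar>F s y\<bar>) \<le> \<phi> s"
  shows "\<bar>Nw F t x\<bar> \<le> 1 / 2 * (LINT s|lborel. indicator {0..t} s * \<phi> s)"
proof -
  have "\<bar>Nw F t x\<bar> \<le> (LINT s|lborel. 1 / 2 * (indicator {0..t} s * \<phi> s))"
    unfolding Nw_def
  proof (rule abs_integral_le)
    fix s
    show "\<bar>indicator {0..t} s * ((prim (F s) (x + (t - s)) - prim (F s) (x - (t - s))) / 2)\<bar> \<le> 1 / 2 * (indicator {0..t} s * \<phi> s)"
    proof (cases "s \<in> {0..t}")
      case True
      note i = cone_sourceD(7)[OF F, of s]
      have "prim (F s) (x + (t - s)) - prim (F s) (x - (t - s)) = (LINT z|lborel. indicator {x - (t - s)<..x + (t - s)} z * F s z)"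
        using True by (intro prim_diff i) auto
      also have "\<bar>\<dots>\<bar> \<le> (LINT z|lborel. \<bar>F s z\<bar>)"
        using i by (intro abs_integral_le) (auto simp: indicator_def)
      also have "\<dots> \<le> \<phi> s" using b True by auto
      finally show ?thesis using True by (simp add: abs_divide)
    qed simp
  qed (use \<phi> in simp)
  then show ?thesis by simp
qed

lemma Nw_bound_sup:
  assumes F: "cone_source R T F" and \<psi>: "integrable lborel (\<lambda>s. indicator {0..t} s * \<psi> s)"
    and b: "\<And>s y. 0 \<le> s \<Longrightarrow> s \<le> t \<Longrightarrow> \<bar>F s y\<bar> \<le> \<psi> s"
  shows "\<bar>Nw F t x\<bar> \<le> t * (LINT s|lborel. indicator {0..t} s * \<psi> s)"
proof -
  have "\<bar>Nw F t x\<bar> \<le> (LINT s|lborel. t * (indicator {0..t} s * \<psi> s))"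
    unfolding Nw_def
  proof (rule abs_integral_le)
    fix s
    show "\<bar>indicator {0..t} s * ((prim (F s) (x + (t - s)) - prim (F s) (x - (t - s))) / 2)\<bar> \<le> t * (indicator {0..t} s * \<psi> s)"
    proof (cases "s \<in> {0..t}")
      case True
      have \<psi>0: "0 \<le> \<psi> s" using b[of s 0] True by (auto intro: order_trans[OF abs_ge_zero])
      have "\<bar>prim (F s) (x + (t - s)) - prim (F s) (x - (t - s))\<bar> \<le> \<psi> s * \<bar>(x + (t - s)) - (x - (t - s))\<bar>"
        using b True by (intro prim_lipschitz[OF cone_sourceD(4)[OF F] cone_sourceD(6)[OF F]]) auto
      also have "\<dots> \<le> \<psi> s * (2 * t)" using True \<psi>0 by (intro mult_left_mono) auto
      finally show ?thesis using True by (simp add: abs_divide mult_ac)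
    qed simp
  qed (use \<psi> in simp)
  then show ?thesis by simp
qed

subsection \<open>Linear decay\<close>

lemma exp_half_decay: "t \<ge> 0 \<Longrightarrow> exp (- t / 2) \<le> 1 / sqrt (1 + t)"
proof -
  assume t: "t \<ge> 0"
  have "sqrt (1 + t) \<le> sqrt ((exp (t / 2))\<^sup>2)"
    using exp_ge_add_one_self[of t] by (intro real_sqrt_le_mono) (simp add: exp_double[symmetric])
  then have "sqrt (1 + t) \<le> exp (t / 2)" by simp
  then have "1 / exp (t / 2) \<le> 1 / sqrt (1 + t)" using t by (intro divide_left_mono) auto
  moreover have "exp (- t / 2) = 1 / exp (t / 2)"
    unfolding divide_minus_left exp_minus by (rule inverse_eq_divide)
  ultimately show ?thesis by simp
qed

lemma ennreal_combination:
  assumes "0 \<le> a1" "0 \<le> a2" "0 \<le> a3" "0 \<le> a4" "0 \<le> b1" "0 \<le> b2" "0 \<le> b3" "0 \<le> b4"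
  shows "ennreal (a1 * b1 + a2 * b2 + a3 * b3 + a4 * b4)
    = ennreal a1 * ennreal b1 + ennreal a2 * ennreal b2 + ennreal a3 * ennreal b3 + ennreal a4 * ennreal b4"
  using assms by (simp only: ennreal_plus ennreal_mult mult_nonneg_nonneg add_nonneg_nonneg)

lemma nn_integral_combination:
  assumes [measurable]: "f1 \<in> borel_measurable M" "f2 \<in> borel_measurable M" "f3 \<in> borel_measurable M" "f4 \<in> borel_measurable M"
  shows "(\<integral>\<^sup>+x. c1 * f1 x + c2 * f2 x + c3 * f3 x + c4 * f4 x \<partial>M)
    = c1 * (\<integral>\<^sup>+x. f1 x \<partial>M) + c2 * (\<integral>\<^sup>+x. f2 x \<partial>M) + c3 * (\<integral>\<^sup>+x. f3 x \<partial>M) + c4 * (\<integral>\<^sup>+x. f4 x \<partial>M)"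
  by (subst nn_integral_add, measurable)+ (simp only: nn_integral_cmult assms)

text \<open>
  Each of the four contributions to the linear damped solution (the two transported copies of \<open>f\<close>, and the kernels of
  \<open>f\<close> and of \<open>g + f / 2\<close>) is bounded in the supremum norm by the decay of the kernel and in \<open>L\<^sup>1\<close> by its
  mass; the transported copies even decay exponentially.
\<close>

lemma ulin_estimates:
  assumes nd: "nice_data R f g"
  shows "\<exists>A L. A > 0 \<and> L > 0 \<and> (\<forall>t\<ge>0. \<forall>x. \<bar>ulin f g t x\<bar> \<le> A / sqrt (1 + t)) \<and>
     (\<forall>t\<ge>0. (\<integral>\<^sup>+x. ennreal \<bar>ulin f g t x\<bar> \<partial>lborel) \<le> ennreal L)"
proof -
  note D = nice_dataD[OF nd]
  obtain B where B: "\<And>x. \<bar>f x\<bar> \<le> B" using D(8) by blast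
  have B0: "0 \<le> B" using B[of 0] by (rule order_trans[OF abs_ge_zero])
  define m where "m y = \<bar>f y\<bar> + \<bar>g y\<bar>" for y
  have im: "integrable lborel m" unfolding m_def[abs_def] using D by auto
  have m0: "0 \<le> m y" for y by (simp add: m_def)
  have m1: "\<bar>f y\<bar> \<le> m y" "\<bar>g y + f y / 2\<bar> \<le> m y" for y unfolding m_def by (auto simp: abs_if)
  define I where "I = (LINT y|lborel. m y)"
  have I0: "0 \<le> I" unfolding I_def using m0 by (intro integral_nonneg_AE) auto
  have If0: "0 \<le> (LINT y|lborel. \<bar>f y\<bar>)" by (intro integral_nonneg_AE) auto
  have le: "\<bar>ulin f g t x\<bar> \<le> exp (- t / 2) * ((\<bar>f (x + t)\<bar> + \<bar>f (x - t)\<bar>) / 2 + t / 16 * \<bar>Ker 1 t x f\<bar> + 1 / 2 * \<bar>Ker 0 t x (\<lambda>y. g y + f y / 2)\<bar>)"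
    if t: "t \<ge> 0" for t x
  proof -
    have "\<bar>(f (x + t) + f (x - t)) / 2 + t / 16 * Ker 1 t x f + 1 / 2 * Ker 0 t x (\<lambda>y. g y + f y / 2)\<bar>
      \<le> \<bar>(f (x + t) + f (x - t)) / 2\<bar> + \<bar>t / 16 * Ker 1 t x f\<bar> + \<bar>1 / 2 * Ker 0 t x (\<lambda>y. g y + f y / 2)\<bar>" by linarith
    also have "\<bar>(f (x + t) + f (x - t)) / 2\<bar> \<le> (\<bar>f (x + t)\<bar> + \<bar>f (x - t)\<bar>) / 2" by (simp add: abs_divide)
    also have "\<bar>t / 16 * Ker 1 t x f\<bar> = t / 16 * \<bar>Ker 1 t x f\<bar>" using t by (simp add: abs_mult)
    also have "\<bar>1 / 2 * Ker 0 t x (\<lambda>y. g y + f y / 2)\<bar> = 1 / 2 * \<bar>Ker 0 t x (\<lambda>y. g y + f y / 2)\<bar>" by (simp add: abs_mult)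
    finally show ?thesis unfolding ulin_def abs_mult by (simp add: mult_left_mono)
  qed
  have sup: "\<bar>ulin f g t x\<bar> \<le> (B + 3 * I + 1) / sqrt (1 + t)" if t: "t \<ge> 0" for t x
  proof -
    have b0: "0 \<le> bE 0 (t\<^sup>2 / 16)" by (rule bE_nonneg) simp
    have "t / 16 * \<bar>Ker 1 t x f\<bar> \<le> t / 16 * (bE 1 (t\<^sup>2 / 16) * I)"
      unfolding I_def using t by (intro mult_left_mono Ker_L1_source im m1(1)) auto
    also have "\<dots> \<le> bE 0 (t\<^sup>2 / 16) * I" using mult_right_mono[OF bE_1_le_bE_0[OF t] I0] by simp
    finally have 1: "t / 16 * \<bar>Ker 1 t x f\<bar> \<le> bE 0 (t\<^sup>2 / 16) * I" .
    have 2: "\<bar>Ker 0 t x (\<lambda>y. g y + f y / 2)\<bar> \<le> bE 0 (t\<^sup>2 / 16) * I"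
      unfolding I_def using t by (intro Ker_L1_source im m1(2)) auto
    have 3: "(\<bar>f (x + t)\<bar> + \<bar>f (x - t)\<bar>) / 2 \<le> B" using B[of "x + t"] B[of "x - t"] by simp
    have "\<bar>ulin f g t x\<bar> \<le> exp (- t / 2) * (B + 3 / 2 * (bE 0 (t\<^sup>2 / 16) * I))"
    proof (rule order_trans[OF le[OF t]], rule mult_left_mono)
      show "(\<bar>f (x + t)\<bar> + \<bar>f (x - t)\<bar>) / 2 + t / 16 * \<bar>Ker 1 t x f\<bar> + 1 / 2 * \<bar>Ker 0 t x (\<lambda>y. g y + f y / 2)\<bar>
        \<le> B + 3 / 2 * (bE 0 (t\<^sup>2 / 16) * I)"
        using 1 2 3 by linarith
    qed simp
    also have "\<dots> = exp (- t / 2) * B + 3 / 2 * (exp (- t / 2) * bE 0 (t\<^sup>2 / 16)) * I" by (simp add: algebra_simps)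
    also have "\<dots> \<le> 1 / sqrt (1 + t) * B + 3 / 2 * (2 / sqrt (1 + t)) * I"
      using exp_half_decay[OF t] damped_kernel_decay[OF t] B0 I0 by (intro add_mono mult_right_mono mult_left_mono) auto
    also have "\<dots> = (B + 3 * I) / sqrt (1 + t)" by (simp add: add_divide_distrib)
    also have "\<dots> \<le> (B + 3 * I + 1) / sqrt (1 + t)" using t by (intro divide_right_mono) auto
    finally show ?thesis .
  qed
  have L1: "(\<integral>\<^sup>+x. ennreal \<bar>ulin f g t x\<bar> \<partial>lborel) \<le> ennreal ((LINT y|lborel. \<bar>f y\<bar>) + 3 * I + 1)" if t: "t \<ge> 0" for t
  proof -
    define J where "J = (LINT y|lborel. \<bar>f y\<bar>)"
    have fm [measurable]: "f \<in> borel_measurable borel" by (rule borel_measurable_continuous_onI[OF D(4)])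
    have ia: "integrable lborel (\<lambda>x. \<bar>f (x + c)\<bar>)" "(LINT x|lborel. \<bar>f (x + c)\<bar>) = J" for c
      using integrable_shift[of "\<lambda>x. \<bar>f x\<bar>" c] integral_shift[of "\<lambda>x. \<bar>f x\<bar>" c] D(7) by (simp_all add: J_def)
    have nf: "(\<integral>\<^sup>+x. ennreal \<bar>f (x + c)\<bar> \<partial>lborel) = ennreal J" for c
      using nn_integral_eq_integral[OF ia(1)[of c]] ia(2)[of c] by simp
    have J0: "0 \<le> J" using If0 by (simp add: J_def)
    have K0: "0 \<le> Ker n t x m" for n x
    proof -
      have "\<bar>m y\<bar> \<le> m y" for y using m0[of y] by simp
      from Ker_abs_le(1)[OF t im this, of n x] show ?thesis by linarith
    qed
    have mK [measurable]: "(\<lambda>x. Ker n t x m) \<in> borel_measurable borel" for n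
    proof -
      have "(\<lambda>x. LINT y|lborel. hk n t (x - y) * m y) \<in> borel_measurable borel"
      proof -
        have [measurable]: "m \<in> borel_measurable borel" using borel_measurable_integrable[OF im] by simp
        have "(\<lambda>(x, y). hk n t (x - y) * m y) \<in> borel_measurable (borel \<Otimes>\<^sub>M lborel)"
          unfolding case_prod_beta' by (intro borel_measurable_times hk_measurable) simp_all
        then show ?thesis by (rule lborel.borel_measurable_lebesgue_integral)
      qed
      moreover have "(\<lambda>x. prim m (x + c)) \<in> borel_measurable borel" for c
        by (intro borel_measurable_continuous_onI continuous_on_compose_UNIV[OF prim_continuous[OF im]] continuous_intros)
      from this[of t] this[of "- t"] have "(\<lambda>x. bE n 0 * (prim m (x + t) - prim m (x - t))) \<in> borel_measurable borel" by simp
      ultimately show ?thesis unfolding Ker_eq(1)[OF t im] by simp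
    qed
    define e where "e = exp (- t / 2)"
    have e: "0 \<le> e" "e \<le> 1" using t by (auto simp: e_def)
    have "(\<integral>\<^sup>+x. ennreal \<bar>ulin f g t x\<bar> \<partial>lborel)
      \<le> (\<integral>\<^sup>+x. ennreal (1 / 2) * ennreal \<bar>f (x + t)\<bar> + ennreal (1 / 2) * ennreal \<bar>f (x + (- t))\<bar>
           + ennreal (e * (t / 16)) * ennreal (Ker 1 t x m) + ennreal (e / 2) * ennreal (Ker 0 t x m) \<partial>lborel)"
    proof (rule nn_integral_mono)
      fix x :: real
      have "\<bar>ulin f g t x\<bar> \<le> e * ((\<bar>f (x + t)\<bar> + \<bar>f (x - t)\<bar>) / 2 + t / 16 * Ker 1 t x m + 1 / 2 * Ker 0 t x m)"
        unfolding e_def using Ker_abs_le(1)[OF t im m1(1), of 1 x] Ker_abs_le(1)[OF t im m1(2), of 0 x] t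
        by (intro order_trans[OF le[OF t]] mult_left_mono add_mono) auto
      also have "\<dots> = e * ((\<bar>f (x + t)\<bar> + \<bar>f (x - t)\<bar>) / 2) + e * (t / 16) * Ker 1 t x m + e / 2 * Ker 0 t x m"
        by (simp add: algebra_simps)
      also have "\<dots> \<le> 1 * ((\<bar>f (x + t)\<bar> + \<bar>f (x - t)\<bar>) / 2) + e * (t / 16) * Ker 1 t x m + e / 2 * Ker 0 t x m"
        using mult_right_mono[OF e(2), of "(\<bar>f (x + t)\<bar> + \<bar>f (x - t)\<bar>) / 2"] by simp
      also have "\<dots> = 1 / 2 * \<bar>f (x + t)\<bar> + 1 / 2 * \<bar>f (x + (- t))\<bar> + e * (t / 16) * Ker 1 t x m + e / 2 * Ker 0 t x m"
        by (simp add: add_divide_distrib)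
      finally have "ennreal \<bar>ulin f g t x\<bar> \<le> ennreal (1 / 2 * \<bar>f (x + t)\<bar> + 1 / 2 * \<bar>f (x + (- t))\<bar> + e * (t / 16) * Ker 1 t x m + e / 2 * Ker 0 t x m)"
        by (rule ennreal_leI)
      also have "\<dots> = ennreal (1 / 2) * ennreal \<bar>f (x + t)\<bar> + ennreal (1 / 2) * ennreal \<bar>f (x + (- t))\<bar>
           + ennreal (e * (t / 16)) * ennreal (Ker 1 t x m) + ennreal (e / 2) * ennreal (Ker 0 t x m)"
        using e t K0 by (intro ennreal_combination) simp_all
      finally show "ennreal \<bar>ulin f g t x\<bar> \<le> ennreal (1 / 2) * ennreal \<bar>f (x + t)\<bar> + ennreal (1 / 2) * ennreal \<bar>f (x + (- t))\<bar>
           + ennreal (e * (t / 16)) * ennreal (Ker 1 t x m) + ennreal (e / 2) * ennreal (Ker 0 t x m)" .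
    qed
    also have "\<dots> = ennreal (1 / 2) * ennreal J + ennreal (1 / 2) * ennreal J
        + ennreal (e * (t / 16)) * ennreal (mass 1 t * I) + ennreal (e / 2) * ennreal (mass 0 t * I)"
      unfolding nf[of t, symmetric] I_def Ker_nn_integral[OF t im m0, symmetric]
      by (subst nn_integral_combination) (simp_all only: nf[of t] nf[of "- t"], measurable)
    also have "\<dots> = ennreal (1 / 2 * J + 1 / 2 * J + e * (t / 16) * (mass 1 t * I) + e / 2 * (mass 0 t * I))"
      using e t J0 I0 mass_nonneg[OF t] by (intro ennreal_combination[symmetric]) simp_all
    also have "\<dots> \<le> ennreal (J + 3 * I + 1)"
    proof (rule ennreal_leI)
      have ee: "e * exp (t / 2) = 1" by (simp add: e_def exp_minus)
      have "e * (t / 16 * mass 1 t) \<le> e * exp (t / 2)" using bE_1_mass[OF t] e unfolding mass_def by (intro mult_left_mono) auto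
      then have "e * (t / 16) * mass 1 t \<le> 1" by (simp add: ee mult.assoc)
      then have "e * (t / 16) * mass 1 t * I \<le> 1 * I" using I0 by (rule mult_right_mono)
      then have 1: "e * (t / 16) * (mass 1 t * I) \<le> I" by (simp add: mult.assoc)
      have "e * mass 0 t \<le> e * (4 * exp (t / 2))" using bE_0_mass[OF t] e unfolding mass_def by (intro mult_left_mono) auto
      then have "e * mass 0 t \<le> 4" using ee by simp
      then have "e * mass 0 t * I \<le> 4 * I" using I0 by (rule mult_right_mono)
      then have 2: "e / 2 * (mass 0 t * I) \<le> 2 * I" by (simp add: mult.assoc)
      show "1 / 2 * J + 1 / 2 * J + e * (t / 16) * (mass 1 t * I) + e / 2 * (mass 0 t * I) \<le> J + 3 * I + 1"
        using 1 2 by linarith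
    qed
    finally show ?thesis by (simp add: J_def)
  qed
  show ?thesis
  proof (intro exI conjI allI impI)
    show "0 < B + 3 * I + 1" "0 < (LINT y|lborel. \<bar>f y\<bar>) + 3 * I + 1" using B0 I0 If0 by linarith+
  qed (use sup L1 in auto)
qed

section \<open>The nonlinear iteration\<close>

text \<open>
  Interpolation: \<open>|u|^q \<le> (sup |u|)^(q - 1) |u|\<close>.
\<close>

lemma ulin_Lq:
  assumes nd: "nice_data R f g" and q: "q > 1"
  shows "\<exists>C>0. \<forall>t\<ge>0. integrable lborel (\<lambda>x. \<bar>ulin f g t x\<bar> powr q) \<and>
     (LINT x|lborel. \<bar>ulin f g t x\<bar> powr q) \<le> C * (1 + t) powr (- ((q - 1) / 2))"
proof -
  obtain A L where AL: "A > 0" "L > 0" "\<And>t x. t \<ge> 0 \<Longrightarrow> \<bar>ulin f g t x\<bar> \<le> A / sqrt (1 + t)"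
    "\<And>t. t \<ge> 0 \<Longrightarrow> (\<integral>\<^sup>+x. ennreal \<bar>ulin f g t x\<bar> \<partial>lborel) \<le> ennreal L"
    using ulin_estimates[OF nd] by blast
  show ?thesis
  proof (intro exI[of _ "A powr (q - 1) * L"] conjI allI impI)
    show "0 < A powr (q - 1) * L" using AL by simp
    fix t :: real assume t: "t \<ge> 0"
    define K where "K = A powr (q - 1) * (1 + t) powr (- ((q - 1) / 2))"
    have K: "K = (A / sqrt (1 + t)) powr (q - 1)"
    proof -
      have "(A / sqrt (1 + t)) powr (q - 1) = A powr (q - 1) / ((1 + t) powr (1 / 2)) powr (q - 1)"
        using AL t by (simp add: powr_divide powr_half_sqrt)
      also have "\<dots> = K" by (simp add: K_def powr_powr powr_minus_divide mult.commute)
      finally show ?thesis ..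
    qed
    have K0: "0 \<le> K" by (simp add: K_def)
    have "continuous_on UNIV (ulin f g t)"
      using continuous_slice[OF ulin_triple(2)[OF nd t], of t] t by simp
    then have [measurable]: "ulin f g t \<in> borel_measurable borel" by (rule borel_measurable_continuous_onI)
    have pt: "\<bar>ulin f g t x\<bar> powr q \<le> K * \<bar>ulin f g t x\<bar>" for x
    proof -
      have "\<bar>ulin f g t x\<bar> powr q = \<bar>ulin f g t x\<bar> powr (q - 1) * \<bar>ulin f g t x\<bar>"
        by (cases "ulin f g t x = 0") (simp_all add: powr_diff)
      also have "\<dots> \<le> K * \<bar>ulin f g t x\<bar>"
        unfolding K using AL(3)[OF t, of x] q by (intro mult_right_mono powr_mono2) auto
      finally show ?thesis .
    qed
    have "(\<integral>\<^sup>+x. ennreal (\<bar>ulin f g t x\<bar> powr q) \<partial>lborel) \<le> (\<integral>\<^sup>+x. ennreal K * ennreal \<bar>ulin f g t x\<bar> \<partial>lborel)"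
      using pt K0 by (intro nn_integral_mono) (simp add: ennreal_mult[symmetric] ennreal_leI)
    also have "\<dots> = ennreal K * (\<integral>\<^sup>+x. ennreal \<bar>ulin f g t x\<bar> \<partial>lborel)" by (rule nn_integral_cmult) measurable
    also have "\<dots> \<le> ennreal K * ennreal L" by (intro mult_left_mono AL(4) t) simp
    also have "\<dots> = ennreal (K * L)" using K0 AL by (simp add: ennreal_mult)
    finally have "integrable lborel (\<lambda>x. \<bar>ulin f g t x\<bar> powr q) \<and> (LINT x|lborel. \<bar>ulin f g t x\<bar> powr q) \<le> K * L"
      using K0 AL by (intro nn_integral_le_imp_integral_le) auto
    then show "integrable lborel (\<lambda>x. \<bar>ulin f g t x\<bar> powr q)"
      "(LINT x|lborel. \<bar>ulin f g t x\<bar> powr q) \<le> A powr (q - 1) * L * (1 + t) powr (- ((q - 1) / 2))"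
      by (auto simp: K_def mult_ac)
  qed
qed

lemma mean_bound:
  "\<bar>a\<bar> \<le> B \<Longrightarrow> \<bar>b\<bar> \<le> B \<Longrightarrow> \<bar>c\<bar> \<le> G \<Longrightarrow> \<bar>d\<bar> \<le> G \<Longrightarrow> \<bar>(a + b) / 2 + (c - d) / 2\<bar> \<le> B + (G::real)"
  by (auto simp: abs_le_iff field_simps)

lemma vlin_bounded:
  assumes nd: "nice_data R f g"
  shows "\<exists>A>0. \<forall>t x. \<bar>vlin f g t x\<bar> \<le> A"
proof -
  note D = nice_dataD[OF nd]
  obtain B where B: "\<And>x. \<bar>f x\<bar> \<le> B" using D(8) by blast
  define G where "G = (LINT y|lborel. \<bar>g y\<bar>)"
  have G: "\<bar>prim g x\<bar> \<le> G" for x unfolding G_def by (rule prim_bound[OF D(3)])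
  have le: "\<bar>vlin f g t x\<bar> \<le> B + G" for t x
    unfolding vlin_def by (rule mean_bound[OF B B G G])
  have "0 \<le> B + G" using B[of 0] G[of 0] by linarith
  then show ?thesis using order_trans[OF le, of "B + G + 1"] by (intro exI[of _ "B + G + 1"]) simp
qed

lemma Ker_outside:
  assumes "\<And>y. \<bar>y\<bar> > \<rho> \<Longrightarrow> H y = 0" "\<bar>x\<bar> > \<rho> + \<tau>"
  shows "Ker n \<tau> x H = 0"
proof -
  have "indicator {x - \<tau>..x + \<tau>} y * bE n ((\<tau>\<^sup>2 - (x - y)\<^sup>2) / 16) * H y = 0" for y
  proof (cases "y \<in> {x - \<tau>..x + \<tau>}")
    case True
    then have "\<bar>y\<bar> > \<rho>" using assms(2) by auto
    then show ?thesis using assms(1) by simp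
  qed simp
  then show ?thesis unfolding Ker_def by (simp only:) simp
qed

lemma prim_increment_outside:
  assumes "integrable lborel H" "\<And>y. \<bar>y\<bar> > \<rho> \<Longrightarrow> H y = 0" "\<bar>x\<bar> > \<rho> + \<tau>" "\<tau> \<ge> 0"
  shows "prim H (x + \<tau>) - prim H (x - \<tau>) = 0"
proof -
  have z: "indicator {x - \<tau>..x + \<tau>} y * H y = 0" for y
  proof (cases "y \<in> {x - \<tau>..x + \<tau>}")
    case True
    then have "\<bar>y\<bar> > \<rho>" using assms(3) by auto
    then show ?thesis using assms(2) by simp
  qed simp
  have "prim H (x + \<tau>) - prim H (x - \<tau>) = (LINT y|lborel. indicator {x - \<tau>..x + \<tau>} y * H y)"
    using assms by (intro prim_diff_Icc) auto
  then show ?thesis by (simp only: z) simp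
qed

text \<open>
  Finite speed of propagation.
\<close>

lemma cone_supports:
  assumes x: "\<bar>x\<bar> > R + t" and t: "t \<ge> 0"
  shows "nice_data R f g \<Longrightarrow> ulin f g t x = 0" "nice_data R f g \<Longrightarrow> vlin f g t x = 0"
    "cone_source R T F \<Longrightarrow> Nd F t x = 0" "cone_source R T F \<Longrightarrow> Nw F t x = 0"
proof -
  have ab: "\<bar>x + t\<bar> > R" "\<bar>x - t\<bar> > R" using x t by linarith+
  {
    assume nd: "nice_data R f g"
    note D = nice_dataD[OF nd]
    have "g y + f y / 2 = 0" if "\<bar>y\<bar> > R" for y using D(2,5) that by simp
    then have "Ker 0 t x (\<lambda>y. g y + f y / 2) = 0" by (intro Ker_outside[of R] x)
    moreover have "Ker 1 t x f = 0" by (rule Ker_outside[OF D(5) x])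
    ultimately show "ulin f g t x = 0" using D(5)[OF ab(1)] D(5)[OF ab(2)] by (simp add: ulin_def)
    show "vlin f g t x = 0" using D(5)[OF ab(1)] D(5)[OF ab(2)] prim_increment_outside[OF D(3,2) x t] by (simp add: vlin_def)
  }
  {
    assume F: "cone_source R T F"
    have off: "F s y = 0" if "\<bar>y\<bar> > R + s" for s y using cone_sourceD(5)[OF F, of s y] that by fastforce
    have 1: "indicator {0..t} s * (exp (- (t - s) / 2) * (Ker 0 (t - s) x (F s) / 2)) = 0" for s
      using Ker_outside[where \<rho> = "R + s" and H = "F s" and x = x and \<tau> = "t - s" and n = 0] off x by simp
    show "Nd F t x = 0" unfolding Nd_def 1 by simp
    have 2: "indicator {0..t} s * ((prim (F s) (x + (t - s)) - prim (F s) (x - (t - s))) / 2) = 0" for s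
      using prim_increment_outside[where H = "F s" and \<rho> = "R + s" and x = x and \<tau> = "t - s"] cone_sourceD(7)[OF F] off x by (cases "s \<in> {0..t}") auto
    show "Nw F t x = 0" unfolding Nw_def 2 by simp
  }
qed

lemma cone_source_cutoff:
  assumes c: "continuous_on ({0..T} \<times> UNIV) (\<lambda>(t, x). w t x)"
    and supp: "\<And>t x. 0 \<le> t \<Longrightarrow> t \<le> T \<Longrightarrow> \<bar>x\<bar> > R + t \<Longrightarrow> w t x = 0" and T: "T \<ge> 0"
  shows "cone_source R T (\<lambda>t x. if 0 \<le> t \<and> t \<le> T then w t x else 0)"
  unfolding cone_source_def
proof (intro conjI allI impI)
  let ?w = "\<lambda>t x. if 0 \<le> t \<and> t \<le> T then w t x else 0"
  have "(\<lambda>z. indicator ({0..T} \<times> UNIV) z *\<^sub>R (case z of (t, x) \<Rightarrow> w t x)) \<in> borel_measurable borel"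
    by (rule borel_measurable_continuous_on_indicator[OF _ c])
      (auto simp: borel_prod[symmetric])
  also have "(\<lambda>z. indicator ({0..T} \<times> UNIV) z *\<^sub>R (case z of (t, x) \<Rightarrow> w t x)) = (\<lambda>(t, x). ?w t x)"
    by (auto simp: indicator_def)
  finally show "(\<lambda>(t, x). ?w t x) \<in> borel_measurable borel" .
  have "compact ((\<lambda>(t, x). w t x) ` ({0..T} \<times> {- (R + T)..R + T}))"
    by (intro compact_continuous_image continuous_on_subset[OF c] compact_Times compact_Icc) auto
  then obtain B where B: "\<And>y. y \<in> (\<lambda>(t, x). w t x) ` ({0..T} \<times> {- (R + T)..R + T}) \<Longrightarrow> \<bar>y\<bar> \<le> B"
    using compact_imp_bounded[THEN iffD1[OF bounded_iff]] by (metis real_norm_def)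
  have "\<bar>?w t x\<bar> \<le> max B 0" for t x
  proof (cases "0 \<le> t \<and> t \<le> T \<and> \<bar>x\<bar> \<le> R + T")
    case True
    then have "\<bar>w t x\<bar> \<le> B" by (intro B) (auto intro!: image_eqI[of _ _ "(t, x)"])
    then show ?thesis by auto
  next
    case False
    then show ?thesis using supp[of t x] by auto
  qed
  then show "\<exists>B. \<forall>t x. \<bar>?w t x\<bar> \<le> B" by blast
  fix t x
  show "continuous_on UNIV (?w t)"
    using continuous_slice[OF c, of t] by (cases "0 \<le> t \<and> t \<le> T") auto
  assume ne: "?w t x \<noteq> 0"
  then show "0 \<le> t" "t \<le> T" "\<bar>x\<bar> \<le> R + t" using supp[of t x] by (auto split: if_splits simp: not_less[symmetric])
qed

lemma cone_source_powr:
  assumes F: "cone_source R T F" and p: "p > 0"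
  shows "cone_source R T (\<lambda>s y. \<bar>F s y\<bar> powr p)"
  unfolding cone_source_def
proof (intro conjI allI impI)
  note D = cone_sourceD[OF F]
  show "(\<lambda>(s, y). \<bar>F s y\<bar> powr p) \<in> borel_measurable borel"
  proof -
    have [measurable]: "(\<lambda>z. F (fst z) (snd z)) \<in> borel_measurable borel" using D(1) by (simp add: case_prod_beta')
    show ?thesis unfolding case_prod_beta' by simp
  qed
  obtain B where B: "\<And>s y. \<bar>F s y\<bar> \<le> B" using F unfolding cone_source_def by blast
  show "\<exists>B. \<forall>s y. \<bar>\<bar>F s y\<bar> powr p\<bar> \<le> B"
    using B p by (intro exI[of _ "B powr p"]) (auto intro!: powr_mono2)
  fix s y
  show "continuous_on UNIV (\<lambda>y. \<bar>F s y\<bar> powr p)"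
    using p by (intro continuous_on_powr' continuous_intros D(4)) auto
  assume "\<bar>F s y\<bar> powr p \<noteq> 0"
  then have "F s y \<noteq> 0" by auto
  then show "0 \<le> s" "s \<le> T" "\<bar>y\<bar> \<le> R + s" using D(5) by auto
qed

lemma cone_source_diff:
  assumes F: "cone_source R T F" and G: "cone_source R T G"
  shows "cone_source R T (\<lambda>s y. F s y - G s y)"
  unfolding cone_source_def
proof (intro conjI allI impI)
  note DF = cone_sourceD[OF F] and DG = cone_sourceD[OF G]
  show "(\<lambda>(s, y). F s y - G s y) \<in> borel_measurable borel"
    using borel_measurable_diff[OF DF(1) DG(1)] by (simp add: case_prod_beta')
  obtain B B' where B: "\<And>s y. \<bar>F s y\<bar> \<le> B" "\<And>s y. \<bar>G s y\<bar> \<le> B'" using F G unfolding cone_source_def by meson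
  have "\<bar>F s y - G s y\<bar> \<le> B + B'" for s y using B(1)[of s y] B(2)[of s y] by linarith
  then show "\<exists>B. \<forall>s y. \<bar>F s y - G s y\<bar> \<le> B" by blast
  fix s y
  show "continuous_on UNIV (\<lambda>y. F s y - G s y)" by (intro continuous_intros DF(4) DG(4))
  assume "F s y - G s y \<noteq> 0"
  then have "F s y \<noteq> 0 \<or> G s y \<noteq> 0" by auto
  then show "0 \<le> s" "s \<le> T" "\<bar>y\<bar> \<le> R + s" using DF(5) DG(5) by blast+
qed

lemma Ker_integrand_integrable:
  assumes \<tau>: "\<tau> \<ge> 0" and H: "integrable lborel H"
  shows "integrable lborel (\<lambda>y. indicator {x - \<tau>..x + \<tau>} y * bE n ((\<tau>\<^sup>2 - (x - y)\<^sup>2) / 16) * H y)"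
proof -
  have b: "\<bar>indicator {x - \<tau>..x + \<tau>} y * bE n ((\<tau>\<^sup>2 - (x - y)\<^sup>2) / 16)\<bar> \<le> bE n (\<tau>\<^sup>2 / 16)" for y
    unfolding kernel_translate(2) abs_of_nonneg[OF kernel_nonneg_le(1)[OF \<tau>]] by (rule kernel_nonneg_le(2)[OF \<tau>])
  show ?thesis
    using integrable_mult_bounded[OF H borel_measurable_integrable[OF kernel_integral_y(1)] b] by (simp add: mult.commute)
qed

lemma Nd_diff:
  assumes F: "cone_source R T F" and G: "cone_source R T G"
  shows "Nd F t x - Nd G t x = Nd (\<lambda>s y. F s y - G s y) t x"
proof -
  have "Nd F t x - Nd G t x = (LINT s|lborel. indicator {0..t} s * (exp (- (t - s) / 2) * (Ker 0 (t - s) x (F s) / 2))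
      - indicator {0..t} s * (exp (- (t - s) / 2) * (Ker 0 (t - s) x (G s) / 2)))"
    unfolding Nd_def by (rule Bochner_Integration.integral_diff[symmetric, OF Nd_eq(2)[OF F] Nd_eq(2)[OF G]])
  also have "\<dots> = Nd (\<lambda>s y. F s y - G s y) t x"
    unfolding Nd_def
  proof (rule Bochner_Integration.integral_cong)
    fix s
    show "indicator {0..t} s * (exp (- (t - s) / 2) * (Ker 0 (t - s) x (F s) / 2))
      - indicator {0..t} s * (exp (- (t - s) / 2) * (Ker 0 (t - s) x (G s) / 2))
      = indicator {0..t} s * (exp (- (t - s) / 2) * (Ker 0 (t - s) x (\<lambda>y. F s y - G s y) / 2))"
    proof (cases "s \<in> {0..t}")
      case True
      then have \<tau>: "t - s \<ge> 0" by simp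
      have "Ker 0 (t - s) x (\<lambda>y. F s y - G s y) = Ker 0 (t - s) x (F s) - Ker 0 (t - s) x (G s)"
        unfolding Ker_def right_diff_distrib
        by (rule Bochner_Integration.integral_diff[OF Ker_integrand_integrable[OF \<tau> cone_sourceD(7)[OF F]] Ker_integrand_integrable[OF \<tau> cone_sourceD(7)[OF G]]])
      then show ?thesis by (simp add: diff_divide_distrib right_diff_distrib)
    qed simp
  qed simp
  finally show ?thesis .
qed

lemma Nw_diff:
  assumes F: "cone_source R T F" and G: "cone_source R T G"
  shows "Nw F t x - Nw G t x = Nw (\<lambda>s y. F s y - G s y) t x"
proof -
  have P: "prim (\<lambda>y. F s y - G s y) z = prim (F s) z - prim (G s) z" for s z
    using prim_add[OF cone_sourceD(7)[OF F, of s], of "\<lambda>y. (- 1) * G s y" z] cone_sourceD(7)[OF G, of s]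
    unfolding prim_cmult by simp
  have "Nw F t x - Nw G t x = (LINT s|lborel. indicator {0..t} s * ((prim (F s) (x + (t - s)) - prim (F s) (x - (t - s))) / 2)
      - indicator {0..t} s * ((prim (G s) (x + (t - s)) - prim (G s) (x - (t - s))) / 2))"
    unfolding Nw_def by (rule Bochner_Integration.integral_diff[symmetric, OF Nw_integrable[OF F] Nw_integrable[OF G]])
  also have "\<dots> = Nw (\<lambda>s y. F s y - G s y) t x"
    unfolding Nw_def P by (intro Bochner_Integration.integral_cong refl) (simp add: indicator_def diff_divide_distrib)
  finally show ?thesis .
qed

lemma powr_lipschitz:
  fixes a b V p :: real
  assumes "\<bar>a\<bar> \<le> V" "\<bar>b\<bar> \<le> V" "p > 1"
  shows "\<bar>\<bar>a\<bar> powr p - \<bar>b\<bar> powr p\<bar> \<le> p * V powr (p - 1) * \<bar>a - b\<bar>"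
proof -
  have main: "y powr p - x powr p \<le> p * V powr (p - 1) * (y - x)" if xy: "0 \<le> x" "x < y" "y \<le> V" for x y
  proof -
    obtain z where z: "x < z" "z < y" "y powr p - x powr p = (y - x) * (p * z powr (p - 1))"
    proof (rule mvt[OF \<open>x < y\<close>, of "\<lambda>z. z powr p" "\<lambda>z h. h * (p * z powr (p - 1))"])
      show "continuous_on {x..y} (\<lambda>z. z powr p)" using xy assms by (intro continuous_on_powr' continuous_intros) auto
      show "((\<lambda>z. z powr p) has_derivative (\<lambda>h. h * (p * z powr (p - 1)))) (at z)" if "x < z" "z < y" for z
      proof -
        have "((\<lambda>z. z powr p) has_real_derivative p * z powr (p - 1)) (at z)"
          using that \<open>0 \<le> x\<close> by (auto intro!: derivative_eq_intros)
        then show ?thesis by (simp add: has_field_derivative_def mult.commute[of _ "p * z powr (p - 1)"])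
      qed
    qed blast
    have "z powr (p - 1) \<le> V powr (p - 1)" using z xy assms by (intro powr_mono2) auto
    then have "(y - x) * (p * z powr (p - 1)) \<le> (y - x) * (p * V powr (p - 1))" using xy assms by (intro mult_left_mono) auto
    then show ?thesis using z(3) by (simp add: mult_ac)
  qed
  have c: "0 \<le> p * V powr (p - 1)" using assms by simp
  have r: "\<bar>\<bar>a\<bar> - \<bar>b\<bar>\<bar> \<le> \<bar>a - b\<bar>" by simp
  have "\<bar>\<bar>a\<bar> powr p - \<bar>b\<bar> powr p\<bar> \<le> p * V powr (p - 1) * \<bar>\<bar>a\<bar> - \<bar>b\<bar>\<bar>"
  proof (cases "\<bar>a\<bar>" "\<bar>b\<bar>" rule: linorder_cases)
    case less
    then have "\<bar>a\<bar> powr p \<le> \<bar>b\<bar> powr p" using assms by (intro powr_mono2) auto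
    then show ?thesis using main[of "\<bar>a\<bar>" "\<bar>b\<bar>"] less assms by simp
  next
    case greater
    then have "\<bar>b\<bar> powr p \<le> \<bar>a\<bar> powr p" using assms by (intro powr_mono2) auto
    then show ?thesis using main[of "\<bar>b\<bar>" "\<bar>a\<bar>"] greater assms by simp
  qed simp
  also have "\<dots> \<le> p * V powr (p - 1) * \<bar>a - b\<bar>" by (rule mult_left_mono[OF r c])
  finally show ?thesis .
qed

lemma powr_add_le:
  fixes a b q :: real
  assumes "q > 0"
  shows "\<bar>a + b\<bar> powr q \<le> 2 powr q * (\<bar>a\<bar> powr q + \<bar>b\<bar> powr q)"
proof -
  have "\<bar>a + b\<bar> powr q \<le> (2 * max \<bar>a\<bar> \<bar>b\<bar>) powr q" using assms by (intro powr_mono2) auto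
  also have "\<dots> = 2 powr q * (max \<bar>a\<bar> \<bar>b\<bar>) powr q" by (simp add: powr_mult)
  also have "\<dots> \<le> 2 powr q * (\<bar>a\<bar> powr q + \<bar>b\<bar> powr q)"
    by (intro mult_left_mono) (auto simp: max_def)
  finally show ?thesis .
qed

lemma exp_weight:
  fixes l D t :: real
  assumes l: "l > 0" and D: "D \<ge> 0"
  shows "integrable lborel (\<lambda>s. indicator {0..t} s * (D * exp (l * s)))"
    "(LINT s|lborel. indicator {0..t} s * (D * exp (l * s))) \<le> D * exp (l * t) / l"
proof -
  have "set_integrable lborel {0..t} (\<lambda>s. D * exp (l * s))"
    by (intro borel_integrable_atLeastAtMost' continuous_intros)
  then show i: "integrable lborel (\<lambda>s. indicator {0..t} s * (D * exp (l * s)))" by (simp add: set_integrable_def)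
  show "(LINT s|lborel. indicator {0..t} s * (D * exp (l * s))) \<le> D * exp (l * t) / l"
  proof (cases "0 \<le> t")
    case True
    have "has_bochner_integral lborel (\<lambda>s. (D * exp (l * s)) * indicator {0..t} s) (D * exp (l * t) / l - D * exp (l * 0) / l)"
      by (rule has_bochner_integral_FTC_Icc_real[OF True]) (use l in \<open>auto intro!: derivative_eq_intros\<close>)
    from has_bochner_integral_integral_eq[OF this] show ?thesis using l D by (simp add: mult.commute)
  next
    case False
    then show ?thesis using l D by simp
  qed
qed

lemma contraction_algebra:
  "l \<noteq> 0 \<Longrightarrow> T * (Lq * (2 * (Lp * D) / l) * X / l) = (4 * T * Lq * Lp) * (D / 2 * X) / (l * (l::real))"
  by (simp add: field_simps)

text \<open>
  The iteration on \<open>[0, T]\<close> with data \<open>\<epsilon> (f, g)\<close> for \<open>u\<close> and \<open>\<epsilon> (f', g')\<close> for \<open>v\<close>; \<open>V\<close> is the bound imposed on \<open>v\<close>.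
  All functions are extended by \<open>0\<close> outside \<open>[0, T]\<close>, so that they are sources of the class above.
\<close>

locale nakao_iteration =
  fixes p q R T \<epsilon> V :: real and f g f' g' :: "real \<Rightarrow> real"
  assumes pq: "p > 1" "q > 1" and R: "R > 0" and T: "T > 0" and eps: "\<epsilon> \<ge> 0" and V0: "V \<ge> 0"
    and nd: "nice_data R f g" and nd': "nice_data R f' g'"
begin

definition U :: "(real \<Rightarrow> real \<Rightarrow> real) \<Rightarrow> real \<Rightarrow> real \<Rightarrow> real" where
  "U v t x = (if 0 \<le> t \<and> t \<le> T then \<epsilon> * ulin f g t x + Nd (\<lambda>s y. \<bar>v s y\<bar> powr p) t x else 0)"

definition \<Psi> :: "(real \<Rightarrow> real \<Rightarrow> real) \<Rightarrow> real \<Rightarrow> real \<Rightarrow> real" where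
  "\<Psi> v t x = (if 0 \<le> t \<and> t \<le> T then \<epsilon> * vlin f' g' t x + Nw (\<lambda>s y. \<bar>U v s y\<bar> powr q) t x else 0)"

lemma U_cone:
  assumes v: "cone_source R T v"
  shows "cone_source R T (U v)"
  unfolding U_def
proof (rule cone_source_cutoff)
  have vp: "cone_source R T (\<lambda>s y. \<bar>v s y\<bar> powr p)" using pq by (intro cone_source_powr v) auto
  have "continuous_on ({0..T} \<times> UNIV) (\<lambda>z. ulin f g (fst z) (snd z))"
    using ulin_triple(2)[OF nd, of T] T by (simp add: case_prod_beta')
  moreover have "continuous_on ({0..T} \<times> UNIV) (\<lambda>z. Nd (\<lambda>s y. \<bar>v s y\<bar> powr p) (fst z) (snd z))"
  proof -
    have "{0..T} \<times> UNIV \<subseteq> {-T..T} \<times> (UNIV :: real set)" using T by auto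
    from continuous_on_subset[OF Nd_triple(2)[OF vp, of T] this] show ?thesis using R T by (simp add: case_prod_beta')
  qed
  ultimately show "continuous_on ({0..T} \<times> UNIV) (\<lambda>(t, x). \<epsilon> * ulin f g t x + Nd (\<lambda>s y. \<bar>v s y\<bar> powr p) t x)"
    unfolding case_prod_beta' by (intro continuous_intros)
  show "\<epsilon> * ulin f g t x + Nd (\<lambda>s y. \<bar>v s y\<bar> powr p) t x = 0" if "0 \<le> t" "t \<le> T" "\<bar>x\<bar> > R + t" for t x
    using cone_supports(1)[OF that(3,1) nd] cone_supports(3)[OF that(3,1) vp] by simp
qed (use T in simp)

lemma \<Psi>_cone:
  assumes v: "cone_source R T v"
  shows "cone_source R T (\<Psi> v)"
  unfolding \<Psi>_def
proof (rule cone_source_cutoff)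
  have up: "cone_source R T (\<lambda>s y. \<bar>U v s y\<bar> powr q)" using pq by (intro cone_source_powr U_cone v) auto
  have "continuous_on ({0..T} \<times> UNIV) (\<lambda>z. vlin f' g' (fst z) (snd z))"
    using vlin_continuous[OF nd', of "{0..T} \<times> UNIV"] by (simp add: case_prod_beta')
  moreover have "continuous_on ({0..T} \<times> UNIV) (\<lambda>z. Nw (\<lambda>s y. \<bar>U v s y\<bar> powr q) (fst z) (snd z))"
  proof -
    have "{0..T} \<times> UNIV \<subseteq> {-T..T} \<times> (UNIV :: real set)" using T by auto
    from continuous_on_subset[OF Nw_triple(2)[OF up, of T] this] show ?thesis using R T by (simp add: case_prod_beta')
  qed
  ultimately show "continuous_on ({0..T} \<times> UNIV) (\<lambda>(t, x). \<epsilon> * vlin f' g' t x + Nw (\<lambda>s y. \<bar>U v s y\<bar> powr q) t x)"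
    unfolding case_prod_beta' by (intro continuous_intros)
  show "\<epsilon> * vlin f' g' t x + Nw (\<lambda>s y. \<bar>U v s y\<bar> powr q) t x = 0" if "0 \<le> t" "t \<le> T" "\<bar>x\<bar> > R + t" for t x
    using cone_supports(2)[OF that(3,1) nd'] cone_supports(4)[OF that(3,1) up] by simp
qed (use T in simp)

definition S :: "(real \<Rightarrow> real \<Rightarrow> real) set" where
  "S = {v. cone_source R T v \<and> (\<forall>s y. \<bar>v s y\<bar> \<le> V)}"

lemma Nd_apriori:
  assumes v: "v \<in> S" and t: "0 \<le> t" "t \<le> T"
  shows "\<bar>Nd (\<lambda>s y. \<bar>v s y\<bar> powr p) t x\<bar> \<le> 2 * (T * V powr p)"
proof -
  have i: "integrable lborel (\<lambda>s. indicator {0..t} s * V powr p)" using integrable_indicator_Icc by simp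
  have "\<bar>Nd (\<lambda>s y. \<bar>v s y\<bar> powr p) t x\<bar> \<le> 2 * (LINT s|lborel. indicator {0..t} s * V powr p)"
    by (rule Nd_bound[OF i]) (use v pq in \<open>auto simp: S_def intro!: powr_mono2\<close>)
  also have "(LINT s|lborel. indicator {0..t} s * V powr p) = t * V powr p" using t by simp
  also have "t * V powr p \<le> T * V powr p" using t by (intro mult_right_mono) auto
  finally show ?thesis by simp
qed

text \<open>
  The wave Duhamel term is estimated by half the space-time integral of \<open>|u|^q \<le> 2^q (|\<epsilon> u_lin|^q + |Nd|^q)\<close>.
  The first part is the linear decay; for the second, \<open>|Nd| \<le> 2 T V^p\<close> on a cone whose slices have length at
  most \<open>2 (R + T)\<close>. The difference in decay between the two parts is the origin of the two regimes.
\<close>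

lemma \<Psi>_apriori:
  assumes C: "\<And>t. t \<ge> 0 \<Longrightarrow> integrable lborel (\<lambda>x. \<bar>ulin f g t x\<bar> powr q) \<and>
       (LINT x|lborel. \<bar>ulin f g t x\<bar> powr q) \<le> C * (1 + t) powr (- ((q - 1) / 2))" and C0: "C \<ge> 0"
    and A: "\<And>t x. \<bar>vlin f' g' t x\<bar> \<le> A"
    and b: "(LINT s|lborel. indicator {0..T} s * (1 + s) powr (- ((q - 1) / 2))) \<le> b"
    and small: "\<epsilon> * A + 2 powr q * (\<epsilon> powr q * C * b + 2 * (R + T) * T * (2 * (T * V powr p)) powr q) \<le> V"
    and v: "v \<in> S"
  shows "\<Psi> v \<in> S"
proof -
  have vc: "cone_source R T v" using v by (simp add: S_def)
  have up: "cone_source R T (\<lambda>s y. \<bar>U v s y\<bar> powr q)" using pq by (intro cone_source_powr U_cone vc) auto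
  define N where "N = (2 * (T * V powr p)) powr q"
  have N0: "0 \<le> N" by (simp add: N_def)
  define \<phi> where "\<phi> s = 2 powr q * (\<epsilon> powr q * (C * (1 + s) powr (- ((q - 1) / 2))) + 2 * (R + T) * N)" for s
  have \<phi>0: "0 \<le> \<phi> s" for s unfolding \<phi>_def using C0 R T N0 by (intro mult_nonneg_nonneg add_nonneg_nonneg) auto
  have idec: "integrable lborel (\<lambda>s. indicator {0..t} s * (1 + s) powr (- ((q - 1) / 2)))" for t
  proof -
    have "set_integrable lborel {0..t} (\<lambda>s. (1 + s) powr (- ((q - 1) / 2)))"
      by (intro borel_integrable_atLeastAtMost' continuous_intros) auto
    then show ?thesis by (simp add: set_integrable_def)
  qed
  have i\<phi>: "integrable lborel (\<lambda>s. indicator {0..t} s * \<phi> s)" for t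
  proof -
    have "integrable lborel (\<lambda>s. 2 powr q * \<epsilon> powr q * C * (indicator {0..t} s * (1 + s) powr (- ((q - 1) / 2)))
       + 2 powr q * (2 * (R + T) * N) * indicator {0..t} s)"
      using idec[of t] integrable_indicator_Icc by (intro Bochner_Integration.integrable_add integrable_mult_right)
    then show ?thesis unfolding \<phi>_def by (simp add: algebra_simps)
  qed
  have I\<phi>: "(LINT s|lborel. indicator {0..T} s * \<phi> s) \<le> 2 powr q * (\<epsilon> powr q * C * b + 2 * (R + T) * T * N)"
  proof -
    have "(LINT s|lborel. indicator {0..T} s * \<phi> s) = (LINT s|lborel. 2 powr q * \<epsilon> powr q * C * (indicator {0..T} s * (1 + s) powr (- ((q - 1) / 2)))
       + 2 powr q * (2 * (R + T) * N) * indicator {0..T} s)"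
      unfolding \<phi>_def by (simp add: algebra_simps)
    also have "\<dots> = 2 powr q * \<epsilon> powr q * C * (LINT s|lborel. indicator {0..T} s * (1 + s) powr (- ((q - 1) / 2)))
       + 2 powr q * (2 * (R + T) * N) * T"
      using idec[of T] integrable_indicator_Icc[of 0 T] T by simp
    also have "\<dots> \<le> 2 powr q * \<epsilon> powr q * C * b + 2 powr q * (2 * (R + T) * N) * T"
    proof -
      have "2 powr q * \<epsilon> powr q * C * (LINT s|lborel. indicator {0..T} s * (1 + s) powr (- ((q - 1) / 2))) \<le> 2 powr q * \<epsilon> powr q * C * b"
        using C0 by (intro mult_left_mono b) auto
      then show ?thesis by simp
    qed
    finally show ?thesis by (simp add: algebra_simps)
  qed
  have uq: "(LINT y|lborel. \<bar>\<bar>U v s y\<bar> powr q\<bar>) \<le> \<phi> s" if s: "0 \<le> s" "s \<le> T" for s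
  proof -
    have pt: "\<bar>\<bar>U v s y\<bar> powr q\<bar> \<le> 2 powr q * (\<epsilon> powr q * \<bar>ulin f g s y\<bar> powr q + N * indicator {- (R + T)..R + T} y)" for y
    proof (cases "\<bar>y\<bar> > R + s")
      case True
      then have "U v s y = 0" using cone_sourceD(5)[OF U_cone[OF vc], of s y] by fastforce
      then show ?thesis using N0 by simp
    next
      case False
      have "\<bar>U v s y\<bar> powr q \<le> 2 powr q * (\<bar>\<epsilon> * ulin f g s y\<bar> powr q + \<bar>Nd (\<lambda>s y. \<bar>v s y\<bar> powr p) s y\<bar> powr q)"
        unfolding U_def using s pq by (simp add: powr_add_le)
      also have "\<dots> \<le> 2 powr q * (\<epsilon> powr q * \<bar>ulin f g s y\<bar> powr q + N)"
      proof (intro mult_left_mono add_mono)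
        show "\<bar>\<epsilon> * ulin f g s y\<bar> powr q \<le> \<epsilon> powr q * \<bar>ulin f g s y\<bar> powr q"
          using eps by (simp add: abs_mult powr_mult)
        show "\<bar>Nd (\<lambda>s y. \<bar>v s y\<bar> powr p) s y\<bar> powr q \<le> N"
          unfolding N_def using Nd_apriori[OF v s, of y] pq by (intro powr_mono2) auto
      qed simp
      also have "y \<in> {- (R + T)..R + T}" using False s by auto
      then have "2 powr q * (\<epsilon> powr q * \<bar>ulin f g s y\<bar> powr q + N)
          = 2 powr q * (\<epsilon> powr q * \<bar>ulin f g s y\<bar> powr q + N * indicator {- (R + T)..R + T} y)" by simp
      finally show ?thesis by simp
    qed
    have iu: "integrable lborel (\<lambda>y. \<bar>ulin f g s y\<bar> powr q)" using C[OF s(1)] by blast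
    have ib: "integrable lborel (\<lambda>y. 2 powr q * (\<epsilon> powr q * \<bar>ulin f g s y\<bar> powr q + N * indicator {- (R + T)..R + T} y))"
      using iu integrable_indicator_Icc by (intro integrable_mult_right Bochner_Integration.integrable_add)
    have "(LINT y|lborel. \<bar>\<bar>U v s y\<bar> powr q\<bar>) \<le> \<bar>LINT y|lborel. \<bar>\<bar>U v s y\<bar> powr q\<bar>\<bar>" by simp
    also have "\<dots> \<le> (LINT y|lborel. 2 powr q * (\<epsilon> powr q * \<bar>ulin f g s y\<bar> powr q + N * indicator {- (R + T)..R + T} y))"
      by (rule abs_integral_le[OF ib]) (use pt in simp)
    also have "\<dots> = 2 powr q * (\<epsilon> powr q * (LINT y|lborel. \<bar>ulin f g s y\<bar> powr q) + N * (2 * (R + T)))"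
      using iu integrable_indicator_Icc[of "- (R + T)" "R + T"] R T by simp
    also have "\<dots> \<le> 2 powr q * (\<epsilon> powr q * (C * (1 + s) powr (- ((q - 1) / 2))) + N * (2 * (R + T)))"
      using C[OF s(1)] by (intro mult_left_mono add_right_mono) auto
    finally show ?thesis by (simp add: \<phi>_def mult_ac)
  qed
  have "\<bar>\<Psi> v t x\<bar> \<le> V" for t x
  proof (cases "0 \<le> t \<and> t \<le> T")
    case True
    have "\<bar>Nw (\<lambda>s y. \<bar>U v s y\<bar> powr q) t x\<bar> \<le> 1 / 2 * (LINT s|lborel. indicator {0..t} s * \<phi> s)"
      using True by (intro Nw_bound_L1[OF up i\<phi>] uq) auto
    also have "(LINT s|lborel. indicator {0..t} s * \<phi> s) \<le> (LINT s|lborel. indicator {0..T} s * \<phi> s)"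
      using True \<phi>0 by (intro integral_mono i\<phi>) (auto simp: indicator_def)
    also note I\<phi>
    finally have n: "\<bar>Nw (\<lambda>s y. \<bar>U v s y\<bar> powr q) t x\<bar> \<le> 1 / 2 * (2 powr q * (\<epsilon> powr q * C * b + 2 * (R + T) * T * N))" by simp
    have nn: "0 \<le> 2 powr q * (\<epsilon> powr q * C * b + 2 * (R + T) * T * N)"
    proof -
      have "0 \<le> (LINT s|lborel. indicator {0..T} s * \<phi> s)" using \<phi>0 by (intro integral_nonneg_AE) auto
      then show ?thesis using I\<phi> by linarith
    qed
    have "\<bar>\<epsilon> * vlin f' g' t x\<bar> \<le> \<epsilon> * A" using A[of t x] eps by (simp add: abs_mult mult_left_mono)
    then have "\<bar>\<epsilon> * vlin f' g' t x + Nw (\<lambda>s y. \<bar>U v s y\<bar> powr q) t x\<bar> \<le> V"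
      using n nn small unfolding N_def[symmetric] by linarith
    then show ?thesis using True by (simp add: \<Psi>_def)
  next
    case False
    then show ?thesis using V0 by (auto simp: \<Psi>_def)
  qed
  then show ?thesis using \<Psi>_cone[OF vc] by (simp add: S_def)
qed

text \<open>
  Both powers are Lipschitz on bounded sets, with constants \<open>Lp\<close> and \<open>Lq\<close>, and each of the two Duhamel integrals of a
  function bounded by \<open>exp (l s)\<close> gains a factor \<open>1 / l\<close>; so a large \<open>l\<close> compensates all constants, however
  large \<open>T\<close> is.
\<close>

lemma \<Psi>_contraction:
  "\<exists>l>0. \<forall>v\<in>S. \<forall>w\<in>S. \<forall>D\<ge>0. (\<forall>s y. 0 \<le> s \<longrightarrow> \<bar>v s y - w s y\<bar> \<le> D * exp (l * s)) \<longrightarrow>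
     (\<forall>t x. 0 \<le> t \<longrightarrow> \<bar>\<Psi> v t x - \<Psi> w t x\<bar> \<le> D / 2 * exp (l * t))"
proof -
  obtain A L where A: "A > 0" "\<And>t x. t \<ge> 0 \<Longrightarrow> \<bar>ulin f g t x\<bar> \<le> A / sqrt (1 + t)" using ulin_estimates[OF nd] by blast
  define M where "M = \<epsilon> * A + 2 * (T * V powr p)"
  have UM: "\<bar>U v t x\<bar> \<le> M" if v: "v \<in> S" for v t x
  proof (cases "0 \<le> t \<and> t \<le> T")
    case True
    have "A / sqrt (1 + t) \<le> A / 1" using A True by (intro divide_left_mono) auto
    then have "\<bar>ulin f g t x\<bar> \<le> A" using A(2)[of t x] True by simp
    then have "\<bar>\<epsilon> * ulin f g t x\<bar> \<le> \<epsilon> * A" using eps by (simp add: abs_mult mult_left_mono)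
    then show ?thesis using Nd_apriori[OF v, of t x] True unfolding U_def M_def by simp
  next
    case False
    have "0 \<le> M" unfolding M_def using eps A T by simp
    then show ?thesis using False by (auto simp: U_def)
  qed
  define Lp Lq where "Lp = p * V powr (p - 1)" and "Lq = q * M powr (q - 1)"
  have L0: "0 \<le> Lp" "0 \<le> Lq" using pq by (auto simp: Lp_def Lq_def)
  define l where "l = 4 * T * Lq * Lp + 1"
  have l: "l \<ge> 1" "4 * T * Lq * Lp \<le> l" using L0 T by (auto simp: l_def)
  then have l0: "l > 0" by simp
  show ?thesis
  proof (intro exI[of _ l] conjI ballI allI impI)
    show "0 < l" using l by simp
    fix v w D t x
    assume v: "v \<in> S" and w: "w \<in> S" and D: "0 \<le> (D::real)"
      and d: "\<forall>s y. 0 \<le> s \<longrightarrow> \<bar>v s y - w s y\<bar> \<le> D * exp (l * s)" and t: "0 \<le> (t::real)"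
    have vc: "cone_source R T v" and wc: "cone_source R T w" using v w by (auto simp: S_def)
    have vp: "cone_source R T (\<lambda>s y. \<bar>v s y\<bar> powr p)" "cone_source R T (\<lambda>s y. \<bar>w s y\<bar> powr p)"
      using pq vc wc by (auto intro!: cone_source_powr)
    have up: "cone_source R T (\<lambda>s y. \<bar>U v s y\<bar> powr q)" "cone_source R T (\<lambda>s y. \<bar>U w s y\<bar> powr q)"
      using pq vc wc by (auto intro!: cone_source_powr U_cone)
    have 1: "\<bar>\<bar>v s y\<bar> powr p - \<bar>w s y\<bar> powr p\<bar> \<le> (Lp * D) * exp (l * s)" if "0 \<le> s" for s y
    proof -
      have "\<bar>\<bar>v s y\<bar> powr p - \<bar>w s y\<bar> powr p\<bar> \<le> Lp * \<bar>v s y - w s y\<bar>"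
        unfolding Lp_def using v w pq by (intro powr_lipschitz) (auto simp: S_def)
      also have "\<dots> \<le> Lp * (D * exp (l * s))" using d that L0 by (intro mult_left_mono) auto
      finally show ?thesis by (simp add: mult_ac)
    qed
    have 2: "\<bar>U v s y - U w s y\<bar> \<le> (2 * (Lp * D) / l) * exp (l * s)" if s: "0 \<le> s" for s y
    proof (cases "s \<le> T")
      case True
      have "U v s y - U w s y = Nd (\<lambda>s y. \<bar>v s y\<bar> powr p - \<bar>w s y\<bar> powr p) s y"
        unfolding U_def using True s Nd_diff[OF vp, of s y] by simp
      also have "\<bar>\<dots>\<bar> \<le> 2 * (LINT r|lborel. indicator {0..s} r * ((Lp * D) * exp (l * r)))"
        using L0 D l by (intro Nd_bound exp_weight(1) 1) auto
      also have "\<dots> \<le> 2 * ((Lp * D) * exp (l * s) / l)"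
        using L0 D l by (intro mult_left_mono exp_weight(2)) auto
      finally show ?thesis by simp
    next
      case False
      have "0 \<le> (2 * (Lp * D) / l) * exp (l * s)" using L0 D l by simp
      then show ?thesis using False by (simp add: U_def)
    qed
    define E where "E = Lq * (2 * (Lp * D) / l)"
    have E0: "0 \<le> E" unfolding E_def using L0 D l by simp
    have 3: "\<bar>\<bar>U v s y\<bar> powr q - \<bar>U w s y\<bar> powr q\<bar> \<le> E * exp (l * s)" if "0 \<le> s" for s y
    proof -
      have "\<bar>\<bar>U v s y\<bar> powr q - \<bar>U w s y\<bar> powr q\<bar> \<le> Lq * \<bar>U v s y - U w s y\<bar>"
        unfolding Lq_def using UM v w pq by (intro powr_lipschitz) auto
      also have "\<dots> \<le> Lq * ((2 * (Lp * D) / l) * exp (l * s))" using 2[OF that] L0 by (intro mult_left_mono) auto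
      finally show ?thesis by (simp add: E_def mult_ac)
    qed
    show "\<bar>\<Psi> v t x - \<Psi> w t x\<bar> \<le> D / 2 * exp (l * t)"
    proof (cases "t \<le> T")
      case True
      have eq: "\<Psi> v t x - \<Psi> w t x = Nw (\<lambda>s y. \<bar>U v s y\<bar> powr q - \<bar>U w s y\<bar> powr q) t x"
        unfolding \<Psi>_def using True t Nw_diff[OF up, of t x] by simp
      have "\<bar>\<Psi> v t x - \<Psi> w t x\<bar> \<le> t * (LINT r|lborel. indicator {0..t} r * (E * exp (l * r)))"
        unfolding eq
      proof (rule Nw_bound_sup[OF cone_source_diff[OF up]])
        show "integrable lborel (\<lambda>r. indicator {0..t} r * (E * exp (l * r)))" by (rule exp_weight(1)[OF l0 E0])
        show "\<bar>\<bar>U v s y\<bar> powr q - \<bar>U w s y\<bar> powr q\<bar> \<le> E * exp (l * s)" if "0 \<le> s" "s \<le> t" for s y by (rule 3[OF that(1)])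
      qed
      also have "\<dots> \<le> t * (E * exp (l * t) / l)" by (rule mult_left_mono[OF exp_weight(2)[OF l0 E0] t])
      also have "\<dots> \<le> T * (E * exp (l * t) / l)" by (rule mult_right_mono[OF True]) (use E0 l0 in simp)
      also have "\<dots> = (4 * T * Lq * Lp) * (D / 2 * exp (l * t)) / (l * l)" unfolding E_def using l0 by (intro contraction_algebra) simp
      also have "\<dots> \<le> (l * l) * (D / 2 * exp (l * t)) / (l * l)"
      proof (intro divide_right_mono mult_right_mono)
        have "l * 1 \<le> l * l" using l by (intro mult_left_mono) auto
        then show "4 * T * Lq * Lp \<le> l * l" using l by linarith
      qed (use D l in auto)
      also have "\<dots> = D / 2 * exp (l * t)" using l by simp
      finally show ?thesis .
    next
      case False
      then show ?thesis using D by (simp add: \<Psi>_def)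
    qed
  qed
qed

text \<open>
  Picard iteration starting from \<open>0\<close>. The increments are dominated by a geometric series uniformly in space-time,
  and \<open>S\<close> is closed under uniform limits.
\<close>

lemma fixed_point:
  assumes inv: "\<And>v. v \<in> S \<Longrightarrow> \<Psi> v \<in> S"
  shows "\<exists>v\<in>S. \<Psi> v = v"
proof -
  obtain l where l': "l > 0 \<and> (\<forall>v\<in>S. \<forall>w\<in>S. \<forall>D\<ge>0. (\<forall>s y. 0 \<le> s \<longrightarrow> \<bar>v s y - w s y\<bar> \<le> D * exp (l * s)) \<longrightarrow>
     (\<forall>t x. 0 \<le> t \<longrightarrow> \<bar>\<Psi> v t x - \<Psi> w t x\<bar> \<le> D / 2 * exp (l * t)))"
    by (rule exE[OF \<Psi>_contraction])
  note l = conjunct1[OF l'] and contr = conjunct2[OF l', rule_format]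
  define v where "v n = (\<Psi> ^^ n) (\<lambda>_ _. 0)" for n
  have v0: "v 0 = (\<lambda>_ _. 0)" and vS: "v (Suc n) = \<Psi> (v n)" for n by (simp_all add: v_def)
  have vin: "v n \<in> S" for n
  proof (induction n)
    case 0
    show ?case using V0 by (auto simp: v0 S_def cone_source_def intro: exI[of _ 0])
  qed (simp add: vS inv)
  have step: "\<bar>v (Suc n) t x - v n t x\<bar> \<le> V * (1 / 2) ^ n * exp (l * t)" if "0 \<le> t" for n t x
    using that
  proof (induction n arbitrary: t x)
    case 0
    have "\<bar>v (Suc 0) t x\<bar> \<le> V * 1" using vin[of "Suc 0"] by (simp add: S_def)
    also have "V * 1 \<le> V * exp (l * t)" using V0 l 0 by (intro mult_left_mono) auto
    finally show ?case by (simp add: v0)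
  next
    case (Suc n)
    have "\<bar>\<Psi> (v (Suc n)) t x - \<Psi> (v n) t x\<bar> \<le> (V * (1 / 2) ^ n) / 2 * exp (l * t)"
      by (rule contr[OF vin vin _ Suc.IH Suc.prems]) (use V0 in auto)
    then show ?case by (simp add: vS[symmetric])
  qed
  have out: "w t x = 0" if "w \<in> S" "t < 0 \<or> t > T" for w t x
    using that cone_sourceD(5)[of R T w t x] by (force simp: S_def)
  define E where "E = exp (l * T)"
  have stepE: "\<bar>v (Suc n) t x - v n t x\<bar> \<le> V * E * (1 / 2) ^ n" for n t x
  proof (cases "0 \<le> t \<and> t \<le> T")
    case True
    then have "exp (l * t) \<le> E" using l by (simp add: E_def)
    then have "V * (1 / 2) ^ n * exp (l * t) \<le> V * (1 / 2) ^ n * E" using V0 by (intro mult_left_mono) auto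
    then show ?thesis using step[of t n x] True by (simp add: mult_ac)
  next
    case False
    then have "v (Suc n) t x = 0" "v n t x = 0" using out[OF vin] by auto
    then show ?thesis using V0 by (simp add: E_def)
  qed
  define \<Delta> where "\<Delta> n z = v (Suc n) (fst z) (snd z) - v n (fst z) (snd z)" for n z
  have ul: "uniform_limit UNIV (\<lambda>n z. \<Sum>i<n. \<Delta> i z) (\<lambda>z. suminf (\<lambda>i. \<Delta> i z)) sequentially"
  proof (rule Weierstrass_m_test)
    show "norm (\<Delta> n z) \<le> V * E * (1 / 2) ^ n" for n z using stepE by (simp add: \<Delta>_def)
    show "summable (\<lambda>n. V * E * (1 / 2) ^ n)" by (intro summable_mult summable_geometric) simp
  qed
  have sm: "(\<Sum>i<n. \<Delta> i z) = v n (fst z) (snd z)" for n z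
    by (induction n) (simp_all add: \<Delta>_def v0)
  define w where "w t x = suminf (\<lambda>i. \<Delta> i (t, x))" for t x
  have ul': "uniform_limit UNIV (\<lambda>n z. v n (fst z) (snd z)) (\<lambda>z. w (fst z) (snd z)) sequentially"
    using ul unfolding sm by (simp add: w_def)
  have near: "\<exists>N. \<forall>n\<ge>N. \<forall>t x. \<bar>v n t x - w t x\<bar> < e" if "e > 0" for e
  proof -
    have "\<exists>N. \<forall>n\<ge>N. \<forall>z\<in>UNIV. dist (v n (fst z) (snd z)) (w (fst z) (snd z)) < e"
      using ul' that unfolding uniform_limit_iff eventually_sequentially by blast
    then obtain N where N: "\<And>n z. n \<ge> N \<Longrightarrow> dist (v n (fst z) (snd z)) (w (fst z) (snd z)) < e" by auto
    have "\<bar>v n t x - w t x\<bar> < e" if "n \<ge> N" for n t x using N[OF that, of "(t, x)"] by (simp add: dist_real_def)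
    then show ?thesis by blast
  qed
  have pw: "(\<lambda>n. v n t x) \<longlonglongrightarrow> w t x" for t x
  proof (rule LIMSEQ_I)
    fix e :: real assume "e > 0"
    then show "\<exists>no. \<forall>n\<ge>no. norm (v n t x - w t x) < e" using near[of e] by auto
  qed
  have wS: "w \<in> S"
  proof -
    have "\<bar>w t x\<bar> \<le> V" for t x
    proof (rule LIMSEQ_le_const2)
      show "(\<lambda>n. \<bar>v n t x\<bar>) \<longlonglongrightarrow> \<bar>w t x\<bar>" by (intro tendsto_rabs pw)
      show "\<exists>N. \<forall>n\<ge>N. \<bar>v n t x\<bar> \<le> V" using vin by (auto simp: S_def)
    qed
    moreover have "cone_source R T w"
      unfolding cone_source_def
    proof (intro conjI allI impI)
      show "(\<lambda>(s, y). w s y) \<in> borel_measurable borel"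
      proof (rule borel_measurable_LIMSEQ_real)
        show "(\<lambda>(s, y). v n s y) \<in> borel_measurable borel" for n using vin[of n] by (simp add: S_def cone_source_def)
        show "(\<lambda>n. case z of (s, y) \<Rightarrow> v n s y) \<longlonglongrightarrow> (case z of (s, y) \<Rightarrow> w s y)" for z
          using pw by (cases z) simp
      qed
      show "\<exists>B. \<forall>s y. \<bar>w s y\<bar> \<le> B" using \<open>\<And>t x. \<bar>w t x\<bar> \<le> V\<close> by blast
      fix s y
      show "continuous_on UNIV (w s)"
      proof (rule uniform_limit_theorem)
        show "eventually (\<lambda>n. continuous_on UNIV (v n s)) sequentially" using vin by (simp add: S_def cone_source_def)
        show "uniform_limit UNIV (\<lambda>n. v n s) (w s) sequentially"
          unfolding uniform_limit_iff eventually_sequentially dist_real_def using near by blast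
      qed simp
      assume ne: "w s y \<noteq> 0"
      have "\<exists>n. v n s y \<noteq> 0"
      proof (rule ccontr)
        assume "\<nexists>n. v n s y \<noteq> 0"
        then have "(\<lambda>n. v n s y) = (\<lambda>_. 0)" by auto
        then have "w s y = 0" using pw[of s y] LIMSEQ_unique[OF _ tendsto_const[of 0]] by simp
        then show False using ne by simp
      qed
      then obtain n where "v n s y \<noteq> 0" by blast
      then show "0 \<le> s" "s \<le> T" "\<bar>y\<bar> \<le> R + s" using cone_sourceD(5)[of R T "v n" s y] vin[of n] by (auto simp: S_def)
    qed
    ultimately show ?thesis by (simp add: S_def)
  qed
  have "\<Psi> w t x = w t x" for t x
  proof (cases "0 \<le> t \<and> t \<le> T")
    case True
    have "(\<lambda>n. v (Suc n) t x) \<longlonglongrightarrow> \<Psi> w t x"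
    proof (rule LIMSEQ_I)
      fix e :: real assume e: "e > 0"
      have e': "e / exp (l * t) > 0" using e by simp
      obtain N where N: "\<forall>n\<ge>N. \<forall>r y. \<bar>v n r y - w r y\<bar> < e / exp (l * t)" using near[OF e'] by blast
      show "\<exists>no. \<forall>n\<ge>no. norm (v (Suc n) t x - \<Psi> w t x) < e"
      proof (intro exI[of _ N] allI impI)
        fix n assume n: "n \<ge> N"
        have "\<bar>\<Psi> (v n) t x - \<Psi> w t x\<bar> \<le> (e / exp (l * t)) / 2 * exp (l * t)"
        proof (rule contr[OF vin wS])
          fix s y :: real assume s: "0 \<le> s"
          have "\<bar>v n s y - w s y\<bar> \<le> (e / exp (l * t)) * 1" using N n by (simp add: less_imp_le)
          also have "\<dots> \<le> (e / exp (l * t)) * exp (l * s)" using e l s by (intro mult_left_mono) auto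
          finally show "\<bar>v n s y - w s y\<bar> \<le> (e / exp (l * t)) * exp (l * s)" .
        qed (use e True in auto)
        then show "norm (v (Suc n) t x - \<Psi> w t x) < e" using e by (simp add: vS)
      qed
    qed
    then show ?thesis using LIMSEQ_unique[OF _ LIMSEQ_Suc[OF pw]] by blast
  next
    case False
    then show ?thesis using out[OF wS, of t x] by (auto simp: \<Psi>_def)
  qed
  then show ?thesis using wS by (intro bexI[of _ w]) auto
qed

end

section \<open>The propagators on Lebesgue measurable data\<close>

lemma AE_shift:
  assumes "AE x in lborel. P (x :: real)"
  shows "AE x in lborel. P (x + c)"
proof -
  have "AE x in distr lborel borel ((+) c). P x" using assms by (simp only: lborel_distr_plus)
  from AE_distrD[OF _ this] show ?thesis by (simp add: add.commute)
qed

text \<open>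
  Only the restriction of the kernel \<open>k\<close> to \<open>A\<close> has to be Borel: outside the cone the Bessel expressions
  involve square roots of negative numbers.
\<close>

lemma set_lebesgue_integral_representative:
  fixes f f' k K :: "real \<Rightarrow> real"
  assumes K: "K \<in> borel_measurable borel" and k: "\<And>y. indicator A y * k y = K y"
    and f: "f \<in> borel_measurable lebesgue" "f' \<in> borel_measurable borel" "AE y in lborel. f y = f' y"
  shows "(LINT y:A|lebesgue. k y * f y) = (LINT y|lborel. K y * f' y)"
proof -
  have "(LINT y:A|lebesgue. k y * f y) = (LINT y|lebesgue. K y * f y)"
    unfolding set_lebesgue_integral_def k[symmetric] by (simp add: mult.assoc)
  also have "\<dots> = (LINT y|lborel. K y * f' y)"
  proof (rule integral_lebesgue_representative(2))
    have "K \<in> borel_measurable lebesgue" using K by (simp add: measurable_completion)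
    then show "(\<lambda>y. K y * f y) \<in> borel_measurable lebesgue" using f(1) by simp
    show "(\<lambda>y. K y * f' y) \<in> borel_measurable borel" using K f(2) by simp
    show "AE y in lborel. K y * f y = K y * f' y" using f(3) by eventually_elim simp
  qed
  finally show ?thesis .
qed

lemma wave_prop_representative:
  assumes t: "t \<ge> 0" and g0: "g0 \<in> borel_measurable lebesgue" "AE y in lborel. g0 y = g y" and g: "integrable lborel g"
  shows "wave_prop t f0 g0 x = (f0 (x + t) + f0 (x - t)) / 2 + (prim g (x + t) - prim g (x - t)) / 2"
proof -
  have "(LINT y:{x - t..x + t}|lebesgue. 1 * g0 y) = (LINT y|lborel. indicator {x - t..x + t} y * g y)"
    by (rule set_lebesgue_integral_representative[OF _ _ g0(1) _ g0(2)]) (use borel_measurable_integrable[OF g] in auto)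
  then show ?thesis unfolding wave_prop_def using prim_diff_Icc[OF g, of "x - t" "x + t"] t by simp
qed

text \<open>
  The integrals do not see the choice of a representative, but the transported values \<open>f0 (x + t)\<close> and
  \<open>f0 (x - t)\<close> do; they agree with those of \<open>f\<close> for almost every \<open>x\<close> only.
\<close>

lemma damped_wave_prop_representative:
  assumes t: "t \<ge> 0" and f0: "f0 \<in> borel_measurable lebesgue" "AE y in lborel. f0 y = f y"
    and g0: "g0 \<in> borel_measurable lebesgue" "AE y in lborel. g0 y = g y"
    and [measurable]: "f \<in> borel_measurable borel" "g \<in> borel_measurable borel"
  shows "damped_wave_prop t f0 g0 x = exp (- t / 2) * ((f0 (x + t) + f0 (x - t)) / 2
     + t / 16 * Ker 1 t x f + 1 / 2 * Ker 0 t x (\<lambda>y. g y + f y / 2))"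
proof -
  have rng: "(x - y)\<^sup>2 \<le> t\<^sup>2" if "y \<in> {x - t..x + t}" for y
    using that power_mono[of "\<bar>x - y\<bar>" t 2] by (auto simp: abs_le_iff)
  have rng': "(x - y)\<^sup>2 < t\<^sup>2" if "y \<in> {x - t<..<x + t}" for y
    using that power_strict_mono[of "\<bar>x - y\<bar>" t 2] by (auto simp: abs_less_iff)
  have "(LINT y:{x - t..x + t}|lebesgue. bessel_I 0 (sqrt (t\<^sup>2 - (x - y)\<^sup>2) / 2) * (g0 y + f0 y / 2))
     = Ker 0 t x (\<lambda>y. g y + f y / 2)"
    unfolding Ker_def
  proof (rule set_lebesgue_integral_representative)
    fix y
    show "indicator {x - t..x + t} y * bessel_I 0 (sqrt (t\<^sup>2 - (x - y)\<^sup>2) / 2)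
       = indicator {x - t..x + t} y * bE 0 ((t\<^sup>2 - (x - y)\<^sup>2) / 16)"
      using rng[of y] bessel_I_0[of "t\<^sup>2 - (x - y)\<^sup>2"] by (cases "y \<in> {x - t..x + t}") auto
    show "(\<lambda>y. g0 y + f0 y / 2) \<in> borel_measurable lebesgue" using f0(1) g0(1) by simp
    show "AE y in lborel. g0 y + f0 y / 2 = g y + f y / 2" using f0(2) g0(2) by eventually_elim simp
  qed measurable
  moreover have "(LINT y:{x - t..x + t}|lebesgue. bessel_I 1 (sqrt (t\<^sup>2 - (x - y)\<^sup>2) / 2) / sqrt (t\<^sup>2 - (x - y)\<^sup>2) * f0 y)
     = Ker 1 t x f / 4"
  proof -
    have "(LINT y:{x - t..x + t}|lebesgue. bessel_I 1 (sqrt (t\<^sup>2 - (x - y)\<^sup>2) / 2) / sqrt (t\<^sup>2 - (x - y)\<^sup>2) * f0 y)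
      = (LINT y|lborel. indicator {x - t<..<x + t} y * (bE 1 ((t\<^sup>2 - (x - y)\<^sup>2) / 16) / 4) * f y)"
    proof (rule set_lebesgue_integral_representative[OF _ _ f0(1) _ f0(2)])
      fix y
      consider "y \<in> {x - t<..<x + t}" | "y = x - t \<or> y = x + t" | "y \<notin> {x - t..x + t}" by force
      then show "indicator {x - t..x + t} y * (bessel_I 1 (sqrt (t\<^sup>2 - (x - y)\<^sup>2) / 2) / sqrt (t\<^sup>2 - (x - y)\<^sup>2))
        = indicator {x - t<..<x + t} y * (bE 1 ((t\<^sup>2 - (x - y)\<^sup>2) / 16) / 4)"
      proof cases
        case 1
        then have "bessel_I 1 (sqrt (t\<^sup>2 - (x - y)\<^sup>2) / 2) / sqrt (t\<^sup>2 - (x - y)\<^sup>2) = bE 1 ((t\<^sup>2 - (x - y)\<^sup>2) / 16) / 4"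
          using rng'[OF 1] by (intro bessel_I_1) simp
        then show ?thesis using 1 by (simp only:) (simp add: indicator_def)
      next
        \<comment> \<open>at the end points of the cone the quotient is a division by zero, hence \<open>0\<close>\<close>
        case 2
        then have "sqrt (t\<^sup>2 - (x - y)\<^sup>2) = 0" by auto
        then show ?thesis using 2 by (simp only:) (auto simp: indicator_def)
      next
        case 3
        then have "y \<notin> {x - t<..<x + t}" by auto
        then show ?thesis using 3 by simp
      qed
    qed measurable
    also have "\<dots> = (LINT y|lborel. (indicator {x - t..x + t} y * bE 1 ((t\<^sup>2 - (x - y)\<^sup>2) / 16) * f y) / 4)"
    proof (rule integral_cong_AE)
      show "AE y in lborel. indicator {x - t<..<x + t} y * (bE 1 ((t\<^sup>2 - (x - y)\<^sup>2) / 16) / 4) * f y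
         = (indicator {x - t..x + t} y * bE 1 ((t\<^sup>2 - (x - y)\<^sup>2) / 16) * f y) / 4"
        using AE_lborel_singleton[of "x - t"] AE_lborel_singleton[of "x + t"]
        by eventually_elim (auto simp: indicator_def)
    qed measurable
    finally show ?thesis by (simp add: Ker_def)
  qed
  ultimately show ?thesis unfolding damped_wave_prop_def by simp
qed

lemma Ker_cmult: "Ker n t x (\<lambda>y. c * H y) = c * Ker n t x H"
  unfolding Ker_def by (subst integral_mult_right_zero[symmetric]) (simp add: mult_ac)

lemma AE_both_shifts:
  assumes "AE x in lborel. f0 x = f (x :: real)"
  shows "AE x in lebesgue. f0 (x + t) = f (x + t) \<and> f0 (x - t) = f (x - t)"
  unfolding AE_lebesgue_iff using AE_shift[OF assms, of t] AE_shift[OF assms, of "- t"] by eventually_elim simp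

lemma wave_prop_eq_vlin:
  assumes t: "t \<ge> 0" and f0: "AE y in lborel. f0 y = f y"
    and g0: "g0 \<in> borel_measurable lebesgue" "AE y in lborel. g0 y = g y" and g: "integrable lborel g"
  shows "AE x in lebesgue. wave_prop t (\<lambda>x. c * f0 x) (\<lambda>x. c * g0 x) x = c * vlin f g t x"
proof -
  have e: "wave_prop t (\<lambda>x. c * f0 x) (\<lambda>x. c * g0 x) x = (c * f0 (x + t) + c * f0 (x - t)) / 2
      + (prim (\<lambda>x. c * g x) (x + t) - prim (\<lambda>x. c * g x) (x - t)) / 2" for x
  proof (rule wave_prop_representative[OF t])
    show "(\<lambda>x. c * g0 x) \<in> borel_measurable lebesgue" using g0(1) by simp
    show "AE y in lborel. c * g0 y = c * g y" using g0(2) by eventually_elim simp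
    show "integrable lborel (\<lambda>x. c * g x)" using g by simp
  qed
  show ?thesis using AE_both_shifts[OF f0, of t]
    by eventually_elim (simp add: e vlin_def prim_cmult field_simps)
qed

lemma damped_wave_prop_eq_ulin:
  assumes t: "t \<ge> 0" and f0: "f0 \<in> borel_measurable lebesgue" "AE y in lborel. f0 y = f y"
    and g0: "g0 \<in> borel_measurable lebesgue" "AE y in lborel. g0 y = g y"
    and fg: "f \<in> borel_measurable borel" "g \<in> borel_measurable borel"
  shows "AE x in lebesgue. damped_wave_prop t (\<lambda>x. c * f0 x) (\<lambda>x. c * g0 x) x = c * ulin f g t x"
proof -
  have e: "damped_wave_prop t (\<lambda>x. c * f0 x) (\<lambda>x. c * g0 x) x = exp (- t / 2) * ((c * f0 (x + t) + c * f0 (x - t)) / 2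
     + t / 16 * Ker 1 t x (\<lambda>y. c * f y) + 1 / 2 * Ker 0 t x (\<lambda>y. c * g y + c * f y / 2))" for x
  proof (rule damped_wave_prop_representative[OF t])
    show "(\<lambda>x. c * f0 x) \<in> borel_measurable lebesgue" "(\<lambda>x. c * g0 x) \<in> borel_measurable lebesgue" using f0(1) g0(1) by simp_all
    show "AE y in lborel. c * f0 y = c * f y" using f0(2) by eventually_elim simp
    show "AE y in lborel. c * g0 y = c * g y" using g0(2) by eventually_elim simp
    show "(\<lambda>x. c * f x) \<in> borel_measurable borel" "(\<lambda>x. c * g x) \<in> borel_measurable borel" using fg by simp_all
  qed
  define K where "K x = Ker 0 t x (\<lambda>y. g y + f y / 2)" for x
  have k: "Ker 0 t x (\<lambda>y. c * g y + c * f y / 2) = c * K x" for x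
    unfolding K_def Ker_cmult[symmetric] by (simp add: distrib_left)
  have u: "ulin f g t x = exp (- t / 2) * ((f (x + t) + f (x - t)) / 2 + t / 16 * Ker 1 t x f + 1 / 2 * K x)" for x
    by (simp only: ulin_def K_def)
  show ?thesis using AE_both_shifts[OF f0(2), of t]
    by eventually_elim (simp add: e[unfolded k Ker_cmult] u field_simps)
qed

lemma wave_Duhamel_eq_Nw:
  assumes F: "cone_source R T F"
  shows "(LINT s:{0..t}|lebesgue. wave_prop (t - s) (\<lambda>_. 0) (F s) x) = Nw F t x"
proof -
  have "indicator {0..t} s * wave_prop (t - s) (\<lambda>_. 0) (F s) x
      = indicator {0..t} s * ((prim (F s) (x + (t - s)) - prim (F s) (x - (t - s))) / 2)" for s
  proof (cases "s \<in> {0..t}")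
    case True
    have m: "F s \<in> borel_measurable lebesgue" using cone_sourceD(3)[OF F, of s] by (simp add: measurable_completion)
    have "wave_prop (t - s) (\<lambda>_. 0) (F s) x = (0 + 0) / 2 + (prim (F s) (x + (t - s)) - prim (F s) (x - (t - s))) / 2"
      by (rule wave_prop_representative[OF _ m _ cone_sourceD(7)[OF F]]) (use True in auto)
    then show ?thesis by simp
  qed simp
  note pointwise = this
  have "(LINT s:{0..t}|lebesgue. wave_prop (t - s) (\<lambda>_. 0) (F s) x)
      = (LINT s|lebesgue. indicator {0..t} s * ((prim (F s) (x + (t - s)) - prim (F s) (x - (t - s))) / 2))"
    unfolding set_lebesgue_integral_def real_scaleR_def by (simp only: pointwise)
  also have "\<dots> = Nw F t x"
    unfolding Nw_def by (rule integral_completion[OF borel_measurable_integrable[OF Nw_integrable[OF F]]])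
  finally show ?thesis .
qed

lemma damped_Duhamel_eq_Nd:
  assumes F: "cone_source R T F"
  shows "(LINT s:{0..t}|lebesgue. damped_wave_prop (t - s) (\<lambda>_. 0) (F s) x) = Nd F t x"
proof -
  have "indicator {0..t} s * damped_wave_prop (t - s) (\<lambda>_. 0) (F s) x
      = indicator {0..t} s * (exp (- (t - s) / 2) * (Ker 0 (t - s) x (F s) / 2))" for s
  proof (cases "s \<in> {0..t}")
    case True
    have m: "F s \<in> borel_measurable lebesgue" using cone_sourceD(3)[OF F, of s] by (simp add: measurable_completion)
    have "damped_wave_prop (t - s) (\<lambda>_. 0) (F s) x = exp (- (t - s) / 2) * ((0 + 0) / 2
       + (t - s) / 16 * Ker 1 (t - s) x (\<lambda>_. 0) + 1 / 2 * Ker 0 (t - s) x (\<lambda>y. F s y + 0 / 2))"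
      by (rule damped_wave_prop_representative[OF _ _ _ m _ _ cone_sourceD(3)[OF F]]) (use True in auto)
    then show ?thesis by (simp add: Ker_def[of _ _ _ "\<lambda>_. 0"])
  qed simp
  note pointwise = this
  have "(LINT s:{0..t}|lebesgue. damped_wave_prop (t - s) (\<lambda>_. 0) (F s) x)
      = (LINT s|lebesgue. indicator {0..t} s * (exp (- (t - s) / 2) * (Ker 0 (t - s) x (F s) / 2)))"
    unfolding set_lebesgue_integral_def real_scaleR_def by (simp only: pointwise)
  also have "\<dots> = Nd F t x"
    unfolding Nd_def by (rule integral_completion[OF borel_measurable_integrable[OF Nd_eq(2)[OF F]]])
  finally show ?thesis .
qed

text \<open>
  The weight is at most \<open>(1 + s)^(\<eta> - 1)\<close>, whose primitive is \<open>(1 + s)^\<eta> / \<eta>\<close>. An auxiliary \<open>\<eta>\<close> covers the cases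
  of growing, logarithmic and bounded integrals at once.
\<close>

lemma weighted_time_integral:
  fixes T \<eta> r :: real
  assumes T: "T \<ge> 0" and \<eta>: "\<eta> > 0" "1 - \<eta> \<le> r"
  shows "(LINT s|lborel. indicator {0..T} s * (1 + s) powr (- r)) \<le> (1 + T) powr \<eta> / \<eta>"
proof -
  have hb: "has_bochner_integral lborel (\<lambda>s. (1 + s) powr (\<eta> - 1) * indicator {0..T} s) ((1 + T) powr \<eta> / \<eta> - (1 + 0) powr \<eta> / \<eta>)"
    by (rule has_bochner_integral_FTC_Icc_real[OF T]) (use \<eta> in \<open>auto intro!: derivative_eq_intros continuous_intros\<close>)
  have "set_integrable lborel {0..T} (\<lambda>s. (1 + s) powr (- r))"
    by (intro borel_integrable_atLeastAtMost' continuous_intros) auto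
  then have i: "integrable lborel (\<lambda>s. indicator {0..T} s * (1 + s) powr (- r))" by (simp add: set_integrable_def)
  have "(LINT s|lborel. indicator {0..T} s * (1 + s) powr (- r)) \<le> (LINT s|lborel. (1 + s) powr (\<eta> - 1) * indicator {0..T} s)"
  proof (rule integral_mono[OF i integrable.intros[OF hb]])
    fix s
    show "indicator {0..T} s * (1 + s) powr (- r) \<le> (1 + s) powr (\<eta> - 1) * indicator {0..T} s"
      using \<eta> by (cases "s \<in> {0..T}") (auto intro!: powr_mono)
  qed
  also have "\<dots> = (1 + T) powr \<eta> / \<eta> - (1 + 0) powr \<eta> / \<eta>" by (rule has_bochner_integral_integral_eq[OF hb])
  also have "\<dots> \<le> (1 + T) powr \<eta> / \<eta>" using \<eta> by simp
  finally show ?thesis .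
qed

section \<open>Lower bounds for the lifespan\<close>

lemma energy_triple_cmult:
  assumes "energy_triple I w a b"
  shows "\<exists>a b. energy_triple I (\<lambda>t x. (c :: real) * w t x) a b"
proof -
  have "energy_triple I (\<lambda>t x. c * w t x) (\<lambda>t x. c * a t x) (\<lambda>t x. c * b t x + 0 * w t x)"
    by (rule energy_triple_mult[OF assms, of "\<lambda>_. c" "\<lambda>_. 0"]) simp_all
  then show ?thesis by blast
qed

context nakao_iteration
begin

lemma mild_solution:
  assumes u0: "u0 \<in> borel_measurable lebesgue" "AE x in lborel. u0 x = f x"
    and u1: "u1 \<in> borel_measurable lebesgue" "AE x in lborel. u1 x = g x"
    and v0: "v0 \<in> borel_measurable lebesgue" "AE x in lborel. v0 x = f' x"
    and v1: "v1 \<in> borel_measurable lebesgue" "AE x in lborel. v1 x = g' x"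
    and v: "v \<in> S" "\<Psi> v = v"
  shows "mild_energy_solution p q (\<lambda>x. \<epsilon> * u0 x) (\<lambda>x. \<epsilon> * u1 x) (\<lambda>x. \<epsilon> * v0 x) (\<lambda>x. \<epsilon> * v1 x) (ereal T) (U v) v"
proof -
  note D = nice_dataD[OF nd] and D' = nice_dataD[OF nd']
  have vc: "cone_source R T v" using v by (simp add: S_def)
  have vp: "cone_source R T (\<lambda>s y. \<bar>v s y\<bar> powr p)" using pq by (intro cone_source_powr vc) auto
  have up: "cone_source R T (\<lambda>s y. \<bar>U v s y\<bar> powr q)" using pq by (intro cone_source_powr U_cone vc) auto
  have I: "t \<in> time_interval (ereal T) \<longleftrightarrow> 0 \<le> t \<and> t < T" for t by (simp add: time_interval_def)
  have veq: "v t x = \<epsilon> * vlin f' g' t x + Nw (\<lambda>s y. \<bar>U v s y\<bar> powr q) t x" if "0 \<le> t" "t < T" for t x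
    using fun_cong[OF fun_cong[OF v(2)], of t x] that by (simp add: \<Psi>_def)
  have ueq: "U v t x = \<epsilon> * ulin f g t x + Nd (\<lambda>s y. \<bar>v s y\<bar> powr p) t x" if "0 \<le> t" "t < T" for t x
    using that by (simp add: U_def)
  show ?thesis
    unfolding mild_energy_solution_def
  proof (intro conjI ballI)
    obtain a b where 1: "energy_triple {0..<T} (ulin f g) a b" using ulin_triple(1)[OF nd, of T] T by auto
    obtain a b where 2: "energy_triple {0..<T} (\<lambda>t x. \<epsilon> * ulin f g t x) a b" using energy_triple_cmult[OF 1] by blast
    obtain a' b' where 3: "energy_triple {0..<T} (Nd (\<lambda>s y. \<bar>v s y\<bar> powr p)) a' b'"
      using Nd_triple(1)[OF vp, of T] R T by auto
    show "energy_curve (ereal T) (U v)"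
    proof (rule energy_triple_imp_energy_curve[OF energy_triple_cong[OF energy_triple_add[OF 2 3]]])
      show "\<epsilon> * ulin f g t x + Nd (\<lambda>s y. \<bar>v s y\<bar> powr p) t x = U v t x" if "t \<in> {0..<T}" for t x
        using ueq that by simp
    qed
  next
    obtain a b where 1: "energy_triple {0..<T} (vlin f' g') a b" using vlin_triple[OF nd'] by blast
    obtain a b where 2: "energy_triple {0..<T} (\<lambda>t x. \<epsilon> * vlin f' g' t x) a b" using energy_triple_cmult[OF 1] by blast
    obtain a' b' where 3: "energy_triple {0..<T} (Nw (\<lambda>s y. \<bar>U v s y\<bar> powr q)) a' b'"
      using Nw_triple(1)[OF up, of T] R T by auto
    show "energy_curve (ereal T) v"
    proof (rule energy_triple_imp_energy_curve[OF energy_triple_cong[OF energy_triple_add[OF 2 3]]])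
      show "\<epsilon> * vlin f' g' t x + Nw (\<lambda>s y. \<bar>U v s y\<bar> powr q) t x = v t x" if "t \<in> {0..<T}" for t x
        using veq that by simp
    qed
  next
    fix t assume "t \<in> time_interval (ereal T)"
    then have t: "0 \<le> t" "t < T" by (simp_all add: I)
    have "AE x in lebesgue. damped_wave_prop t (\<lambda>x. \<epsilon> * u0 x) (\<lambda>x. \<epsilon> * u1 x) x = \<epsilon> * ulin f g t x"
      by (rule damped_wave_prop_eq_ulin[OF t(1) u0 u1 sqintD(1)[OF D(6)] sqintD(1)[OF D(1)]])
    then show "AE x in lebesgue. U v t x = damped_wave_prop t (\<lambda>x. \<epsilon> * u0 x) (\<lambda>x. \<epsilon> * u1 x) x
        + (LINT s:{0..t}|lebesgue. damped_wave_prop (t - s) (\<lambda>_. 0) (\<lambda>y. \<bar>v s y\<bar> powr p) x)"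
      unfolding damped_Duhamel_eq_Nd[OF vp] by eventually_elim (simp add: ueq[OF t])
    have "AE x in lebesgue. wave_prop t (\<lambda>x. \<epsilon> * v0 x) (\<lambda>x. \<epsilon> * v1 x) x = \<epsilon> * vlin f' g' t x"
      by (rule wave_prop_eq_vlin[OF t(1) v0(2) v1 D'(3)])
    then show "AE x in lebesgue. v t x = wave_prop t (\<lambda>x. \<epsilon> * v0 x) (\<lambda>x. \<epsilon> * v1 x) x
        + (LINT s:{0..t}|lebesgue. wave_prop (t - s) (\<lambda>_. 0) (\<lambda>y. \<bar>U v s y\<bar> powr q) x)"
      unfolding wave_Duhamel_eq_Nw[OF up] by eventually_elim (simp add: veq[OF t])
  qed
qed

end

text \<open>
  The bookkeeping of the exponents: with \<open>T = c \<epsilon>^(- \<kappa>)\<close> and \<open>V = 2 K \<epsilon>^\<mu>\<close>, the linear and the semilinear term together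
  are at most \<open>K \<epsilon>^\<mu> = V / 2\<close>, and the nonlinear term is at most \<open>V / 2\<close> once \<open>c\<close> is small.
\<close>

lemma iteration_smallness:
  fixes p q R C A \<kappa> \<eta> \<mu> :: real
  assumes pq: "p > 1" "q > 1" and R: "R > 0" and C: "C > 0" and A: "A > 0"
    and \<kappa>: "\<kappa> > 0" and \<eta>: "\<eta> > 0" and \<mu>: "\<mu> \<le> 1" "\<mu> \<le> q - \<kappa> * \<eta>" "\<kappa> * (q + 2) \<le> \<mu> * (p * q - 1)"
  obtains \<epsilon>0 c where "\<epsilon>0 > 0" "c > 0"
    "\<And>\<epsilon>. 0 < \<epsilon> \<Longrightarrow> \<epsilon> \<le> \<epsilon>0 \<Longrightarrow> \<exists>V>0. \<epsilon> * A + 2 powr q * (\<epsilon> powr q * C * ((1 + c * \<epsilon> powr (- \<kappa>)) powr \<eta> / \<eta>)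
       + 2 * (R + c * \<epsilon> powr (- \<kappa>)) * (c * \<epsilon> powr (- \<kappa>)) * (2 * ((c * \<epsilon> powr (- \<kappa>)) * V powr p)) powr q) \<le> V"
proof -
  define K where "K = A + 2 powr q * C * 2 powr \<eta> / \<eta>"
  have K: "K > 0" unfolding K_def using A C \<eta> by (intro add_pos_nonneg) auto
  define m where "m = 2 powr (2 * q + 3) * (2 * K) powr (p * q - 1)"
  have m: "m > 0" unfolding m_def using K by (intro mult_pos_pos) auto
  \<comment> \<open>\<open>m T^(q + 2) \<epsilon>^(\<mu> (p q - 1))\<close> bounds the ratio of the nonlinear term to \<open>V / 2\<close>\<close>
  define c where "c = min 1 ((1 / m) powr (1 / (q + 2)))"
  have c: "c > 0" "c \<le> 1" unfolding c_def using m by auto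
  have cm: "m * c powr (q + 2) \<le> 1"
  proof -
    have "c powr (q + 2) \<le> ((1 / m) powr (1 / (q + 2))) powr (q + 2)"
      using c pq by (intro powr_mono2) (auto simp: c_def)
    also have "\<dots> = 1 / m" using m pq by (simp add: powr_powr)
    finally show ?thesis using m by (simp add: field_simps)
  qed
  \<comment> \<open>ensures \<open>T \<ge> 1 + R\<close>, so that \<open>1 + T\<close> and \<open>R + T\<close> are at most \<open>2 T\<close>\<close>
  define \<epsilon>0 where "\<epsilon>0 = min 1 ((c / (1 + R)) powr (1 / \<kappa>))"
  have e0: "\<epsilon>0 > 0" "\<epsilon>0 \<le> 1" unfolding \<epsilon>0_def using c R by auto
  show ?thesis
  proof (rule that[OF e0(1) c(1)])
    fix \<epsilon> assume e: "0 < \<epsilon>" "\<epsilon> \<le> \<epsilon>0"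
    define T where "T = c * \<epsilon> powr (- \<kappa>)"
    have "\<epsilon> powr \<kappa> \<le> ((c / (1 + R)) powr (1 / \<kappa>)) powr \<kappa>"
      using e \<kappa> by (intro powr_mono2) (auto simp: \<epsilon>0_def)
    also have "\<dots> = c / (1 + R)" using c R \<kappa> by (simp add: powr_powr)
    finally have T1: "1 + R \<le> T" using e R by (simp add: T_def powr_minus field_simps)
    have T0: "T > 0" using T1 R by simp
    define V where "V = 2 * K * \<epsilon> powr \<mu>"
    have V: "V > 0" unfolding V_def using K e by simp
    have e1: "\<epsilon> \<le> 1" using e e0 by simp
    have mono: "\<epsilon> powr a \<le> \<epsilon> powr \<mu>" if "\<mu> \<le> a" for a using e e1 that by (intro powr_mono') auto
    have lin: "\<epsilon> * A \<le> A * \<epsilon> powr \<mu>" using mono[OF \<mu>(1)] e A by (simp add: mult.commute)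
    have "\<epsilon> powr q * C * ((1 + T) powr \<eta> / \<eta>) \<le> \<epsilon> powr q * C * ((2 * T) powr \<eta> / \<eta>)"
      using T1 R C \<eta> e by (intro mult_left_mono divide_right_mono powr_mono2) auto
    also have "\<dots> = (C * 2 powr \<eta> / \<eta>) * c powr \<eta> * \<epsilon> powr (q - \<kappa> * \<eta>)"
    proof -
      have "(2 * T) powr \<eta> = 2 powr \<eta> * c powr \<eta> * \<epsilon> powr (- (\<kappa> * \<eta>))"
        using e c by (simp add: T_def powr_mult powr_powr)
      moreover have "\<epsilon> powr (q - \<kappa> * \<eta>) = \<epsilon> powr q * \<epsilon> powr (- (\<kappa> * \<eta>))" by (simp add: powr_add[symmetric])
      ultimately show ?thesis by simp
    qed
    also have "\<dots> \<le> (C * 2 powr \<eta> / \<eta>) * 1 * \<epsilon> powr \<mu>"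
      using c C \<eta> mono[OF \<mu>(2)] by (intro mult_mono powr_le1) auto
    finally have "2 powr q * (\<epsilon> powr q * C * ((1 + T) powr \<eta> / \<eta>)) \<le> 2 powr q * ((C * 2 powr \<eta> / \<eta>) * 1 * \<epsilon> powr \<mu>)"
      by (rule mult_left_mono) simp
    also have "\<dots> = (2 powr q * C * 2 powr \<eta> / \<eta>) * \<epsilon> powr \<mu>" by simp
    finally have semi: "2 powr q * (\<epsilon> powr q * C * ((1 + T) powr \<eta> / \<eta>)) \<le> (2 powr q * C * 2 powr \<eta> / \<eta>) * \<epsilon> powr \<mu>" .
    have "2 * (R + T) * T * (2 * (T * V powr p)) powr q \<le> 2 * (2 * T) * T * (2 * (T * V powr p)) powr q"
      using T1 T0 R by (intro mult_right_mono) auto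
    also have "\<dots> = 4 * 2 powr q * (T * T * T powr q) * V powr (p * q)"
      using T0 V by (simp add: powr_mult powr_powr)
    also have "T * T * T powr q = T powr (q + 2)" using T0 by (simp add: powr_add powr_numeral power2_eq_square)
    also have "V powr (p * q) = V powr (p * q - 1) * V" using V by (simp add: powr_diff)
    finally have "2 powr q * (2 * (R + T) * T * (2 * (T * V powr p)) powr q)
        \<le> 2 powr q * (4 * 2 powr q * T powr (q + 2) * (V powr (p * q - 1) * V))" by (intro mult_left_mono) auto
    also have "\<dots> = (2 powr (2 * q + 3) * T powr (q + 2) * V powr (p * q - 1)) * (V / 2)"
    proof -
      have "2 powr (2 * q + 3) = 8 * 2 powr q * 2 powr (q::real)"
        using powr_add[of 2 "q + q" 3] powr_add[of 2 q q] by (simp add: powr_numeral)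
      then show ?thesis by simp
    qed
    also have "2 powr (2 * q + 3) * T powr (q + 2) * V powr (p * q - 1)
        = (m * c powr (q + 2)) * \<epsilon> powr (\<mu> * (p * q - 1) - \<kappa> * (q + 2))"
    proof -
      have "T powr (q + 2) = c powr (q + 2) * \<epsilon> powr (- (\<kappa> * (q + 2)))"
        using e c by (simp add: T_def powr_mult powr_powr)
      moreover have "V powr (p * q - 1) = (2 * K) powr (p * q - 1) * \<epsilon> powr (\<mu> * (p * q - 1))"
        using e K by (simp add: V_def powr_mult powr_powr)
      moreover have "\<epsilon> powr (\<mu> * (p * q - 1) - \<kappa> * (q + 2)) = \<epsilon> powr (- (\<kappa> * (q + 2))) * \<epsilon> powr (\<mu> * (p * q - 1))"
        by (simp add: powr_add[symmetric])
      ultimately show ?thesis by (simp add: m_def)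
    qed
    also have "(m * c powr (q + 2)) * \<epsilon> powr (\<mu> * (p * q - 1) - \<kappa> * (q + 2)) * (V / 2) \<le> 1 * 1 * (V / 2)"
      using cm m e e1 \<mu>(3) V by (intro mult_right_mono mult_mono powr_le1) auto
    finally have nonl: "2 powr q * (2 * (R + T) * T * (2 * (T * V powr p)) powr q) \<le> V / 2" by simp
    have tot: "A * \<epsilon> powr \<mu> + (2 powr q * C * 2 powr \<eta> / \<eta>) * \<epsilon> powr \<mu> = V / 2"
      by (simp add: V_def K_def distrib_right)
    have add: "a + k * (x + y) \<le> v" if "a \<le> a'" "k * x \<le> b'" "k * y \<le> v / 2" "a' + b' = v / 2" for a k x y a' b' v :: real
      using that by (simp add: distrib_left)
    have "\<epsilon> * A + 2 powr q * (\<epsilon> powr q * C * ((1 + T) powr \<eta> / \<eta>) + 2 * (R + T) * T * (2 * (T * V powr p)) powr q) \<le> V"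
      by (rule add[OF lin semi nonl tot])
    then show "\<exists>V>0. \<epsilon> * A + 2 powr q * (\<epsilon> powr q * C * ((1 + c * \<epsilon> powr (- \<kappa>)) powr \<eta> / \<eta>)
       + 2 * (R + c * \<epsilon> powr (- \<kappa>)) * (c * \<epsilon> powr (- \<kappa>)) * (2 * ((c * \<epsilon> powr (- \<kappa>)) * V powr p)) powr q) \<le> V"
      using V unfolding T_def by blast
  qed
qed

lemma lifespan_lower_bound:
  fixes p q R \<kappa> \<eta> \<mu> :: real
  assumes pq: "p > 1" "q > 1" and R: "R > 0"
    and nd: "nice_data R f g" "nice_data R f' g'"
    and u0: "u0 \<in> borel_measurable lebesgue" "AE x in lborel. u0 x = f x"
    and u1: "u1 \<in> borel_measurable lebesgue" "AE x in lborel. u1 x = g x"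
    and v0: "v0 \<in> borel_measurable lebesgue" "AE x in lborel. v0 x = f' x"
    and v1: "v1 \<in> borel_measurable lebesgue" "AE x in lborel. v1 x = g' x"
    and \<kappa>: "\<kappa> > 0" and \<eta>: "\<eta> > 0" "1 - \<eta> \<le> (q - 1) / 2"
    and \<mu>: "\<mu> \<le> 1" "\<mu> \<le> q - \<kappa> * \<eta>" "\<kappa> * (q + 2) \<le> \<mu> * (p * q - 1)"
  shows "\<exists>\<epsilon>0>0. \<exists>c>0. \<forall>\<epsilon>. 0 < \<epsilon> \<and> \<epsilon> \<le> \<epsilon>0 \<longrightarrow>
    lifespan p q (\<lambda>x. \<epsilon> * u0 x) (\<lambda>x. \<epsilon> * u1 x) (\<lambda>x. \<epsilon> * v0 x) (\<lambda>x. \<epsilon> * v1 x) \<ge> ereal (c * \<epsilon> powr (- \<kappa>))"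
proof -
  obtain C where C0: "C > 0" and C: "\<And>t. t \<ge> 0 \<Longrightarrow> integrable lborel (\<lambda>x. \<bar>ulin f g t x\<bar> powr q) \<and>
      (LINT x|lborel. \<bar>ulin f g t x\<bar> powr q) \<le> C * (1 + t) powr (- ((q - 1) / 2))"
    using ulin_Lq[OF nd(1) pq(2)] by blast
  obtain A where A0: "A > 0" and A: "\<And>t x. \<bar>vlin f' g' t x\<bar> \<le> A" using vlin_bounded[OF nd(2)] by blast
  obtain \<epsilon>0 c where e0: "\<epsilon>0 > 0" and c: "c > 0" and small: "\<And>\<epsilon>. 0 < \<epsilon> \<Longrightarrow> \<epsilon> \<le> \<epsilon>0 \<Longrightarrow>
      \<exists>V>0. \<epsilon> * A + 2 powr q * (\<epsilon> powr q * C * ((1 + c * \<epsilon> powr (- \<kappa>)) powr \<eta> / \<eta>)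
       + 2 * (R + c * \<epsilon> powr (- \<kappa>)) * (c * \<epsilon> powr (- \<kappa>)) * (2 * ((c * \<epsilon> powr (- \<kappa>)) * V powr p)) powr q) \<le> V"
    by (rule iteration_smallness[OF pq R C0 A0 \<kappa> \<eta>(1) \<mu>]) blast
  show ?thesis
  proof (rule exI[of _ \<epsilon>0], rule conjI[OF e0], rule exI[of _ c], rule conjI[OF c], intro allI impI)
    fix \<epsilon> assume e: "0 < \<epsilon> \<and> \<epsilon> \<le> \<epsilon>0"
    define T where "T = c * \<epsilon> powr (- \<kappa>)"
    have T: "T > 0" unfolding T_def using c e by simp
    obtain V where V: "V > 0" and sm: "\<epsilon> * A + 2 powr q * (\<epsilon> powr q * C * ((1 + T) powr \<eta> / \<eta>)
       + 2 * (R + T) * T * (2 * (T * V powr p)) powr q) \<le> V"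
      using small[of \<epsilon>] e unfolding T_def by blast
    interpret nakao_iteration p q R T \<epsilon> V f g f' g'
      using pq R T e V nd by unfold_locales auto
    have inv: "\<Psi> v \<in> S" if "v \<in> S" for v
      by (rule \<Psi>_apriori[OF C _ A weighted_time_integral[OF _ \<eta>] sm that]) (use C0 T in auto)
    obtain v where v: "v \<in> S" "\<Psi> v = v" using fixed_point[OF inv] by blast
    have "mild_energy_solution p q (\<lambda>x. \<epsilon> * u0 x) (\<lambda>x. \<epsilon> * u1 x) (\<lambda>x. \<epsilon> * v0 x) (\<lambda>x. \<epsilon> * v1 x) (ereal T) (U v) v"
      by (rule mild_solution[OF u0 u1 v0 v1 v])
    then show "lifespan p q (\<lambda>x. \<epsilon> * u0 x) (\<lambda>x. \<epsilon> * u1 x) (\<lambda>x. \<epsilon> * v0 x) (\<lambda>x. \<epsilon> * v1 x) \<ge> ereal (c * \<epsilon> powr (- \<kappa>))"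
      unfolding lifespan_def T_def[symmetric] using T by (intro Sup_upper CollectI conjI) auto
  qed
qed

text \<open>
  With \<open>\<mu> = 1\<close> the remaining condition is \<open>\<kappa> \<eta> \<le> q - 1\<close>. For \<open>q < 3\<close> and \<open>\<eta> = (3 - q) / 2\<close> it is exactly the
  inequality that defines the region; for \<open>q \<ge> 3\<close> it holds for small \<open>\<eta>\<close>.
\<close>

lemma exponents_region_1:
  assumes pq: "(p, q) \<in> Omega_Nakao1"
  defines "\<kappa> \<equiv> (p * q - 1) / (q + 2)"
  obtains \<eta> \<mu> where "\<kappa> > 0" "\<eta> > 0" "1 - \<eta> \<le> (q - 1) / 2" "\<mu> \<le> 1" "\<mu> \<le> q - \<kappa> * \<eta>" "\<kappa> * (q + 2) \<le> \<mu> * (p * q - 1)"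
proof -
  have pq1: "p > 1" "q > 1" using pq by (auto simp: Omega_Nakao1_def)
  have pq0: "p * q > 1" using pq1 less_1_mult by blast
  have \<kappa>: "\<kappa> > 0" "\<kappa> * (q + 2) \<le> 1 * (p * q - 1)" using pq0 pq1 by (simp_all add: \<kappa>_def)
  show ?thesis
  proof (cases "q < 3")
    case True
    have "p \<le> (2 * q\<^sup>2 + q - 1) / (q * (3 - q))" using pq True by (auto simp: Omega_Nakao1_def)
    then have "p * (q * (3 - q)) \<le> 2 * q\<^sup>2 + q - 1" using True pq1 by (simp add: pos_le_divide_eq)
    then have "(p * q - 1) * (3 - q) \<le> 2 * (q - 1) * (q + 2)" by (simp add: algebra_simps power2_eq_square)
    then have "\<kappa> * ((3 - q) / 2) \<le> q - 1" using pq1 by (simp add: \<kappa>_def divide_simps) (simp add: algebra_simps)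
    then have "1 \<le> q - \<kappa> * ((3 - q) / 2)" by simp
    moreover have "1 - (3 - q) / 2 \<le> (q - 1) / 2" by (simp add: field_simps)
    moreover have "(3 - q) / 2 > 0" using True by simp
    ultimately show ?thesis using that[of "(3 - q) / 2" 1] \<kappa> by blast
  next
    case False
    define \<eta> where "\<eta> = min 1 ((q - 1) / \<kappa>)"
    have "\<kappa> * \<eta> \<le> \<kappa> * ((q - 1) / \<kappa>)" unfolding \<eta>_def using \<kappa> by (intro mult_left_mono) auto
    also have "\<dots> = q - 1" using \<kappa> by simp
    finally have "1 \<le> q - \<kappa> * \<eta>" by simp
    moreover have "\<eta> > 0" unfolding \<eta>_def using \<kappa> pq1 by simp
    moreover from this have "1 - \<eta> \<le> (q - 1) / 2" using False by simp
    ultimately show ?thesis using that[of \<eta> 1] \<kappa> by blast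
  qed
qed

text \<open>
  Here \<open>\<mu> = q - \<kappa> (3 - q) / 2\<close>, which equals \<open>2 q (q + 2)\<close> divided by the denominator of \<open>\<kappa>\<close>. Being outside of the
  first region means that \<open>\<mu> < 1\<close>.
\<close>

lemma exponents_region_2:
  assumes pq: "(p, q) \<in> ({1<..} \<times> {1<..}) - Omega_Nakao1"
  defines "\<kappa> \<equiv> 2 * q * (p * q - 1) / (p * q * (3 - q) + 3 * q + 1)"
  obtains \<eta> \<mu> where "\<kappa> > 0" "\<eta> > 0" "1 - \<eta> \<le> (q - 1) / 2" "\<mu> \<le> 1" "\<mu> \<le> q - \<kappa> * \<eta>" "\<kappa> * (q + 2) \<le> \<mu> * (p * q - 1)"
proof -
  have pq1: "p > 1" "q > 1" "q < 3" and big: "p > (2 * q\<^sup>2 + q - 1) / (q * (3 - q))"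
    using pq by (auto simp: Omega_Nakao1_def)
  have pq0: "p * q > 1" using pq1 less_1_mult by blast
  define D where "D = p * q * (3 - q) + 3 * q + 1"
  have "p * (q * (3 - q)) > 2 * q\<^sup>2 + q - 1" using big pq1 by (simp add: pos_divide_less_eq)
  then have D: "2 * q * (q + 2) \<le> D" unfolding D_def by (simp add: algebra_simps power2_eq_square)
  have D0: "D > 0" using D pq1 by (intro less_le_trans[OF _ D]) simp
  have \<kappa>: "\<kappa> = 2 * q * (p * q - 1) / D" by (simp add: \<kappa>_def D_def)
  define \<mu> where "\<mu> = 2 * q * (q + 2) / D"
  have "\<kappa> > 0" unfolding \<kappa> using pq0 pq1 D0 by simp
  moreover have "\<mu> \<le> 1" unfolding \<mu>_def using D D0 by simp
  moreover have "\<mu> \<le> q - \<kappa> * ((3 - q) / 2)"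
  proof -
    have "D * (q - \<kappa> * ((3 - q) / 2)) = q * D - q * (p * q - 1) * (3 - q)" using D0 by (simp add: \<kappa> field_simps)
    also have "\<dots> = 2 * q * (q + 2)" unfolding D_def by (simp add: algebra_simps)
    finally show ?thesis using D0 by (simp add: \<mu>_def field_simps)
  qed
  moreover have "\<kappa> * (q + 2) \<le> \<mu> * (p * q - 1)"
  proof -
    have e: "2 * q * (p * q - 1) * (q + 2) = 2 * q * (q + 2) * (p * q - 1)" by (simp only: mult_ac)
    show ?thesis unfolding \<kappa> \<mu>_def times_divide_eq_left e by (rule order_refl)
  qed
  moreover have "1 - (3 - q) / 2 \<le> (q - 1) / 2" by (simp add: field_simps)
  moreover have "(3 - q) / 2 > 0" using pq1 by simp
  ultimately show ?thesis using that[of "(3 - q) / 2" \<mu>] by blast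
qed

theorem theorem2p1:
  fixes p q R :: real and u0 u1 v0 v1 :: "real \<Rightarrow> real"
  assumes "1 < p" and "1 < q"
    and "u0 \<in> H1_space \<inter> Lp_space 1"
    and "u1 \<in> Lp_space 2 \<inter> Lp_space 1 \<inter> Lp_space q"
    and "v0 \<in> H1_space"
    and "v1 \<in> Lp_space 2 \<inter> Lp_space 1"
    and "0 < R"
    and "ess_support u0 \<union> ess_support u1 \<union> ess_support v0 \<union> ess_support v1 \<subseteq> {- R..R}"
  shows "\<exists>\<epsilon>0>0. \<exists>c>0. \<forall>\<epsilon>. 0 < \<epsilon> \<and> \<epsilon> \<le> \<epsilon>0 \<longrightarrow>
    (let T\<epsilon> = lifespan p q (\<lambda>x. \<epsilon> * u0 x) (\<lambda>x. \<epsilon> * u1 x) (\<lambda>x. \<epsilon> * v0 x) (\<lambda>x. \<epsilon> * v1 x) in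
      ((p, q) \<in> Omega_Nakao1 \<longrightarrow>
         T\<epsilon> \<ge> ereal (c * \<epsilon> powr (- ((p * q - 1) / (q + 2))))) \<and>
      ((p, q) \<in> ({1<..} \<times> {1<..}) - Omega_Nakao1 \<longrightarrow>
         T\<epsilon> \<ge> ereal (c * \<epsilon> powr
            (- (2 * q * (p * q - 1) / (p * q * (3 - q) + 3 * q + 1))))))"
proof -
  have representative: "\<exists>f g. nice_data R f g \<and> (AE x in lborel. w0 x = f x) \<and> (AE x in lborel. w1 x = g x)"
    if w: "w0 \<in> H1_space" "w1 \<in> Lp_space 2" "ess_support w0 \<subseteq> {- R..R}" "ess_support w1 \<subseteq> {- R..R}" for w0 w1
  proof -
    obtain h where h: "sqint h" "\<And>x. \<bar>x\<bar> > R \<Longrightarrow> h x = 0" "(LINT x|lborel. h x) = 0" "AE x in lborel. w0 x = prim h x"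
      by (rule H1_compact_representative[OF w(1,3) \<open>0 < R\<close>]) blast
    obtain g where g: "sqint g" "\<And>x. \<bar>x\<bar> > R \<Longrightarrow> g x = 0" "AE x in lborel. w1 x = g x"
      by (rule compact_L2_representative[OF w(2,4)]) blast
    have "nice_data R (prim h) g" unfolding nice_data_def using h(1-3) g(1,2) by blast
    then show ?thesis using h(4) g(3) by blast
  qed
  have supp: "ess_support u0 \<subseteq> {- R..R}" "ess_support u1 \<subseteq> {- R..R}" "ess_support v0 \<subseteq> {- R..R}" "ess_support v1 \<subseteq> {- R..R}"
    using assms(8) by blast+
  have meas: "u0 \<in> borel_measurable lebesgue" "u1 \<in> borel_measurable lebesgue"
      "v0 \<in> borel_measurable lebesgue" "v1 \<in> borel_measurable lebesgue"
    using assms(3-6) by (auto simp: H1_space_def Lp_space_def)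
  obtain f g where 1: "nice_data R f g" "AE x in lborel. u0 x = f x" "AE x in lborel. u1 x = g x"
    using representative[of u0 u1] assms(3,4) supp by blast
  obtain f' g' where 2: "nice_data R f' g'" "AE x in lborel. v0 x = f' x" "AE x in lborel. v1 x = g' x"
    using representative[of v0 v1] assms(5,6) supp by blast
  note bound = lifespan_lower_bound[OF \<open>1 < p\<close> \<open>1 < q\<close> \<open>0 < R\<close> 1(1) 2(1) meas(1) 1(2) meas(2) 1(3) meas(3) 2(2) meas(4) 2(3)]
  show ?thesis
  proof (cases "(p, q) \<in> Omega_Nakao1")
    case True
    obtain \<eta> \<mu> where "(p * q - 1) / (q + 2) > 0" "\<eta> > 0" "1 - \<eta> \<le> (q - 1) / 2" "\<mu> \<le> 1"
      "\<mu> \<le> q - (p * q - 1) / (q + 2) * \<eta>" "(p * q - 1) / (q + 2) * (q + 2) \<le> \<mu> * (p * q - 1)"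
      by (rule exponents_region_1[OF True])
    from bound[OF this] show ?thesis using True by (simp add: Let_def)
  next
    case False
    then have F: "(p, q) \<in> ({1<..} \<times> {1<..}) - Omega_Nakao1" using assms(1,2) by simp
    let ?k = "2 * q * (p * q - 1) / (p * q * (3 - q) + 3 * q + 1)"
    obtain \<eta> \<mu> where "?k > 0" "\<eta> > 0" "1 - \<eta> \<le> (q - 1) / 2" "\<mu> \<le> 1"
      "\<mu> \<le> q - ?k * \<eta>" "?k * (q + 2) \<le> \<mu> * (p * q - 1)"
      by (rule exponents_region_2[OF F])
    from bound[OF this] show ?thesis using False assms(1,2) by (simp add: Let_def)
  qed
qed

end
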